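(* Let $d\ge 2$ be an integer, let $t_d^*$ be the unique root in $(0,1)$ of $$(d+1)(1-t_d^* )+(1+dt_d^* )\ln t_d^*=0,$$ and let $$c_d^*:=\frac{-\ln t_d^*}{(1-t_d^* )^d}.$$ Then for every $0<c<c_d^*$, asymptotically almost surely, $H_d\left(Y_d\left(n,\frac cn\right);\mathbb{R}\right)$ is either trivial or it is generated by at most a bounded number of copies of the boundary of a $(d+1)$-simplex.
   Context: $Y_d(n,p)$ is the probability space of random $d$-dimensional simplicial complexes on $n$ vertices with full $(d-1)$-dimensional skeleton (all vertex subsets of size at most $d$ are faces), in which each of the $\binom{n}{d+1}$ possible $d$-faces (vertex sets of size $d+1$) is included independently with probability $p$; $Y_d\left(n,\frac cn\right)$ also denotes a random complex sampled from this space with $p=\frac cn$. For a $d$-complex $Y$, $\partial_d(Y)$ is the real simplicial boundary operator from $d$-chains to $(d-1)$-chains, and $H_d(Y;\mathbb{R})=\ker\partial_d(Y)$; its elements are called $d$-cycles. A copy in $Y$ of the boundary of a $(d+1)$-simplex is the $d$-cycle $\partial_{d+1}\tau$, where $\tau$ is an (oriented) set of $d+2$ vertices all of whose $(d+1)$-element subsets are $d$-faces of $Y$. All logarithms are natural. Asymptotically almost surely means with probability tending to $1$ as $n\to\infty$ (with $d$ and $c$ fixed).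
   Formalization: "At most a bounded number" is proved as bounded in probability: a.a.s. copies generate the homology, and for each ε some M suffices with probability at least 1−ε for large n; a single M for "asymptotically almost surely" fails, as the number of copies is asymptotically Poisson. *)

theory Defs
  imports "HOL-Probability.Probability" "HOL-Analysis.Finite_Function_Topology"
begin

text \<open>A complex is the set of its faces, with vertices in \<^typ>\<open>nat\<close>; the empty set counts as a
  face. A face of dimension \<open>k\<close> has \<open>k + 1\<close> vertices.\<close>

definition faces :: "nat set set \<Rightarrow> nat \<Rightarrow> nat set set" where
  "faces Y k = {\<sigma> \<in> Y. card \<sigma> = k + 1}"

definition chains :: "nat set set \<Rightarrow> nat \<Rightarrow> (nat set \<Rightarrow>\<^sub>0 real) set" where
  "chains Y k = {x. Poly_Mapping.keys x \<subseteq> faces Y k}"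

text \<open>Every face is oriented by the increasing order of its vertices, so the basis chain
  \<open>Poly_Mapping.single \<sigma> 1\<close> stands for \<open>[v\<^sub>0, \<dots>, v\<^sub>k]\<close>, where \<open>\<sigma> = {v\<^sub>0 < \<dots> < v\<^sub>k}\<close>, and has
  boundary \<open>\<Sum>i\<le>k. (-1)^i [v\<^sub>0, \<dots>, v\<^sub>i omitted, \<dots>, v\<^sub>k]\<close>. In dimension \<open>0\<close> this yields the
  augmentation.\<close>

definition face_boundary :: "nat set \<Rightarrow> (nat set \<Rightarrow>\<^sub>0 real)" where
  "face_boundary \<sigma> =
     (\<Sum>i<card \<sigma>. Poly_Mapping.single (\<sigma> - {sorted_list_of_set \<sigma> ! i}) ((-1) ^ i))"

definition boundary :: "(nat set \<Rightarrow>\<^sub>0 real) \<Rightarrow> (nat set \<Rightarrow>\<^sub>0 real)" where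
  "boundary x = (\<Sum>\<sigma>\<in>Poly_Mapping.keys x. Poly_Mapping.lookup x \<sigma> *\<^sub>R face_boundary \<sigma>)"

text \<open>In a complex of dimension \<open>d\<close> there are no \<open>d\<close>-boundaries to factor out, so the
  homology in degree \<open>d\<close> is the space of \<open>d\<close>-cycles.\<close>

definition top_homology :: "nat set set \<Rightarrow> nat \<Rightarrow> (nat set \<Rightarrow>\<^sub>0 real) set" where
  "top_homology Y d = {x \<in> chains Y d. boundary x = 0}"

text \<open>Only one of the two opposite orientations of each \<open>\<tau>\<close> is listed. The simplex \<open>\<tau>\<close> itself need
  not belong to \<open>Y\<close>.\<close>

definition simplex_boundaries :: "nat set set \<Rightarrow> nat \<Rightarrow> (nat set \<Rightarrow>\<^sub>0 real) set" where
  "simplex_boundaries Y d =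
     {face_boundary \<tau> | \<tau>. card \<tau> = d + 2 \<and> (\<forall>\<sigma>\<subseteq>\<tau>. card \<sigma> = d + 1 \<longrightarrow> \<sigma> \<in> faces Y d)}"

definition random_complex :: "nat \<Rightarrow> nat \<Rightarrow> real \<Rightarrow> nat set set pmf" where
  "random_complex d n p =
     map_pmf (\<lambda>f. {\<sigma>. \<sigma> \<subseteq> {..<n} \<and> card \<sigma> \<le> d} \<union> {\<sigma>. \<sigma> \<subseteq> {..<n} \<and> card \<sigma> = d + 1 \<and> f \<sigma>})
       (Pi_pmf {\<sigma>. \<sigma> \<subseteq> {..<n} \<and> card \<sigma> = d + 1} False (\<lambda>_. bernoulli_pmf p))"

definition is_root :: "nat \<Rightarrow> real \<Rightarrow> bool" where
  "is_root d t \<longleftrightarrow> 0 < t \<and> t < 1 \<and> (real d + 1) * (1 - t) + (1 + real d * t) * ln t = 0"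

definition t_star :: "nat \<Rightarrow> real" where
  "t_star d = (THE t. is_root d t)"

definition c_star :: "nat \<Rightarrow> real" where
  "c_star d = - ln (t_star d) / (1 - t_star d) ^ d"

lemma ex1_root:
  assumes "2 \<le> d"
  shows "\<exists>!t. is_root d t"
proof -
  define f where "f t = (real d + 1) * (1 - t) + (1 + real d * t) * ln t" for t
  define g where "g t = -1 + real d * ln t + 1 / t" for t
  have d: "real d \<ge> 2" using assms by simp
  have df: "(f has_real_derivative g t) (at t)" if "t > 0" for t
    unfolding f_def g_def using that
    by (auto intro!: derivative_eq_intros simp: field_simps)
  have dg: "(g has_real_derivative (real d * t - 1) / t\<^sup>2) (at t)" if "t > 0" for t
    unfolding g_def using that
    by (auto intro!: derivative_eq_intros simp: field_simps power2_eq_square)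
  define a where "a = 1 / real d"
  have a: "0 < a" "a < 1" using d by (auto simp: a_def)
  have f1: "f 1 = 0" by (simp add: f_def)
  have g_inc: "g x < g y" if "a \<le> x" "x < y" for x y
  proof (rule DERIV_pos_imp_increasing_open[OF \<open>x < y\<close>])
    fix t assume "x < t" "t < y"
    have "real d * a = 1" using d by (simp add: a_def)
    moreover have "t > a" "real d * t > real d * a" using that \<open>x < t\<close> d by auto
    ultimately have "t > 0" "real d * t > 1" using a by auto
    then show "\<exists>D. (g has_real_derivative D) (at t) \<and> 0 < D"
      using dg by (intro exI[of _ "(real d * t - 1) / t\<^sup>2"]) auto
  next
    show "continuous_on {x..y} g"
      using that a by (intro continuous_at_imp_continuous_on ballI DERIV_isCont[OF dg]) auto
  qed
  have g_neg: "g x < 0" if "a \<le> x" "x < 1" for x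
    using g_inc[OF that] by (simp add: g_def)
  have g_dec: "g y < g x" if "0 < x" "x < y" "y \<le> a" for x y
  proof (rule DERIV_neg_imp_decreasing_open[OF \<open>x < y\<close>])
    fix t assume "x < t" "t < y"
    have "real d * a = 1" using d by (simp add: a_def)
    moreover have "t > 0" "real d * t < real d * a" using that \<open>x < t\<close> \<open>t < y\<close> d by auto
    ultimately have "t > 0" "real d * t < 1" by auto
    then show "\<exists>D. (g has_real_derivative D) (at t) \<and> D < 0"
      using dg by (intro exI[of _ "(real d * t - 1) / t\<^sup>2"]) (auto simp: divide_neg_pos)
  next
    show "continuous_on {x..y} g"
      using that a by (intro continuous_at_imp_continuous_on ballI DERIV_isCont[OF dg]) auto
  qed
  have f_contr: False if "0 < x" "x < y" "y < 1" "f x = 0" "f y = 0" for x y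
  proof -
    have "\<exists>u>x. u < y \<and> f y - f x = (y - x) * g u"
      using \<open>0 < x\<close> by (intro MVT2 \<open>x < y\<close> df) linarith
    then obtain u where u: "x < u" "u < y" "f y - f x = (y - x) * g u" by blast
    have "\<exists>v>y. v < 1 \<and> f 1 - f y = (1 - y) * g v"
      using \<open>0 < x\<close> \<open>x < y\<close> by (intro MVT2 \<open>y < 1\<close> df) linarith
    then obtain v where v: "y < v" "v < 1" "f 1 - f y = (1 - y) * g v" by blast
    have gu: "g u = 0" using u(3) \<open>f x = 0\<close> \<open>f y = 0\<close> \<open>x < y\<close> by simp
    have gv: "g v = 0" using v(3) f1 \<open>f y = 0\<close> \<open>y < 1\<close> by simp
    have "v < a" using g_neg[of v] gv v(2) by linarith
    then have "g v < g u" using u v \<open>0 < x\<close> by (intro g_dec) linarith+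
    then show False using gu gv by simp
  qed
  have "\<exists>x>0. x < a \<and> f x < 0"
  proof -
    define x where "x = exp (- (2 * real d + 1))"
    have "x > 0" by (simp add: x_def)
    have "2 * real d + 1 < exp (2 * real d + 1)"
      using exp_ge_add_one_self[of "2 * real d + 1"] by linarith
    then have "x < 1 / (2 * real d + 1)"
      unfolding x_def exp_minus using d by (simp add: field_simps)
    also have "\<dots> \<le> a" unfolding a_def using d by (intro divide_left_mono) auto
    finally have "x < a" .
    have "f x = (real d + 1) * (1 - x) - (1 + real d * x) * (2 * real d + 1)"
      by (simp add: f_def x_def algebra_simps)
    also have "\<dots> \<le> (real d + 1) * 1 - 1 * (2 * real d + 1)"
      using d \<open>x > 0\<close> \<open>x < a\<close> \<open>a < 1\<close> by (intro diff_mono mult_mono) auto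
    also have "\<dots> < 0" using d by simp
    finally show ?thesis using \<open>x > 0\<close> \<open>x < a\<close> by blast
  qed
  then obtain x where x: "0 < x" "x < a" "f x < 0" by blast
  have fa: "f a > 0"
  proof -
    have "\<exists>v>a. v < 1 \<and> f 1 - f a = (1 - a) * g v"
      using \<open>0 < a\<close> by (intro MVT2 \<open>a < 1\<close> df) linarith
    then obtain v where v: "a < v" "v < 1" "f 1 - f a = (1 - a) * g v" by blast
    have "(1 - a) * g v < 0" using g_neg[of v] v a by (intro mult_pos_neg) auto
    then show ?thesis using v f1 by simp
  qed
  have "continuous_on {x..a} f"
    using x(1) by (intro continuous_at_imp_continuous_on ballI DERIV_isCont[OF df]) auto
  then obtain r where r: "x \<le> r" "r \<le> a" "f r = 0"
    using IVT'[of f x 0 a] x fa by auto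
  have "0 < r" "r < 1" using r x a by linarith+
  then have "is_root d r" using r by (simp add: is_root_def f_def)
  moreover have "s = r" if "is_root d s" for s
  proof -
    have "0 < s" "s < 1" "f s = 0" using that by (auto simp: is_root_def f_def)
    then show ?thesis
      using f_contr[of s r] f_contr[of r s] \<open>0 < r\<close> \<open>r < 1\<close> \<open>f r = 0\<close>
      by (cases s r rule: linorder_cases) blast+
  qed
  ultimately show ?thesis by blast
qed

end

theory Submission
  imports Defs "HOL-Real_Asymp.Real_Asymp"
begin

text \<open>Let \<open>F\<close> be the random set of \<open>d\<close>-faces and let \<open>p = c / n\<close>. A \<open>d\<close>-cycle is a linear relation between
the chains \<open>\<partial>\<sigma>\<close>, \<open>\<sigma> \<in> F\<close>. The theorem follows from two facts about such relations.

\<^emph>\<open>Few faces lie in cycles\<close> (\<open>expected_cyclic_small\<close>). The rank of \<open>{\<partial>\<sigma> | \<sigma> \<in> F}\<close> is the trace of an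
orthogonal projection, that is, the sum over all \<open>(d-1)\<close>-faces \<open>\<tau>\<close> of one minus the squared distance
of the basis chain \<open>e\<^sub>\<tau>\<close> from the span (\<open>card_ge_of_approximation\<close>). This distance is bounded by
looking only at the faces of \<open>F\<close> near \<open>\<tau>\<close>, which form a tree with high probability: the best
combination of boundaries along the tree leaves a residue that satisfies a recursion, the one of
resistances in electrical networks (\<open>local_approximation\<close>). In the limit, the residue is a random
variable given by a Galton-Watson tree with Poisson offspring (\<open>cavity\<close>). Its mean decreases with the depth of the
tree. The limit of the means is at most \<open>t + c (1-t)^(d+1) / (d+1) + c t (1-t)^d - c / (d+1)\<close>, where
\<open>t = exp (- c (1-t)^d)\<close> is the limiting probability of a residue bounded away from \<open>0\<close>. For \<open>c\<close>
below \<open>c_star d\<close> this bound is at most \<open>1 - c / (d+1)\<close> (\<open>fixed_point_mean_le_1\<close>).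
So below \<open>c_star d\<close> the rank is, up to \<open>o(n^d)\<close>, at least \<open>c / (d+1)\<close> times the
number of \<open>(d-1)\<close>-faces, which is asymptotically the expected number of \<open>d\<close>-faces: there are hardly any
linear relations. To pass from few relations to few faces involved in relations, the statement is applied
to a slightly larger constant \<open>c' < c_star d\<close>, and the faces are added in two rounds. A face of the
second round whose boundary is spanned by the first round does not contribute to the rank (\<open>shadow_hits\<close>), hence there are few
of these, hence few sets outside \<open>F\<close> have a boundary spanned by \<open>F\<close>. Moving one face in or out of \<open>F\<close>
turns this into a bound for the faces of \<open>F\<close> which are spanned by the others (\<open>expected_cyclic\<close>).

\<^emph>\<open>A small support contains the boundary of a simplex\<close> (\<open>core_gap\<close>). The support of a cycle is a core: every
facet of each of its faces lies in a second face. With high probability, every core in \<open>F\<close> with at most \<open>\<delta> n^d\<close>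
faces contains all facets of some \<open>(d+1)\<close>-simplex. To see this, explore a core face by face, always
across a facet that lies in one face only so far. A core of \<open>m + 1\<close> faces without the boundary of a simplex
has at most \<open>m\<close> vertices (\<open>core_few_vertices\<close>), which excludes cores of bounded size. For larger ones the exploration
must close up, and a positive proportion of its steps choose the new vertex from a set that is small compared to
\<open>n\<close> (\<open>walk_invariant\<close>). This makes the expected number of cores decay geometrically in \<open>m\<close>.

Together, with high probability every cycle has a support of at most \<open>\<delta> n^d\<close> faces, thus contains the boundary of
a simplex. Subtracting a multiple of it makes the support smaller, and induction expresses every
cycle by boundaries of simplices (\<open>top_homology_eq_span\<close>). The expected number of copies of this boundary is at most
\<open>c^(d+2)\<close>, so their number is bounded in probability.\<close>

section \<open>Random sums and the cavity recursion\<close>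

primrec iid_sum :: "nat \<Rightarrow> real pmf \<Rightarrow> real pmf" where
  "iid_sum 0 \<xi> = return_pmf 0"
| "iid_sum (Suc m) \<xi> = bind_pmf \<xi> (\<lambda>y. map_pmf ((+) y) (iid_sum m \<xi>))"

definition compound_sum :: "nat pmf \<Rightarrow> real pmf \<Rightarrow> real pmf" where
  "compound_sum N \<xi> = bind_pmf N (\<lambda>m. iid_sum m \<xi>)"

text \<open>The law of the residue \<open>energy\<close> at the root of a random tree of depth \<open>k\<close>: the root has \<open>N\<close> children \<open>v\<close>,
each of which has \<open>d\<close> independent copies of the same tree, of depth \<open>k - 1\<close>, below it.\<close>

primrec cavity :: "nat pmf \<Rightarrow> nat \<Rightarrow> nat \<Rightarrow> real pmf" where
  "cavity N d 0 = return_pmf 1"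
| "cavity N d (Suc k) =
     map_pmf (\<lambda>s. 1 / (1 + s)) (compound_sum N (map_pmf inverse (iid_sum d (cavity N d k))))"

lemma set_iid_sum_nonneg:
  assumes "set_pmf \<xi> \<subseteq> {0..}" shows "set_pmf (iid_sum m \<xi>) \<subseteq> {0..}"
  using assms by (induction m) (force simp: subset_eq)+

lemma set_iid_sum_pos:
  assumes "set_pmf \<xi> \<subseteq> {0<..}" "m > 0" shows "set_pmf (iid_sum m \<xi>) \<subseteq> {0<..}"
proof -
  obtain j where j: "m = Suc j" using assms(2) by (cases m) auto
  have "set_pmf \<xi> \<subseteq> {0..}" using assms(1) by force
  then have "set_pmf (iid_sum j \<xi>) \<subseteq> {0..}" by (rule set_iid_sum_nonneg)
  then show ?thesis using assms(1) unfolding j by (force simp: subset_eq intro: add_pos_nonneg)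
qed

lemma set_compound_sum_nonneg:
  assumes "set_pmf \<xi> \<subseteq> {0..}" shows "set_pmf (compound_sum N \<xi>) \<subseteq> {0..}"
  using set_iid_sum_nonneg[OF assms] by (auto simp: compound_sum_def)

lemma set_cavity:
  assumes "d > 0" shows "set_pmf (cavity N d k) \<subseteq> {0<..1}"
proof (induction k)
  case (Suc k)
  have "set_pmf (iid_sum d (cavity N d k)) \<subseteq> {0<..}"
    using Suc assms by (intro set_iid_sum_pos) auto
  then have "set_pmf (map_pmf inverse (iid_sum d (cavity N d k))) \<subseteq> {0..}"
    by (force simp: subset_eq)
  then have "set_pmf (compound_sum N (map_pmf inverse (iid_sum d (cavity N d k)))) \<subseteq> {0..}"
    by (rule set_compound_sum_nonneg)
  then show ?case by (force simp: subset_eq)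
qed simp

lemma rel_iid_sum:
  assumes "rel_pmf R p q" "P 0 0" "\<And>x y a b. R x y \<Longrightarrow> P a b \<Longrightarrow> P (x + a) (y + b)"
  shows "rel_pmf P (iid_sum m p) (iid_sum m q)"
proof (induction m)
  case (Suc m)
  show ?case unfolding iid_sum.simps
    by (rule rel_pmf_bindI[OF assms(1)])
       (auto simp: pmf.rel_map intro!: pmf.rel_mono_strong[OF Suc] assms(3))
qed (simp add: assms)

lemma rel_iid_sum_pos:
  assumes "rel_pmf (\<lambda>x y. 0 < y \<and> y \<le> (x::real)) p q" "m > 0"
  shows "rel_pmf (\<lambda>x y. 0 < y \<and> y \<le> x) (iid_sum m p) (iid_sum m q)"
proof -
  obtain j where j: "m = Suc j" using assms(2) by (cases m) auto
  have *: "rel_pmf (\<lambda>x y. 0 \<le> y \<and> y \<le> x) (iid_sum j p) (iid_sum j q)"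
    by (rule rel_iid_sum[OF assms(1)]) auto
  show ?thesis unfolding j iid_sum.simps
    by (rule rel_pmf_bindI[OF assms(1)])
       (auto simp: pmf.rel_map intro!: pmf.rel_mono_strong[OF *])
qed

lemma rel_compound_sum:
  assumes "rel_pmf (\<lambda>x y. 0 \<le> x \<and> x \<le> (y::real)) p q"
  shows "rel_pmf (\<lambda>x y. 0 \<le> x \<and> x \<le> y) (compound_sum N p) (compound_sum N q)"
  unfolding compound_sum_def
  by (rule rel_pmf_bindI[where R = "(=)"])
     (auto simp: pmf.rel_eq intro!: rel_iid_sum[OF assms])

text \<open>A deeper tree leaves a smaller residue. The recursion is antitone twice, in the sum of the \<open>d\<close>
residues and in the outer sum, so that a monotone coupling is passed on from one depth to the next.\<close>

lemma rel_cavity: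
  assumes "d > 0"
  shows "rel_pmf (\<lambda>x y. 0 < y \<and> y \<le> x) (cavity N d k) (cavity N d (Suc k))"
proof (induction k)
  case 0
  show ?case
    using set_cavity[OF assms, of N "Suc 0"]
    by (simp add: rel_pmf_return_pmf1 subset_eq del: cavity.simps(2))
next
  case (Suc k)
  have "rel_pmf (\<lambda>x y. 0 < y \<and> y \<le> x) (iid_sum d (cavity N d k)) (iid_sum d (cavity N d (Suc k)))"
    by (rule rel_iid_sum_pos[OF Suc assms])
  then have "rel_pmf (\<lambda>x y. 0 \<le> x \<and> x \<le> y) (map_pmf inverse (iid_sum d (cavity N d k)))
     (map_pmf inverse (iid_sum d (cavity N d (Suc k))))"
    unfolding pmf.rel_map by (rule pmf.rel_mono_strong) (auto intro!: le_imp_inverse_le)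
  from rel_compound_sum[OF this, of N]
  show ?case unfolding cavity.simps(2)[of N d "Suc k"] cavity.simps(2)[of N d k]
    unfolding pmf.rel_map
    by (rule pmf.rel_mono_strong) (auto intro!: frac_le simp: cavity.simps)
qed

lemma rel_pmf_nn_integral_mono:
  assumes "rel_pmf R p q" "\<And>x y. R x y \<Longrightarrow> f x \<le> g y"
  shows "(\<integral>\<^sup>+x. f x \<partial>measure_pmf p) \<le> (\<integral>\<^sup>+y. g y \<partial>measure_pmf q)"
proof -
  from assms(1) obtain pq where pq: "\<And>x y. (x, y) \<in> set_pmf pq \<Longrightarrow> R x y"
    and p: "map_pmf fst pq = p" and q: "map_pmf snd pq = q"
    by (auto elim: rel_pmf.cases)
  have "(\<integral>\<^sup>+x. f x \<partial>measure_pmf p) = (\<integral>\<^sup>+z. f (fst z) \<partial>measure_pmf pq)"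
    by (simp flip: p)
  also have "\<dots> \<le> (\<integral>\<^sup>+z. g (snd z) \<partial>measure_pmf pq)"
    by (rule nn_integral_mono_AE) (auto simp: AE_measure_pmf_iff intro!: assms(2) pq)
  also have "\<dots> = (\<integral>\<^sup>+y. g y \<partial>measure_pmf q)" by (simp flip: q)
  finally show ?thesis .
qed

text \<open>Each of the \<open>m + 1\<close> summands contributes the same to the weight \<open>s\<close>, so that one of them may be singled
out.\<close>

lemma nn_integral_iid_sum_weighted:
  assumes "set_pmf \<xi> \<subseteq> {0..}"
  shows "(\<integral>\<^sup>+s. ennreal s * \<psi> s \<partial>iid_sum (Suc m) \<xi>) =
    of_nat (Suc m) * (\<integral>\<^sup>+y. \<integral>\<^sup>+s. ennreal y * \<psi> (y + s) \<partial>iid_sum m \<xi> \<partial>\<xi>)"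
proof (induction m arbitrary: \<psi>)
  case 0
  then show ?case by simp
next
  case (Suc m)
  have nn: "x \<ge> 0" if "x \<in> set_pmf \<xi>" for x using assms that by auto
  have nn': "x \<ge> 0" if "x \<in> set_pmf (iid_sum j \<xi>)" for x j
    using set_iid_sum_nonneg[OF assms] that by auto
  have "(\<integral>\<^sup>+s. ennreal s * \<psi> s \<partial>iid_sum (Suc (Suc m)) \<xi>) =
     (\<integral>\<^sup>+y. \<integral>\<^sup>+s. ennreal (y + s) * \<psi> (y + s) \<partial>iid_sum (Suc m) \<xi> \<partial>\<xi>)"
    by (simp del: iid_sum.simps add: iid_sum.simps(2)[of "Suc m"])
  also have "\<dots> = (\<integral>\<^sup>+y. (\<integral>\<^sup>+s. ennreal y * \<psi> (y + s) \<partial>iid_sum (Suc m) \<xi>) +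
      (\<integral>\<^sup>+s. ennreal s * \<psi> (y + s) \<partial>iid_sum (Suc m) \<xi>) \<partial>\<xi>)"
    by (intro nn_integral_cong_AE AE_pmfI, subst nn_integral_add[symmetric])
       (auto intro!: nn_integral_cong_AE AE_pmfI simp: ennreal_plus nn nn' distrib_right
          simp del: iid_sum.simps)
  also have "\<dots> = (\<integral>\<^sup>+y. (\<integral>\<^sup>+s. ennreal y * \<psi> (y + s) \<partial>iid_sum (Suc m) \<xi>) \<partial>\<xi>) +
      (\<integral>\<^sup>+y. (\<integral>\<^sup>+s. ennreal s * \<psi> (y + s) \<partial>iid_sum (Suc m) \<xi>) \<partial>\<xi>)"
    by (rule nn_integral_add) auto
  also have "(\<integral>\<^sup>+y. (\<integral>\<^sup>+s. ennreal s * \<psi> (y + s) \<partial>iid_sum (Suc m) \<xi>) \<partial>\<xi>) =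
     (\<integral>\<^sup>+y. of_nat (Suc m) * (\<integral>\<^sup>+y'. \<integral>\<^sup>+s. ennreal y' * \<psi> (y + (y' + s)) \<partial>iid_sum m \<xi> \<partial>\<xi>) \<partial>\<xi>)"
    by (subst Suc) simp
  also have "\<dots> = of_nat (Suc m) * (\<integral>\<^sup>+y. \<integral>\<^sup>+y'. \<integral>\<^sup>+s. ennreal y' * \<psi> (y + (y' + s)) \<partial>iid_sum m \<xi> \<partial>\<xi> \<partial>\<xi>)"
    by (rule nn_integral_cmult) auto
  also have "(\<integral>\<^sup>+y. \<integral>\<^sup>+y'. \<integral>\<^sup>+s. ennreal y' * \<psi> (y + (y' + s)) \<partial>iid_sum m \<xi> \<partial>\<xi> \<partial>\<xi>) =
     (\<integral>\<^sup>+z. (case z of (y,y') \<Rightarrow> \<integral>\<^sup>+s. ennreal y' * \<psi> (y' + (y + s)) \<partial>iid_sum m \<xi>) \<partial>pair_pmf \<xi> \<xi>)"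
    by (simp add: nn_integral_pair_pmf' add_ac)
  also have "\<dots> = (\<integral>\<^sup>+z. (case z of (y',y) \<Rightarrow> \<integral>\<^sup>+s. ennreal y' * \<psi> (y' + (y + s)) \<partial>iid_sum m \<xi>) \<partial>pair_pmf \<xi> \<xi>)"
    by (subst pair_commute_pmf) (simp add: case_prod_unfold)
  also have "\<dots> = (\<integral>\<^sup>+y'. \<integral>\<^sup>+s. ennreal y' * \<psi> (y' + s) \<partial>iid_sum (Suc m) \<xi> \<partial>\<xi>)"
    by (simp add: nn_integral_pair_pmf')
  finally show ?case
    by (simp del: iid_sum.simps add: distrib_right)
qed

lemma nn_integral_iid_sum:
  assumes "set_pmf \<xi> \<subseteq> {0..}"
  shows "(\<integral>\<^sup>+s. ennreal s \<partial>iid_sum m \<xi>) = of_nat m * (\<integral>\<^sup>+y. ennreal y \<partial>\<xi>)"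
proof (cases m)
  case (Suc j)
  then show ?thesis using nn_integral_iid_sum_weighted[OF assms, of j "\<lambda>_. 1"]
    by (simp del: iid_sum.simps)
qed simp

lemma nn_integral_poisson:
  assumes "c > 0"
  shows "(\<integral>\<^sup>+m. g m \<partial>poisson_pmf c) = suminf (\<lambda>m. ennreal (c ^ m / fact m * exp (-c)) * g m)"
  using assms by (simp add: nn_integral_measure_pmf nn_integral_count_space_nat)

text \<open>Size biasing a compound Poisson sum adds one independent size biased summand.\<close>

lemma nn_integral_compound_poisson_weighted:
  assumes "set_pmf \<xi> \<subseteq> {0..}" "c > 0"
  shows "(\<integral>\<^sup>+s. ennreal s * \<psi> s \<partial>compound_sum (poisson_pmf c) \<xi>) =
    ennreal c * (\<integral>\<^sup>+s. \<integral>\<^sup>+y. ennreal y * \<psi> (y + s) \<partial>\<xi> \<partial>compound_sum (poisson_pmf c) \<xi>)"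
proof -
  define G where "G m = (\<integral>\<^sup>+y. \<integral>\<^sup>+s. ennreal y * \<psi> (y + s) \<partial>iid_sum m \<xi> \<partial>\<xi>)" for m
  define w where "w m = ennreal (c ^ m / fact m * exp (-c))" for m
  have w: "w (Suc m) * of_nat (Suc m) = ennreal c * w m" for m
  proof -
    have "w (Suc m) * of_nat (Suc m) = ennreal (c ^ Suc m / fact (Suc m) * exp (-c) * real (Suc m))"
      unfolding w_def ennreal_of_nat_eq_real_of_nat
      by (rule ennreal_mult''[symmetric]) simp
    also have "c ^ Suc m / fact (Suc m) * exp (-c) * real (Suc m) = c * (c ^ m / fact m * exp (-c))"
      by (simp add: field_simps del: of_nat_Suc)
    also have "ennreal \<dots> = ennreal c * w m"
      unfolding w_def using assms(2) by (intro ennreal_mult'') simp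
    finally show ?thesis .
  qed
  have G: "G m = (\<integral>\<^sup>+s. \<integral>\<^sup>+y. ennreal y * \<psi> (y + s) \<partial>\<xi> \<partial>iid_sum m \<xi>)" for m
  proof -
    have "G m = (\<integral>\<^sup>+z. (case z of (y,s) \<Rightarrow> ennreal y * \<psi> (y + s)) \<partial>pair_pmf \<xi> (iid_sum m \<xi>))"
      by (simp add: G_def nn_integral_pair_pmf')
    also have "\<dots> = (\<integral>\<^sup>+z. (case z of (s,y) \<Rightarrow> ennreal y * \<psi> (y + s)) \<partial>pair_pmf (iid_sum m \<xi>) \<xi>)"
      by (subst pair_commute_pmf) (simp add: case_prod_unfold)
    finally show ?thesis by (simp add: nn_integral_pair_pmf')
  qed
  have "(\<integral>\<^sup>+s. ennreal s * \<psi> s \<partial>compound_sum (poisson_pmf c) \<xi>) =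
     suminf (\<lambda>m. w m * (\<integral>\<^sup>+s. ennreal s * \<psi> s \<partial>iid_sum m \<xi>))"
    by (simp add: compound_sum_def nn_integral_poisson[OF assms(2)] w_def)
  also have "\<dots> = suminf (\<lambda>m. w (m + 1) * (\<integral>\<^sup>+s. ennreal s * \<psi> s \<partial>iid_sum (m + 1) \<xi>))"
    using suminf_offset[of "\<lambda>m. w m * (\<integral>\<^sup>+s. ennreal s * \<psi> s \<partial>iid_sum m \<xi>)" 1]
    by (simp add: summableI del: iid_sum.simps(2))
  also have "\<dots> = suminf (\<lambda>m. ennreal c * (w m * G m))"
    by (simp add: nn_integral_iid_sum_weighted[OF assms(1)] w mult.assoc[symmetric] G_def
        del: iid_sum.simps(2) of_nat_Suc)
  also have "\<dots> = ennreal c * suminf (\<lambda>m. w m * G m)" by simp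
  also have "suminf (\<lambda>m. w m * G m) = (\<integral>\<^sup>+s. \<integral>\<^sup>+y. ennreal y * \<psi> (y + s) \<partial>\<xi> \<partial>compound_sum (poisson_pmf c) \<xi>)"
    by (simp add: compound_sum_def nn_integral_poisson[OF assms(2)] w_def G)
  finally show ?thesis .
qed

text \<open>Each summand of a small nonnegative sum is small.\<close>

lemma prob_iid_sum_le:
  assumes "set_pmf \<xi> \<subseteq> {0..}"
  shows "measure_pmf.prob (iid_sum m \<xi>) {..b} \<le> measure_pmf.prob \<xi> {..b} ^ m"
proof -
  have "emeasure (iid_sum m \<xi>) {..b} \<le> emeasure \<xi> {..b} ^ m"
  proof (induction m)
    case (Suc m)
    have "emeasure (iid_sum (Suc m) \<xi>) {..b} = (\<integral>\<^sup>+y. emeasure (iid_sum m \<xi>) ((+) y -` {..b}) \<partial>\<xi>)"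
      by simp
    also have "\<dots> \<le> (\<integral>\<^sup>+y. indicator {..b} y * emeasure (iid_sum m \<xi>) {..b} \<partial>\<xi>)"
    proof (intro nn_integral_mono_AE AE_pmfI)
      fix y assume "y \<in> set_pmf \<xi>"
      then have y: "y \<ge> 0" using assms by auto
      show "emeasure (iid_sum m \<xi>) ((+) y -` {..b}) \<le> indicator {..b} y * emeasure (iid_sum m \<xi>) {..b}"
      proof (cases "y \<le> b")
        case True
        then show ?thesis using y by (auto intro!: emeasure_mono)
      next
        case False
        have "emeasure (iid_sum m \<xi>) ((+) y -` {..b}) = 0"
          using False set_iid_sum_nonneg[OF assms, of m]
          by (auto simp: measure_pmf.emeasure_eq_measure measure_pmf_zero_iff)
        then show ?thesis by simp
      qed
    qed
    also have "\<dots> = emeasure \<xi> {..b} * emeasure (iid_sum m \<xi>) {..b}"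
      by (subst nn_integral_multc) auto
    also have "\<dots> \<le> emeasure \<xi> {..b} * emeasure \<xi> {..b} ^ m"
      by (intro mult_left_mono Suc) simp
    finally show ?case by simp
  qed (simp add: indicator_def measure_pmf.emeasure_eq_measure)
  then show ?thesis
    by (simp add: measure_pmf.emeasure_eq_measure ennreal_power)
qed

lemma prob_iid_sum_ge:
  shows "measure_pmf.prob (iid_sum m \<xi>) {..real m * b} \<ge> measure_pmf.prob \<xi> {..b} ^ m"
proof -
  have "emeasure (iid_sum m \<xi>) {..real m * b} \<ge> emeasure \<xi> {..b} ^ m"
  proof (induction m)
    case (Suc m)
    have "emeasure \<xi> {..b} * emeasure \<xi> {..b} ^ m \<le> emeasure \<xi> {..b} * emeasure (iid_sum m \<xi>) {..real m * b}"
      by (intro mult_left_mono Suc) simp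
    also have "\<dots> = (\<integral>\<^sup>+y. indicator {..b} y * emeasure (iid_sum m \<xi>) {..real m * b} \<partial>\<xi>)"
      by (subst nn_integral_multc) auto
    also have "\<dots> \<le> (\<integral>\<^sup>+y. emeasure (iid_sum m \<xi>) ((+) y -` {..real (Suc m) * b}) \<partial>\<xi>)"
      by (intro nn_integral_mono) (auto intro!: emeasure_mono simp: indicator_def algebra_simps)
    also have "\<dots> = emeasure (iid_sum (Suc m) \<xi>) {..real (Suc m) * b}"
      by simp
    finally show ?case by simp
  qed (simp add: indicator_def measure_pmf.emeasure_eq_measure)
  then show ?thesis
    by (simp add: measure_pmf.emeasure_eq_measure ennreal_power)
qed

section \<open>Tails and means for Poisson offspring\<close>

lemma rel_cavity_Suc:
  assumes "d > 0"
  shows "rel_pmf (\<lambda>x y. 0 < x \<and> x \<le> y) (cavity N d (Suc k)) (cavity N d k)"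
proof -
  have "rel_pmf (\<lambda>x y. 0 < y \<and> y \<le> x)\<inverse>\<inverse> (cavity N d (Suc k)) (cavity N d k)"
    unfolding pmf.rel_flip by (rule rel_cavity[OF assms])
  then show ?thesis by (rule pmf.rel_mono_strong) auto
qed

lemma measure_pmf_mono_AE:
  assumes "\<And>x. x \<in> set_pmf p \<Longrightarrow> x \<in> A \<Longrightarrow> x \<in> B"
  shows "measure_pmf.prob p A \<le> measure_pmf.prob p B"
  by (rule measure_pmf.finite_measure_mono_AE) (auto simp: AE_measure_pmf_iff assms)

lemma poisson_sums_pgf:
  "(\<lambda>m. c ^ m / fact m * exp (-c) * q ^ m) sums exp (c * (q - 1))" for c q :: real
proof -
  have "(\<lambda>m. (c * q) ^ m /\<^sub>R fact m * exp (-c)) sums (exp (c * q) * exp (-c))"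
    by (rule sums_mult2[OF exp_converges])
  moreover have "exp (c * q) * exp (-c) = exp (c * (q - 1))"
    by (simp flip: exp_add add: algebra_simps)
  ultimately show ?thesis by (simp add: power_mult_distrib field_simps)
qed

lemma prob_bind_pmf:
  "ennreal (measure_pmf.prob (bind_pmf p f) A) = (\<integral>\<^sup>+x. ennreal (measure_pmf.prob (f x) A) \<partial>measure_pmf p)"
  using emeasure_bind_pmf[of p f A] unfolding measure_pmf.emeasure_eq_measure .

lemma prob_compound_poisson:
  assumes "c > 0"
  shows "(\<lambda>m. c ^ m / fact m * exp (-c) * measure_pmf.prob (iid_sum m \<xi>) A) sums
      measure_pmf.prob (compound_sum (poisson_pmf c) \<xi>) A"
proof -
  have nn: "0 \<le> c ^ m / fact m * exp (-c) * measure_pmf.prob (iid_sum m \<xi>) A" for m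
    using assms by simp
  have "summable (\<lambda>m. c ^ m / fact m * exp (-c) * 1 ^ m)"
    using poisson_sums_pgf[of c 1] by (rule sums_summable)
  then have sm: "summable (\<lambda>m. c ^ m / fact m * exp (-c) * measure_pmf.prob (iid_sum m \<xi>) A)"
  proof (rule summable_comparison_test'[where N = 0])
    fix m
    show "norm (c ^ m / fact m * exp (-c) * measure_pmf.prob (iid_sum m \<xi>) A)
        \<le> c ^ m / fact m * exp (-c) * 1 ^ m"
      using mult_left_mono[of "measure_pmf.prob (iid_sum m \<xi>) A" 1 "c ^ m / fact m * exp (-c)"] nn[of m] assms
      by simp
  qed
  have "ennreal (measure_pmf.prob (compound_sum (poisson_pmf c) \<xi>) A) =
     suminf (\<lambda>m. ennreal (c ^ m / fact m * exp (-c) * measure_pmf.prob (iid_sum m \<xi>) A))"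
    unfolding compound_sum_def prob_bind_pmf nn_integral_poisson[OF assms]
    by (intro suminf_cong ennreal_mult''[symmetric]) simp
  also have "\<dots> = ennreal (suminf (\<lambda>m. c ^ m / fact m * exp (-c) * measure_pmf.prob (iid_sum m \<xi>) A))"
    by (rule suminf_ennreal2[OF nn sm])
  finally have "measure_pmf.prob (compound_sum (poisson_pmf c) \<xi>) A =
     suminf (\<lambda>m. c ^ m / fact m * exp (-c) * measure_pmf.prob (iid_sum m \<xi>) A)"
    using suminf_nonneg[OF sm nn] by (simp add: ennreal_inj)
  then show ?thesis using summable_sums[OF sm] by simp
qed

context
  fixes c :: real and d :: nat
  assumes c: "c > 0" and d: "d > 0"
begin

private abbreviation "\<mu> \<equiv> cavity (poisson_pmf c) d"
private abbreviation "\<xi> k \<equiv> map_pmf inverse (iid_sum d (\<mu> k))"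
private abbreviation "tail k e \<equiv> measure_pmf.prob (\<mu> k) {e<..}"

lemma prob_cavity_le: "measure_pmf.prob (\<mu> k) {..e} = 1 - tail k e"
proof -
  have "{..e} = space (\<mu> k) - {e<..}" by auto
  then show ?thesis by (simp only: measure_pmf.prob_compl sets_measure_pmf UNIV_I)
qed

lemma cavity_nonneg: "set_pmf (\<mu> k) \<subseteq> {0..}"
  using set_cavity[OF d, of "poisson_pmf c" k] by force

lemma iid_cavity_pos: "set_pmf (iid_sum d (\<mu> k)) \<subseteq> {0<..}"
  using set_cavity[OF d, of "poisson_pmf c" k] d by (intro set_iid_sum_pos) auto

lemma \<xi>_nonneg: "set_pmf (\<xi> k) \<subseteq> {0..}"
  using iid_cavity_pos[of k] by (force simp: subset_eq)

lemma tail_Suc_le: "tail (Suc k) e \<le> tail k e"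
proof -
  have "(\<integral>\<^sup>+x. indicator {e<..} x \<partial>\<mu> (Suc k)) \<le> (\<integral>\<^sup>+x. indicator {e<..} x \<partial>\<mu> k)"
    by (rule rel_pmf_nn_integral_mono[OF rel_cavity_Suc[OF d]]) (auto simp: indicator_def)
  then show ?thesis by (simp add: measure_pmf.emeasure_eq_measure del: cavity.simps)
qed

text \<open>A residue above \<open>e\<close> forces all terms of the outer sum to be below \<open>1 / e\<close>, that is, no child has \<open>d\<close>
small residues below it. The number of children with \<open>d\<close> small residues is Poisson.\<close>

lemma tail_Suc_upper:
  assumes e: "e > 0"
  shows "tail (Suc k) e \<le> exp (- c * (1 - tail k (e / (2 * real d))) ^ d)"
proof -
  define q where "q = measure_pmf.prob (\<xi> k) {..1 / e}"
  have "tail (Suc k) e = measure_pmf.prob (compound_sum (poisson_pmf c) (\<xi> k)) {s. e < 1 / (1 + s)}"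
    by (simp add: vimage_def)
  also have "\<dots> \<le> measure_pmf.prob (compound_sum (poisson_pmf c) (\<xi> k)) {..1 / e}"
  proof (rule measure_pmf_mono_AE)
    fix s assume "s \<in> set_pmf (compound_sum (poisson_pmf c) (\<xi> k))" "s \<in> {s. e < 1 / (1 + s)}"
    moreover from this have "s \<ge> 0" using set_compound_sum_nonneg[OF \<xi>_nonneg[of k]] by auto
    ultimately have "e * (1 + s) < 1" by (simp add: field_simps)
    then have "e * s < 1" using e by (simp add: algebra_simps)
    then show "s \<in> {..1 / e}" using e by (simp add: field_simps)
  qed
  also have "\<dots> \<le> exp (c * (q - 1))"
  proof (rule sums_le[OF _ prob_compound_poisson[OF c] poisson_sums_pgf])
    fix m show "c ^ m / fact m * exp (- c) * measure_pmf.prob (iid_sum m (\<xi> k)) {..1 / e}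
         \<le> c ^ m / fact m * exp (- c) * q ^ m"
      unfolding q_def using c by (intro mult_left_mono prob_iid_sum_le \<xi>_nonneg) simp
  qed
  also have "\<dots> \<le> exp (- c * (1 - tail k (e / (2 * real d))) ^ d)"
  proof -
    have "(1 - tail k (e / (2 * real d))) ^ d \<le> measure_pmf.prob (iid_sum d (\<mu> k)) {..real d * (e / (2 * real d))}"
      using prob_iid_sum_ge[where \<xi> = "\<mu> k" and m = d and b = "e / (2 * real d)"] by (simp add: prob_cavity_le)
    also have "real d * (e / (2 * real d)) = e / 2" using d by simp
    also have "measure_pmf.prob (iid_sum d (\<mu> k)) {..e / 2} \<le>
       measure_pmf.prob (iid_sum d (\<mu> k)) (space (iid_sum d (\<mu> k)) - inverse -` {..1 / e})"
    proof (rule measure_pmf_mono_AE)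
      fix x assume "x \<in> set_pmf (iid_sum d (\<mu> k))" "x \<in> {..e / 2}"
      moreover from this have "x > 0" using iid_cavity_pos[of k] by auto
      ultimately show "x \<in> space (iid_sum d (\<mu> k)) - inverse -` {..1 / e}"
        using e by (auto simp: field_simps)
    qed
    also have "\<dots> = 1 - q"
      unfolding q_def by (subst measure_pmf.prob_compl) (auto simp: vimage_def)
    finally have "(1 - tail k (e / (2 * real d))) ^ d \<le> 1 - q" .
    then have "c * (1 - tail k (e / (2 * real d))) ^ d \<le> c * (1 - q)"
      using c by (intro mult_left_mono) auto
    then show ?thesis by (simp add: algebra_simps)
  qed
  finally show ?thesis .
qed

text \<open>Conversely, if there are at most \<open>M\<close> children and each has a residue of at least \<open>e\<close> below it, then
the outer sum is at most \<open>M / e\<close>. As \<open>M\<close> grows, the left hand side tends to the bound of \<open>tail_Suc_upper\<close>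
with \<open>e\<close> in place of \<open>e / (2 d)\<close>.\<close>

lemma tail_Suc_lower:
  assumes e: "e > 0"
  shows "(\<Sum>m\<le>M. c ^ m / fact m * exp (-c) * (1 - (1 - tail k e) ^ d) ^ m)
     \<le> tail (Suc k) (1 / (2 + real M / e))"
proof -
  define q where "q = measure_pmf.prob (\<xi> k) {..1 / e}"
  have q: "1 - (1 - tail k e) ^ d \<le> q"
  proof -
    have "1 - (1 - tail k e) ^ d \<le> 1 - measure_pmf.prob (iid_sum d (\<mu> k)) {..e}"
      using prob_iid_sum_le[OF cavity_nonneg, where m = d and b = e] by (simp add: prob_cavity_le)
    also have "\<dots> = measure_pmf.prob (iid_sum d (\<mu> k)) (space (iid_sum d (\<mu> k)) - {..e})"
      by (subst measure_pmf.prob_compl) auto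
    also have "\<dots> \<le> measure_pmf.prob (iid_sum d (\<mu> k)) (inverse -` {..1 / e})"
      by (rule measure_pmf_mono_AE) (use e in \<open>auto simp: field_simps\<close>)
    finally show ?thesis unfolding q_def by simp
  qed
  have q0: "0 \<le> 1 - (1 - tail k e) ^ d" by (simp add: power_le_one)
  have "(\<Sum>m\<le>M. c ^ m / fact m * exp (-c) * (1 - (1 - tail k e) ^ d) ^ m)
     \<le> (\<Sum>m\<le>M. c ^ m / fact m * exp (-c) * measure_pmf.prob (iid_sum m (\<xi> k)) {..real M / e})"
  proof (intro sum_mono mult_left_mono)
    fix m assume m: "m \<in> {..M}"
    have "(1 - (1 - tail k e) ^ d) ^ m \<le> q ^ m" by (intro power_mono q q0)
    also have "\<dots> \<le> measure_pmf.prob (iid_sum m (\<xi> k)) {..real m * (1 / e)}"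
      unfolding q_def by (rule prob_iid_sum_ge)
    also have "\<dots> \<le> measure_pmf.prob (iid_sum m (\<xi> k)) {..real M / e}"
      using m e by (intro measure_pmf.finite_measure_mono) (auto simp: field_simps intro: order_trans)
    finally show "(1 - (1 - tail k e) ^ d) ^ m \<le> measure_pmf.prob (iid_sum m (\<xi> k)) {..real M / e}" .
  qed (use c in simp)
  also have "\<dots> \<le> measure_pmf.prob (compound_sum (poisson_pmf c) (\<xi> k)) {..real M / e}"
    unfolding sums_unique[OF prob_compound_poisson[OF c]]
    by (intro sum_le_suminf sums_summable[OF prob_compound_poisson[OF c]]) (use c in auto)
  also have "\<dots> \<le> measure_pmf.prob (compound_sum (poisson_pmf c) (\<xi> k)) {s. 1 / (2 + real M / e) < 1 / (1 + s)}"
  proof (rule measure_pmf_mono_AE)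
    fix s assume "s \<in> set_pmf (compound_sum (poisson_pmf c) (\<xi> k))" and s: "s \<in> {..real M / e}"
    from this have "s \<ge> 0" using set_compound_sum_nonneg[OF \<xi>_nonneg[of k]] by auto
    then have "1 / (2 + real M / e) < 1 / (1 + s)"
      using s e by (intro divide_strict_left_mono) (auto intro!: mult_pos_pos add_pos_nonneg)
    then show "s \<in> {s. 1 / (2 + real M / e) < 1 / (1 + s)}" by simp
  qed
  also have "\<dots> = tail (Suc k) (1 / (2 + real M / e))"
    by (simp add: vimage_def)
  finally show ?thesis .
qed

definition cavity_mean :: "nat \<Rightarrow> real" where "cavity_mean k = measure_pmf.expectation (\<mu> k) (\<lambda>x. x)"

lemma nn_cavity_mean: "(\<integral>\<^sup>+x. ennreal x \<partial>\<mu> k) = ennreal (cavity_mean k)" and cavity_mean_nonneg: "0 \<le> cavity_mean k"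
proof -
  have "integrable (\<mu> k) (\<lambda>x. x)"
    using set_cavity[OF d, of "poisson_pmf c" k]
    by (intro measure_pmf.integrable_const_bound[where B = 1]) (force simp: AE_measure_pmf_iff)+
  moreover have *: "AE x in \<mu> k. 0 \<le> x" using cavity_nonneg[of k] by (auto simp: AE_measure_pmf_iff)
  ultimately show "(\<integral>\<^sup>+x. ennreal x \<partial>\<mu> k) = ennreal (cavity_mean k)"
    unfolding cavity_mean_def by (intro nn_integral_eq_integral)
  show "0 \<le> cavity_mean k" unfolding cavity_mean_def using * by (rule integral_nonneg_AE)
qed

lemma cavity_mean_Suc_le: "cavity_mean (Suc k) \<le> cavity_mean k"
proof -
  have "ennreal (cavity_mean (Suc k)) \<le> ennreal (cavity_mean k)"
    unfolding nn_cavity_mean[symmetric]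
    by (rule rel_pmf_nn_integral_mono[OF rel_cavity_Suc[OF d]]) (auto simp: ennreal_leI)
  then show ?thesis using cavity_mean_nonneg by (simp)
qed

text \<open>The share of \<open>x\<close> in \<open>x + X\<close>, cut off where one of the two is below \<open>h\<close>. In the region that remains
\<open>x / (x + X)\<close> is Lipschitz in \<open>X\<close>, with constant \<open>1 / h\<close>.\<close>

definition share :: "real \<Rightarrow> real \<Rightarrow> real \<Rightarrow> ennreal" where
  "share h x X = (if h < x \<and> h < X then ennreal (x / (x + X)) else 0)"

text \<open>Write the residue as \<open>x = 1 / (1 + s)\<close>, so that \<open>x + s x = 1\<close>. The term \<open>s x\<close> is evaluated by size biasing the
compound Poisson sum \<open>s\<close>: singling out a summand \<open>1 / X\<close> turns \<open>s x\<close> into \<open>c\<close> times the share of \<open>x\<close> in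
\<open>x + X\<close>. Where \<open>x\<close> is at most \<open>h / 2\<close>, the term \<open>s x\<close> is dropped and \<open>x\<close> itself is bounded by \<open>h\<close>.\<close>

lemma mean_share_le:
  assumes h: "h > 0"
  shows "ennreal (cavity_mean (Suc k)) + ennreal c * (\<integral>\<^sup>+x. \<integral>\<^sup>+X. share h x X \<partial>iid_sum d (\<mu> k) \<partial>\<mu> (Suc k))
    \<le> ennreal h + ennreal (tail (Suc k) (h / 2))"
proof -
  define C where "C = compound_sum (poisson_pmf c) (\<xi> k)"
  define \<psi> where "\<psi> s = (if h / 2 < 1 / (1 + s) then ennreal (1 / (1 + s)) else 0)" for s :: real
  have C0: "s \<ge> 0" if "s \<in> set_pmf C" for s
    using that set_compound_sum_nonneg[OF \<xi>_nonneg[of k]] by (auto simp: C_def)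
  have Cmap: "\<mu> (Suc k) = map_pmf (\<lambda>s. 1 / (1 + s)) C" by (simp add: C_def)
  have "ennreal c * (\<integral>\<^sup>+x. \<integral>\<^sup>+X. share h x X \<partial>iid_sum d (\<mu> k) \<partial>\<mu> (Suc k)) =
     ennreal c * (\<integral>\<^sup>+s. \<integral>\<^sup>+X. share h (1 / (1 + s)) X \<partial>iid_sum d (\<mu> k) \<partial>C)"
    unfolding Cmap by simp
  also have "\<dots> \<le> ennreal c * (\<integral>\<^sup>+s. \<integral>\<^sup>+X. ennreal (inverse X) * \<psi> (inverse X + s) \<partial>iid_sum d (\<mu> k) \<partial>C)"
  proof (intro mult_left_mono nn_integral_mono_AE AE_pmfI)
    fix s X assume "s \<in> set_pmf C" "X \<in> set_pmf (iid_sum d (\<mu> k))"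
    then have s: "s \<ge> 0" and X: "X > 0" using C0 iid_cavity_pos by auto
    show "share h (1 / (1 + s)) X \<le> ennreal (inverse X) * \<psi> (inverse X + s)"
    proof (cases "h < 1 / (1 + s) \<and> h < X")
      case True
      have "1 + s < 1 / h" using True s h by (simp add: field_simps)
      moreover have "inverse X < 1 / h" using True h X by (simp add: field_simps)
      ultimately have "1 + (inverse X + s) < 2 / h" by (simp add: field_simps)
      then have "h / 2 < 1 / (1 + (inverse X + s))"
        using h X s by (subst less_divide_eq) (auto simp: field_simps add_pos_nonneg)
      then have "ennreal (inverse X) * \<psi> (inverse X + s) = ennreal (inverse X * (1 / (1 + (inverse X + s))))"
        using X s unfolding \<psi>_def by (subst ennreal_mult) auto
      also have "inverse X * (1 / (1 + (inverse X + s))) = (1 / (1 + s)) / (1 / (1 + s) + X)"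
      proof -
        have "X * (1 + (inverse X + s)) = (1 / (1 + s) + X) * (1 + s)"
          using X s by (simp add: field_simps)
        moreover have "X * (1 + (inverse X + s)) > 0" using X s by (intro mult_pos_pos) (auto intro: add_pos_nonneg)
        ultimately show ?thesis by (simp add: divide_simps)
      qed
      finally show ?thesis using True by (simp add: share_def)
    qed (auto simp: share_def)
  qed simp
  also have "\<dots> = (\<integral>\<^sup>+s. ennreal s * \<psi> s \<partial>C)"
    unfolding C_def by (subst nn_integral_compound_poisson_weighted[OF \<xi>_nonneg c]) simp
  finally have *: "ennreal c * (\<integral>\<^sup>+x. \<integral>\<^sup>+X. share h x X \<partial>iid_sum d (\<mu> k) \<partial>\<mu> (Suc k))
     \<le> (\<integral>\<^sup>+s. ennreal s * \<psi> s \<partial>C)" .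
  have "ennreal (cavity_mean (Suc k)) + ennreal c * (\<integral>\<^sup>+x. \<integral>\<^sup>+X. share h x X \<partial>iid_sum d (\<mu> k) \<partial>\<mu> (Suc k))
     \<le> (\<integral>\<^sup>+s. ennreal (1 / (1 + s)) \<partial>C) + (\<integral>\<^sup>+s. ennreal s * \<psi> s \<partial>C)"
    unfolding nn_cavity_mean[symmetric] using * by (intro add_mono) (auto simp: Cmap simp del: cavity.simps)
  also have "\<dots> = (\<integral>\<^sup>+s. ennreal (1 / (1 + s)) + ennreal s * \<psi> s \<partial>C)"
    by (rule nn_integral_add[symmetric]) auto
  also have "\<dots> \<le> (\<integral>\<^sup>+s. ennreal h + indicator {s. h / 2 < 1 / (1 + s)} s \<partial>C)"
  proof (intro nn_integral_mono_AE AE_pmfI)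
    fix s assume "s \<in> set_pmf C"
    then have s: "s \<ge> 0" by (rule C0)
    show "ennreal (1 / (1 + s)) + ennreal s * \<psi> s \<le> ennreal h + indicator {s. h / 2 < 1 / (1 + s)} s"
    proof (cases "h / 2 < 1 / (1 + s)")
      case True
      have "ennreal (1 / (1 + s)) + ennreal s * \<psi> s = ennreal (1 / (1 + s) + s * (1 / (1 + s)))"
        using True s unfolding \<psi>_def by (simp add: ennreal_mult[symmetric] ennreal_plus[symmetric] del: ennreal_plus)
      also have "1 / (1 + s) + s * (1 / (1 + s)) = 1" using s by (simp add: field_simps)
      finally show ?thesis using True h by simp
    next
      case False
      then have "1 / (1 + s) \<le> h" using h by simp
      then show ?thesis using False by (simp add: \<psi>_def ennreal_leI)
    qed
  qed
  also have "\<dots> = ennreal h + ennreal (tail (Suc k) (h / 2))"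
    by (subst nn_integral_add) (auto simp: C_def vimage_def measure_pmf.emeasure_eq_measure)
  finally show ?thesis .
qed

lemma share_lipschitz:
  assumes "0 < h" "0 < x" "0 < Y" "Y \<le> X"
  shows "share h x Y + ennreal (Y / h) \<le> share h x X + ennreal (X / h)"
proof (cases "h < x \<and> h < Y")
  case True
  have "x / (x + Y) - x / (x + X) = x * (X - Y) / ((x + Y) * (x + X))"
    using assms by (simp add: divide_simps) (simp add: algebra_simps)
  also have "\<dots> = (x / (x + X)) * ((X - Y) / (x + Y))" by simp
  also have "\<dots> \<le> 1 * ((X - Y) / h)"
    using assms True by (intro mult_mono divide_left_mono) auto
  finally have "x / (x + Y) + Y / h \<le> x / (x + X) + X / h" by (simp add: diff_divide_distrib)
  then show ?thesis
    using True assms by (simp add: share_def ennreal_leI ennreal_plus[symmetric] del: ennreal_plus)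
next
  case False
  then have "share h x Y = 0" by (auto simp: share_def)
  moreover have "ennreal (Y / h) \<le> ennreal (X / h)" using assms by (intro ennreal_leI divide_right_mono) auto
  ultimately show ?thesis by (simp add: add_increasing)
qed

lemma nn_iid_cavity: "(\<integral>\<^sup>+X. ennreal (X / h) \<partial>iid_sum d (\<mu> k)) = ennreal (real d * cavity_mean k / h)" if "h > 0"
proof -
  have "(\<integral>\<^sup>+X. ennreal (X / h) \<partial>iid_sum d (\<mu> k)) = (\<integral>\<^sup>+X. ennreal X * ennreal (1 / h) \<partial>iid_sum d (\<mu> k))"
    using that by (intro nn_integral_cong) (subst ennreal_mult''[symmetric], auto)
  also have "\<dots> = (of_nat d * ennreal (cavity_mean k)) * ennreal (1 / h)"
    by (subst nn_integral_multc) (simp_all add: nn_integral_iid_sum[OF cavity_nonneg] nn_cavity_mean)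
  also have "\<dots> = ennreal (real d * cavity_mean k / h)"
    using that cavity_mean_nonneg[of k] unfolding ennreal_of_nat_eq_real_of_nat
    by (subst ennreal_mult[symmetric], simp, simp)+ simp
  finally show ?thesis .
qed

text \<open>The share in \<open>mean_share_le\<close> compares a residue of depth \<open>k + 1\<close> with residues of depth \<open>k\<close>. To
exploit symmetry both depths must agree; replacing \<open>k\<close> by \<open>k + 1\<close> under the monotone coupling costs the
decrease of the means divided by \<open>h\<close>, which vanishes as \<open>k\<close> tends to infinity while \<open>h\<close> is fixed.\<close>

lemma share_shift:
  assumes h: "h > 0"
  shows "(\<integral>\<^sup>+x. \<integral>\<^sup>+X. share h x X \<partial>iid_sum d (\<mu> (Suc k)) \<partial>\<mu> (Suc k)) + ennreal (real d * cavity_mean (Suc k) / h)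
   \<le> (\<integral>\<^sup>+x. \<integral>\<^sup>+X. share h x X \<partial>iid_sum d (\<mu> k) \<partial>\<mu> (Suc k)) + ennreal (real d * cavity_mean k / h)"
proof -
  have I: "(\<integral>\<^sup>+x. \<integral>\<^sup>+X. share h x X + ennreal (X / h) \<partial>iid_sum d (\<mu> j) \<partial>\<mu> (Suc k)) =
     (\<integral>\<^sup>+x. \<integral>\<^sup>+X. share h x X \<partial>iid_sum d (\<mu> j) \<partial>\<mu> (Suc k)) + ennreal (real d * cavity_mean j / h)" for j
  proof -
    have "(\<integral>\<^sup>+x. \<integral>\<^sup>+X. share h x X + ennreal (X / h) \<partial>iid_sum d (\<mu> j) \<partial>\<mu> (Suc k)) =
      (\<integral>\<^sup>+x. (\<integral>\<^sup>+X. share h x X \<partial>iid_sum d (\<mu> j)) + ennreal (real d * cavity_mean j / h) \<partial>\<mu> (Suc k))"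
      by (subst nn_integral_add) (auto simp: nn_iid_cavity[OF h] simp del: cavity.simps)
    also have "\<dots> = (\<integral>\<^sup>+x. \<integral>\<^sup>+X. share h x X \<partial>iid_sum d (\<mu> j) \<partial>\<mu> (Suc k)) + ennreal (real d * cavity_mean j / h)"
      by (subst nn_integral_add) (auto simp del: cavity.simps)
    finally show ?thesis .
  qed
  have "rel_pmf (\<lambda>x y. 0 < x \<and> x \<le> y) (iid_sum d (\<mu> (Suc k))) (iid_sum d (\<mu> k))"
  proof -
    have "rel_pmf (\<lambda>x y. 0 < y \<and> y \<le> x)\<inverse>\<inverse> (iid_sum d (\<mu> (Suc k))) (iid_sum d (\<mu> k))"
      unfolding pmf.rel_flip by (rule rel_iid_sum_pos[OF rel_cavity[OF d] d])
    then show ?thesis by (rule pmf.rel_mono_strong) auto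
  qed
  note rel = this
  show ?thesis unfolding I[symmetric]
  proof (intro nn_integral_mono_AE AE_pmfI rel_pmf_nn_integral_mono[OF rel])
    fix x Y X :: real assume "x \<in> set_pmf (\<mu> (Suc k))" "0 < Y \<and> Y \<le> X"
    then show "share h x Y + ennreal (Y / h) \<le> share h x X + ennreal (X / h)"
      using set_cavity[OF d, of "poisson_pmf c" "Suc k"] h by (intro share_lipschitz) auto
  qed
qed

text \<open>If \<open>X\<close> is the sum of \<open>d\<close> further copies of \<open>x\<close>, then by symmetry the expected share of \<open>x\<close> in
\<open>x + X\<close> is \<open>1 / (d + 1)\<close>. The cut off loses the event that all \<open>d + 1\<close> residues are small (below \<open>h'\<close>), on which
the symmetry may be used again, the event that only \<open>x\<close> is large, and a share of at most \<open>h / h'\<close>.\<close>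

lemma share_symmetric:
  assumes h: "0 < h" "h < h'"
  shows "ennreal (1 / (real d + 1)) \<le> (\<integral>\<^sup>+x. \<integral>\<^sup>+X. share h x X \<partial>iid_sum d (\<mu> k) \<partial>\<mu> k)
    + ennreal ((1 - tail k h') ^ (d + 1) / (real d + 1) + tail k h * (1 - tail k h) ^ d + h / h')"
proof -
  define \<phi> where "\<phi> s = (if s \<le> h' then ennreal (1 / s) else 0)" for s :: real
  have pos: "x > 0" if "x \<in> set_pmf (\<mu> k)" for x
    using that set_cavity[OF d, of "poisson_pmf c" k] by auto
  have posX: "X > 0" if "X \<in> set_pmf (iid_sum d (\<mu> k))" for X
    using that iid_cavity_pos[of k] by auto
  have posS: "X > 0" if "X \<in> set_pmf (iid_sum (Suc d) (\<mu> k))" for X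
    using that set_iid_sum_pos[of "\<mu> k" "Suc d"] pos by (force simp: subset_eq)
  have dd: "of_nat (Suc d) = ennreal (real d + 1)"
    by (simp add: ennreal_of_nat_eq_real_of_nat add.commute)
  have inv: "a = b * ennreal (1 / (real d + 1))" if "b = of_nat (Suc d) * a" for a b
  proof -
    have "b * ennreal (1 / (real d + 1)) = a * (ennreal (real d + 1) * ennreal (1 / (real d + 1)))"
      unfolding that dd by (simp add: ac_simps)
    also have "ennreal (real d + 1) * ennreal (1 / (real d + 1)) = 1"
      by (subst ennreal_mult[symmetric]) auto
    finally show ?thesis by simp
  qed
  have all: "(\<integral>\<^sup>+x. \<integral>\<^sup>+X. ennreal (x / (x + X)) \<partial>iid_sum d (\<mu> k) \<partial>\<mu> k) = ennreal (1 / (real d + 1))"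
  proof -
    have "(\<integral>\<^sup>+s. ennreal s * ennreal (1 / s) \<partial>iid_sum (Suc d) (\<mu> k)) = (\<integral>\<^sup>+s. 1 \<partial>iid_sum (Suc d) (\<mu> k))"
    proof (intro nn_integral_cong_AE AE_pmfI)
      fix s assume "s \<in> set_pmf (iid_sum (Suc d) (\<mu> k))"
      then have "s > 0" by (rule posS)
      then show "ennreal s * ennreal (1 / s) = 1" by (subst ennreal_mult[symmetric]) auto
    qed
    then have one: "1 = (\<integral>\<^sup>+s. ennreal s * ennreal (1 / s) \<partial>iid_sum (Suc d) (\<mu> k))" by simp
    have "(\<integral>\<^sup>+x. \<integral>\<^sup>+X. ennreal x * ennreal (1 / (x + X)) \<partial>iid_sum d (\<mu> k) \<partial>\<mu> k) = 1 * ennreal (1 / (real d + 1))"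
      by (rule inv) (subst one, rule nn_integral_iid_sum_weighted[OF cavity_nonneg])
    moreover have "(\<integral>\<^sup>+x. \<integral>\<^sup>+X. ennreal x * ennreal (1 / (x + X)) \<partial>iid_sum d (\<mu> k) \<partial>\<mu> k) =
       (\<integral>\<^sup>+x. \<integral>\<^sup>+X. ennreal (x / (x + X)) \<partial>iid_sum d (\<mu> k) \<partial>\<mu> k)"
      by (intro nn_integral_cong_AE AE_pmfI, subst ennreal_mult[symmetric]) (auto dest!: pos posX)
    ultimately show ?thesis by simp
  qed
  have low: "(\<integral>\<^sup>+x. \<integral>\<^sup>+X. ennreal x * \<phi> (x + X) \<partial>iid_sum d (\<mu> k) \<partial>\<mu> k)
     \<le> ennreal ((1 - tail k h') ^ (d + 1) / (real d + 1))"
  proof -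
    have "(\<integral>\<^sup>+s. ennreal s * \<phi> s \<partial>iid_sum (Suc d) (\<mu> k)) = (\<integral>\<^sup>+s. indicator {..h'} s \<partial>iid_sum (Suc d) (\<mu> k))"
    proof (intro nn_integral_cong_AE AE_pmfI)
      fix s assume "s \<in> set_pmf (iid_sum (Suc d) (\<mu> k))"
      then have "s > 0" by (rule posS)
      then show "ennreal s * \<phi> s = indicator {..h'} s" by (auto simp: \<phi>_def ennreal_mult[symmetric])
    qed
    also have "\<dots> = ennreal (measure_pmf.prob (iid_sum (Suc d) (\<mu> k)) {..h'})"
      by (simp add: measure_pmf.emeasure_eq_measure del: iid_sum.simps cavity.simps)
    also have "\<dots> \<le> ennreal ((1 - tail k h') ^ (d + 1))"
      using prob_iid_sum_le[OF cavity_nonneg, where m = "Suc d" and b = h']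
      by (intro ennreal_leI) (simp add: prob_cavity_le del: iid_sum.simps cavity.simps)
    finally have *: "(\<integral>\<^sup>+s. ennreal s * \<phi> s \<partial>iid_sum (Suc d) (\<mu> k)) \<le> \<dots>" .
    have "(\<integral>\<^sup>+x. \<integral>\<^sup>+X. ennreal x * \<phi> (x + X) \<partial>iid_sum d (\<mu> k) \<partial>\<mu> k) =
       (\<integral>\<^sup>+s. ennreal s * \<phi> s \<partial>iid_sum (Suc d) (\<mu> k)) * ennreal (1 / (real d + 1))"
      by (rule inv) (rule nn_integral_iid_sum_weighted[OF cavity_nonneg])
    also have "\<dots> \<le> ennreal ((1 - tail k h') ^ (d + 1)) * ennreal (1 / (real d + 1))"
      by (intro mult_right_mono *) simp
    also have "\<dots> = ennreal ((1 - tail k h') ^ (d + 1) / (real d + 1))"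
      by (subst ennreal_mult[symmetric]) auto
    finally show ?thesis .
  qed
  have "ennreal (1 / (real d + 1)) \<le> (\<integral>\<^sup>+x. \<integral>\<^sup>+X. (share h x X + ennreal x * \<phi> (x + X)) +
      (indicator {h<..} x * indicator {..h} X + ennreal (h / h')) \<partial>iid_sum d (\<mu> k) \<partial>\<mu> k)"
    unfolding all[symmetric]
  proof (intro nn_integral_mono_AE AE_pmfI)
    fix x X assume "x \<in> set_pmf (\<mu> k)" "X \<in> set_pmf (iid_sum d (\<mu> k))"
    then have x: "x > 0" and X: "X > 0" by (auto dest: pos posX)
    have le1: "ennreal (x / (x + X)) \<le> 1" using x X by (simp add: ennreal_le_1)
    show "ennreal (x / (x + X)) \<le> (share h x X + ennreal x * \<phi> (x + X)) +
      (indicator {h<..} x * indicator {..h} X + ennreal (h / h'))"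
    proof -
      \<comment> \<open>The share survives the cut off, or all \<open>d + 1\<close> residues are small, or only \<open>x\<close> is large, or \<open>x\<close> is tiny compared to \<open>x + X\<close>.\<close>
      consider "h < x \<and> h < X" | "x + X \<le> h'" | "h < x" "X \<le> h" | "x \<le> h" "x + X > h'" by force
      then show ?thesis
      proof cases
        case 1
        then have "ennreal (x / (x + X)) = share h x X" by (simp add: share_def)
        then show ?thesis by (simp add: add_increasing2 add.assoc)
      next
        case 2
        then have "ennreal (x / (x + X)) = ennreal x * \<phi> (x + X)"
          using x X by (simp add: \<phi>_def ennreal_mult[symmetric])
        then show ?thesis by (simp add: add_increasing2 add_increasing)
      next
        case 3
        have "ennreal (x / (x + X)) \<le> indicator {h<..} x * indicator {..h} X"
          using 3 le1 by simp
        then show ?thesis by (simp add: add_increasing2 add_increasing)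
      next
        case 4
        have "x / (x + X) \<le> h / h'" using 4 x X h by (intro frac_le) auto
        then have "ennreal (x / (x + X)) \<le> ennreal (h / h')" by (rule ennreal_leI)
        then show ?thesis by (intro add_increasing) auto
      qed
    qed
  qed
  also have "\<dots> = (\<integral>\<^sup>+x. (\<integral>\<^sup>+X. share h x X \<partial>iid_sum d (\<mu> k)) + (\<integral>\<^sup>+X. ennreal x * \<phi> (x + X) \<partial>iid_sum d (\<mu> k)) +
      (indicator {h<..} x * emeasure (iid_sum d (\<mu> k)) {..h} + ennreal (h / h')) \<partial>\<mu> k)"
    by (simp add: nn_integral_add nn_integral_cmult del: cavity.simps iid_sum.simps)
  also have "\<dots> = (\<integral>\<^sup>+x. \<integral>\<^sup>+X. share h x X \<partial>iid_sum d (\<mu> k) \<partial>\<mu> k) +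
      (\<integral>\<^sup>+x. \<integral>\<^sup>+X. ennreal x * \<phi> (x + X) \<partial>iid_sum d (\<mu> k) \<partial>\<mu> k) +
      (emeasure (\<mu> k) {h<..} * emeasure (iid_sum d (\<mu> k)) {..h} + ennreal (h / h'))"
    by (simp add: nn_integral_add nn_integral_multc del: cavity.simps iid_sum.simps)
  also have "\<dots> \<le> (\<integral>\<^sup>+x. \<integral>\<^sup>+X. share h x X \<partial>iid_sum d (\<mu> k) \<partial>\<mu> k) +
      ennreal ((1 - tail k h') ^ (d + 1) / (real d + 1)) +
      (ennreal (tail k h) * ennreal ((1 - tail k h) ^ d) + ennreal (h / h'))"
    using prob_iid_sum_le[OF cavity_nonneg, where m = d and b = h]
    by (intro add_mono low order_refl mult_mono)
       (auto simp: measure_pmf.emeasure_eq_measure prob_cavity_le simp del: cavity.simps iid_sum.simps intro!: ennreal_leI)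
  also have "\<dots> = (\<integral>\<^sup>+x. \<integral>\<^sup>+X. share h x X \<partial>iid_sum d (\<mu> k) \<partial>\<mu> k)
    + ennreal ((1 - tail k h') ^ (d + 1) / (real d + 1) + tail k h * (1 - tail k h) ^ d + h / h')"
    using h by (simp add: ennreal_mult add.assoc)
  finally show ?thesis .
qed

text \<open>Combines \<open>mean_share_le\<close>, \<open>share_shift\<close> and \<open>share_symmetric\<close>. The two scales \<open>h < h'\<close> remain free; in the
limit both tend to \<open>0\<close> with \<open>h / h'\<close> tending to \<open>0\<close> as well.\<close>

lemma cavity_mean_Suc_bound:
  assumes h: "0 < h" "h < h'"
  shows "cavity_mean (Suc k) + c / (real d + 1) \<le> h + tail (Suc k) (h / 2)
    + c * ((1 - tail (Suc k) h') ^ (d + 1) / (real d + 1) + tail (Suc k) h * (1 - tail (Suc k) h) ^ d + h / h')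
    + c * (real d * (cavity_mean k - cavity_mean (Suc k)) / h)"
proof -
  define R where "R = (1 - tail (Suc k) h') ^ (d + 1) / (real d + 1) + tail (Suc k) h * (1 - tail (Suc k) h) ^ d + h / h'"
  have R: "R \<ge> 0" unfolding R_def using h by (intro add_nonneg_nonneg) auto
  define A where "A = (\<integral>\<^sup>+x. \<integral>\<^sup>+X. share h x X \<partial>iid_sum d (\<mu> k) \<partial>\<mu> (Suc k))"
  have "ennreal c * A \<le> ennreal h + ennreal (tail (Suc k) (h / 2))"
    using mean_share_le[OF h(1), of k] unfolding A_def by (rule order_trans[rotated]) simp
  then have "ennreal c * A < \<top>" by (rule order_le_less_trans) simp
  then have "A < \<top>" using c by (auto simp: ennreal_mult_less_top)
  then obtain a where a: "a \<ge> 0" "A = ennreal a" by (cases A) auto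
  have 1: "cavity_mean (Suc k) + c * a \<le> h + tail (Suc k) (h / 2)"
    using mean_share_le[OF h(1), of k] cavity_mean_nonneg[of "Suc k"] a c h unfolding A_def[symmetric]
    by (simp add: ennreal_mult[symmetric] ennreal_plus[symmetric] del: ennreal_plus cavity.simps)
  have "ennreal (1 / (real d + 1)) + ennreal (real d * cavity_mean (Suc k) / h)
     \<le> (\<integral>\<^sup>+x. \<integral>\<^sup>+X. share h x X \<partial>iid_sum d (\<mu> (Suc k)) \<partial>\<mu> (Suc k)) + ennreal R + ennreal (real d * cavity_mean (Suc k) / h)"
    unfolding R_def by (intro add_right_mono share_symmetric h)
  also have "\<dots> \<le> (A + ennreal (real d * cavity_mean k / h)) + ennreal R"
    using share_shift[OF h(1), of k] unfolding A_def[symmetric] by (simp add: ac_simps add_left_mono)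
  finally have "1 / (real d + 1) + real d * cavity_mean (Suc k) / h \<le> a + real d * cavity_mean k / h + R"
    using a R h cavity_mean_nonneg by (simp add: ennreal_plus[symmetric] del: ennreal_plus)
  then have "c * (1 / (real d + 1) + real d * cavity_mean (Suc k) / h) \<le> c * (a + real d * cavity_mean k / h + R)"
    using c by (intro mult_left_mono) auto
  then show ?thesis using 1 unfolding R_def[symmetric] by (simp add: algebra_simps diff_divide_distrib)
qed

end

section \<open>The threshold and the fixed point equation\<close>

context
  fixes d :: nat
  assumes d: "2 \<le> d"
begin

text \<open>The function \<open>f\<close> vanishes at \<open>t_star d\<close>, and \<open>g\<close> is its derivative. Up to a factor of constant sign, \<open>g\<close> is also the
derivative of \<open>- ln t / (1 - t)^d\<close>, the value of \<open>c\<close> for which \<open>t\<close> is a fixed point.\<close>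

private definition f where "f t = (real d + 1) * (1 - t) + (1 + real d * t) * ln t" for t
private definition g where "g t = -1 + real d * ln t + 1 / t" for t :: real

private lemma df: "(f has_real_derivative g t) (at t)" if "t > 0"
  unfolding f_def[abs_def] g_def using that
  by (auto intro!: derivative_eq_intros simp: field_simps)

private lemma dg: "(g has_real_derivative (real d * t - 1) / t\<^sup>2) (at t)" if "t > 0"
  unfolding g_def[abs_def] using that
  by (auto intro!: derivative_eq_intros simp: field_simps power2_eq_square)

private lemma cont_f: "continuous_on {x..y} f" if "x > 0"
  using that by (intro continuous_at_imp_continuous_on ballI DERIV_isCont[OF df]) auto

private lemma cont_g: "continuous_on {x..y} g" if "x > 0"
  using that by (intro continuous_at_imp_continuous_on ballI DERIV_isCont[OF dg]) auto

private lemma g_neg: "g x < 0" if "1 / real d \<le> x" "x < 1"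
proof -
  have x: "x > 0" using that d by (auto intro: less_le_trans[of 0 "1 / real d"])
  have "g x < g 1"
  proof (rule DERIV_pos_imp_increasing_open[OF \<open>x < 1\<close> _ cont_g[OF x]])
    fix t assume "x < t" "t < 1"
    then have "1 / real d < t" using that by simp
    then have "0 < t" "1 < real d * t" using d x \<open>x < t\<close> by (auto simp: field_simps)
    then show "\<exists>D. (g has_real_derivative D) (at t) \<and> 0 < D" using dg[of t] by (intro exI[of _ "(real d * t - 1) / t\<^sup>2"]) auto
  qed
  then show ?thesis by (simp add: g_def)
qed

private lemma g_dec: "g y < g x" if "0 < x" "x < y" "y \<le> 1 / real d"
proof (rule DERIV_neg_imp_decreasing_open[OF \<open>x < y\<close> _ cont_g[OF \<open>0 < x\<close>]])
  fix t assume "x < t" "t < y"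
  then have "t < 1 / real d" "0 < t" using that by auto
  then have "real d * t < 1" using d by (auto simp: field_simps)
  then show "\<exists>D. (g has_real_derivative D) (at t) \<and> D < 0" using dg[of t] \<open>0 < t\<close>
    by (intro exI[of _ "(real d * t - 1) / t\<^sup>2"]) (auto simp: divide_neg_pos)
qed

private lemma f_pos_right: "f x > 0" if "1 / real d \<le> x" "x < 1"
proof -
  have x: "x > 0" using that d by (auto intro: less_le_trans[of 0 "1 / real d"])
  have "f 1 < f x"
  proof (rule DERIV_neg_imp_decreasing_open[OF \<open>x < 1\<close> _ cont_f[OF x]])
    fix t assume "x < t" "t < 1"
    then have "g t < 0" "t > 0" using that x by (auto intro!: g_neg)
    then show "\<exists>D. (f has_real_derivative D) (at t) \<and> D < 0" using df[of t] by blast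
  qed
  then show ?thesis by (simp add: f_def)
qed

private lemma f_root_unique: "t = t_star d" if "0 < t" "t < 1" "f t = 0"
proof -
  have "is_root d t" using that by (simp add: is_root_def f_def)
  then show ?thesis unfolding t_star_def by (rule the1_equality[OF ex1_root[OF d], symmetric])
qed

private lemma t_star: "0 < t_star d" "t_star d < 1" "f (t_star d) = 0" "t_star d < 1 / real d"
proof -
  have "is_root d (t_star d)" unfolding t_star_def by (rule theI'[OF ex1_root[OF d]])
  then show *: "0 < t_star d" "t_star d < 1" "f (t_star d) = 0" by (auto simp: is_root_def f_def)
  show "t_star d < 1 / real d" using f_pos_right[of "t_star d"] * by (cases "t_star d < 1 / real d") auto
qed

private lemma f_nonneg: "f t \<ge> 0" if "t_star d \<le> t" "t < 1"
proof (rule ccontr)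
  assume "\<not> f t \<ge> 0"
  then have t: "f t < 0" "t < 1 / real d" "t_star d < t"
  proof -
    show "t < 1 / real d" using f_pos_right[of t] that \<open>\<not> f t \<ge> 0\<close> by (meson not_le order.strict_implies_order)
    show "t_star d < t" using that t_star(3) \<open>\<not> f t \<ge> 0\<close> by (cases "t = t_star d") auto
  qed (use \<open>\<not> f t \<ge> 0\<close> in simp)
  then obtain r where "t \<le> r" "r \<le> 1 / real d" "f r = 0"
    using IVT'[of f t 0 "1 / real d"] f_pos_right[of "1 / real d"] d cont_f[of t] t_star(1) by force
  moreover have "r \<noteq> 1 / real d" using f_pos_right[of "1 / real d"] d \<open>f r = 0\<close> by force
  moreover have "1 / real d \<le> 1" using d by simp
  ultimately have "r = t_star d" using t t_star(1) \<open>f r = 0\<close> by (intro f_root_unique) linarith+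
  then show False using t \<open>t \<le> r\<close> by simp
qed

private lemma f_neg: "f t < 0" if "0 < t" "t < t_star d"
proof (rule ccontr)
  assume "\<not> f t < 0"
  then have ft: "f t > 0" using f_root_unique[of t] that t_star by (cases "f t = 0") auto
  define x where "x = min t (exp (- (real d + 2)))"
  have x: "0 < x" "x \<le> t" "ln x \<le> - (real d + 2)"
  proof -
    have "ln x \<le> ln (exp (- (real d + 2)))"
      unfolding x_def using that by (subst ln_le_cancel_iff) auto
    then show "ln x \<le> - (real d + 2)" by simp
  qed (use that in \<open>auto simp: x_def\<close>)
  have "f x \<le> (real d + 1) * 1 + 1 * ln x"
  proof -
    have "ln x \<le> 0" using x(3) by linarith
    then have "real d * x * ln x \<le> 0" using x(1) by (intro mult_nonneg_nonpos) simp_all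
    moreover have "(real d + 1) * (1 - x) \<le> (real d + 1) * 1" using x by (intro mult_left_mono) auto
    ultimately show ?thesis unfolding f_def by (simp add: algebra_simps)
  qed
  then have "f x < 0" using x by simp
  then obtain r where "x \<le> r" "r \<le> t" "f r = 0"
    using IVT'[of f x 0 t] ft x cont_f[of x] by force
  then show False using f_root_unique[of r] x that t_star by auto
qed

private lemma g_pos: "g y > 0" if "0 < y" "y < t_star d"
proof -
  have "\<exists>u>y. u < t_star d \<and> f (t_star d) - f y = (t_star d - y) * g u"
    using that by (intro MVT2 df) auto
  then obtain u where u: "y < u" "u < t_star d" "f (t_star d) - f y = (t_star d - y) * g u" by blast
  then have "(t_star d - y) * g u > 0" using f_neg[of y] that t_star by simp
  then have "g u > 0" using that by (simp add: zero_less_mult_iff)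
  then show ?thesis using g_dec[of y u] u that t_star by simp
qed

text \<open>On \<open>(0, t_star d)\<close> the value of \<open>c\<close> that belongs to a fixed point \<open>t\<close> is decreasing. So a fixed point below
\<open>t_star d\<close> belongs to some \<open>c\<close> above \<open>c_star d\<close>.\<close>

private lemma c_star_less: "c_star d < - ln t / (1 - t) ^ d" if t: "0 < t" "t < t_star d"
proof -
  define q where "q = (\<lambda>t::real. - ln t / (1 - t) ^ d)"
  obtain e where e: "d = Suc e" using d by (cases d) auto
  have dq: "(q has_real_derivative (- (g t) / (1 - t) ^ Suc d)) (at t)" if "0 < t" "t < 1" for t
  proof -
    have "(q has_real_derivative ((- (1 / t)) * (1 - t) ^ d - (- ln t) * (real d * (1 - t) ^ e * (- 1))) / ((1 - t) ^ d * (1 - t) ^ d)) (at t)"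
    proof -
      have "((\<lambda>t. - ln t) has_real_derivative - (1 / t)) (at t)"
        using that by (auto intro!: derivative_eq_intros)
      moreover have "((\<lambda>t. (1 - t) ^ d) has_real_derivative real d * (- 1 * (1 - t) ^ (d - Suc 0))) (at t)"
        by (rule DERIV_power) (auto intro!: derivative_eq_intros)
      then have "((\<lambda>t. (1 - t) ^ d) has_real_derivative real d * (1 - t) ^ e * (- 1)) (at t)" by (simp add: e)
      ultimately show ?thesis unfolding q_def using that by (intro DERIV_divide) auto
    qed
    moreover have "((- (1 / t)) * (1 - t) ^ d - (- ln t) * (real d * (1 - t) ^ e * (- 1))) / ((1 - t) ^ d * (1 - t) ^ d)
      = - (g t) / (1 - t) ^ Suc d"
    proof -
      have "(- (1 / t)) * (1 - t) ^ d - (- ln t) * (real d * (1 - t) ^ e * (- 1)) = - (g t) * (1 - t) ^ e"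
        unfolding g_def using that by (simp add: e field_simps del: of_nat_Suc)
      moreover have "(1 - t) ^ d * (1 - t) ^ d = (1 - t) ^ e * (1 - t) ^ Suc d" by (simp add: e)
      ultimately show ?thesis using that by (simp only:) (simp add: divide_simps)
    qed
    ultimately show ?thesis by simp
  qed
  have "q (t_star d) < q t"
  proof (rule DERIV_neg_imp_decreasing_open[OF t(2)])
    fix s assume s: "t < s" "s < t_star d"
    then have s': "0 < s" "s < 1" using t t_star by auto
    then have "- (g s) / (1 - s) ^ Suc d < 0" using g_pos[of s] s by (intro divide_neg_pos) auto
    then show "\<exists>D. (q has_real_derivative D) (at s) \<and> D < 0" using dq s' by blast
  next
    show "continuous_on {t..t_star d} q"
      using t t_star by (intro continuous_at_imp_continuous_on ballI DERIV_isCont[OF dq]) auto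
  qed
  then show ?thesis by (simp add: q_def c_star_def)
qed

text \<open>At a fixed point \<open>t < 1\<close>, the left hand side equals \<open>1 - f t / (d + 1)\<close>. Below the threshold every fixed point is at
least \<open>t_star d\<close>, where \<open>f\<close> is nonnegative.\<close>

lemma fixed_point_mean_le_1:
  assumes c: "0 < c" "c < c_star d" and t: "0 \<le> t" "t \<le> 1" "t = exp (- c * (1 - t) ^ d)"
  shows "t + c * ((1 - t) ^ (d + 1) / (real d + 1) + t * (1 - t) ^ d) \<le> 1"
proof (cases "t = 1")
  case False
  have t01: "0 < t" "t < 1" proof -
    show "0 < t" by (subst t(3)) simp
  qed (use t(2) False in simp)
  have "ln t = ln (exp (- c * (1 - t) ^ d))" by (rule arg_cong[OF t(3)])
  then have L: "c * (1 - t) ^ d = - ln t" by simp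
  have "c = - ln t / (1 - t) ^ d" using L t01 by (simp add: field_simps)
  then have "t \<ge> t_star d" using c_star_less[of t] c t01 by force
  then have f: "f t \<ge> 0" by (rule f_nonneg) fact
  have "c * ((1 - t) ^ (d + 1) / (real d + 1) + t * (1 - t) ^ d) =
     (c * (1 - t) ^ d) * ((1 - t) / (real d + 1) + t)" by (simp add: algebra_simps)
  also have "\<dots> = - ln t * ((1 - t) / (real d + 1) + t)" by (simp add: L)
  also have "\<dots> = (1 - t) - f t / (real d + 1)"
    unfolding f_def by (simp add: field_simps)
  finally show ?thesis using f by (simp add: divide_nonneg_nonneg)
qed (use d in \<open>simp add: power_0_left\<close>)

end

section \<open>The limiting mean below the threshold\<close>

text \<open>Let \<open>T e\<close> be the limit over the depth of the probability that the residue exceeds \<open>e\<close>, and let \<open>t\<close> be the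
limit of \<open>T e\<close> for \<open>e\<close> tending to \<open>0\<close>. The two tail estimates make \<open>t\<close> a fixed point, and \<open>cavity_mean_Suc_bound\<close>
with \<open>h' = sqrt h\<close> bounds the limit of the means by the expression of \<open>fixed_point_mean_le_1\<close>.\<close>

lemma cavity_mean_limit:
  assumes d: "2 \<le> d" and c: "0 < c" "c < c_star d" and e: "e > 0"
  shows "\<exists>k. cavity_mean c d k \<le> 1 - c / (real d + 1) + e"
proof -
  have d0: "d > 0" using d by simp
  let ?tail = "\<lambda>k e. measure_pmf.prob (cavity (poisson_pmf c) d k) {e<..}"
  \<comment> \<open>limiting tails over the depth; they are antitone in \<open>e\<close>, so that \<open>T\<close> has a limit at \<open>0\<close>, its supremum\<close>
  define T where "T e = lim (\<lambda>k. ?tail k e)" for e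
  have T: "(\<lambda>k. ?tail k e) \<longlonglongrightarrow> T e" for e
  proof -
    have "decseq (\<lambda>k. ?tail k e)" by (intro decseq_SucI tail_Suc_le c d0)
    moreover have "\<forall>k. 0 \<le> ?tail k e" by (intro allI measure_nonneg)
    ultimately obtain L where L: "(\<lambda>k. ?tail k e) \<longlonglongrightarrow> L"
      using decseq_convergent[of "\<lambda>k. ?tail k e" 0] by blast
    show ?thesis unfolding T_def limI[OF L] by (rule L)
  qed
  have T_anti: "T b \<le> T a" if "a \<le> b" for a b
  proof (rule LIMSEQ_le[OF T T])
    show "\<exists>N. \<forall>n\<ge>N. ?tail n b \<le> ?tail n a"
      using that by (intro exI[of _ 0] allI impI measure_pmf.finite_measure_mono) auto
  qed
  have T01: "0 \<le> T a" "T a \<le> 1" for a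
    using LIMSEQ_le_const[OF T, of 0 a] LIMSEQ_le_const2[OF T, of a 1] by simp_all
  define t where "t = (SUP a\<in>{0<..}. T a)"
  have bdd: "bdd_above (T ` {0<..})" using T01 by (auto intro!: bdd_aboveI2)
  have T_le_t: "T a \<le> t" if "a > 0" for a
    unfolding t_def using that by (intro cSUP_upper bdd) auto
  have t01: "0 \<le> t" "t \<le> 1"
    using T_le_t[of 1] T01(1)[of 1] T01(2) unfolding t_def by (auto intro!: cSUP_least)
  have T_t: "(T \<longlongrightarrow> t) (at_right 0)"
  proof (rule order_tendstoI)
    fix a assume "a < t"
    then have "\<exists>b\<in>{0<..}. a < T b" unfolding t_def using less_cSUP_iff[OF _ bdd, of a] by simp
    then obtain b where b: "b > 0" "a < T b" by auto
    show "\<forall>\<^sub>F x in at_right 0. a < T x"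
      using eventually_at_right_real[OF b(1)]
    proof eventually_elim
      case (elim x)
      then show ?case using T_anti[of x b] b by simp
    qed
  next
    fix a assume "t < a"
    show "\<forall>\<^sub>F x in at_right 0. T x < a"
      using eventually_at_right_less[of "0::real"]
    proof eventually_elim
      case (elim x)
      then show ?case using T_le_t[of x] \<open>t < a\<close> by simp
    qed
  qed
  \<comment> \<open>\<open>tail_Suc_upper\<close>, first with the depth tending to infinity, then with \<open>e\<close> tending to \<open>0\<close>\<close>
  have upper: "t \<le> exp (- c * (1 - t) ^ d)"
  proof (rule tendsto_le[of "at_right (0::real)"])
    have "filterlim (\<lambda>e. e / (2 * real d)) (at_right 0) (at_right (0::real))"
      unfolding filterlim_at
    proof
      show "\<forall>\<^sub>F e in at_right (0::real). e / (2 * real d) \<in> {0<..} \<and> e / (2 * real d) \<noteq> 0"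
        using eventually_at_right_less[of "0::real"] by eventually_elim (use d0 in simp)
      have "((\<lambda>e. e / (2 * real d)) \<longlongrightarrow> 0 / (2 * real d)) (at_right 0)"
        by (intro tendsto_intros) (use d0 in auto)
      then show "((\<lambda>e. e / (2 * real d)) \<longlongrightarrow> 0) (at_right 0)" by simp
    qed
    from filterlim_compose[OF T_t this]
    show "((\<lambda>e. exp (- c * (1 - T (e / (2 * real d))) ^ d)) \<longlongrightarrow> exp (- c * (1 - t) ^ d)) (at_right 0)"
      by (intro tendsto_intros)
    show "\<forall>\<^sub>F e in at_right 0. T e \<le> exp (- c * (1 - T (e / (2 * real d))) ^ d)"
      using eventually_at_right_less[of "0::real"]
    proof eventually_elim
      case (elim e)
      have "(\<lambda>k. exp (- c * (1 - ?tail k (e / (2 * real d))) ^ d)) \<longlonglongrightarrow> exp (- c * (1 - T (e / (2 * real d))) ^ d)"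
        by (intro tendsto_intros T)
      from LIMSEQ_le[OF LIMSEQ_Suc[OF T] this] show ?case
        using tail_Suc_upper[OF c(1) d0 elim] by blast
    qed
  qed (use T_t in auto)
  \<comment> \<open>\<open>tail_Suc_lower\<close>; the limits are taken over the depth, over \<open>M\<close> and over \<open>e\<close>, in this order\<close>
  have lower: "exp (- c * (1 - t) ^ d) \<le> t"
  proof (rule tendsto_upperbound[of _ _ "at_right (0::real)"])
    show "((\<lambda>e. exp (- c * (1 - T e) ^ d)) \<longlongrightarrow> exp (- c * (1 - t) ^ d)) (at_right 0)"
      by (intro tendsto_intros T_t)
    show "\<forall>\<^sub>F e in at_right 0. exp (- c * (1 - T e) ^ d) \<le> t"
      using eventually_at_right_less[of "0::real"]
    proof eventually_elim
      case (elim e)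
      have M: "(\<Sum>m\<le>M. c ^ m / fact m * exp (-c) * (1 - (1 - T e) ^ d) ^ m) \<le> t" for M
      proof -
        have "(\<Sum>m\<le>M. c ^ m / fact m * exp (-c) * (1 - (1 - T e) ^ d) ^ m) \<le> T (1 / (2 + real M / e))"
        proof (rule LIMSEQ_le[OF _ LIMSEQ_Suc[OF T]])
          show "(\<lambda>k. \<Sum>m\<le>M. c ^ m / fact m * exp (-c) * (1 - (1 - ?tail k e) ^ d) ^ m) \<longlonglongrightarrow>
            (\<Sum>m\<le>M. c ^ m / fact m * exp (-c) * (1 - (1 - T e) ^ d) ^ m)"
            by (intro tendsto_intros T)
        qed (use tail_Suc_lower[OF c(1) d0 elim] in blast)
        also have "\<dots> \<le> t" using elim by (intro T_le_t) (auto intro!: divide_pos_pos add_pos_nonneg)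
        finally show ?thesis .
      qed
      have "(\<lambda>M. \<Sum>m\<le>M. c ^ m / fact m * exp (-c) * (1 - (1 - T e) ^ d) ^ m) \<longlonglongrightarrow> exp (c * (1 - (1 - T e) ^ d - 1))"
        using poisson_sums_pgf[of c "1 - (1 - T e) ^ d"] unfolding sums_def_le .
      from LIMSEQ_le_const2[OF this] M show ?case by simp
    qed
  qed auto
  have mono: "decseq (cavity_mean c d)" by (intro decseq_SucI cavity_mean_Suc_le c d0)
  obtain m where m: "cavity_mean c d \<longlonglongrightarrow> m"
    using decseq_convergent[OF mono, of 0] cavity_mean_nonneg[OF c(1) d0] by blast
  \<comment> \<open>The term with \<open>m - m\<close> is the limit of the cost of \<open>share_shift\<close>.\<close>
  have bound: "m + c / (real d + 1) \<le> h + T (h / 2)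
    + c * ((1 - T (sqrt h)) ^ (d + 1) / (real d + 1) + T h * (1 - T h) ^ d + h / sqrt h) + c * (real d * (m - m) / h)"
    if h: "0 < h" "h < 1" for h
  proof (rule LIMSEQ_le)
    have "h < sqrt h" using h real_less_rsqrt[of h h] power2_eq_square[of h] by (simp add: mult_less_cancel_left1)
    then show "\<exists>N. \<forall>k\<ge>N. cavity_mean c d (Suc k) + c / (real d + 1) \<le> h + ?tail (Suc k) (h / 2)
    + c * ((1 - ?tail (Suc k) (sqrt h)) ^ (d + 1) / (real d + 1) + ?tail (Suc k) h * (1 - ?tail (Suc k) h) ^ d + h / sqrt h)
    + c * (real d * (cavity_mean c d k - cavity_mean c d (Suc k)) / h)"
      using cavity_mean_Suc_bound[OF c(1) d0 h(1), of "sqrt h"] by blast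
    show "(\<lambda>k. cavity_mean c d (Suc k) + c / (real d + 1)) \<longlonglongrightarrow> m + c / (real d + 1)"
      by (intro tendsto_add tendsto_const LIMSEQ_Suc[OF m])
    have TS: "(\<lambda>k. ?tail (Suc k) a) \<longlonglongrightarrow> T a" for a by (rule LIMSEQ_Suc[OF T])
    show "(\<lambda>k. h + ?tail (Suc k) (h / 2)
    + c * ((1 - ?tail (Suc k) (sqrt h)) ^ (d + 1) / (real d + 1) + ?tail (Suc k) h * (1 - ?tail (Suc k) h) ^ d + h / sqrt h)
    + c * (real d * (cavity_mean c d k - cavity_mean c d (Suc k)) / h)) \<longlonglongrightarrow> h + T (h / 2)
    + c * ((1 - T (sqrt h)) ^ (d + 1) / (real d + 1) + T h * (1 - T h) ^ d + h / sqrt h) + c * (real d * (m - m) / h)"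
      using h by (intro tendsto_add tendsto_mult tendsto_divide tendsto_const tendsto_power tendsto_diff TS
          m LIMSEQ_Suc[OF m]) simp_all
  qed
  have "m + c / (real d + 1) \<le> 0 + t + c * ((1 - t) ^ (d + 1) / (real d + 1) + t * (1 - t) ^ d + 0) + 0"
  proof (rule tendsto_lowerbound[of _ _ "at_right (0::real)"])
    have 1: "filterlim (\<lambda>h. h / 2) (at_right 0) (at_right (0::real))"
      unfolding filterlim_at
    proof
      show "\<forall>\<^sub>F h in at_right (0::real). h / 2 \<in> {0<..} \<and> h / 2 \<noteq> 0"
        using eventually_at_right_less[of "0::real"] by eventually_elim simp
      have "((\<lambda>h::real. h / 2) \<longlongrightarrow> 0 / 2) (at_right 0)" by (intro tendsto_intros) auto
      then show "((\<lambda>h::real. h / 2) \<longlongrightarrow> 0) (at_right 0)" by simp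
    qed
    have sq: "(sqrt \<longlongrightarrow> 0) (at_right 0)"
      using tendsto_real_sqrt[OF tendsto_ident_at[of 0 "{0<..}"]] by simp
    have 2: "filterlim sqrt (at_right 0) (at_right (0::real))"
      unfolding filterlim_at
    proof (intro conjI sq)
      show "\<forall>\<^sub>F h in at_right (0::real). sqrt h \<in> {0<..} \<and> sqrt h \<noteq> 0"
        using eventually_at_right_less[of "0::real"] by eventually_elim simp
    qed
    have 3: "((\<lambda>h::real. h / sqrt h) \<longlongrightarrow> 0) (at_right 0)"
    proof (rule Lim_transform_eventually[OF sq])
      show "\<forall>\<^sub>F h in at_right 0. sqrt h = h / sqrt h"
        using eventually_at_right_less[of "0::real"] by eventually_elim (simp add: real_div_sqrt)
    qed
    show "((\<lambda>h. h + T (h / 2)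
    + c * ((1 - T (sqrt h)) ^ (d + 1) / (real d + 1) + T h * (1 - T h) ^ d + h / sqrt h) + 0) \<longlongrightarrow>
      0 + t + c * ((1 - t) ^ (d + 1) / (real d + 1) + t * (1 - t) ^ d + 0) + 0) (at_right 0)"
      by (intro tendsto_add tendsto_mult tendsto_divide tendsto_const tendsto_power tendsto_diff tendsto_ident_at
          filterlim_compose[OF T_t 1] filterlim_compose[OF T_t 2] T_t 3) simp_all
    show "\<forall>\<^sub>F h in at_right 0. m + c / (real d + 1) \<le> h + T (h / 2)
    + c * ((1 - T (sqrt h)) ^ (d + 1) / (real d + 1) + T h * (1 - T h) ^ d + h / sqrt h) + 0"
      using eventually_at_right_real[of 0 "1::real", simplified]
    proof eventually_elim
      case (elim h)
      then show ?case using bound[of h] by simp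
    qed
  qed simp
  also have "\<dots> \<le> 1" using fixed_point_mean_le_1[OF d c t01 antisym[OF upper lower]] by simp
  finally have "m < 1 - c / (real d + 1) + e" using e by simp
  then have "\<forall>\<^sub>F k in sequentially. cavity_mean c d k < 1 - c / (real d + 1) + e"
    by (rule order_tendstoD(2)[OF m])
  then obtain N where "\<forall>k\<ge>N. cavity_mean c d k < 1 - c / (real d + 1) + e"
    unfolding eventually_sequentially ..
  then have "cavity_mean c d N < 1 - c / (real d + 1) + e" by simp
  then show ?thesis by (intro exI[of _ N]) simp
qed

section \<open>Random subsets\<close>

definition random_subset :: "'a set \<Rightarrow> real \<Rightarrow> 'a set pmf" where
  "random_subset A p = map_pmf (\<lambda>f. {x \<in> A. f x}) (Pi_pmf A False (\<lambda>_. bernoulli_pmf p))"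

lemma set_random_subset: "set_pmf (random_subset A p) \<subseteq> Pow A"
  by (auto simp: random_subset_def)

context
  fixes A :: "'a set" and p :: real
  assumes A: "finite A" and p: "0 \<le> p" "p \<le> 1"
begin

lemma prob_random_subset:
  assumes "P \<subseteq> A" "Q \<subseteq> A" "P \<inter> Q = {}"
  shows "measure_pmf.prob (random_subset A p) {F. P \<subseteq> F \<and> F \<inter> Q = {}} = p ^ card P * (1 - p) ^ card Q"
proof -
  define B where "B x = (if x \<in> P then {True} else if x \<in> Q then {False} else UNIV)" for x
  have "measure_pmf.prob (random_subset A p) {F. P \<subseteq> F \<and> F \<inter> Q = {}} =
     measure_pmf.prob (Pi_pmf A False (\<lambda>_. bernoulli_pmf p)) (Pi A B)"
    unfolding random_subset_def measure_map_pmf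
    by (intro arg_cong[where f = "measure_pmf.prob _"]) (use assms in \<open>auto simp: B_def Pi_def\<close>)
  also have "\<dots> = (\<Prod>x\<in>A. measure_pmf.prob (bernoulli_pmf p) (B x))"
    by (rule measure_Pi_pmf_Pi[OF A])
  also have "\<dots> = (\<Prod>x\<in>A. (if x \<in> P then p else 1) * (if x \<in> Q then 1 - p else 1))"
    using assms p by (intro prod.cong) (auto simp: B_def measure_pmf_single)
  also have "\<dots> = (\<Prod>x\<in>A. if x \<in> P then p else 1) * (\<Prod>x\<in>A. if x \<in> Q then 1 - p else 1)"
    by (rule prod.distrib)
  also have "(\<Prod>x\<in>A. if x \<in> P then p else 1) = p ^ card P"
    using assms A by (simp add: prod.If_cases Int_absorb1)
  also have "(\<Prod>x\<in>A. if x \<in> Q then 1 - p else 1) = (1 - p) ^ card Q"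
    using assms A by (simp add: prod.If_cases Int_absorb1)
  finally show ?thesis .
qed

lemma prob_random_subset_superset:
  assumes "P \<subseteq> A"
  shows "measure_pmf.prob (random_subset A p) {F. P \<subseteq> F} = p ^ card P"
  using prob_random_subset[of P "{}"] assms by simp

lemma prob_random_subset_superset_le:
  assumes "finite P"
  shows "measure_pmf.prob (random_subset A p) {F. P \<subseteq> F} \<le> p ^ card P"
proof (cases "P \<subseteq> A")
  case False
  then have "measure_pmf.prob (random_subset A p) {F. P \<subseteq> F} = 0"
    using set_random_subset[of A p] by (auto simp: measure_pmf_zero_iff)
  then show ?thesis using p by simp
qed (simp add: prob_random_subset_superset)

lemma pmf_random_subset:
  "pmf (random_subset A p) N = (if N \<subseteq> A then p ^ card N * (1 - p) ^ card (A - N) else 0)"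
proof (cases "N \<subseteq> A")
  case True
  have "pmf (random_subset A p) N = measure_pmf.prob (random_subset A p) {F. N \<subseteq> F \<and> F \<inter> (A - N) = {}}"
    unfolding measure_pmf_single[symmetric]
    by (rule measure_pmf.finite_measure_eq_AE)
       (use True in \<open>auto simp: AE_measure_pmf_iff dest!: subsetD[OF set_random_subset]\<close>)
  also have "\<dots> = p ^ card N * (1 - p) ^ card (A - N)"
    using True by (intro prob_random_subset) auto
  finally show ?thesis using True by simp
next
  case False
  then show ?thesis using set_random_subset[of A p] by (auto simp: pmf_eq_0_set_pmf)
qed

lemma map_card_random_subset: "map_pmf card (random_subset A p) = binomial_pmf (card A) p"
  unfolding random_subset_def pmf.map_comp o_def
  by (rule binomial_pmf_altdef'[symmetric]) (use A p in auto)

lemma nn_integral_card_random_subset: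
  "(\<integral>\<^sup>+N. of_nat (card N) \<partial>random_subset A p) = ennreal (real (card A) * p)"
proof -
  have "(\<integral>\<^sup>+N. of_nat (card N) \<partial>random_subset A p) = (\<integral>\<^sup>+N. (\<Sum>v\<in>A. indicator {F. {v} \<subseteq> F} N) \<partial>random_subset A p)"
  proof (intro nn_integral_cong_AE AE_pmfI)
    fix N assume "N \<in> set_pmf (random_subset A p)"
    then have N: "N \<subseteq> A" using set_random_subset[of A p] by auto
    have "(\<Sum>v\<in>A. indicator {F. {v} \<subseteq> F} N) = (\<Sum>v\<in>A. if v \<in> N then 1 else 0 :: ennreal)"
      by (rule sum.cong) (auto simp: indicator_def)
    also have "\<dots> = of_nat (card N)" using A N by (simp add: sum.If_cases Int_absorb1)
    finally show "of_nat (card N) = (\<Sum>v\<in>A. indicator {F. {v} \<subseteq> F} N :: ennreal)" by simp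
  qed
  also have "\<dots> = (\<Sum>v\<in>A. emeasure (random_subset A p) {F. {v} \<subseteq> F})"
    by (subst nn_integral_sum) auto
  also have "\<dots> = (\<Sum>v\<in>A. ennreal p)"
    by (intro sum.cong refl, unfold measure_pmf.emeasure_eq_measure, subst prob_random_subset_superset) auto
  also have "\<dots> = ennreal (real (card A) * p)"
    using p by (simp add: ennreal_mult ennreal_of_nat_eq_real_of_nat)
  finally show ?thesis .
qed

lemma nn_integral_card_sq_random_subset:
  "(\<integral>\<^sup>+N. (of_nat (card N))\<^sup>2 \<partial>random_subset A p) \<le> ennreal (real (card A) * p + (real (card A) * p)\<^sup>2)"
proof -
  have "(\<integral>\<^sup>+N. (of_nat (card N))\<^sup>2 \<partial>random_subset A p) = (\<integral>\<^sup>+N. (\<Sum>v\<in>A. \<Sum>w\<in>A. indicator {F. {v, w} \<subseteq> F} N) \<partial>random_subset A p)"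
  proof (intro nn_integral_cong_AE AE_pmfI)
    fix N assume "N \<in> set_pmf (random_subset A p)"
    then have N: "N \<subseteq> A" using set_random_subset[of A p] by auto
    have "(\<Sum>v\<in>A. \<Sum>w\<in>A. indicator {F. {v, w} \<subseteq> F} N) = (\<Sum>v\<in>A. \<Sum>w\<in>A. (if v \<in> N then 1 else 0) * (if w \<in> N then 1 else 0 :: ennreal))"
      by (intro sum.cong) (auto simp: indicator_def)
    also have "\<dots> = of_nat (card N) * of_nat (card N)"
      using A N by (simp add: sum_distrib_left[symmetric] sum_distrib_right[symmetric] sum.If_cases Int_absorb1)
    finally show "(of_nat (card N))\<^sup>2 = (\<Sum>v\<in>A. \<Sum>w\<in>A. indicator {F. {v, w} \<subseteq> F} N :: ennreal)"
      by (simp add: power2_eq_square)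
  qed
  also have "\<dots> = (\<Sum>v\<in>A. \<Sum>w\<in>A. emeasure (random_subset A p) {F. {v, w} \<subseteq> F})"
    by (simp add: nn_integral_sum)
  also have "\<dots> = (\<Sum>v\<in>A. \<Sum>w\<in>A. ennreal (p ^ card {v, w}))"
    by (intro sum.cong refl, unfold measure_pmf.emeasure_eq_measure, subst prob_random_subset_superset) auto
  also have "\<dots> \<le> (\<Sum>v\<in>A. \<Sum>w\<in>A. ennreal ((if v = w then p else 0) + p\<^sup>2))"
    using p by (intro sum_mono ennreal_leI) (auto simp: card_insert_if power2_eq_square)
  also have "\<dots> = ennreal (\<Sum>v\<in>A. \<Sum>w\<in>A. (if v = w then p else 0) + p\<^sup>2)"
  proof -
    have "(\<Sum>v\<in>A. \<Sum>w\<in>A. ennreal (g v w)) = ennreal (\<Sum>v\<in>A. \<Sum>w\<in>A. g v w)"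
      if "\<And>v w. 0 \<le> g v w" for g :: "'a \<Rightarrow> 'a \<Rightarrow> real"
      using that by (simp only: sum_ennreal sum_nonneg)
    from this[of "\<lambda>v w. (if v = w then p else 0) + p\<^sup>2"] show ?thesis
      using p by (simp del: ennreal_plus)
  qed
  also have "(\<Sum>v\<in>A. \<Sum>w\<in>A. (if v = w then p else 0) + p\<^sup>2) = real (card A) * p + (real (card A) * p)\<^sup>2"
    using A by (simp add: sum.distrib power2_eq_square algebra_simps)
  finally show ?thesis .
qed

end

section \<open>From binomial to Poisson offspring\<close>

text \<open>A one-sided form of closeness in total variation, phrased for test functions with values in \<open>[0, 1]\<close>. It is
stable under maps and mixtures, which carries closeness of the offspring distribution through the
recursion.\<close>

definition tv_close :: "'a pmf \<Rightarrow> 'a pmf \<Rightarrow> ennreal \<Rightarrow> bool" where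
  "tv_close p q e \<longleftrightarrow> (\<forall>h. (\<forall>x. h x \<le> 1) \<longrightarrow> (\<integral>\<^sup>+x. h x \<partial>q) \<le> (\<integral>\<^sup>+x. h x \<partial>p) + e)"

lemma tv_closeD: "tv_close p q e \<Longrightarrow> (\<And>x. h x \<le> 1) \<Longrightarrow> (\<integral>\<^sup>+x. h x \<partial>q) \<le> (\<integral>\<^sup>+x. h x \<partial>p) + e"
  by (simp add: tv_close_def)

lemma tv_close_refl: "tv_close p p e"
  by (simp add: tv_close_def)

lemma tv_close_mono: "tv_close p q e \<Longrightarrow> e \<le> e' \<Longrightarrow> tv_close p q e'"
  unfolding tv_close_def by (meson add_left_mono order_trans)

lemma tv_close_map: "tv_close p q e \<Longrightarrow> tv_close (map_pmf f p) (map_pmf f q) e"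
  unfolding tv_close_def by simp

text \<open>The error of the mixed distributions is averaged over the limiting mixing distribution only, whose moments are known.\<close>

lemma tv_close_bind:
  assumes "tv_close p q e" "\<And>x. tv_close (f x) (g x) (\<epsilon> x)"
  shows "tv_close (bind_pmf p f) (bind_pmf q g) (e + (\<integral>\<^sup>+x. \<epsilon> x \<partial>q))"
  unfolding tv_close_def
proof (intro allI impI)
  fix h :: "'b \<Rightarrow> ennreal" assume h: "\<forall>x. h x \<le> 1"
  have "(\<integral>\<^sup>+x. h x \<partial>bind_pmf q g) = (\<integral>\<^sup>+x. \<integral>\<^sup>+y. h y \<partial>g x \<partial>q)" by simp
  also have "\<dots> \<le> (\<integral>\<^sup>+x. (\<integral>\<^sup>+y. h y \<partial>f x) + \<epsilon> x \<partial>q)"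
    using h by (intro nn_integral_mono tv_closeD[OF assms(2)]) auto
  also have "\<dots> = (\<integral>\<^sup>+x. \<integral>\<^sup>+y. h y \<partial>f x \<partial>q) + (\<integral>\<^sup>+x. \<epsilon> x \<partial>q)"
    by (rule nn_integral_add) auto
  also have "(\<integral>\<^sup>+x. \<integral>\<^sup>+y. h y \<partial>f x \<partial>q) \<le> (\<integral>\<^sup>+x. \<integral>\<^sup>+y. h y \<partial>f x \<partial>p) + e"
  proof (rule tv_closeD[OF assms(1)])
    fix x
    have "(\<integral>\<^sup>+y. h y \<partial>f x) \<le> (\<integral>\<^sup>+y. 1 \<partial>f x)" using h by (intro nn_integral_mono) auto
    then show "(\<integral>\<^sup>+y. h y \<partial>f x) \<le> 1" by simp
  qed
  finally show "(\<integral>\<^sup>+x. h x \<partial>bind_pmf q g) \<le> (\<integral>\<^sup>+x. h x \<partial>bind_pmf p f) + (e + (\<integral>\<^sup>+x. \<epsilon> x \<partial>q))"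
    by (simp add: add.assoc add_mono)
qed

lemma tv_close_iid_sum:
  assumes "tv_close \<xi> \<xi>' e"
  shows "tv_close (iid_sum m \<xi>) (iid_sum m \<xi>') (of_nat m * e)"
proof (induction m)
  case (Suc m)
  have "tv_close (iid_sum (Suc m) \<xi>) (iid_sum (Suc m) \<xi>') (e + (\<integral>\<^sup>+x. of_nat m * e \<partial>\<xi>'))"
    unfolding iid_sum.simps by (intro tv_close_bind assms tv_close_map Suc)
  then show ?case by (simp add: distrib_right)
qed (simp add: tv_close_refl)

lemma tv_close_compound_sum:
  assumes "tv_close N N' e" "tv_close \<xi> \<xi>' e'"
  shows "tv_close (compound_sum N \<xi>) (compound_sum N' \<xi>') (e + (\<integral>\<^sup>+m. of_nat m \<partial>N') * e')"
proof -
  have "tv_close (compound_sum N \<xi>) (compound_sum N' \<xi>') (e + (\<integral>\<^sup>+m. of_nat m * e' \<partial>N'))"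
    unfolding compound_sum_def by (intro tv_close_bind assms(1) tv_close_iid_sum assms(2))
  then show ?thesis by (subst (asm) nn_integral_multc) auto
qed

lemma nn_integral_poisson_mean:
  assumes "c > 0" shows "(\<integral>\<^sup>+m. of_nat m \<partial>poisson_pmf c) = ennreal c"
proof -
  have "(\<integral>\<^sup>+s. ennreal s \<partial>compound_sum (poisson_pmf c) (return_pmf 1)) =
     (\<integral>\<^sup>+m. \<integral>\<^sup>+s. ennreal s \<partial>iid_sum m (return_pmf 1) \<partial>poisson_pmf c)"
    by (simp add: compound_sum_def)
  also have "\<dots> = (\<integral>\<^sup>+m. of_nat m \<partial>poisson_pmf c)"
    by (subst nn_integral_iid_sum) auto
  finally have *: "(\<integral>\<^sup>+s. ennreal s \<partial>compound_sum (poisson_pmf c) (return_pmf 1)) = (\<integral>\<^sup>+m. of_nat m \<partial>poisson_pmf c)" .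
  have "(\<integral>\<^sup>+s. ennreal s * 1 \<partial>compound_sum (poisson_pmf c) (return_pmf 1)) = ennreal c"
    by (subst nn_integral_compound_poisson_weighted) (use assms in auto)
  then show ?thesis using * by simp
qed

lemma tv_close_cavity:
  assumes "c > 0"
  shows "\<exists>K. K < \<top> \<and> (\<forall>N e. tv_close N (poisson_pmf c) e \<longrightarrow> tv_close (cavity N d k) (cavity (poisson_pmf c) d k) (K * e))"
proof (induction k)
  case 0
  then show ?case by (intro exI[of _ 0]) (auto simp: tv_close_refl)
next
  case (Suc k)
  then obtain K where K: "K < \<top>" "\<And>N e. tv_close N (poisson_pmf c) e \<Longrightarrow> tv_close (cavity N d k) (cavity (poisson_pmf c) d k) (K * e)"
    by blast
  define K' where "K' = 1 + ennreal c * (of_nat d * K)"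
  have "tv_close (cavity N d (Suc k)) (cavity (poisson_pmf c) d (Suc k)) (K' * e)"
    if "tv_close N (poisson_pmf c) e" for N e
  proof -
    have "tv_close (cavity N d (Suc k)) (cavity (poisson_pmf c) d (Suc k))
       (e + (\<integral>\<^sup>+m. of_nat m \<partial>poisson_pmf c) * (of_nat d * (K * e)))"
      unfolding cavity.simps
      by (intro tv_close_map tv_close_compound_sum tv_close_iid_sum K(2) that)
    then show ?thesis unfolding nn_integral_poisson_mean[OF assms] K'_def
      by (simp add: distrib_right mult.assoc)
  qed
  moreover have "K' < \<top>" using K(1) by (auto simp: K'_def ennreal_mult_less_top ennreal_of_nat_eq_real_of_nat)
  ultimately show ?case by blast
qed

lemma tendsto_choose_over_power:
  "(\<lambda>n. real ((n - d) choose m) / real n ^ m) \<longlonglongrightarrow> 1 / fact m"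
proof -
  have lim: "(\<lambda>n. (\<Prod>i<m. 1 - real (d + i) / real n) / fact m) \<longlonglongrightarrow> (\<Prod>i<m. 1 - 0) / fact m"
    by (intro tendsto_intros lim_const_over_n) auto
  have ev: "\<forall>\<^sub>F n in sequentially. (\<Prod>i<m. 1 - real (d + i) / real n) / fact m = real ((n - d) choose m) / real n ^ m"
    using eventually_ge_at_top[of "d + m + 1"]
  proof eventually_elim
    case (elim n)
    have "real ((n - d) choose m) = real (n - d) gchoose m" by (rule binomial_gbinomial)
    also have "\<dots> = (\<Prod>i<m. real (n - d) - real i) / fact m"
      by (simp add: gbinomial_prod_rev atLeast0LessThan)
    also have "(\<Prod>i<m. real (n - d) - real i) = (\<Prod>i<m. real n * (1 - real (d + i) / real n))"
      using elim by (intro prod.cong) (auto simp: field_simps of_nat_diff)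
    also have "\<dots> = real n ^ m * (\<Prod>i<m. 1 - real (d + i) / real n)" by (simp add: prod.distrib)
    finally show ?case using elim by (simp add: field_simps)
  qed
  show ?thesis using Lim_transform_eventually[OF lim ev] by simp
qed

lemma tendsto_pmf_binomial_poisson:
  assumes c: "c > 0"
  shows "(\<lambda>n. pmf (binomial_pmf (n - d) (c / real n)) m) \<longlonglongrightarrow> pmf (poisson_pmf c) m"
proof -
  have 1: "(\<lambda>n. (1 + (- c) / real n) ^ n) \<longlonglongrightarrow> exp (- c)" by (rule tendsto_exp_limit_sequentially)
  have 2: "(\<lambda>n. (1 + (- c) / real n) ^ (d + m)) \<longlonglongrightarrow> (1 + 0) ^ (d + m)"
    by (intro tendsto_intros lim_const_over_n)
  have lim: "(\<lambda>n. real ((n - d) choose m) / real n ^ m * c ^ m * ((1 + (- c) / real n) ^ n / (1 + (- c) / real n) ^ (d + m)))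
     \<longlonglongrightarrow> 1 / fact m * c ^ m * (exp (- c) / (1 + 0) ^ (d + m))"
    by (intro tendsto_mult tendsto_choose_over_power tendsto_const tendsto_divide 1 2) simp
  have ev: "\<forall>\<^sub>F n in sequentially. real ((n - d) choose m) / real n ^ m * c ^ m * ((1 + (- c) / real n) ^ n / (1 + (- c) / real n) ^ (d + m))
     = pmf (binomial_pmf (n - d) (c / real n)) m"
    using eventually_gt_at_top[of "d + m + nat \<lceil>c\<rceil>"]
  proof eventually_elim
    case (elim n)
    then have cn: "c < real n" by linarith
    have q: "1 - c / real n > 0" "1 - c / real n \<noteq> 0" using cn c by (auto simp: field_simps)
    have "(1 - c / real n) ^ (n - (d + m)) = (1 - c / real n) ^ n / (1 - c / real n) ^ (d + m)"
      by (rule power_diff) (use elim q in auto)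
    then show ?case using elim cn c
      by (subst pmf_binomial) (auto simp: power_divide field_simps)
  qed
  show ?thesis using Lim_transform_eventually[OF lim ev] c by (simp add: field_simps)
qed

text \<open>Pointwise convergence of the probabilities implies convergence in total variation, by
dominated convergence of the positive part of the difference.\<close>

lemma tv_close_binomial_poisson:
  assumes c: "c > 0" and e: "e > 0"
  shows "\<forall>\<^sub>F n in sequentially. tv_close (binomial_pmf (n - d) (c / real n)) (poisson_pmf c) (ennreal e)"
proof -
  define b where "b n = pmf (binomial_pmf (n - d) (c / real n))" for n
  define w where "w = pmf (poisson_pmf c)"
  have "(\<lambda>n. \<integral>\<^sup>+m. ennreal (max 0 (w m - b n m)) \<partial>count_space UNIV) \<longlonglongrightarrow> (\<integral>\<^sup>+(m::nat). 0 \<partial>count_space UNIV)"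
  proof (rule nn_integral_dominated_convergence[where w = "\<lambda>m. ennreal (w m)" and u' = "\<lambda>_. 0" and u = "\<lambda>n m. ennreal (max 0 (w m - b n m))"])
    show "(\<integral>\<^sup>+m. ennreal (w m) \<partial>count_space UNIV) < \<infinity>"
      by (simp add: w_def nn_integral_pmf measure_pmf.emeasure_eq_measure)
    show "AE m in count_space UNIV. ennreal (max 0 (w m - b n m)) \<le> ennreal (w m)" for n
      by (auto intro!: AE_I2 ennreal_leI simp: w_def b_def simp del: pmf_poisson)
    show "AE m in count_space UNIV. (\<lambda>n. ennreal (max 0 (w m - b n m))) \<longlonglongrightarrow> 0"
    proof (rule AE_I2)
      fix m
      have "(\<lambda>n. max 0 (w m - b n m)) \<longlonglongrightarrow> max 0 (w m - w m)"
        unfolding w_def b_def by (intro tendsto_intros tendsto_pmf_binomial_poisson c)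
      then show "(\<lambda>n. ennreal (max 0 (w m - b n m))) \<longlonglongrightarrow> 0"
        using tendsto_ennrealI by fastforce
    qed
  qed auto
  then have "\<forall>\<^sub>F n in sequentially. (\<integral>\<^sup>+m. ennreal (max 0 (w m - b n m)) \<partial>count_space UNIV) < ennreal e"
    by (rule order_tendstoD(2)) (use e in simp)
  then show ?thesis
  proof eventually_elim
    case (elim n)
    show ?case unfolding tv_close_def
    proof (intro allI impI)
      fix h :: "nat \<Rightarrow> ennreal" assume h: "\<forall>x. h x \<le> 1"
      have "(\<integral>\<^sup>+m. h m \<partial>poisson_pmf c) = (\<integral>\<^sup>+m. ennreal (w m) * h m \<partial>count_space UNIV)"
        unfolding w_def by (rule nn_integral_measure_pmf)
      also have "\<dots> \<le> (\<integral>\<^sup>+m. ennreal (b n m) * h m + ennreal (max 0 (w m - b n m)) \<partial>count_space UNIV)"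
      proof (rule nn_integral_mono)
        fix m
        have "ennreal (w m) \<le> ennreal (b n m + max 0 (w m - b n m))" by (intro ennreal_leI) auto
        also have "\<dots> = ennreal (b n m) + ennreal (max 0 (w m - b n m))"
          by (rule ennreal_plus) (auto simp: b_def)
        finally have "ennreal (w m) * h m \<le> (ennreal (b n m) + ennreal (max 0 (w m - b n m))) * h m"
          by (rule mult_right_mono) simp
        also have "\<dots> = ennreal (b n m) * h m + ennreal (max 0 (w m - b n m)) * h m" by (rule distrib_right)
        also have "\<dots> \<le> ennreal (b n m) * h m + ennreal (max 0 (w m - b n m)) * 1"
          using h by (intro add_left_mono mult_left_mono) auto
        finally show "ennreal (w m) * h m \<le> ennreal (b n m) * h m + ennreal (max 0 (w m - b n m))" by simp
      qed
      also have "\<dots> = (\<integral>\<^sup>+m. ennreal (b n m) * h m \<partial>count_space UNIV) + (\<integral>\<^sup>+m. ennreal (max 0 (w m - b n m)) \<partial>count_space UNIV)"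
        by (rule nn_integral_add) auto
      also have "\<dots> \<le> (\<integral>\<^sup>+m. h m \<partial>binomial_pmf (n - d) (c / real n)) + ennreal e"
        unfolding b_def nn_integral_measure_pmf[symmetric]
        using elim by (intro add_mono) (auto simp: b_def)
      finally show "(\<integral>\<^sup>+m. h m \<partial>poisson_pmf c) \<le> (\<integral>\<^sup>+m. h m \<partial>binomial_pmf (n - d) (c / real n)) + ennreal e" .
    qed
  qed
qed

lemma tv_close_cavity_binomial:
  assumes c: "c > 0" and e: "e > 0"
  shows "\<forall>\<^sub>F n in sequentially. tv_close (cavity (binomial_pmf (n - j) (c / real n)) d k) (cavity (poisson_pmf c) d k) (ennreal e)"
proof -
  obtain K where K: "K < \<top>" "\<And>N e. tv_close N (poisson_pmf c) e \<Longrightarrow> tv_close (cavity N d k) (cavity (poisson_pmf c) d k) (K * e)"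
    using tv_close_cavity[OF c, of d k] by blast
  obtain r where r: "r \<ge> 0" "K = ennreal r" using K(1) by (cases K) auto
  have "e / (r + 1) > 0" using e r by simp
  from tv_close_binomial_poisson[OF c this, of j] show ?thesis
  proof eventually_elim
    case (elim n)
    have "tv_close (cavity (binomial_pmf (n - j) (c / real n)) d k) (cavity (poisson_pmf c) d k) (K * ennreal (e / (r + 1)))"
      by (rule K(2)[OF elim])
    moreover have "K * ennreal (e / (r + 1)) \<le> ennreal e"
      unfolding r using r e by (subst ennreal_mult[symmetric]) (auto intro!: ennreal_leI simp: field_simps)
    ultimately show ?case by (rule tv_close_mono)
  qed
qed

section \<open>Rank and approximation of basis vectors\<close>

text \<open>The vectors \<open>w \<tau> = \<Sum>j\<in>J. c \<tau> j * b j\<close> lie in a space of dimension at most \<open>card J\<close>. The squared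
distance of the unit vector at \<open>\<tau>\<close> from \<open>w \<tau>\<close> is at least its squared distance from this space, and one minus the
latter is a diagonal entry of the orthogonal projection, whose trace is the dimension. The proof does this
by hand: one generator is split off at a time, and the others are made orthogonal to it.\<close>

lemma trace_minus_defect_le_rank:
  fixes b :: "'j \<Rightarrow> 'a \<Rightarrow> real" and c :: "'a \<Rightarrow> 'j \<Rightarrow> real"
  assumes "finite J" and E: "finite E"
  shows "(\<Sum>\<tau>\<in>E. 1 - (\<Sum>\<rho>\<in>E. ((if \<rho> = \<tau> then 1 else 0) - (\<Sum>j\<in>J. c \<tau> j * b j \<rho>))\<^sup>2)) \<le> real (card J)"
  using assms(1)
proof (induction J arbitrary: b)
  case empty
  have "(\<Sum>\<rho>\<in>E. (if \<rho> = \<tau> then 1 else 0 :: real)\<^sup>2) = 1" if "\<tau> \<in> E" for \<tau>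
  proof -
    have "(\<Sum>\<rho>\<in>E. (if \<rho> = \<tau> then 1 else 0 :: real)\<^sup>2) = (\<Sum>\<rho>\<in>E. if \<rho> = \<tau> then 1 else 0)"
      by (rule sum.cong) auto
    then show ?thesis using that E by simp
  qed
  then show ?case by simp
next
  case (insert i J)
  define N where "N = (\<Sum>\<rho>\<in>E. (b i \<rho>)\<^sup>2)"
  show ?case
  proof (cases "N = 0")
    case True
    then have "b i \<rho> = 0" if "\<rho> \<in> E" for \<rho>
      using that E by (simp add: N_def sum_nonneg_eq_0_iff)
    then have "(\<Sum>\<tau>\<in>E. 1 - (\<Sum>\<rho>\<in>E. ((if \<rho> = \<tau> then 1 else 0) - (\<Sum>j\<in>insert i J. c \<tau> j * b j \<rho>))\<^sup>2))
      = (\<Sum>\<tau>\<in>E. 1 - (\<Sum>\<rho>\<in>E. ((if \<rho> = \<tau> then 1 else 0) - (\<Sum>j\<in>J. c \<tau> j * b j \<rho>))\<^sup>2))"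
      using insert.hyps by simp
    then show ?thesis using insert.IH[of b] insert.hyps by simp
  next
    case False
    then have N: "N > 0" using sum_nonneg[of E "\<lambda>\<rho>. (b i \<rho>)\<^sup>2"] by (simp add: N_def)
    \<comment> \<open>project the other generators to the orthogonal complement of \<open>b i\<close>\<close>
    define l where "l j = (\<Sum>\<rho>\<in>E. b j \<rho> * b i \<rho>) / N" for j
    define b' where "b' j \<rho> = b j \<rho> - l j * b i \<rho>" for j \<rho>
    have orth: "(\<Sum>\<rho>\<in>E. b' j \<rho> * b i \<rho>) = 0" for j
    proof -
      have "(\<Sum>\<rho>\<in>E. b' j \<rho> * b i \<rho>) = (\<Sum>\<rho>\<in>E. b j \<rho> * b i \<rho>) - l j * N"
        by (simp add: b'_def N_def algebra_simps sum_subtractf sum_distrib_left power2_eq_square)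
      then show ?thesis using N by (simp add: l_def)
    qed
    define w where "w \<tau> \<rho> = (\<Sum>j\<in>J. c \<tau> j * b' j \<rho>)" for \<tau> \<rho>
    define a where "a \<tau> = c \<tau> i + (\<Sum>j\<in>J. c \<tau> j * l j)" for \<tau>
    have split: "(\<Sum>j\<in>insert i J. c \<tau> j * b j \<rho>) = a \<tau> * b i \<rho> + w \<tau> \<rho>" for \<tau> \<rho>
      using insert.hyps
      by (simp add: a_def w_def b'_def algebra_simps sum_subtractf sum_distrib_left sum_distrib_right sum.distrib)
    have worth: "(\<Sum>\<rho>\<in>E. w \<tau> \<rho> * b i \<rho>) = 0" for \<tau>
    proof -
      have "(\<Sum>\<rho>\<in>E. w \<tau> \<rho> * b i \<rho>) = (\<Sum>j\<in>J. c \<tau> j * (\<Sum>\<rho>\<in>E. b' j \<rho> * b i \<rho>))"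
        unfolding w_def sum_distrib_left sum_distrib_right by (subst sum.swap) (simp add: mult.assoc)
      then show ?thesis by (simp add: orth)
    qed
    have step: "1 - (\<Sum>\<rho>\<in>E. ((if \<rho> = \<tau> then 1 else 0) - (\<Sum>j\<in>insert i J. c \<tau> j * b j \<rho>))\<^sup>2)
      \<le> (1 - (\<Sum>\<rho>\<in>E. ((if \<rho> = \<tau> then 1 else 0) - (\<Sum>j\<in>J. c \<tau> j * b' j \<rho>))\<^sup>2)) + (b i \<tau>)\<^sup>2 / N"
      if "\<tau> \<in> E" for \<tau>
    proof -
      define e where "e \<rho> = (if \<rho> = \<tau> then 1 else 0 :: real)" for \<rho>
      have e: "(\<Sum>\<rho>\<in>E. e \<rho> * b i \<rho>) = b i \<tau>"
      proof -
        have "(\<Sum>\<rho>\<in>E. e \<rho> * b i \<rho>) = (\<Sum>\<rho>\<in>E. if \<rho> = \<tau> then b i \<rho> else 0)"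
          by (rule sum.cong) (auto simp: e_def)
        then show ?thesis using that E by simp
      qed
      have "(\<Sum>\<rho>\<in>E. (e \<rho> - (a \<tau> * b i \<rho> + w \<tau> \<rho>))\<^sup>2) =
         (\<Sum>\<rho>\<in>E. (e \<rho> - w \<tau> \<rho>)\<^sup>2 - 2 * a \<tau> * (e \<rho> * b i \<rho>) + 2 * a \<tau> * (w \<tau> \<rho> * b i \<rho>) + (a \<tau>)\<^sup>2 * (b i \<rho>)\<^sup>2)"
        by (rule sum.cong) (simp_all add: power2_eq_square algebra_simps)
      also have "\<dots> = (\<Sum>\<rho>\<in>E. (e \<rho> - w \<tau> \<rho>)\<^sup>2) - 2 * a \<tau> * b i \<tau> + (a \<tau>)\<^sup>2 * N"
        by (simp add: sum.distrib sum_subtractf sum_distrib_left[symmetric] e worth N_def)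
      finally have *: "(\<Sum>\<rho>\<in>E. (e \<rho> - (a \<tau> * b i \<rho> + w \<tau> \<rho>))\<^sup>2) =
        (\<Sum>\<rho>\<in>E. (e \<rho> - w \<tau> \<rho>)\<^sup>2) - 2 * a \<tau> * b i \<tau> + (a \<tau>)\<^sup>2 * N" .
      \<comment> \<open>The best coefficient of \<open>b i\<close> would be \<open>b i \<tau> / N\<close>.\<close>
      have "0 \<le> (a \<tau> * N - b i \<tau>)\<^sup>2 / N" using N by simp
      also have "\<dots> = (a \<tau>)\<^sup>2 * N - 2 * a \<tau> * b i \<tau> + (b i \<tau>)\<^sup>2 / N"
        using N by (simp add: power2_eq_square field_simps)
      finally show ?thesis using * unfolding split w_def[symmetric] e_def by simp
    qed
    have "(\<Sum>\<tau>\<in>E. 1 - (\<Sum>\<rho>\<in>E. ((if \<rho> = \<tau> then 1 else 0) - (\<Sum>j\<in>insert i J. c \<tau> j * b j \<rho>))\<^sup>2))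
       \<le> (\<Sum>\<tau>\<in>E. (1 - (\<Sum>\<rho>\<in>E. ((if \<rho> = \<tau> then 1 else 0) - (\<Sum>j\<in>J. c \<tau> j * b' j \<rho>))\<^sup>2)) + (b i \<tau>)\<^sup>2 / N)"
      by (rule sum_mono[OF step])
    also have "\<dots> = (\<Sum>\<tau>\<in>E. 1 - (\<Sum>\<rho>\<in>E. ((if \<rho> = \<tau> then 1 else 0) - (\<Sum>j\<in>J. c \<tau> j * b' j \<rho>))\<^sup>2)) + 1"
      using N by (subst sum.distrib) (simp add: N_def sum_divide_distrib[symmetric])
    also have "\<dots> \<le> real (card J) + 1" using insert.IH[of b'] by simp
    finally show ?thesis using insert.hyps by simp
  qed
qed

definition sq_norm :: "('a \<Rightarrow>\<^sub>0 real) \<Rightarrow> real" where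
  "sq_norm x = (\<Sum>k\<in>Poly_Mapping.keys x. (Poly_Mapping.lookup x k)\<^sup>2)"

lemma sq_norm_superset:
  assumes "finite A" "Poly_Mapping.keys x \<subseteq> A"
  shows "sq_norm x = (\<Sum>k\<in>A. (Poly_Mapping.lookup x k)\<^sup>2)"
  unfolding sq_norm_def using assms by (intro sum.mono_neutral_left) (auto simp: in_keys_iff)

lemma sq_norm_ge:
  assumes "finite A"
  shows "(\<Sum>k\<in>A. (Poly_Mapping.lookup x k)\<^sup>2) \<le> sq_norm x"
proof -
  have "(\<Sum>k\<in>A. (Poly_Mapping.lookup x k)\<^sup>2) \<le> (\<Sum>k\<in>A \<union> Poly_Mapping.keys x. (Poly_Mapping.lookup x k)\<^sup>2)"
    using assms by (intro sum_mono2) auto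
  also have "\<dots> = sq_norm x" using assms by (intro sq_norm_superset[symmetric]) auto
  finally show ?thesis .
qed

lemma lookup_scaleR [simp]: "Poly_Mapping.lookup (r *\<^sub>R x) k = r *\<^sub>R Poly_Mapping.lookup x k"
proof -
  have "finite {i. r *\<^sub>R Poly_Mapping.lookup x i \<noteq> 0}"
    by (rule finite_subset[of _ "Poly_Mapping.keys x"]) (auto simp: in_keys_iff)
  then show ?thesis by (simp add: scaleR_poly_mapping_def)
qed

lemma keys_scaleR: "Poly_Mapping.keys (r *\<^sub>R (x :: 'a \<Rightarrow>\<^sub>0 real)) \<subseteq> Poly_Mapping.keys x"
  by (auto simp: in_keys_iff)

lemma sq_norm_scaleR: "sq_norm (r *\<^sub>R x) = r\<^sup>2 * sq_norm x"
proof -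
  have "sq_norm (r *\<^sub>R x) = (\<Sum>k\<in>Poly_Mapping.keys x. (Poly_Mapping.lookup (r *\<^sub>R x) k)\<^sup>2)"
    by (rule sq_norm_superset) (auto intro: keys_scaleR[THEN subsetD])
  then show ?thesis by (simp add: sq_norm_def sum_distrib_left power_mult_distrib)
qed

lemma sq_norm_single: "sq_norm (Poly_Mapping.single k r) = r\<^sup>2"
proof -
  have "sq_norm (Poly_Mapping.single k r) = (\<Sum>l\<in>{k}. (Poly_Mapping.lookup (Poly_Mapping.single k r) l)\<^sup>2)"
    by (rule sq_norm_superset) auto
  then show ?thesis by simp
qed

lemma sq_norm_add_disjoint:
  assumes "Poly_Mapping.keys x \<inter> Poly_Mapping.keys y = {}"
  shows "sq_norm (x + y) = sq_norm x + sq_norm y"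
proof -
  have x: "Poly_Mapping.lookup y k = 0" if "k \<in> Poly_Mapping.keys x" for k
    using that assms by (auto simp: in_keys_iff)
  have y: "Poly_Mapping.lookup x k = 0" if "k \<in> Poly_Mapping.keys y" for k
    using that assms by (auto simp: in_keys_iff)
  have "sq_norm (x + y) = (\<Sum>k\<in>Poly_Mapping.keys x \<union> Poly_Mapping.keys y. (Poly_Mapping.lookup (x + y) k)\<^sup>2)"
    by (rule sq_norm_superset) (simp_all add: Poly_Mapping.keys_add)
  also have "\<dots> = (\<Sum>k\<in>Poly_Mapping.keys x. (Poly_Mapping.lookup (x + y) k)\<^sup>2) + (\<Sum>k\<in>Poly_Mapping.keys y. (Poly_Mapping.lookup (x + y) k)\<^sup>2)"
    using assms by (subst sum.union_disjoint) auto
  finally show ?thesis by (simp add: sq_norm_def lookup_add x y)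
qed

lemma sq_norm_sum_disjoint:
  assumes "finite I" "\<And>i j. i \<in> I \<Longrightarrow> j \<in> I \<Longrightarrow> i \<noteq> j \<Longrightarrow> Poly_Mapping.keys (f i) \<inter> Poly_Mapping.keys (f j) = {}"
  shows "sq_norm (\<Sum>i\<in>I. f i) = (\<Sum>i\<in>I. sq_norm (f i))"
  using assms
proof (induction I)
  case (insert i I)
  have "Poly_Mapping.keys (f i) \<inter> Poly_Mapping.keys (\<Sum>i\<in>I. f i) = {}"
    using insert.hyps insert.prems[of i] keys_sum[of f I] by fastforce
  then show ?case using insert by (simp add: sq_norm_add_disjoint)
qed (simp add: sq_norm_def)

text \<open>A lower bound for the rank of \<open>B\<close>, here in the form of a bound for \<open>card B\<close>: the better the basis vectors are approximated
within the span, the larger the rank.\<close>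

lemma card_ge_of_approximation:
  fixes w :: "'a \<Rightarrow> 'a \<Rightarrow>\<^sub>0 real"
  assumes "finite B" "finite E" "\<And>\<tau>. \<tau> \<in> E \<Longrightarrow> w \<tau> \<in> span B"
  shows "(\<Sum>\<tau>\<in>E. 1 - sq_norm (Poly_Mapping.single \<tau> 1 - w \<tau>)) \<le> real (card B)"
proof -
  have "\<exists>u. w \<tau> = (\<Sum>v\<in>B. u v *\<^sub>R v)" if "\<tau> \<in> E" for \<tau>
    using assms(3)[OF that] unfolding span_finite[OF assms(1)] by auto
  then obtain u where u: "\<And>\<tau>. \<tau> \<in> E \<Longrightarrow> w \<tau> = (\<Sum>v\<in>B. u \<tau> v *\<^sub>R v)" by metis
  have "(\<Sum>\<tau>\<in>E. 1 - sq_norm (Poly_Mapping.single \<tau> 1 - w \<tau>))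
    \<le> (\<Sum>\<tau>\<in>E. 1 - (\<Sum>\<rho>\<in>E. ((if \<rho> = \<tau> then 1 else 0) - (\<Sum>v\<in>B. u \<tau> v * Poly_Mapping.lookup v \<rho>))\<^sup>2))"
  proof (intro sum_mono diff_left_mono)
    fix \<tau> assume \<tau>: "\<tau> \<in> E"
    have "(\<Sum>\<rho>\<in>E. ((if \<rho> = \<tau> then 1 else 0) - (\<Sum>v\<in>B. u \<tau> v * Poly_Mapping.lookup v \<rho>))\<^sup>2)
       = (\<Sum>\<rho>\<in>E. (Poly_Mapping.lookup (Poly_Mapping.single \<tau> 1 - w \<tau>) \<rho>)\<^sup>2)"
      by (intro sum.cong refl arg_cong[where f = "\<lambda>x. x\<^sup>2"])
         (auto simp: lookup_minus u[OF \<tau>] lookup_sum lookup_single when_def)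
    also have "\<dots> \<le> sq_norm (Poly_Mapping.single \<tau> 1 - w \<tau>)" by (rule sq_norm_ge[OF assms(2)])
    finally show "(\<Sum>\<rho>\<in>E. ((if \<rho> = \<tau> then 1 else 0) - (\<Sum>v\<in>B. u \<tau> v * Poly_Mapping.lookup v \<rho>))\<^sup>2)
       \<le> sq_norm (Poly_Mapping.single \<tau> 1 - w \<tau>)" .
  qed
  also have "\<dots> \<le> real (card B)" by (rule trace_minus_defect_le_rank[OF assms(1,2)])
  finally show ?thesis .
qed

section \<open>Boundaries and cores\<close>

text \<open>The sign with which \<open>\<sigma> - {v}\<close> occurs in \<open>face_boundary \<sigma>\<close>, computed from the rank of \<open>v\<close> in \<open>\<sigma>\<close>.\<close>

definition face_sign :: "nat set \<Rightarrow> nat \<Rightarrow> real" where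
  "face_sign \<sigma> v = (-1) ^ card {u \<in> \<sigma>. u < v}"

lemma face_sign_sq [simp]: "(face_sign \<sigma> v)\<^sup>2 = 1" and face_sign_nonzero [simp]: "face_sign \<sigma> v \<noteq> 0"
  by (auto simp: face_sign_def power_mult[symmetric] power2_eq_square simp flip: power_add)

lemma face_boundary_sum:
  assumes "finite \<sigma>"
  shows "face_boundary \<sigma> = (\<Sum>v\<in>\<sigma>. Poly_Mapping.single (\<sigma> - {v}) (face_sign \<sigma> v))"
proof -
  define xs where "xs = sorted_list_of_set \<sigma>"
  have xs: "set xs = \<sigma>" "sorted xs" "distinct xs" "length xs = card \<sigma>"
    using assms by (auto simp: xs_def)
  have bij: "bij_betw (nth xs) {..<card \<sigma>} \<sigma>"
    using bij_betw_nth[OF xs(3)] xs by auto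
  have pos: "card {u \<in> \<sigma>. u < xs ! i} = i" if "i < card \<sigma>" for i
  proof -
    have "{u \<in> \<sigma>. u < xs ! i} = nth xs ` {..<i}"
    proof safe
      fix u assume "u \<in> \<sigma>" "u < xs ! i"
      then obtain j where j: "j < card \<sigma>" "u = xs ! j" using bij unfolding bij_betw_def by auto
      have "j < i" using \<open>u < xs ! i\<close> j xs that sorted_nth_mono[OF xs(2), of i j] by (force simp: not_less[symmetric])
      then show "u \<in> nth xs ` {..<i}" using j by auto
    next
      fix j assume "j < i"
      then show "xs ! j \<in> \<sigma>" using xs that by auto
      show "xs ! j < xs ! i"
        using sorted_nth_mono[OF xs(2), of j i] nth_eq_iff_index_eq[OF xs(3), of j i] \<open>j < i\<close> that xs
        by (simp add: order.order_iff_strict)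
    qed
    moreover have "inj_on (nth xs) {..<i}" using bij that by (auto simp: bij_betw_def intro: inj_on_subset)
    ultimately show ?thesis by (simp add: card_image)
  qed
  have "face_boundary \<sigma> = (\<Sum>i<card \<sigma>. Poly_Mapping.single (\<sigma> - {xs ! i}) (face_sign \<sigma> (xs ! i)))"
    unfolding face_boundary_def xs_def[symmetric] by (intro sum.cong refl) (simp add: face_sign_def pos)
  also have "\<dots> = (\<Sum>v\<in>\<sigma>. Poly_Mapping.single (\<sigma> - {v}) (face_sign \<sigma> v))"
    by (rule sum.reindex_bij_betw[OF bij])
  finally show ?thesis .
qed

lemma lookup_face_boundary:
  assumes "finite \<sigma>"
  shows "v \<in> \<sigma> \<Longrightarrow> Poly_Mapping.lookup (face_boundary \<sigma>) (\<sigma> - {v}) = face_sign \<sigma> v"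
    and "\<not> (\<exists>v\<in>\<sigma>. \<tau> = \<sigma> - {v}) \<Longrightarrow> Poly_Mapping.lookup (face_boundary \<sigma>) \<tau> = 0"
proof -
  assume v: "v \<in> \<sigma>"
  have "Poly_Mapping.lookup (face_boundary \<sigma>) (\<sigma> - {v}) = (\<Sum>u\<in>\<sigma>. if u = v then face_sign \<sigma> u else 0)"
    unfolding face_boundary_sum[OF assms] lookup_sum
    by (rule sum.cong) (use v in \<open>auto simp: lookup_single when_def\<close>)
  then show "Poly_Mapping.lookup (face_boundary \<sigma>) (\<sigma> - {v}) = face_sign \<sigma> v" using v assms by simp
next
  assume "\<not> (\<exists>v\<in>\<sigma>. \<tau> = \<sigma> - {v})"
  then show "Poly_Mapping.lookup (face_boundary \<sigma>) \<tau> = 0"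
    unfolding face_boundary_sum[OF assms] lookup_sum
    by (intro sum.neutral) (auto simp: lookup_single when_def)
qed

lemma boundary_superset:
  assumes "finite A" "Poly_Mapping.keys x \<subseteq> A"
  shows "boundary x = (\<Sum>\<sigma>\<in>A. Poly_Mapping.lookup x \<sigma> *\<^sub>R face_boundary \<sigma>)"
  unfolding boundary_def using assms by (intro sum.mono_neutral_left) (auto simp: in_keys_iff)

lemma boundary_add: "boundary (x + y) = boundary x + boundary y"
proof -
  let ?A = "Poly_Mapping.keys x \<union> Poly_Mapping.keys y"
  have "boundary (x + y) = (\<Sum>\<sigma>\<in>?A. Poly_Mapping.lookup (x + y) \<sigma> *\<^sub>R face_boundary \<sigma>)"
    by (rule boundary_superset) (simp_all add: Poly_Mapping.keys_add)
  also have "\<dots> = (\<Sum>\<sigma>\<in>?A. Poly_Mapping.lookup x \<sigma> *\<^sub>R face_boundary \<sigma>) + (\<Sum>\<sigma>\<in>?A. Poly_Mapping.lookup y \<sigma> *\<^sub>R face_boundary \<sigma>)"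
    by (simp add: lookup_add scaleR_add_left sum.distrib)
  also have "\<dots> = boundary x + boundary y" by (simp add: boundary_superset[of ?A])
  finally show ?thesis .
qed

lemma boundary_scaleR: "boundary (r *\<^sub>R x) = r *\<^sub>R boundary x"
  using boundary_superset[of "Poly_Mapping.keys x" "r *\<^sub>R x"] keys_scaleR[of r x]
  by (simp add: boundary_def scaleR_sum_right)

lemma boundary_zero [simp]: "boundary 0 = 0"
  by (simp add: boundary_def)

lemma boundary_sum: "boundary (\<Sum>i\<in>I. f i) = (\<Sum>i\<in>I. boundary (f i))"
  by (induction I rule: infinite_finite_induct) (auto simp: boundary_add)

lemma boundary_single: "boundary (Poly_Mapping.single \<sigma> r) = r *\<^sub>R face_boundary \<sigma>"
  using boundary_superset[of "{\<sigma>}" "Poly_Mapping.single \<sigma> r"] by simp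

lemma subspace_top_homology: "subspace (top_homology Y d)"
proof (rule subspaceI)
  show "0 \<in> top_homology Y d" by (simp add: top_homology_def chains_def)
next
  fix x y assume "x \<in> top_homology Y d" "y \<in> top_homology Y d"
  then show "x + y \<in> top_homology Y d"
    using Poly_Mapping.keys_add[of x y] by (auto simp: top_homology_def chains_def boundary_add)
next
  fix r x assume "x \<in> top_homology Y d"
  then show "r *\<^sub>R x \<in> top_homology Y d"
    using keys_scaleR[of r x] by (auto simp: top_homology_def chains_def boundary_scaleR)
qed

text \<open>The coefficients of \<open>\<tau> - {v, u}\<close> coming from removing \<open>v\<close> first and from removing \<open>u\<close> first are opposite.\<close>

lemma boundary_face_boundary:
  assumes "finite \<tau>"
  shows "boundary (face_boundary \<tau>) = 0"
proof -
  define h where "h v u = Poly_Mapping.single (\<tau> - {v, u}) (face_sign \<tau> v * face_sign (\<tau> - {v}) u)" for v u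
  have anti: "h v u = - h u v" if "v \<in> \<tau>" "u \<in> \<tau>" "v \<noteq> u" for v u
  proof -
    have *: "face_sign \<tau> v * face_sign (\<tau> - {v}) u = - (face_sign \<tau> u * face_sign (\<tau> - {u}) v)"
      if "v \<in> \<tau>" "u \<in> \<tau>" "v < u" for v u
    proof -
      have "{w \<in> \<tau>. w < u} = insert v {w \<in> \<tau> - {v}. w < u}" using that by auto
      then have 1: "card {w \<in> \<tau>. w < u} = Suc (card {w \<in> \<tau> - {v}. w < u})" using assms by simp
      have 2: "{w \<in> \<tau> - {u}. w < v} = {w \<in> \<tau>. w < v}" using that by auto
      show ?thesis unfolding face_sign_def 1 2 by simp
    qed
    show ?thesis using that *[of v u] *[of u v]
      by (cases "v < u") (auto simp: h_def insert_commute simp flip: Poly_Mapping.single_uminus)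
  qed
  define S where "S = (\<Sum>v\<in>\<tau>. \<Sum>u\<in>\<tau> - {v}. h v u)"
  have S_pairs: "S = (\<Sum>z\<in>{z\<in>\<tau> \<times> \<tau>. fst z \<noteq> snd z}. h (fst z) (snd z))"
  proof -
    have "S = (\<Sum>z\<in>(SIGMA v:\<tau>. \<tau> - {v}). h (fst z) (snd z))"
      unfolding S_def using assms by (subst sum.Sigma) (auto simp: case_prod_unfold)
    also have "(SIGMA v:\<tau>. \<tau> - {v}) = {z\<in>\<tau> \<times> \<tau>. fst z \<noteq> snd z}" by auto
    finally show ?thesis .
  qed
  also have "\<dots> = (\<Sum>z\<in>{z\<in>\<tau> \<times> \<tau>. fst z \<noteq> snd z}. h (snd z) (fst z))"
    by (rule sum.reindex_bij_witness[where i = prod.swap and j = prod.swap]) auto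
  also have "\<dots> = - S"
    unfolding S_pairs sum_negf[symmetric] by (intro sum.cong refl) (auto intro!: anti)
  finally have "S + S = 0" by simp
  then have "2 *\<^sub>R S = 0" by (simp add: scaleR_2)
  then have "S = 0" by simp
  have "boundary (face_boundary \<tau>) = (\<Sum>v\<in>\<tau>. face_sign \<tau> v *\<^sub>R face_boundary (\<tau> - {v}))"
    unfolding face_boundary_sum[OF assms] boundary_sum boundary_single ..
  also have "\<dots> = S"
    unfolding S_def
  proof (intro sum.cong refl)
    fix v assume "v \<in> \<tau>"
    have "face_sign \<tau> v *\<^sub>R face_boundary (\<tau> - {v}) =
      (\<Sum>u\<in>\<tau> - {v}. face_sign \<tau> v *\<^sub>R Poly_Mapping.single (\<tau> - {v} - {u}) (face_sign (\<tau> - {v}) u))"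
      using assms by (simp add: face_boundary_sum scaleR_sum_right)
    also have "\<dots> = (\<Sum>u\<in>\<tau> - {v}. h v u)"
    proof (intro sum.cong refl)
      fix u
      have "\<tau> - {v} - {u} = \<tau> - {v, u}" by auto
      then show "face_sign \<tau> v *\<^sub>R Poly_Mapping.single (\<tau> - {v} - {u}) (face_sign (\<tau> - {v}) u) = h v u"
        by (intro poly_mapping_eqI) (simp add: h_def lookup_single when_def)
    qed
    finally show "face_sign \<tau> v *\<^sub>R face_boundary (\<tau> - {v}) = (\<Sum>u\<in>\<tau> - {v}. h v u)" .
  qed
  finally show ?thesis using \<open>S = 0\<close> by simp
qed

text \<open>No facet of a face in \<open>K\<close> is free: it lies in a second face. Supports of cycles have this property,
and it is robust enough to be counted.\<close>

definition core :: "'a set set \<Rightarrow> bool" where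
  "core K \<longleftrightarrow> K \<noteq> {} \<and> (\<forall>\<sigma>\<in>K. \<forall>u\<in>\<sigma>. \<exists>\<sigma>'\<in>K. \<sigma>' \<noteq> \<sigma> \<and> \<sigma> - {u} \<subseteq> \<sigma>')"

text \<open>A facet that lies in one face of the support only would survive in the boundary.\<close>

lemma core_keys_cycle:
  assumes x: "x \<in> top_homology Y d" and "x \<noteq> 0"
  shows "core (Poly_Mapping.keys x)"
  unfolding core_def
proof (intro conjI ballI)
  show "Poly_Mapping.keys x \<noteq> {}" using assms by simp
next
  fix \<sigma> u assume \<sigma>: "\<sigma> \<in> Poly_Mapping.keys x" and u: "u \<in> \<sigma>"
  have fin: "finite s" if "s \<in> Poly_Mapping.keys x" for s
    using that x by (auto simp: top_homology_def chains_def faces_def intro!: card_ge_0_finite)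
  show "\<exists>\<sigma>'\<in>Poly_Mapping.keys x. \<sigma>' \<noteq> \<sigma> \<and> \<sigma> - {u} \<subseteq> \<sigma>'"
  proof (rule ccontr)
    assume *: "\<not> ?thesis"
    have "0 = Poly_Mapping.lookup (boundary x) (\<sigma> - {u})" using x by (simp add: top_homology_def)
    also have "\<dots> = (\<Sum>s\<in>Poly_Mapping.keys x. Poly_Mapping.lookup x s * Poly_Mapping.lookup (face_boundary s) (\<sigma> - {u}))"
      by (simp add: boundary_def lookup_sum)
    also have "\<dots> = (\<Sum>s\<in>Poly_Mapping.keys x. if s = \<sigma> then Poly_Mapping.lookup x \<sigma> * face_sign \<sigma> u else 0)"
    proof (rule sum.cong[OF refl])
      fix s assume s: "s \<in> Poly_Mapping.keys x"
      have "Poly_Mapping.lookup (face_boundary s) (\<sigma> - {u}) = 0" if "s \<noteq> \<sigma>"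
        by (rule lookup_face_boundary(2)[OF fin[OF s]]) (use * that s in auto)
      then show "Poly_Mapping.lookup x s * Poly_Mapping.lookup (face_boundary s) (\<sigma> - {u}) =
        (if s = \<sigma> then Poly_Mapping.lookup x \<sigma> * face_sign \<sigma> u else 0)"
        using lookup_face_boundary(1)[OF fin[OF s]] u by auto
    qed
    also have "\<dots> = Poly_Mapping.lookup x \<sigma> * face_sign \<sigma> u" using \<sigma> by simp
    finally show False using \<sigma> by (simp add: in_keys_iff)
  qed
qed

text \<open>By induction on the size of the support: it is a core, thus contains all facets of a simplex, and
subtracting a suitable multiple of the boundary of this simplex removes one face from the support and adds none.\<close>

lemma top_homology_eq_span:
  assumes fin: "finite (faces Y d)"
    and cores: "\<And>K. core K \<Longrightarrow> K \<subseteq> faces Y d \<Longrightarrow> real (card K) \<le> L \<Longrightarrow>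
       \<exists>\<tau>. card \<tau> = d + 2 \<and> (\<forall>\<sigma>\<subseteq>\<tau>. card \<sigma> = d + 1 \<longrightarrow> \<sigma> \<in> K)"
    and small: "\<And>x. x \<in> top_homology Y d \<Longrightarrow> real (card (Poly_Mapping.keys x)) \<le> L"
  shows "top_homology Y d = span (simplex_boundaries Y d)"
proof
  have sb: "simplex_boundaries Y d \<subseteq> top_homology Y d"
  proof
    fix x assume "x \<in> simplex_boundaries Y d"
    then obtain \<tau> where \<tau>: "x = face_boundary \<tau>" "card \<tau> = d + 2"
      "\<And>\<sigma>. \<sigma> \<subseteq> \<tau> \<Longrightarrow> card \<sigma> = d + 1 \<Longrightarrow> \<sigma> \<in> faces Y d"
      by (auto simp: simplex_boundaries_def)
    have f: "finite \<tau>" using \<tau>(2) by (intro card_ge_0_finite) simp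
    have "Poly_Mapping.keys x \<subseteq> faces Y d"
    proof
      fix \<rho> assume "\<rho> \<in> Poly_Mapping.keys x"
      then obtain v where "v \<in> \<tau>" "\<rho> = \<tau> - {v}"
        using lookup_face_boundary(2)[OF f, of \<rho>] \<tau>(1) by (auto simp: in_keys_iff)
      then show "\<rho> \<in> faces Y d" using \<tau>(2) by (intro \<tau>(3)) auto
    qed
    then show "x \<in> top_homology Y d"
      by (simp add: top_homology_def chains_def \<tau>(1) boundary_face_boundary[OF f])
  qed
  show "span (simplex_boundaries Y d) \<subseteq> top_homology Y d"
    by (rule span_minimal[OF sb subspace_top_homology])
  have "x \<in> span (simplex_boundaries Y d)" if "x \<in> top_homology Y d" for x
    using that
  proof (induction "card (Poly_Mapping.keys x)" arbitrary: x rule: less_induct)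
    case less
    show ?case
    proof (cases "x = 0")
      case False
      have "Poly_Mapping.keys x \<subseteq> faces Y d" using less.prems by (simp add: top_homology_def chains_def)
      then obtain \<tau> where \<tau>: "card \<tau> = d + 2" "\<And>\<sigma>. \<sigma> \<subseteq> \<tau> \<Longrightarrow> card \<sigma> = d + 1 \<Longrightarrow> \<sigma> \<in> Poly_Mapping.keys x"
        using cores[OF core_keys_cycle[OF less.prems False]] small[OF less.prems] by blast
      have f: "finite \<tau>" using \<tau>(1) by (intro card_ge_0_finite) simp
      have z: "face_boundary \<tau> \<in> simplex_boundaries Y d"
        using \<tau> \<open>Poly_Mapping.keys x \<subseteq> faces Y d\<close> by (auto simp: simplex_boundaries_def)
      obtain v where v: "v \<in> \<tau>" using \<tau>(1) by fastforce
      define r where "r = Poly_Mapping.lookup x (\<tau> - {v}) / face_sign \<tau> v"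
      define y where "y = x - r *\<^sub>R face_boundary \<tau>"
      have vk: "\<tau> - {v} \<in> Poly_Mapping.keys x" using v \<tau> f by (intro \<tau>(2)) auto
      have "Poly_Mapping.keys y \<subseteq> Poly_Mapping.keys x - {\<tau> - {v}}"
      proof
        fix \<rho> assume \<rho>: "\<rho> \<in> Poly_Mapping.keys y"
        have "\<rho> \<noteq> \<tau> - {v}"
          using \<rho> lookup_face_boundary(1)[OF f v] by (auto simp: y_def r_def in_keys_iff lookup_minus)
        moreover have "\<rho> \<in> Poly_Mapping.keys x"
        proof (cases "\<exists>u\<in>\<tau>. \<rho> = \<tau> - {u}")
          case True
          then show ?thesis using \<tau>(1) f by (auto intro!: \<tau>(2))
        next
          case False
          then show ?thesis using \<rho> lookup_face_boundary(2)[OF f, of \<rho>]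
            by (auto simp: y_def in_keys_iff lookup_minus)
        qed
        ultimately show "\<rho> \<in> Poly_Mapping.keys x - {\<tau> - {v}}" by simp
      qed
      then have "card (Poly_Mapping.keys y) < card (Poly_Mapping.keys x)"
        using vk by (intro psubset_card_mono) auto
      moreover have "y \<in> top_homology Y d"
        unfolding y_def using z sb less.prems
        by (intro subspace_diff[OF subspace_top_homology] subspace_scale[OF subspace_top_homology]) auto
      ultimately have "y \<in> span (simplex_boundaries Y d)" by (rule less.hyps)
      moreover have "x = y + r *\<^sub>R face_boundary \<tau>" by (simp add: y_def)
      ultimately show ?thesis using z by (metis span_add span_scale span_base)
    qed (simp add: span_zero)
  qed
  then show "top_homology Y d \<subseteq> span (simplex_boundaries Y d)" by blast
qed

section \<open>Exploration trees\<close>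

text \<open>The tree explored from a \<open>(d-1)\<close>-face \<open>\<tau>\<close>: \<open>N\<close> consists of the vertices \<open>v\<close> for which \<open>insert v \<tau>\<close> is a face, and
\<open>f v u\<close> is the tree below its facet opposite to \<open>u\<close>, for \<open>u \<in> \<tau>\<close>. The face that belongs to a node is not stored; it is computed
on the way down by \<open>swap_vertex\<close>.\<close>

datatype etree = Leaf | Node "nat set" "nat \<Rightarrow> nat \<Rightarrow> etree"

text \<open>For \<open>v \<notin> \<tau>\<close> and \<open>u \<in> \<tau>\<close>, this is the facet of \<open>insert v \<tau>\<close> opposite to \<open>u\<close>.\<close>

definition swap_vertex :: "nat set \<Rightarrow> nat \<Rightarrow> nat \<Rightarrow> nat set" where
  "swap_vertex \<tau> v u = insert v (\<tau> - {u})"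

primrec labels :: "etree \<Rightarrow> nat set \<Rightarrow> nat set" where
  "labels Leaf \<tau> = {}"
| "labels (Node N f) \<tau> = N \<union> (\<Union>v\<in>N. \<Union>u\<in>\<tau>. labels (f v u) (swap_vertex \<tau> v u))"

text \<open>A squared distance to the span of the boundaries in the tree. If the facets of \<open>insert v \<tau>\<close> other than \<open>\<tau>\<close>
have residues of total energy \<open>X v\<close>, then \<open>e\<^sub>\<tau>\<close> is, up to boundaries, a combination of orthogonal vectors of square norms
\<open>X v\<close>. Minimising over the weights adds the inverses as for resistors in parallel, with an additional resistor \<open>1\<close> for
using no face at all.\<close>

primrec energy :: "etree \<Rightarrow> nat set \<Rightarrow> real" where
  "energy Leaf \<tau> = 1"
| "energy (Node N f) \<tau> = 1 / (1 + (\<Sum>v\<in>N. inverse (\<Sum>u\<in>\<tau>. energy (f v u) (swap_vertex \<tau> v u))))"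

text \<open>A tree is fresh when no vertex occurs twice and none lies in \<open>A\<close>. Then different branches contain different faces, and their
residues have disjoint supports.\<close>

primrec fresh :: "etree \<Rightarrow> nat set \<Rightarrow> nat set \<Rightarrow> bool" where
  "fresh Leaf \<tau> A \<longleftrightarrow> True"
| "fresh (Node N f) \<tau> A \<longleftrightarrow> N \<inter> A = {} \<and>
     (\<forall>v\<in>N. \<forall>u\<in>\<tau>. fresh (f v u) (swap_vertex \<tau> v u) (A \<union> N)) \<and>
     (\<forall>v\<in>N. \<forall>u\<in>\<tau>. \<forall>v'\<in>N. \<forall>u'\<in>\<tau>. (v, u) \<noteq> (v', u') \<longrightarrow>
        labels (f v u) (swap_vertex \<tau> v u) \<inter> labels (f v' u') (swap_vertex \<tau> v' u') = {})"

primrec tree_faces :: "etree \<Rightarrow> nat set \<Rightarrow> nat set set" where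
  "tree_faces Leaf \<tau> = {}"
| "tree_faces (Node N f) \<tau> = (\<lambda>v. insert v \<tau>) ` N \<union>
     (\<Union>v\<in>N. \<Union>u\<in>\<tau>. tree_faces (f v u) (swap_vertex \<tau> v u))"

text \<open>The sets that must not be faces for \<open>explore\<close> to find exactly this tree. The vertices in \<open>X\<close> are not
examined.\<close>

primrec tree_nonfaces :: "nat set \<Rightarrow> etree \<Rightarrow> nat set \<Rightarrow> nat set \<Rightarrow> nat set set" where
  "tree_nonfaces V Leaf \<tau> X = {}"
| "tree_nonfaces V (Node N f) \<tau> X = (\<lambda>v. insert v \<tau>) ` (V - \<tau> - X - N) \<union>
     (\<Union>v\<in>N. \<Union>u\<in>\<tau>. tree_nonfaces V (f v u) (swap_vertex \<tau> v u) {u})"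

text \<open>Below the facet opposite to \<open>u\<close> the vertex \<open>u\<close> is skipped, since it leads back to the face from which the
exploration came.\<close>

primrec explore :: "nat set \<Rightarrow> nat set set \<Rightarrow> nat \<Rightarrow> nat set \<Rightarrow> nat set \<Rightarrow> etree" where
  "explore V F 0 \<tau> X = Leaf"
| "explore V F (Suc k) \<tau> X = (let N = {v \<in> V - \<tau> - X. insert v \<tau> \<in> F} in
     Node N (\<lambda>v u. if v \<in> N \<and> u \<in> \<tau> then explore V F k (swap_vertex \<tau> v u) {u} else Leaf))"

text \<open>The idealised exploration, in which every node examines all potential faces with fresh independent coins. In
particular, it may return to a vertex seen before; such trees are not \<open>fresh\<close>.\<close>

primrec branching :: "nat set \<Rightarrow> real \<Rightarrow> nat \<Rightarrow> nat set \<Rightarrow> etree pmf" where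
  "branching V p 0 \<tau> = return_pmf Leaf"
| "branching V p (Suc k) \<tau> = bind_pmf (random_subset (V - \<tau>) p) (\<lambda>N.
     map_pmf (Node N) (Pi_pmf N (\<lambda>_. Leaf) (\<lambda>v. Pi_pmf \<tau> Leaf (\<lambda>u. branching V p k (swap_vertex \<tau> v u)))))"

lemma labels_fresh: "fresh L \<tau> A \<Longrightarrow> labels L \<tau> \<inter> A = {}"
proof (induction L arbitrary: \<tau> A)
  case (Node N f)
  then have "labels (f v u) (swap_vertex \<tau> v u) \<inter> (A \<union> N) = {}" if "v \<in> N" "u \<in> \<tau>" for v u
    using that by (intro Node.IH) auto
  then show ?case using Node.prems by fastforce
qed simp

lemma tree_faces_subset: "\<sigma> \<in> tree_faces L \<tau> \<Longrightarrow> \<sigma> \<subseteq> \<tau> \<union> labels L \<tau>"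
proof (induction L arbitrary: \<tau>)
  case (Node N f)
  then consider v where "v \<in> N" "\<sigma> = insert v \<tau>"
    | v u where "v \<in> N" "u \<in> \<tau>" "\<sigma> \<in> tree_faces (f v u) (swap_vertex \<tau> v u)" by auto
  then show ?case
  proof cases
    case 2
    then have "\<sigma> \<subseteq> swap_vertex \<tau> v u \<union> labels (f v u) (swap_vertex \<tau> v u)"
      using Node.IH by blast
    then show ?thesis using 2 by (auto simp: swap_vertex_def)
  qed auto
qed simp

lemma tree_nonfaces_cases:
  "q \<in> tree_nonfaces V L \<tau> X \<Longrightarrow>
     (\<exists>w\<in>V - \<tau> - X. q = insert w \<tau>) \<or> q \<inter> labels L \<tau> \<noteq> {}"
proof (induction L arbitrary: \<tau> X)
  case (Node N f)
  then consider w where "w \<in> V - \<tau> - X" "q = insert w \<tau>"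
    | v u where "v \<in> N" "u \<in> \<tau>" "q \<in> tree_nonfaces V (f v u) (swap_vertex \<tau> v u) {u}" by auto
  then show ?case
  proof cases
    case 2
    then consider w where "w \<in> V - swap_vertex \<tau> v u - {u}" "q = insert w (swap_vertex \<tau> v u)"
      | "q \<inter> labels (f v u) (swap_vertex \<tau> v u) \<noteq> {}" using Node.IH by blast
    then show ?thesis
    proof cases
      case 1
      then have "v \<in> q" by (auto simp: swap_vertex_def)
      then show ?thesis using 2(1) by auto
    next
      case 2
      then show ?thesis using \<open>v \<in> N\<close> \<open>u \<in> \<tau>\<close> by auto
    qed
  qed auto
qed simp

text \<open>In a fresh tree, the vertex that distinguishes a face of one node from a non-face of another one is a label of
only one of the two branches.\<close>

lemma tree_faces_nonfaces_disjoint: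
  assumes "fresh L \<tau> A" "\<tau> \<union> X \<subseteq> A"
  shows "tree_faces L \<tau> \<inter> tree_nonfaces V L \<tau> X = {}"
  using assms
proof (induction L arbitrary: \<tau> A X)
  case (Node N f)
  let ?s = "swap_vertex \<tau>"
  let ?L = "\<lambda>v u. labels (f v u) (?s v u)"
  have NA: "N \<inter> A = {}" and fr: "\<And>v u. v \<in> N \<Longrightarrow> u \<in> \<tau> \<Longrightarrow> fresh (f v u) (?s v u) (A \<union> N)"
    and dj: "\<And>v u v' u'. v \<in> N \<Longrightarrow> u \<in> \<tau> \<Longrightarrow> v' \<in> N \<Longrightarrow> u' \<in> \<tau> \<Longrightarrow> (v, u) \<noteq> (v', u') \<Longrightarrow> ?L v u \<inter> ?L v' u' = {}"
    using Node.prems(1) by auto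
  have La: "?L v u \<inter> (A \<union> N) = {}" if "v \<in> N" "u \<in> \<tau>" for v u
    using labels_fresh[OF fr[OF that]] .
  have \<tau>A: "\<tau> \<subseteq> A" "X \<subseteq> A" using Node.prems(2) by auto
  show ?case
  proof (rule ccontr)
    assume "tree_faces (Node N f) \<tau> \<inter> tree_nonfaces V (Node N f) \<tau> X \<noteq> {}"
    then obtain q where q1: "q \<in> tree_faces (Node N f) \<tau>" and q2: "q \<in> tree_nonfaces V (Node N f) \<tau> X" by auto
    from q1 consider v where "v \<in> N" "q = insert v \<tau>"
      | v u where "v \<in> N" "u \<in> \<tau>" "q \<in> tree_faces (f v u) (?s v u)" by auto
    then show False
    proof cases
      case q: 1
      from q2 consider w where "w \<in> V - \<tau> - X - N" "q = insert w \<tau>"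
        | v' u' where "v' \<in> N" "u' \<in> \<tau>" "q \<in> tree_nonfaces V (f v' u') (?s v' u') {u'}" by auto
      then show False
      proof cases
        case 1
        then have "w = v" using q NA \<tau>A by blast
        then show False using 1 q by auto
      next
        case 2
        from tree_nonfaces_cases[OF 2(3)] consider w where "w \<in> V - ?s v' u' - {u'}" "q = insert w (?s v' u')"
          | "q \<inter> ?L v' u' \<noteq> {}" by blast
        then show False
        proof cases
          case 1
          have "u' \<in> q" using q 2 by auto
          then have "u' = v'" using 1 by (auto simp: swap_vertex_def)
          then show False using 2 NA \<tau>A by auto
        next
          case 2
          then show False using q La[of v' u'] \<open>v' \<in> N\<close> \<open>u' \<in> \<tau>\<close> \<tau>A by auto
        qed
      qed
    next
      case q: 2
      have sub: "q \<subseteq> ?s v u \<union> ?L v u" by (rule tree_faces_subset[OF q(3)])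
      have "u \<noteq> v" using q(1,2) NA \<tau>A by blast
      moreover have "u \<notin> ?L v u" using La[OF q(1,2)] q(2) \<tau>A by blast
      ultimately have uq: "u \<notin> q" using sub by (auto simp: swap_vertex_def)
      from q2 consider w where "w \<in> V - \<tau> - X - N" "q = insert w \<tau>"
        | v' u' where "v' \<in> N" "u' \<in> \<tau>" "q \<in> tree_nonfaces V (f v' u') (?s v' u') {u'}" by auto
      then show False
      proof cases
        case 1
        then show False using uq q by auto
      next
        case n: 2
        show False
        proof (cases "(v, u) = (v', u')")
          case True
          have "tree_faces (f v u) (?s v u) \<inter> tree_nonfaces V (f v u) (?s v u) {u} = {}"
            by (rule Node.IH[of "f v" _ _ "A \<union> N"])
               (use q fr \<tau>A in \<open>auto simp: swap_vertex_def\<close>)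
          then show False using q n True by auto
        next
          case False
          from tree_nonfaces_cases[OF n(3)] consider w where "w \<in> V - ?s v' u' - {u'}" "q = insert w (?s v' u')"
            | "q \<inter> ?L v' u' \<noteq> {}" by blast
          then show False
          proof cases
            case 1
            have "v' \<in> q" using 1 by (auto simp: swap_vertex_def)
            then have "v' = v" using sub n La[OF q(1,2)] NA \<tau>A by (auto simp: swap_vertex_def)
            then have "u \<noteq> u'" using False by simp
            then have "u \<in> q" using 1 q by (auto simp: swap_vertex_def)
            then show False using uq by simp
          next
            case 2
            then obtain z where z: "z \<in> q" "z \<in> ?L v' u'" by auto
            then have "z \<notin> A \<union> N" using La[OF n(1,2)] by auto
            then have "z \<in> ?L v u" using sub z q(1) \<tau>A by (auto simp: swap_vertex_def)
            then show False using dj[OF q(1,2) n(1,2) False] z by auto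
          qed
        qed
      qed
    qed
  qed
qed simp

lemma tree_faces_explore: "tree_faces (explore V F k \<tau> X) \<tau> \<subseteq> F"
  by (induction k arbitrary: \<tau> X) (auto simp: Let_def image_subset_iff)

lemma card_swap_vertex:
  assumes "finite \<tau>" "v \<notin> \<tau>" "u \<in> \<tau>" shows "card (swap_vertex \<tau> v u) = card \<tau>"
  using assms by (simp add: swap_vertex_def card_Diff_singleton card_gt_0_iff)
    (metis Suc_pred card_gt_0_iff empty_iff)

text \<open>The trees of depth \<open>k\<close> in a normal form, where \<open>f\<close> is \<open>Leaf\<close> outside its intended domain \<open>N \<times> \<tau>\<close>.\<close>

primrec tree_shape :: "nat set \<Rightarrow> nat \<Rightarrow> etree \<Rightarrow> nat set \<Rightarrow> bool" where
  "tree_shape V 0 L \<tau> \<longleftrightarrow> L = Leaf"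
| "tree_shape V (Suc k) L \<tau> \<longleftrightarrow> (\<exists>N f. L = Node N f \<and> N \<subseteq> V - \<tau> \<and>
     (\<forall>v u. if v \<in> N \<and> u \<in> \<tau> then tree_shape V k (f v u) (swap_vertex \<tau> v u) else f v u = Leaf))"

lemma set_branching:
  assumes "finite V" "\<tau> \<subseteq> V"
  shows "L \<in> set_pmf (branching V p k \<tau>) \<Longrightarrow> tree_shape V k L \<tau>"
  using assms(2)
proof (induction k arbitrary: L \<tau>)
  case (Suc k)
  have fin: "finite \<tau>" using Suc.prems assms(1) finite_subset by blast
  obtain N f where N: "N \<in> set_pmf (random_subset (V - \<tau>) p)" and L: "L = Node N f"
    and f: "f \<in> set_pmf (Pi_pmf N (\<lambda>_. Leaf) (\<lambda>v. Pi_pmf \<tau> Leaf (\<lambda>u. branching V p k (swap_vertex \<tau> v u))))"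
    using Suc.prems(1) by auto
  have NV: "N \<subseteq> V - \<tau>" using N set_random_subset by fastforce
  then have finN: "finite N" using assms(1) finite_subset by blast
  have fN: "f v \<in> set_pmf (Pi_pmf \<tau> Leaf (\<lambda>u. branching V p k (swap_vertex \<tau> v u)))" if "v \<in> N" for v
    using f that finN by (auto simp: set_Pi_pmf PiE_dflt_def)
  have out: "f v = (\<lambda>_. Leaf)" if "v \<notin> N" for v
    using f that finN by (auto simp: set_Pi_pmf PiE_dflt_def)
  have "tree_shape V k (f v u) (swap_vertex \<tau> v u)" if "v \<in> N" "u \<in> \<tau>" for v u
  proof (rule Suc.IH)
    show "f v u \<in> set_pmf (branching V p k (swap_vertex \<tau> v u))"
      using fN[OF that(1)] that(2) fin by (auto simp: set_Pi_pmf PiE_dflt_def)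
    show "swap_vertex \<tau> v u \<subseteq> V" using that NV Suc.prems by (auto simp: swap_vertex_def)
  qed
  moreover have "f v u = Leaf" if "\<not> (v \<in> N \<and> u \<in> \<tau>)" for v u
    using that out fN[of v] fin by (cases "v \<in> N") (auto simp: set_Pi_pmf PiE_dflt_def)
  ultimately show ?case using NV L by auto
qed simp

text \<open>The exploration only looks at faces and non-faces of the tree, so that they determine its outcome.\<close>

lemma explore_eq:
  assumes "tree_shape V k L \<tau>" "fresh L \<tau> A" "X \<subseteq> A" "\<tau> \<subseteq> A"
    "tree_faces L \<tau> \<subseteq> F" "tree_nonfaces V L \<tau> X \<inter> F = {}"
  shows "explore V F k \<tau> X = L"
  using assms
proof (induction k arbitrary: L \<tau> A X)
  case (Suc k)
  obtain N f where L: "L = Node N f" and N: "N \<subseteq> V - \<tau>"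
    and f: "\<And>v u. v \<in> N \<Longrightarrow> u \<in> \<tau> \<Longrightarrow> tree_shape V k (f v u) (swap_vertex \<tau> v u)"
    and out: "\<And>v u. \<not> (v \<in> N \<and> u \<in> \<tau>) \<Longrightarrow> f v u = Leaf"
    using Suc.prems(1) by (force split: if_splits)
  have NA: "N \<inter> A = {}" using Suc.prems(2) by (simp add: L)
  have N_eq: "{v \<in> V - \<tau> - X. insert v \<tau> \<in> F} = N"
  proof
    show "N \<subseteq> {v \<in> V - \<tau> - X. insert v \<tau> \<in> F}"
      using N NA Suc.prems(3,5) by (auto simp: L)
    show "{v \<in> V - \<tau> - X. insert v \<tau> \<in> F} \<subseteq> N"
      using Suc.prems(6) by (auto simp: L)
  qed
  have "explore V F k (swap_vertex \<tau> v u) {u} = f v u" if "v \<in> N" "u \<in> \<tau>" for v u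
  proof (rule Suc.IH[of _ _ "A \<union> N"])
    show "tree_shape V k (f v u) (swap_vertex \<tau> v u)" by (rule f[OF that])
    show "fresh (f v u) (swap_vertex \<tau> v u) (A \<union> N)" using Suc.prems(2) that by (simp add: L)
    show "{u} \<subseteq> A \<union> N" "swap_vertex \<tau> v u \<subseteq> A \<union> N" using Suc.prems(4) that by (auto simp: swap_vertex_def)
    show "tree_faces (f v u) (swap_vertex \<tau> v u) \<subseteq> F" using Suc.prems(5) that by (auto simp: L)
    show "tree_nonfaces V (f v u) (swap_vertex \<tau> v u) {u} \<inter> F = {}" using Suc.prems(6) that by (auto simp: L)
  qed
  then have "(\<lambda>v u. if v \<in> N \<and> u \<in> \<tau> then explore V F k (swap_vertex \<tau> v u) {u} else Leaf) = f"
    using out by (intro ext) simp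
  then show ?case unfolding L explore.simps Let_def N_eq by simp
qed simp

lemma tree_sets_dfaces:
  assumes "tree_shape V k L \<tau>" "finite V" "\<tau> \<subseteq> V" "card \<tau> = d"
  shows "tree_faces L \<tau> \<subseteq> {\<sigma>. \<sigma> \<subseteq> V \<and> card \<sigma> = d + 1}"
    "tree_nonfaces V L \<tau> X \<subseteq> {\<sigma>. \<sigma> \<subseteq> V \<and> card \<sigma> = d + 1}"
  using assms(1,3,4)
proof (induction k arbitrary: L \<tau> X)
  case (Suc k)
  {
    case 1
    obtain N f where L: "L = Node N f" and N: "N \<subseteq> V - \<tau>"
      and f: "\<And>v u. v \<in> N \<Longrightarrow> u \<in> \<tau> \<Longrightarrow> tree_shape V k (f v u) (swap_vertex \<tau> v u)"
      using 1(1) by (force split: if_splits)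
    have fin: "finite \<tau>" using 1(2) assms(2) finite_subset by blast
    have sw: "swap_vertex \<tau> v u \<subseteq> V" "card (swap_vertex \<tau> v u) = d" if "v \<in> N" "u \<in> \<tau>" for v u
      using that 1 N card_swap_vertex[OF fin, of v u] by (auto simp: swap_vertex_def)
    have "tree_faces (f v u) (swap_vertex \<tau> v u) \<subseteq> {\<sigma>. \<sigma> \<subseteq> V \<and> card \<sigma> = d + 1}" if "v \<in> N" "u \<in> \<tau>" for v u
      by (rule Suc.IH(1)[OF f[OF that] sw[OF that]])
    then show ?case using 1 N fin by (auto simp: L)
  next
    case 2
    obtain N f where L: "L = Node N f" and N: "N \<subseteq> V - \<tau>"
      and f: "\<And>v u. v \<in> N \<Longrightarrow> u \<in> \<tau> \<Longrightarrow> tree_shape V k (f v u) (swap_vertex \<tau> v u)"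
      using 2(1) by (force split: if_splits)
    have fin: "finite \<tau>" using 2(2) assms(2) finite_subset by blast
    have sw: "swap_vertex \<tau> v u \<subseteq> V" "card (swap_vertex \<tau> v u) = d" if "v \<in> N" "u \<in> \<tau>" for v u
      using that 2 N card_swap_vertex[OF fin, of v u] by (auto simp: swap_vertex_def)
    have "tree_nonfaces V (f v u) (swap_vertex \<tau> v u) {u} \<subseteq> {\<sigma>. \<sigma> \<subseteq> V \<and> card \<sigma> = d + 1}" if "v \<in> N" "u \<in> \<tau>" for v u
      by (rule Suc.IH(2)[OF f[OF that] sw[OF that]])
    then show ?case using 2 N fin by (auto simp: L)
  }
qed simp_all

lemma pmf_branching_Node:
  assumes "finite V" "0 \<le> p" "p \<le> 1" "finite \<tau>" "N \<subseteq> V - \<tau>" "\<And>v u. \<not> (v \<in> N \<and> u \<in> \<tau>) \<Longrightarrow> f v u = Leaf"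
  shows "pmf (branching V p (Suc k) \<tau>) (Node N f) =
    p ^ card N * (1 - p) ^ card (V - \<tau> - N) * (\<Prod>v\<in>N. \<Prod>u\<in>\<tau>. pmf (branching V p k (swap_vertex \<tau> v u)) (f v u))"
proof -
  define Q where "Q N = Pi_pmf N (\<lambda>_. Leaf) (\<lambda>v. Pi_pmf \<tau> Leaf (\<lambda>u. branching V p k (swap_vertex \<tau> v u)))" for N
  have finN: "finite N" using assms(1,5) finite_subset by blast
  have "ennreal (pmf (branching V p (Suc k) \<tau>) (Node N f)) =
     (\<integral>\<^sup>+N'. ennreal (pmf (map_pmf (Node N') (Q N')) (Node N f)) \<partial>random_subset (V - \<tau>) p)"
    by (simp add: Q_def ennreal_pmf_bind)
  also have "\<dots> = (\<integral>\<^sup>+N'. ennreal (pmf (Q N) f) * indicator {N} N' \<partial>random_subset (V - \<tau>) p)"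
  proof (intro nn_integral_cong)
    fix N'
    show "ennreal (pmf (map_pmf (Node N') (Q N')) (Node N f)) = ennreal (pmf (Q N) f) * indicator {N} N'"
    proof (cases "N' = N")
      case True
      have "pmf (map_pmf (Node N) (Q N)) (Node N f) = pmf (Q N) f"
        by (rule pmf_map_inj') (simp add: inj_def)
      then show ?thesis using True by simp
    next
      case False
      then have "Node N f \<notin> set_pmf (map_pmf (Node N') (Q N'))" by auto
      then show ?thesis using False by (simp add: pmf_eq_0_set_pmf)
    qed
  qed
  also have "\<dots> = ennreal (pmf (Q N) f) * ennreal (pmf (random_subset (V - \<tau>) p) N)"
    by (subst nn_integral_cmult_indicator) (auto simp: emeasure_pmf_single)
  finally have "pmf (branching V p (Suc k) \<tau>) (Node N f) = pmf (Q N) f * pmf (random_subset (V - \<tau>) p) N"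
    by (simp add: ennreal_mult[symmetric] del: branching.simps)
  also have "pmf (random_subset (V - \<tau>) p) N = p ^ card N * (1 - p) ^ card (V - \<tau> - N)"
    using assms by (subst pmf_random_subset) auto
  also have "pmf (Q N) f = (\<Prod>v\<in>N. pmf (Pi_pmf \<tau> Leaf (\<lambda>u. branching V p k (swap_vertex \<tau> v u))) (f v))"
    unfolding Q_def by (rule pmf_Pi') (use finN assms in \<open>auto simp: fun_eq_iff\<close>)
  also have "\<dots> = (\<Prod>v\<in>N. \<Prod>u\<in>\<tau>. pmf (branching V p k (swap_vertex \<tau> v u)) (f v u))"
    by (intro prod.cong refl pmf_Pi') (use assms in auto)
  finally show ?thesis by simp
qed

text \<open>Every node contributes a factor \<open>p\<close> for each child and \<open>1 - p\<close> for each vertex that is not a child. A set may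
occur at several nodes, and the vertices in \<open>X\<close> are left out, hence only an inequality.\<close>

lemma pmf_branching_le:
  assumes "finite V" "0 \<le> p" "p \<le> 1" "\<tau> \<subseteq> V"
  shows "pmf (branching V p k \<tau>) L \<le> p ^ card (tree_faces L \<tau>) * (1 - p) ^ card (tree_nonfaces V L \<tau> X)"
proof (cases "tree_shape V k L \<tau>")
  case False
  then have "pmf (branching V p k \<tau>) L = 0" using set_branching[OF assms(1,4), of L p k] by (auto simp: pmf_eq_0_set_pmf)
  then show ?thesis using assms by simp
next
  case True
  then show ?thesis using assms(4)
  proof (induction k arbitrary: L \<tau> X)
    case 0
    then show ?case by simp
  next
    case (Suc k)
    obtain N f where L: "L = Node N f" and N: "N \<subseteq> V - \<tau>"
      and f: "\<And>v u. v \<in> N \<Longrightarrow> u \<in> \<tau> \<Longrightarrow> tree_shape V k (f v u) (swap_vertex \<tau> v u)"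
      and out: "\<And>v u. \<not> (v \<in> N \<and> u \<in> \<tau>) \<Longrightarrow> f v u = Leaf"
      using Suc.prems(1) by (force split: if_splits)
    have fin: "finite \<tau>" "finite N" using Suc.prems assms(1) N finite_subset by (blast, blast)
    have sw: "swap_vertex \<tau> v u \<subseteq> V" if "v \<in> N" "u \<in> \<tau>" for v u
      using that Suc.prems N by (auto simp: swap_vertex_def)
    define a where "a v u = card (tree_faces (f v u) (swap_vertex \<tau> v u))" for v u
    define b where "b v u = card (tree_nonfaces V (f v u) (swap_vertex \<tau> v u) {u})" for v u
    have "pmf (branching V p (Suc k) \<tau>) L =
       p ^ card N * (1 - p) ^ card (V - \<tau> - N) * (\<Prod>v\<in>N. \<Prod>u\<in>\<tau>. pmf (branching V p k (swap_vertex \<tau> v u)) (f v u))"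
      unfolding L by (rule pmf_branching_Node[OF assms(1,2,3) fin(1) N out])
    also have "\<dots> \<le> p ^ card N * (1 - p) ^ card (V - \<tau> - N) * (\<Prod>v\<in>N. \<Prod>u\<in>\<tau>. p ^ a v u * (1 - p) ^ b v u)"
      unfolding a_def b_def using assms
      by (intro mult_left_mono prod_mono conjI prod_nonneg Suc.IH f sw) auto
    also have "\<dots> = p ^ (card N + (\<Sum>v\<in>N. \<Sum>u\<in>\<tau>. a v u)) * (1 - p) ^ (card (V - \<tau> - N) + (\<Sum>v\<in>N. \<Sum>u\<in>\<tau>. b v u))"
      by (simp add: prod.distrib power_add power_sum)
    also have "\<dots> \<le> p ^ card (tree_faces L \<tau>) * (1 - p) ^ card (tree_nonfaces V L \<tau> X)"
    proof (intro mult_mono power_decreasing)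
      have "card (tree_faces L \<tau>) \<le> card ((\<lambda>v. insert v \<tau>) ` N) + card (\<Union>v\<in>N. \<Union>u\<in>\<tau>. tree_faces (f v u) (swap_vertex \<tau> v u))"
        unfolding L tree_faces.simps by (rule card_Un_le)
      also have "\<dots> \<le> card N + (\<Sum>v\<in>N. card (\<Union>u\<in>\<tau>. tree_faces (f v u) (swap_vertex \<tau> v u)))"
        by (intro add_mono card_image_le card_UN_le fin)
      also have "\<dots> \<le> card N + (\<Sum>v\<in>N. \<Sum>u\<in>\<tau>. a v u)"
        unfolding a_def by (intro add_left_mono sum_mono card_UN_le fin)
      finally show "card (tree_faces L \<tau>) \<le> card N + (\<Sum>v\<in>N. \<Sum>u\<in>\<tau>. a v u)" .
      have "card (tree_nonfaces V L \<tau> X) \<le> card ((\<lambda>v. insert v \<tau>) ` (V - \<tau> - X - N)) + card (\<Union>v\<in>N. \<Union>u\<in>\<tau>. tree_nonfaces V (f v u) (swap_vertex \<tau> v u) {u})"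
        unfolding L tree_nonfaces.simps by (rule card_Un_le)
      also have "\<dots> \<le> card (V - \<tau> - X - N) + (\<Sum>v\<in>N. card (\<Union>u\<in>\<tau>. tree_nonfaces V (f v u) (swap_vertex \<tau> v u) {u}))"
        using assms(1) by (intro add_mono card_image_le card_UN_le fin) auto
      also have "\<dots> \<le> card (V - \<tau> - N) + (\<Sum>v\<in>N. \<Sum>u\<in>\<tau>. b v u)"
        unfolding b_def using assms(1) by (intro add_mono sum_mono card_UN_le fin card_mono) auto
      finally show "card (tree_nonfaces V L \<tau> X) \<le> card (V - \<tau> - N) + (\<Sum>v\<in>N. \<Sum>u\<in>\<tau>. b v u)" .
    qed (use assms in auto)
    finally show ?case .
  qed
qed

text \<open>A fresh tree is found by the exploration at least as often as it is produced by the branching process, since its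
faces and non-faces are disjoint and thus independent. So expectations over fresh trees can be bounded below in
the branching process, where independence is exact.\<close>

lemma pmf_branching_le_explore:
  assumes V: "finite V" and p: "0 \<le> p" "p \<le> 1" and \<tau>: "\<tau> \<subseteq> V" "card \<tau> = d" and fr: "fresh L \<tau> \<tau>"
  shows "pmf (branching V p k \<tau>) L \<le>
    pmf (map_pmf (\<lambda>F. explore V F k \<tau> {}) (random_subset {\<sigma>. \<sigma> \<subseteq> V \<and> card \<sigma> = d + 1} p)) L"
proof (cases "tree_shape V k L \<tau>")
  case False
  then have "pmf (branching V p k \<tau>) L = 0" using set_branching[OF V \<tau>(1), of L p k] by (auto simp: pmf_eq_0_set_pmf)
  then show ?thesis by simp
next
  case True
  let ?A = "{\<sigma>. \<sigma> \<subseteq> V \<and> card \<sigma> = d + 1}"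
  have A: "finite ?A" using V by simp
  have "pmf (branching V p k \<tau>) L \<le> p ^ card (tree_faces L \<tau>) * (1 - p) ^ card (tree_nonfaces V L \<tau> {})"
    by (rule pmf_branching_le[OF V p \<tau>(1)])
  also have "\<dots> = measure_pmf.prob (random_subset ?A p) {F. tree_faces L \<tau> \<subseteq> F \<and> F \<inter> tree_nonfaces V L \<tau> {} = {}}"
    by (rule prob_random_subset[symmetric, OF A p])
       (use tree_sets_dfaces[OF True V \<tau>] tree_faces_nonfaces_disjoint[OF fr, of "{}" V] in auto)
  also have "\<dots> \<le> measure_pmf.prob (random_subset ?A p) {F. explore V F k \<tau> {} = L}"
    by (rule measure_pmf.finite_measure_mono) (auto intro!: explore_eq[OF True fr])
  also have "\<dots> = pmf (map_pmf (\<lambda>F. explore V F k \<tau> {}) (random_subset ?A p)) L"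
    by (simp add: pmf_map vimage_def)
  finally show ?thesis .
qed

section \<open>Approximation of a basis chain along a tree\<close>

lemma energy_pos: "finite \<tau> \<Longrightarrow> \<tau> \<noteq> {} \<Longrightarrow> 0 < energy L \<tau>"
proof (induction L arbitrary: \<tau>)
  case (Node N f)
  have "0 < energy (f v u) (swap_vertex \<tau> v u)" for v u
    by (rule Node.IH) (use Node.prems in \<open>auto simp: swap_vertex_def\<close>)
  then have "0 \<le> (\<Sum>v\<in>N. inverse (\<Sum>u\<in>\<tau>. energy (f v u) (swap_vertex \<tau> v u)))"
    by (intro sum_nonneg) (simp add: sum_nonneg less_imp_le)
  then show ?case by (simp add: add_pos_nonneg)
qed simp

lemma energy_le_1: "finite \<tau> \<Longrightarrow> \<tau> \<noteq> {} \<Longrightarrow> energy L \<tau> \<le> 1"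
proof (cases L)
  case (Node N f)
  assume \<tau>: "finite \<tau>" "\<tau> \<noteq> {}"
  have "0 < energy (f v u) (swap_vertex \<tau> v u)" for v u
    by (rule energy_pos) (use \<tau> in \<open>auto simp: swap_vertex_def\<close>)
  then have "0 \<le> (\<Sum>v\<in>N. inverse (\<Sum>u\<in>\<tau>. energy (f v u) (swap_vertex \<tau> v u)))"
    by (intro sum_nonneg) (simp add: sum_nonneg less_imp_le)
  then show ?thesis using Node by simp
qed simp

text \<open>Up to sign, \<open>\<partial>(insert v \<tau>)\<close> minus the approximations of the other facets of \<open>insert v \<tau>\<close> is \<open>e\<^sub>\<tau>\<close>
plus the residues of these facets. Averaging over \<open>v\<close> with weights \<open>\<alpha> v\<close> leaves \<open>(1 - \<Sum>\<alpha>) e\<^sub>\<tau>\<close> and the weighted residues,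
whose supports are disjoint because the tree is fresh. The weights \<open>\<alpha> v\<close>, proportional to the inverse energies, minimise the
square norm. The statement on the support of the residue keeps the induction going.\<close>

lemma local_approximation:
  assumes "fresh L \<tau> A" "\<tau> \<subseteq> A" "finite A" "\<tau> \<noteq> {}"
  shows "\<exists>w\<in>span (face_boundary ` tree_faces L \<tau>).
    sq_norm (Poly_Mapping.single \<tau> 1 - w) \<le> energy L \<tau> \<and>
    Poly_Mapping.keys (Poly_Mapping.single \<tau> 1 - w) \<subseteq> insert \<tau> {\<rho>. \<rho> \<subseteq> \<tau> \<union> labels L \<tau> \<and> \<rho> \<inter> labels L \<tau> \<noteq> {}}"
  using assms
proof (induction L arbitrary: \<tau> A)
  case Leaf
  then show ?case by (intro bexI[of _ 0]) (auto simp: sq_norm_single span_zero)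
next
  case (Node N f)
  show ?case
  proof (cases "finite N")
    case False
    then show ?thesis by (intro bexI[of _ 0]) (auto simp: sq_norm_single span_zero)
  next
    case finN: True
    let ?s = "swap_vertex \<tau>"
    let ?L = "\<lambda>v u. labels (f v u) (?s v u)"
    have fin: "finite \<tau>" using Node.prems finite_subset by blast
    have NA: "N \<inter> A = {}" and fr: "\<And>v u. v \<in> N \<Longrightarrow> u \<in> \<tau> \<Longrightarrow> fresh (f v u) (?s v u) (A \<union> N)"
      and dj: "\<And>v u v' u'. v \<in> N \<Longrightarrow> u \<in> \<tau> \<Longrightarrow> v' \<in> N \<Longrightarrow> u' \<in> \<tau> \<Longrightarrow> (v, u) \<noteq> (v', u') \<Longrightarrow> ?L v u \<inter> ?L v' u' = {}"
      using Node.prems(1) by auto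
    have La: "?L v u \<inter> (A \<union> N) = {}" if "v \<in> N" "u \<in> \<tau>" for v u
      using labels_fresh[OF fr[OF that]] .
    have \<tau>A: "\<tau> \<subseteq> A" by fact
    define K where "K v u = insert (?s v u) {\<rho>. \<rho> \<subseteq> ?s v u \<union> ?L v u \<and> \<rho> \<inter> ?L v u \<noteq> {}}" for v u
    have "\<exists>w. w \<in> span (face_boundary ` tree_faces (f v u) (?s v u)) \<and>
      sq_norm (Poly_Mapping.single (?s v u) 1 - w) \<le> energy (f v u) (?s v u) \<and>
      Poly_Mapping.keys (Poly_Mapping.single (?s v u) 1 - w) \<subseteq> K v u" if "v \<in> N" "u \<in> \<tau>" for v u
    proof -
      have "?s v u \<subseteq> A \<union> N" "?s v u \<noteq> {}" using that \<tau>A by (auto simp: swap_vertex_def)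
      then show ?thesis
        using Node.IH[of "f v" "f v u" "?s v u" "A \<union> N"] fr[OF that] Node.prems(3) finN
        unfolding K_def by blast
    qed
    then obtain w where w: "\<And>v u. v \<in> N \<Longrightarrow> u \<in> \<tau> \<Longrightarrow> w v u \<in> span (face_boundary ` tree_faces (f v u) (?s v u))"
      and we: "\<And>v u. v \<in> N \<Longrightarrow> u \<in> \<tau> \<Longrightarrow> sq_norm (Poly_Mapping.single (?s v u) 1 - w v u) \<le> energy (f v u) (?s v u)"
      and wk: "\<And>v u. v \<in> N \<Longrightarrow> u \<in> \<tau> \<Longrightarrow> Poly_Mapping.keys (Poly_Mapping.single (?s v u) 1 - w v u) \<subseteq> K v u"
      by metis
    define r where "r v u = Poly_Mapping.single (?s v u) 1 - w v u" for v u
    \<comment> \<open>A set in two of the supports would meet the labels of neither branch, thus be one of the facets \<open>swap_vertex \<tau> v u\<close> itself, which determines \<open>v\<close> and \<open>u\<close>.\<close>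
    have K_disj: "K v u \<inter> K v' u' = {}" if "v \<in> N" "u \<in> \<tau>" "v' \<in> N" "u' \<in> \<tau>" "(v, u) \<noteq> (v', u')" for v u v' u'
    proof (rule ccontr)
      assume "K v u \<inter> K v' u' \<noteq> {}"
      then obtain \<rho> where \<rho>: "\<rho> \<in> K v u" "\<rho> \<in> K v' u'" by auto
      have no: "\<rho> \<inter> ?L a b = {}" if "a \<in> N" "b \<in> \<tau>" "a' \<in> N" "b' \<in> \<tau>" "(a, b) \<noteq> (a', b')" "\<rho> \<in> K a' b'" for a b a' b'
      proof -
        have "\<rho> \<subseteq> ?s a' b' \<union> ?L a' b'" using that(6) by (auto simp: K_def)
        moreover have "?s a' b' \<subseteq> A \<union> N" using that \<tau>A by (auto simp: swap_vertex_def)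
        ultimately show ?thesis using La[OF that(1,2)] dj[OF that(1-5)] by blast
      qed
      have "\<rho> = ?s v u" using \<rho>(1) no[OF that \<rho>(2)] by (auto simp: K_def)
      moreover have "\<rho> = ?s v' u'" using \<rho>(2) no[OF that(3,4,1,2) _ \<rho>(1)] that(5) by (auto simp: K_def)
      ultimately have eq: "insert v (\<tau> - {u}) = insert v' (\<tau> - {u'})" by (simp add: swap_vertex_def)
      have nv: "v \<notin> \<tau>" "v' \<notin> \<tau>" using that NA \<tau>A by auto
      have vv: "v = v'" using eq nv by auto
      have "\<tau> - {u} = \<tau> - {u'}" using eq nv unfolding vv by (metis Diff_iff insert_ident)
      then have "u = u'" using that(2,4) by blast
      moreover note vv
      ultimately show False using that by simp
    qed
    have \<tau>_K: "\<tau> \<notin> K v u" if "v \<in> N" "u \<in> \<tau>" for v u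
    proof -
      have "v \<notin> \<tau>" using that NA \<tau>A by auto
      moreover have "\<tau> \<inter> ?L v u = {}" using La[OF that] \<tau>A by auto
      ultimately show ?thesis by (auto simp: K_def swap_vertex_def)
    qed
    have rK: "Poly_Mapping.keys (r v u) \<subseteq> K v u" if "v \<in> N" "u \<in> \<tau>" for v u
      using wk[OF that] by (simp add: r_def)
    define X where "X v = (\<Sum>u\<in>\<tau>. energy (f v u) (?s v u))" for v
    have Xpos: "X v > 0" for v
      unfolding X_def by (intro sum_pos energy_pos) (use fin Node.prems in \<open>auto simp: swap_vertex_def\<close>)
    define S where "S = (\<Sum>v\<in>N. inverse (X v))"
    have S0: "S \<ge> 0" unfolding S_def using Xpos by (intro sum_nonneg) (simp add: less_imp_le)
    \<comment> \<open>the minimiser of \<open>(1 - \<Sum>\<alpha>)^2 + \<Sum>v. (\<alpha> v)^2 * X v\<close>\<close>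
    define \<alpha> where "\<alpha> v = inverse (X v) / (1 + S)" for v
    define sg where "sg v = face_sign (insert v \<tau>) v" for v
    define sh where "sh v u = face_sign (insert v \<tau>) u" for v u
    have fb: "face_boundary (insert v \<tau>) = sg v *\<^sub>R Poly_Mapping.single \<tau> 1 + (\<Sum>u\<in>\<tau>. sh v u *\<^sub>R Poly_Mapping.single (?s v u) 1)"
      if "v \<in> N" for v
    proof -
      have nv: "v \<notin> \<tau>" using that NA \<tau>A by auto
      have sc: "Poly_Mapping.single a b = b *\<^sub>R Poly_Mapping.single a (1::real)" for a :: "nat set" and b
        by (intro poly_mapping_eqI) (simp add: lookup_single when_def)
      have "face_boundary (insert v \<tau>) = Poly_Mapping.single (insert v \<tau> - {v}) (sg v) +
        (\<Sum>u\<in>\<tau>. Poly_Mapping.single (insert v \<tau> - {u}) (sh v u))"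
        using fin nv by (simp add: face_boundary_sum sg_def sh_def)
      also have "insert v \<tau> - {v} = \<tau>" using nv by auto
      also have "(\<Sum>u\<in>\<tau>. Poly_Mapping.single (insert v \<tau> - {u}) (sh v u)) = (\<Sum>u\<in>\<tau>. Poly_Mapping.single (?s v u) (sh v u))"
        using nv by (intro sum.cong refl arg_cong2[where f = Poly_Mapping.single]) (auto simp: swap_vertex_def)
      finally show ?thesis by (subst (asm) (1 2) sc)
    qed
    \<comment> \<open>boundaries whose coefficient at \<open>\<tau>\<close> is normalised to \<open>1\<close>\<close>
    define g where "g v = sg v *\<^sub>R (face_boundary (insert v \<tau>) - (\<Sum>u\<in>\<tau>. sh v u *\<^sub>R w v u))" for v
    have g_eq: "g v = Poly_Mapping.single \<tau> 1 + (\<Sum>u\<in>\<tau>. (sg v * sh v u) *\<^sub>R r v u)" if "v \<in> N" for v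
    proof -
      have "face_boundary (insert v \<tau>) - (\<Sum>u\<in>\<tau>. sh v u *\<^sub>R w v u) = sg v *\<^sub>R Poly_Mapping.single \<tau> 1 + (\<Sum>u\<in>\<tau>. sh v u *\<^sub>R r v u)"
        unfolding fb[OF that] r_def by (simp add: scaleR_diff_right sum_subtractf)
      moreover have "sg v * sg v = 1" using face_sign_sq[of "insert v \<tau>" v] by (simp add: sg_def power2_eq_square)
      ultimately show ?thesis unfolding g_def by (simp add: scaleR_add_right scaleR_sum_right)
    qed
    define W where "W = (\<Sum>v\<in>N. \<alpha> v *\<^sub>R g v)"
    define R where "R v = (\<Sum>u\<in>\<tau>. (sg v * sh v u) *\<^sub>R r v u)" for v
    have res: "Poly_Mapping.single \<tau> 1 - W = (1 - sum \<alpha> N) *\<^sub>R Poly_Mapping.single \<tau> 1 + (\<Sum>v\<in>N. (- \<alpha> v) *\<^sub>R R v)"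
    proof -
      have "W = (\<Sum>v\<in>N. \<alpha> v *\<^sub>R Poly_Mapping.single \<tau> 1 + \<alpha> v *\<^sub>R R v)"
        unfolding W_def R_def by (intro sum.cong refl) (simp add: g_eq scaleR_add_right)
      then show ?thesis by (simp add: sum.distrib scaleR_diff_left scaleR_sum_left sum_negf)
    qed
    have keys_R: "Poly_Mapping.keys (R v) \<subseteq> (\<Union>u\<in>\<tau>. K v u)" if "v \<in> N" for v
    proof -
      have "Poly_Mapping.keys (R v) \<subseteq> (\<Union>u\<in>\<tau>. Poly_Mapping.keys ((sg v * sh v u) *\<^sub>R r v u))"
        unfolding R_def by (rule keys_sum)
      also have "\<dots> \<subseteq> (\<Union>u\<in>\<tau>. K v u)" using that by (intro UN_mono order.trans[OF keys_scaleR rK] order_refl)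
      finally show ?thesis .
    qed
    have sq_R: "sq_norm (R v) \<le> X v" if "v \<in> N" for v
    proof -
      have "sq_norm (R v) = (\<Sum>u\<in>\<tau>. sq_norm ((sg v * sh v u) *\<^sub>R r v u))"
        unfolding R_def
      proof (rule sq_norm_sum_disjoint[OF fin])
        fix i j assume ij: "i \<in> \<tau>" "j \<in> \<tau>" "i \<noteq> j"
        have "K v i \<inter> K v j = {}" by (rule K_disj) (use that ij in auto)
        then show "Poly_Mapping.keys ((sg v * sh v i) *\<^sub>R r v i) \<inter> Poly_Mapping.keys ((sg v * sh v j) *\<^sub>R r v j) = {}"
          using keys_scaleR[of _ "r v i"] keys_scaleR[of _ "r v j"] rK[OF that ij(1)] rK[OF that ij(2)] by blast
      qed
      also have "\<dots> = (\<Sum>u\<in>\<tau>. sq_norm (r v u))"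
        by (simp add: sq_norm_scaleR power_mult_distrib sg_def sh_def)
      also have "\<dots> \<le> X v" unfolding X_def r_def by (intro sum_mono we that)
      finally show ?thesis .
    qed
    have keys_tail: "Poly_Mapping.keys (\<Sum>v\<in>N. (- \<alpha> v) *\<^sub>R R v) \<subseteq> (\<Union>v\<in>N. \<Union>u\<in>\<tau>. K v u)"
    proof -
      have "Poly_Mapping.keys (\<Sum>v\<in>N. (- \<alpha> v) *\<^sub>R R v) \<subseteq> (\<Union>v\<in>N. Poly_Mapping.keys ((- \<alpha> v) *\<^sub>R R v))"
        by (rule keys_sum)
      also have "\<dots> \<subseteq> (\<Union>v\<in>N. \<Union>u\<in>\<tau>. K v u)" by (intro UN_mono order.trans[OF keys_scaleR keys_R] order_refl)
      finally show ?thesis .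
    qed
    have "sq_norm (Poly_Mapping.single \<tau> 1 - W) = (1 - sum \<alpha> N)\<^sup>2 + sq_norm (\<Sum>v\<in>N. (- \<alpha> v) *\<^sub>R R v)"
    proof -
      have "Poly_Mapping.keys ((1 - sum \<alpha> N) *\<^sub>R Poly_Mapping.single \<tau> (1::real)) \<subseteq> {\<tau>}"
        using keys_scaleR[of "1 - sum \<alpha> N" "Poly_Mapping.single \<tau> (1::real)"] by simp
      then have "Poly_Mapping.keys ((1 - sum \<alpha> N) *\<^sub>R Poly_Mapping.single \<tau> (1::real)) \<inter> Poly_Mapping.keys (\<Sum>v\<in>N. (- \<alpha> v) *\<^sub>R R v) = {}"
        using keys_tail \<tau>_K by blast
      then show ?thesis unfolding res by (simp add: sq_norm_add_disjoint sq_norm_scaleR sq_norm_single)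
    qed
    also have "sq_norm (\<Sum>v\<in>N. (- \<alpha> v) *\<^sub>R R v) = (\<Sum>v\<in>N. sq_norm ((- \<alpha> v) *\<^sub>R R v))"
    proof (rule sq_norm_sum_disjoint[OF finN])
      fix i j assume ij: "i \<in> N" "j \<in> N" "i \<noteq> j"
      have "K i u \<inter> K j u' = {}" if "u \<in> \<tau>" "u' \<in> \<tau>" for u u'
        by (rule K_disj) (use ij that in auto)
      then have "(\<Union>u\<in>\<tau>. K i u) \<inter> (\<Union>u\<in>\<tau>. K j u) = {}" by blast
      moreover have "Poly_Mapping.keys ((- \<alpha> i) *\<^sub>R R i) \<subseteq> (\<Union>u\<in>\<tau>. K i u)"
        by (rule order.trans[OF keys_scaleR keys_R[OF ij(1)]])
      moreover have "Poly_Mapping.keys ((- \<alpha> j) *\<^sub>R R j) \<subseteq> (\<Union>u\<in>\<tau>. K j u)"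
        by (rule order.trans[OF keys_scaleR keys_R[OF ij(2)]])
      ultimately show "Poly_Mapping.keys ((- \<alpha> i) *\<^sub>R R i) \<inter> Poly_Mapping.keys ((- \<alpha> j) *\<^sub>R R j) = {}"
        by blast
    qed
    also have "\<dots> \<le> (\<Sum>v\<in>N. (\<alpha> v)\<^sup>2 * X v)"
      unfolding sq_norm_scaleR by (intro sum_mono) (auto intro!: mult_left_mono sq_R)
    also have "(\<Sum>v\<in>N. (\<alpha> v)\<^sup>2 * X v) = S / (1 + S)\<^sup>2"
      unfolding S_def[of] \<alpha>_def sum_divide_distrib
    proof (intro sum.cong refl)
      fix v show "(inverse (X v) / (1 + (\<Sum>v\<in>N. inverse (X v))))\<^sup>2 * X v = inverse (X v) / (1 + (\<Sum>v\<in>N. inverse (X v)))\<^sup>2"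
        using Xpos[of v] by (simp add: power_divide power2_eq_square)
    qed
    also have "(1 - sum \<alpha> N)\<^sup>2 = 1 / (1 + S)\<^sup>2"
    proof -
      have "sum \<alpha> N = S / (1 + S)" by (simp add: \<alpha>_def S_def sum_divide_distrib)
      then have "1 - sum \<alpha> N = 1 / (1 + S)" using S0 by (simp add: field_simps)
      then show ?thesis by (simp add: power_divide)
    qed
    also have "1 / (1 + S)\<^sup>2 + S / (1 + S)\<^sup>2 = 1 / (1 + S)"
      using S0 by (simp add: add_divide_distrib[symmetric] power2_eq_square)
    finally have sq: "sq_norm (Poly_Mapping.single \<tau> 1 - W) \<le> energy (Node N f) \<tau>"
      by (simp add: S_def X_def)
    have keys: "Poly_Mapping.keys (Poly_Mapping.single \<tau> 1 - W) \<subseteq>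
      insert \<tau> {\<rho>. \<rho> \<subseteq> \<tau> \<union> labels (Node N f) \<tau> \<and> \<rho> \<inter> labels (Node N f) \<tau> \<noteq> {}}"
    proof
      fix \<rho> assume "\<rho> \<in> Poly_Mapping.keys (Poly_Mapping.single \<tau> 1 - W)"
      then have "\<rho> \<in> Poly_Mapping.keys ((1 - sum \<alpha> N) *\<^sub>R Poly_Mapping.single \<tau> (1::real)) \<union> Poly_Mapping.keys (\<Sum>v\<in>N. (- \<alpha> v) *\<^sub>R R v)"
        unfolding res by (rule subsetD[OF Poly_Mapping.keys_add])
      then have "\<rho> = \<tau> \<or> (\<exists>v\<in>N. \<exists>u\<in>\<tau>. \<rho> \<in> K v u)"
        using keys_tail keys_scaleR[of "1 - sum \<alpha> N" "Poly_Mapping.single \<tau> (1::real)"] by auto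
      then show "\<rho> \<in> insert \<tau> {\<rho>. \<rho> \<subseteq> \<tau> \<union> labels (Node N f) \<tau> \<and> \<rho> \<inter> labels (Node N f) \<tau> \<noteq> {}}"
      proof
        assume "\<exists>v\<in>N. \<exists>u\<in>\<tau>. \<rho> \<in> K v u"
        then obtain v u where vu: "v \<in> N" "u \<in> \<tau>" "\<rho> \<in> K v u" by blast
        then consider "\<rho> = ?s v u" | "\<rho> \<subseteq> ?s v u \<union> ?L v u" "\<rho> \<inter> ?L v u \<noteq> {}" by (auto simp: K_def)
        then show ?thesis
        proof cases
          case 1
          then show ?thesis using vu by (auto simp: swap_vertex_def)
        next
          case 2
          moreover have "?L v u \<subseteq> labels (Node N f) \<tau>" using vu by auto
          moreover have "?s v u \<subseteq> \<tau> \<union> labels (Node N f) \<tau>" using vu by (auto simp: swap_vertex_def)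
          ultimately show ?thesis by blast
        qed
      qed simp
    qed
    have "W \<in> span (face_boundary ` tree_faces (Node N f) \<tau>)"
    proof -
      let ?S = "span (face_boundary ` tree_faces (Node N f) \<tau>)"
      have a: "face_boundary (insert v \<tau>) \<in> ?S" if "v \<in> N" for v using that by (intro span_base) auto
      have b: "w v u \<in> ?S" if "v \<in> N" "u \<in> \<tau>" for v u
      proof -
        have "face_boundary ` tree_faces (f v u) (?s v u) \<subseteq> face_boundary ` tree_faces (Node N f) \<tau>"
          using that by (intro image_mono) auto
        from span_mono[OF this] show ?thesis using w[OF that] by blast
      qed
      show ?thesis unfolding W_def g_def
        by (intro span_sum span_scale span_diff a b) auto
    qed
    then show ?thesis by (rule bexI[rotated]) (intro conjI sq keys)
  qed
qed

lemma map_sum_Pi_pmf: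
  fixes g :: "'i \<Rightarrow> 'b \<Rightarrow> real"
  assumes "finite I" "\<And>i. i \<in> I \<Longrightarrow> map_pmf (g i) (P i) = \<xi>"
  shows "map_pmf (\<lambda>f. \<Sum>i\<in>I. g i (f i)) (Pi_pmf I dflt P) = iid_sum (card I) \<xi>"
  using assms
proof (induction I)
  case (insert i I)
  have "map_pmf (\<lambda>f. \<Sum>i\<in>insert i I. g i (f i)) (Pi_pmf (insert i I) dflt P) =
     bind_pmf (P i) (\<lambda>y. map_pmf (\<lambda>f. \<Sum>j\<in>insert i I. g j ((f(i := y)) j)) (Pi_pmf I dflt P))"
    using insert.hyps by (simp add: Pi_pmf_insert' map_bind_pmf map_pmf_def bind_assoc_pmf bind_return_pmf)
  also have "\<dots> = bind_pmf (P i) (\<lambda>y. map_pmf ((+) (g i y)) (map_pmf (\<lambda>f. \<Sum>j\<in>I. g j (f j)) (Pi_pmf I dflt P)))"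
  proof -
    have "(\<Sum>j\<in>insert i I. g j ((f(i := y)) j)) = g i y + (\<Sum>j\<in>I. g j (f j))" for f y
    proof -
      have "(\<Sum>j\<in>I. g j ((f(i := y)) j)) = (\<Sum>j\<in>I. g j (f j))"
        using insert.hyps by (intro sum.cong) auto
      then show ?thesis using insert.hyps by simp
    qed
    then show ?thesis by (simp add: pmf.map_comp o_def)
  qed
  also have "\<dots> = bind_pmf (map_pmf (g i) (P i)) (\<lambda>y. map_pmf ((+) y) (iid_sum (card I) \<xi>))"
  proof -
    have IH: "map_pmf (\<lambda>f. \<Sum>j\<in>I. g j (f j)) (Pi_pmf I dflt P) = iid_sum (card I) \<xi>"
      using insert by simp
    show ?thesis unfolding IH bind_map_pmf ..
  qed
  also have "map_pmf (g i) (P i) = \<xi>" using insert.prems by simp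
  finally show ?case using insert.hyps by simp
qed simp

text \<open>The children of the branching process are independent, with residues distributed alike; their number is binomial.\<close>

lemma energy_branching:
  assumes "finite V" "0 \<le> p" "p \<le> 1" "\<tau> \<subseteq> V" "card \<tau> = d" "d > 0"
  shows "map_pmf (\<lambda>L. energy L \<tau>) (branching V p k \<tau>) = cavity (binomial_pmf (card V - d) p) d k"
  using assms(4,5)
proof (induction k arbitrary: \<tau>)
  case (Suc k)
  have fin: "finite \<tau>" using Suc.prems assms(1) finite_subset by blast
  let ?\<mu> = "cavity (binomial_pmf (card V - d) p) d k"
  let ?Q = "\<lambda>N. Pi_pmf N (\<lambda>_. Leaf) (\<lambda>v. Pi_pmf \<tau> Leaf (\<lambda>u. branching V p k (swap_vertex \<tau> v u)))"
  have "map_pmf (\<lambda>L. energy L \<tau>) (branching V p (Suc k) \<tau>) =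
    bind_pmf (random_subset (V - \<tau>) p) (\<lambda>N. map_pmf (\<lambda>s. 1 / (1 + s))
      (map_pmf (\<lambda>f. \<Sum>v\<in>N. inverse (\<Sum>u\<in>\<tau>. energy (f v u) (swap_vertex \<tau> v u))) (?Q N)))"
    by (simp add: map_bind_pmf pmf.map_comp o_def)
  also have "\<dots> = bind_pmf (random_subset (V - \<tau>) p) (\<lambda>N. map_pmf (\<lambda>s. 1 / (1 + s))
      (iid_sum (card N) (map_pmf inverse (iid_sum d ?\<mu>))))"
  proof (intro bind_pmf_cong refl arg_cong[where f = "map_pmf _"])
    fix N assume "N \<in> set_pmf (random_subset (V - \<tau>) p)"
    then have N: "N \<subseteq> V - \<tau>" using set_random_subset by fastforce
    then have finN: "finite N" using assms(1) finite_subset by blast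
    show "map_pmf (\<lambda>f. \<Sum>v\<in>N. inverse (\<Sum>u\<in>\<tau>. energy (f v u) (swap_vertex \<tau> v u))) (?Q N) =
      iid_sum (card N) (map_pmf inverse (iid_sum d ?\<mu>))"
    proof (rule map_sum_Pi_pmf[OF finN, where g = "\<lambda>v h. inverse (\<Sum>u\<in>\<tau>. energy (h u) (swap_vertex \<tau> v u))"])
      fix v assume v: "v \<in> N"
      have "map_pmf (\<lambda>h. \<Sum>u\<in>\<tau>. energy (h u) (swap_vertex \<tau> v u)) (Pi_pmf \<tau> Leaf (\<lambda>u. branching V p k (swap_vertex \<tau> v u))) = iid_sum (card \<tau>) ?\<mu>"
      proof (rule map_sum_Pi_pmf[OF fin, where g = "\<lambda>u L. energy L (swap_vertex \<tau> v u)"])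
        fix u assume u: "u \<in> \<tau>"
        show "map_pmf (\<lambda>L. energy L (swap_vertex \<tau> v u)) (branching V p k (swap_vertex \<tau> v u)) = ?\<mu>"
          by (rule Suc.IH) (use u v N Suc.prems fin in \<open>auto simp: card_swap_vertex, auto simp: swap_vertex_def\<close>)
      qed
      then have "map_pmf inverse (map_pmf (\<lambda>h. \<Sum>u\<in>\<tau>. energy (h u) (swap_vertex \<tau> v u)) (Pi_pmf \<tau> Leaf (\<lambda>u. branching V p k (swap_vertex \<tau> v u)))) = map_pmf inverse (iid_sum d ?\<mu>)"
        using Suc.prems by simp
      then show "map_pmf (\<lambda>h. inverse (\<Sum>u\<in>\<tau>. energy (h u) (swap_vertex \<tau> v u))) (Pi_pmf \<tau> Leaf (\<lambda>u. branching V p k (swap_vertex \<tau> v u))) = map_pmf inverse (iid_sum d ?\<mu>)"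
        by (simp add: pmf.map_comp o_def)
    qed
  qed
  also have "\<dots> = map_pmf (\<lambda>s. 1 / (1 + s)) (bind_pmf (map_pmf card (random_subset (V - \<tau>) p)) (\<lambda>m. iid_sum m (map_pmf inverse (iid_sum d ?\<mu>))))"
    by (simp add: map_bind_pmf bind_map_pmf)
  also have "map_pmf card (random_subset (V - \<tau>) p) = binomial_pmf (card V - d) p"
    using map_card_random_subset[of "V - \<tau>" p] assms Suc.prems fin by (simp add: card_Diff_subset)
  finally show ?case by (simp add: compound_sum_def)
qed simp

section \<open>Degenerate trees are rare\<close>

definition child_pmf :: "nat set \<Rightarrow> real \<Rightarrow> nat \<Rightarrow> nat set \<Rightarrow> nat set \<Rightarrow> (nat \<Rightarrow> nat \<Rightarrow> etree) pmf" where
  "child_pmf V p k \<tau> N = Pi_pmf N (\<lambda>_. Leaf) (\<lambda>v. Pi_pmf \<tau> Leaf (\<lambda>u. branching V p k (swap_vertex \<tau> v u)))"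

lemma branching_Suc: "branching V p (Suc k) \<tau> = bind_pmf (random_subset (V - \<tau>) p) (\<lambda>N. map_pmf (Node N) (child_pmf V p k \<tau> N))"
  by (simp add: child_pmf_def)

lemma prob_child:
  assumes "finite N" "finite \<tau>" "v \<in> N" "u \<in> \<tau>"
  shows "measure_pmf.prob (child_pmf V p k \<tau> N) {f. P (f v u)} = measure_pmf.prob (branching V p k (swap_vertex \<tau> v u)) {L. P L}"
proof -
  have "map_pmf (\<lambda>f. f v u) (child_pmf V p k \<tau> N) = map_pmf (\<lambda>h. h u) (map_pmf (\<lambda>f. f v) (child_pmf V p k \<tau> N))"
    by (simp add: pmf.map_comp o_def)
  also have "\<dots> = branching V p k (swap_vertex \<tau> v u)"
    using assms by (simp add: child_pmf_def Pi_pmf_component)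
  finally have "measure_pmf.prob (branching V p k (swap_vertex \<tau> v u)) {L. P L} =
    measure_pmf.prob (map_pmf (\<lambda>f. f v u) (child_pmf V p k \<tau> N)) {L. P L}" by simp
  then show ?thesis by (simp add: vimage_def)
qed

lemma prob_two_children:
  assumes "finite N" "finite \<tau>" "v \<in> N" "u \<in> \<tau>" "v' \<in> N" "u' \<in> \<tau>" "(v, u) \<noteq> (v', u')"
  shows "measure_pmf.prob (child_pmf V p k \<tau> N) {f. P (f v u) \<and> Q (f v' u')} =
    measure_pmf.prob (branching V p k (swap_vertex \<tau> v u)) {L. P L} * measure_pmf.prob (branching V p k (swap_vertex \<tau> v' u')) {L. Q L}"
proof (cases "v = v'")
  case False
  define B where "B w = (if w = v then {h. P (h u)} else if w = v' then {h. Q (h u')} else UNIV)" for w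
  define g where "g w = measure_pmf.prob (Pi_pmf \<tau> Leaf (\<lambda>u. branching V p k (swap_vertex \<tau> w u))) (B w)" for w
  have "{f. P (f v u) \<and> Q (f v' u')} = Pi N B" using assms False by (auto simp: B_def Pi_def)
  then have "measure_pmf.prob (child_pmf V p k \<tau> N) {f. P (f v u) \<and> Q (f v' u')} = (\<Prod>w\<in>N. g w)"
    unfolding child_pmf_def g_def by (simp add: measure_Pi_pmf_Pi[OF assms(1)])
  also have "\<dots> = (\<Prod>w\<in>{v, v'}. g w)"
    by (rule prod.mono_neutral_right) (use assms in \<open>auto simp: g_def B_def\<close>)
  also have "\<dots> = g v * g v'" using False by simp
  also have "g v = measure_pmf.prob (map_pmf (\<lambda>h. h u) (Pi_pmf \<tau> Leaf (\<lambda>u. branching V p k (swap_vertex \<tau> v u)))) {L. P L}"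
    by (simp add: g_def B_def vimage_def)
  also have "\<dots> = measure_pmf.prob (branching V p k (swap_vertex \<tau> v u)) {L. P L}"
    using assms by (subst Pi_pmf_component) auto
  also have "g v' = measure_pmf.prob (map_pmf (\<lambda>h. h u') (Pi_pmf \<tau> Leaf (\<lambda>u. branching V p k (swap_vertex \<tau> v' u)))) {L. Q L}"
    using False by (simp add: g_def B_def vimage_def)
  also have "\<dots> = measure_pmf.prob (branching V p k (swap_vertex \<tau> v' u')) {L. Q L}"
    using assms by (subst Pi_pmf_component) auto
  finally show ?thesis .
next
  case True
  then have u: "u \<noteq> u'" using assms by simp
  define B where "B w = (if w = u then {L. P L} else if w = u' then {L. Q L} else UNIV)" for w
  define g where "g w = measure_pmf.prob (branching V p k (swap_vertex \<tau> v w)) (B w)" for w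
  have "measure_pmf.prob (child_pmf V p k \<tau> N) {f. P (f v u) \<and> Q (f v' u')} =
    measure_pmf.prob (map_pmf (\<lambda>f. f v) (child_pmf V p k \<tau> N)) {h. P (h u) \<and> Q (h u')}"
    using True by (simp add: vimage_def)
  also have "map_pmf (\<lambda>f. f v) (child_pmf V p k \<tau> N) = Pi_pmf \<tau> Leaf (\<lambda>u. branching V p k (swap_vertex \<tau> v u))"
    using assms by (simp add: child_pmf_def Pi_pmf_component)
  also have "{h. P (h u) \<and> Q (h u')} = Pi \<tau> B" using assms u by (auto simp: B_def Pi_def)
  also have "measure_pmf.prob (Pi_pmf \<tau> Leaf (\<lambda>u. branching V p k (swap_vertex \<tau> v u))) \<dots> = (\<Prod>w\<in>\<tau>. g w)"
    unfolding g_def by (rule measure_Pi_pmf_Pi[OF assms(2)])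
  also have "\<dots> = (\<Prod>w\<in>{u, u'}. g w)"
    by (rule prod.mono_neutral_right) (use assms in \<open>auto simp: g_def B_def\<close>)
  also have "\<dots> = g u * g u'" using u by simp
  finally show ?thesis using u True by (simp add: g_def B_def)
qed

lemma tree_shape_labels: "tree_shape V k L \<tau> \<Longrightarrow> labels L \<tau> \<subseteq> V"
proof (induction k arbitrary: L \<tau>)
  case (Suc k)
  obtain N f where L: "L = Node N f" and N: "N \<subseteq> V - \<tau>"
    and f: "\<And>v u. v \<in> N \<Longrightarrow> u \<in> \<tau> \<Longrightarrow> tree_shape V k (f v u) (swap_vertex \<tau> v u)"
    using Suc.prems(1) by (force split: if_splits)
  have "labels (f v u) (swap_vertex \<tau> v u) \<subseteq> V" if "v \<in> N" "u \<in> \<tau>" for v u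
    by (rule Suc.IH[OF f[OF that]])
  then show ?case using N by (auto simp: L)
qed simp

lemma nn_integral_random_subset_bounds:
  assumes "finite V" "0 \<le> p" "p \<le> 1" "real (card V) * p \<le> c" "c \<ge> 0"
  shows "(\<integral>\<^sup>+N. ennreal (real (card N)) \<partial>random_subset (V - \<tau>) p) \<le> ennreal c"
    and "(\<integral>\<^sup>+N. ennreal ((real (card N))\<^sup>2) \<partial>random_subset (V - \<tau>) p) \<le> ennreal (c + c\<^sup>2)"
proof -
  have fin: "finite (V - \<tau>)" using assms by simp
  have "real (card (V - \<tau>)) * p \<le> real (card V) * p"
    using assms by (intro mult_right_mono) (auto intro!: card_mono)
  then have le: "real (card (V - \<tau>)) * p \<le> c" using assms by simp
  show "(\<integral>\<^sup>+N. ennreal (real (card N)) \<partial>random_subset (V - \<tau>) p) \<le> ennreal c"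
    using nn_integral_card_random_subset[OF fin assms(2,3)] le
    by (simp add: ennreal_of_nat_eq_real_of_nat ennreal_leI)
  have sq: "(real (card (V - \<tau>)) * p)\<^sup>2 \<le> c\<^sup>2" using le assms by (intro power_mono) auto
  have "(\<integral>\<^sup>+N. ennreal ((real (card N))\<^sup>2) \<partial>random_subset (V - \<tau>) p) = (\<integral>\<^sup>+N. (of_nat (card N))\<^sup>2 \<partial>random_subset (V - \<tau>) p)"
    by (intro nn_integral_cong) (simp add: ennreal_of_nat_eq_real_of_nat ennreal_power)
  also have "\<dots> \<le> ennreal (c + c\<^sup>2)"
    using nn_integral_card_sq_random_subset[OF fin assms(2,3)] le sq by (elim order_trans) (intro ennreal_leI, simp)
  finally show "(\<integral>\<^sup>+N. ennreal ((real (card N))\<^sup>2) \<partial>random_subset (V - \<tau>) p) \<le> ennreal (c + c\<^sup>2)" .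
qed

lemma prob_random_subset_meets:
  assumes "finite B" "0 \<le> p" "p \<le> 1" "finite A"
  shows "measure_pmf.prob (random_subset B p) {N. N \<inter> A \<noteq> {}} \<le> real (card A) * p"
proof -
  have "measure_pmf.prob (random_subset B p) {N. N \<inter> A \<noteq> {}} \<le> measure_pmf.prob (random_subset B p) (\<Union>a\<in>A. {N. {a} \<subseteq> N})"
    by (rule measure_pmf.finite_measure_mono) auto
  also have "\<dots> \<le> (\<Sum>a\<in>A. measure_pmf.prob (random_subset B p) {N. {a} \<subseteq> N})"
    by (rule measure_pmf.finite_measure_subadditive_finite) (use assms in auto)
  also have "\<dots> \<le> (\<Sum>a\<in>A. p ^ card {a})"
    by (intro sum_mono prob_random_subset_superset_le assms) auto
  finally show ?thesis by simp
qed

text \<open>By a union bound over the children: on average a node has at most \<open>c\<close> of them, each of which is \<open>a\<close> with probability at most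
\<open>p\<close> or carries \<open>d\<close> subtrees that contain \<open>a\<close> with probability of order \<open>p\<close>.\<close>

lemma prob_label_le:
  assumes c: "c \<ge> 0"
  shows "\<exists>D\<ge>0. \<forall>V p \<tau> a. finite V \<longrightarrow> 0 \<le> p \<longrightarrow> p \<le> 1 \<longrightarrow> real (card V) * p \<le> c \<longrightarrow> \<tau> \<subseteq> V \<longrightarrow> card \<tau> = d \<longrightarrow>
    measure_pmf.prob (branching V p k \<tau>) {L. a \<in> labels L \<tau>} \<le> D * p"
proof (induction k)
  case 0
  then show ?case by (intro exI[of _ 0]) simp
next
  case (Suc k)
  then obtain D where D: "D \<ge> 0" and IH: "\<And>V p \<tau> a. finite V \<Longrightarrow> 0 \<le> p \<Longrightarrow> p \<le> 1 \<Longrightarrow> real (card V) * p \<le> c \<Longrightarrow> \<tau> \<subseteq> V \<Longrightarrow> card \<tau> = d \<Longrightarrow>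
    measure_pmf.prob (branching V p k \<tau>) {L. a \<in> labels L \<tau>} \<le> D * p" by blast
  have "measure_pmf.prob (branching V p (Suc k) \<tau>) {L. a \<in> labels L \<tau>} \<le> (1 + c * (real d * D)) * p"
    if V: "finite V" and p: "0 \<le> p" "p \<le> 1" and n: "real (card V) * p \<le> c" and \<tau>: "\<tau> \<subseteq> V" "card \<tau> = d" for V p \<tau> a
  proof -
    have fin: "finite \<tau>" using V \<tau> finite_subset by blast
    have "ennreal (measure_pmf.prob (branching V p (Suc k) \<tau>) {L. a \<in> labels L \<tau>}) =
      (\<integral>\<^sup>+N. ennreal (measure_pmf.prob (child_pmf V p k \<tau> N) {f. a \<in> labels (Node N f) \<tau>}) \<partial>random_subset (V - \<tau>) p)"
      unfolding branching_Suc prob_bind_pmf by (simp add: vimage_def)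
    also have "\<dots> \<le> (\<integral>\<^sup>+N. indicator {N. N \<inter> {a} \<noteq> {}} N + ennreal (real (card N)) * ennreal (real d * (D * p)) \<partial>random_subset (V - \<tau>) p)"
    proof (intro nn_integral_mono_AE AE_pmfI)
      fix N assume "N \<in> set_pmf (random_subset (V - \<tau>) p)"
      then have N: "N \<subseteq> V - \<tau>" using set_random_subset by fastforce
      then have finN: "finite N" using V finite_subset by blast
      show "ennreal (measure_pmf.prob (child_pmf V p k \<tau> N) {f. a \<in> labels (Node N f) \<tau>}) \<le>
        indicator {N. N \<inter> {a} \<noteq> {}} N + ennreal (real (card N)) * ennreal (real d * (D * p))"
      proof (cases "a \<in> N")
        case True
        then have "ennreal (measure_pmf.prob (child_pmf V p k \<tau> N) {f. a \<in> labels (Node N f) \<tau>}) \<le> indicator {N. N \<inter> {a} \<noteq> {}} N"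
          by (simp add: ennreal_le_1)
        then show ?thesis by (simp add: add_increasing2)
      next
        case False
        then have "measure_pmf.prob (child_pmf V p k \<tau> N) {f. a \<in> labels (Node N f) \<tau>} =
          measure_pmf.prob (child_pmf V p k \<tau> N) (\<Union>v\<in>N. \<Union>u\<in>\<tau>. {f. a \<in> labels (f v u) (swap_vertex \<tau> v u)})"
          by (intro arg_cong[where f = "measure_pmf.prob _"]) auto
        also have "\<dots> \<le> (\<Sum>v\<in>N. measure_pmf.prob (child_pmf V p k \<tau> N) (\<Union>u\<in>\<tau>. {f. a \<in> labels (f v u) (swap_vertex \<tau> v u)}))"
          by (rule measure_pmf.finite_measure_subadditive_finite) (use finN in auto)
        also have "\<dots> \<le> (\<Sum>v\<in>N. \<Sum>u\<in>\<tau>. measure_pmf.prob (child_pmf V p k \<tau> N) {f. a \<in> labels (f v u) (swap_vertex \<tau> v u)})"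
          by (intro sum_mono measure_pmf.finite_measure_subadditive_finite) (use fin in auto)
        also have "\<dots> \<le> (\<Sum>v\<in>N. \<Sum>u\<in>\<tau>. D * p)"
        proof (intro sum_mono)
          fix v u assume vu: "v \<in> N" "u \<in> \<tau>"
          have "measure_pmf.prob (child_pmf V p k \<tau> N) {f. a \<in> labels (f v u) (swap_vertex \<tau> v u)} =
            measure_pmf.prob (branching V p k (swap_vertex \<tau> v u)) {L. a \<in> labels L (swap_vertex \<tau> v u)}"
            by (rule prob_child[OF finN fin vu])
          also have "\<dots> \<le> D * p"
            by (rule IH[OF V p n]) (use vu N \<tau> fin in \<open>auto simp: card_swap_vertex, auto simp: swap_vertex_def\<close>)
          finally show "measure_pmf.prob (child_pmf V p k \<tau> N) {f. a \<in> labels (f v u) (swap_vertex \<tau> v u)} \<le> D * p" .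
        qed
        also have "\<dots> = real (card N) * (real d * (D * p))" using \<tau> by simp
        finally have "ennreal (measure_pmf.prob (child_pmf V p k \<tau> N) {f. a \<in> labels (Node N f) \<tau>}) \<le> ennreal (real (card N)) * ennreal (real d * (D * p))"
          using D p by (subst ennreal_mult[symmetric]) (auto intro: ennreal_leI)
        then show ?thesis by (simp add: add_increasing)
      qed
    qed
    also have "\<dots> = emeasure (random_subset (V - \<tau>) p) {N. N \<inter> {a} \<noteq> {}} + (\<integral>\<^sup>+N. ennreal (real (card N)) \<partial>random_subset (V - \<tau>) p) * ennreal (real d * (D * p))"
      by (subst nn_integral_add) (auto simp: nn_integral_multc)
    also have "\<dots> \<le> ennreal (real (card {a}) * p) + ennreal c * ennreal (real d * (D * p))"
      unfolding measure_pmf.emeasure_eq_measure using V p n c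
      by (intro add_mono mult_right_mono ennreal_leI prob_random_subset_meets nn_integral_random_subset_bounds) auto
    also have "\<dots> = ennreal ((1 + c * (real d * D)) * p)"
      using c D p by (simp add: ennreal_mult[symmetric] ennreal_plus[symmetric] algebra_simps del: ennreal_plus)
    finally show ?thesis using c D p by (subst (asm) ennreal_le_iff) auto
  qed
  moreover have "1 + c * (real d * D) \<ge> 0" using c D by simp
  ultimately show ?case by blast
qed

text \<open>A tree fails to be fresh if a child lies in \<open>A\<close>, if a subtree fails to be fresh, or if two subtrees share a label. The
last event has probability of order \<open>card V * p^2\<close> for each pair, by independence and \<open>prob_label_le\<close>, and the expected number of pairs is
bounded.\<close>

lemma prob_not_fresh_le:
  assumes c: "c \<ge> 0"
  shows "\<exists>C\<ge>0. \<forall>V p \<tau> A. finite V \<longrightarrow> 0 \<le> p \<longrightarrow> p \<le> 1 \<longrightarrow> real (card V) * p \<le> c \<longrightarrow> \<tau> \<subseteq> V \<longrightarrow> card \<tau> = d \<longrightarrow> finite A \<longrightarrow>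
    measure_pmf.prob (branching V p k \<tau>) {L. \<not> fresh L \<tau> A} \<le> C * (real (card A) + 1) * p"
proof (induction k)
  case 0
  then show ?case by (intro exI[of _ 0]) simp
next
  case (Suc k)
  then obtain C where C: "C \<ge> 0" and IH: "\<And>V p \<tau> A. finite V \<Longrightarrow> 0 \<le> p \<Longrightarrow> p \<le> 1 \<Longrightarrow> real (card V) * p \<le> c \<Longrightarrow> \<tau> \<subseteq> V \<Longrightarrow> card \<tau> = d \<Longrightarrow> finite A \<Longrightarrow>
    measure_pmf.prob (branching V p k \<tau>) {L. \<not> fresh L \<tau> A} \<le> C * (real (card A) + 1) * p" by blast
  obtain D where D: "D \<ge> 0" and lab: "\<And>V p \<tau> a. finite V \<Longrightarrow> 0 \<le> p \<Longrightarrow> p \<le> 1 \<Longrightarrow> real (card V) * p \<le> c \<Longrightarrow> \<tau> \<subseteq> V \<Longrightarrow> card \<tau> = d \<Longrightarrow>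
    measure_pmf.prob (branching V p k \<tau>) {L. a \<in> labels L \<tau>} \<le> D * p" using prob_label_le[OF c, of d k] by blast
  define C' where "C' = 1 + real d * C * (2 * c + c\<^sup>2) + (real d)\<^sup>2 * (c + c\<^sup>2) * (c * D\<^sup>2)"
  have C': "C' \<ge> 0" unfolding C'_def using C c D by (intro add_nonneg_nonneg mult_nonneg_nonneg) auto
  have "measure_pmf.prob (branching V p (Suc k) \<tau>) {L. \<not> fresh L \<tau> A} \<le> C' * (real (card A) + 1) * p"
    if V: "finite V" and p: "0 \<le> p" "p \<le> 1" and n: "real (card V) * p \<le> c" and \<tau>: "\<tau> \<subseteq> V" "card \<tau> = d" and A: "finite A" for V p \<tau> A
  proof -
    have fin: "finite \<tau>" using V \<tau> finite_subset by blast
    define x where "x = real d * (C * p)"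
    define y where "y = (real d)\<^sup>2 * (c * D\<^sup>2 * p)"
    have xy: "x \<ge> 0" "y \<ge> 0" using C D c p by (auto simp: x_def y_def)
    define a where "a = real (card A)"
    have "ennreal (measure_pmf.prob (branching V p (Suc k) \<tau>) {L. \<not> fresh L \<tau> A}) =
      (\<integral>\<^sup>+N. ennreal (measure_pmf.prob (child_pmf V p k \<tau> N) {f. \<not> fresh (Node N f) \<tau> A}) \<partial>random_subset (V - \<tau>) p)"
      unfolding branching_Suc prob_bind_pmf by (simp add: vimage_def)
    also have "\<dots> \<le> (\<integral>\<^sup>+N. indicator {N. N \<inter> A \<noteq> {}} N + (ennreal (real (card N)) * ennreal ((a + 1) * x) + ennreal ((real (card N))\<^sup>2) * ennreal (x + y)) \<partial>random_subset (V - \<tau>) p)"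
    proof (intro nn_integral_mono_AE AE_pmfI)
      fix N assume "N \<in> set_pmf (random_subset (V - \<tau>) p)"
      then have N: "N \<subseteq> V - \<tau>" using set_random_subset by fastforce
      then have finN: "finite N" using V finite_subset by blast
      let ?m = "real (card N)"
      let ?P = "measure_pmf.prob (child_pmf V p k \<tau> N)"
      have sw: "swap_vertex \<tau> v u \<subseteq> V" "card (swap_vertex \<tau> v u) = d" if "v \<in> N" "u \<in> \<tau>" for v u
        using that N \<tau> card_swap_vertex[OF fin, of v u] by (auto simp: swap_vertex_def)
      show "ennreal (?P {f. \<not> fresh (Node N f) \<tau> A}) \<le>
        indicator {N. N \<inter> A \<noteq> {}} N + (ennreal ?m * ennreal ((a + 1) * x) + ennreal (?m\<^sup>2) * ennreal (x + y))"
      proof (cases "N \<inter> A = {}")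
        case False
        then have "ennreal (?P {f. \<not> fresh (Node N f) \<tau> A}) \<le> indicator {N. N \<inter> A \<noteq> {}} N"
          by (simp add: ennreal_le_1)
        then show ?thesis by (rule order_trans) (simp add: add_increasing2)
      next
        case True
        define I where "I = N \<times> \<tau>"
        have I: "finite I" "card I = card N * d" using finN fin \<tau> by (auto simp: I_def card_cartesian_product)
        define E1 where "E1 z = {f. \<not> fresh (f (fst z) (snd z)) (swap_vertex \<tau> (fst z) (snd z)) (A \<union> N)}" for z
        define E2 where "E2 z z' = {f. labels (f (fst z) (snd z)) (swap_vertex \<tau> (fst z) (snd z)) \<inter>
           labels (f (fst z') (snd z')) (swap_vertex \<tau> (fst z') (snd z')) \<noteq> {}}" for z z'
        have e1: "?P (E1 z) \<le> C * p * (a + ?m + 1)" if zI: "z \<in> I" for z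
        proof -
          obtain v u where z: "z = (v, u)" "v \<in> N" "u \<in> \<tau>" using zI by (auto simp: I_def)
          have "?P (E1 z) = measure_pmf.prob (branching V p k (swap_vertex \<tau> v u)) {L. \<not> fresh L (swap_vertex \<tau> v u) (A \<union> N)}"
            unfolding E1_def z fst_conv snd_conv by (rule prob_child[OF finN fin z(2,3)])
          also have "\<dots> \<le> C * (real (card (A \<union> N)) + 1) * p"
            by (rule IH[OF V p n sw[OF z(2,3)]]) (use A finN in simp)
          also have "\<dots> \<le> C * (a + ?m + 1) * p"
            using C p card_Un_le[of A N] unfolding a_def by (intro mult_right_mono mult_left_mono) auto
          finally show ?thesis by (simp add: ac_simps)
        qed
        have e2: "?P (E2 z z') \<le> c * D\<^sup>2 * p" if zz: "z \<in> I" "z' \<in> I" "z \<noteq> z'" for z z'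
        proof -
          obtain v u where z: "z = (v, u)" "v \<in> N" "u \<in> \<tau>" using zz by (auto simp: I_def)
          obtain v' u' where z': "z' = (v', u')" "v' \<in> N" "u' \<in> \<tau>" using zz by (auto simp: I_def)
          define G where "G b = {f. b \<in> labels (f v u) (swap_vertex \<tau> v u) \<and> b \<in> labels (f v' u') (swap_vertex \<tau> v' u')}" for b
          have "?P (E2 z z') \<le> ?P (\<Union>b\<in>V. G b)"
          proof (rule measure_pmf_mono_AE)
            fix f assume f: "f \<in> set_pmf (child_pmf V p k \<tau> N)" "f \<in> E2 z z'"
            have "f v u \<in> set_pmf (branching V p k (swap_vertex \<tau> v u))"
            proof -
              have "f v \<in> set_pmf (Pi_pmf \<tau> Leaf (\<lambda>u. branching V p k (swap_vertex \<tau> v u)))"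
                using f(1) finN z(2) by (auto simp: child_pmf_def set_Pi_pmf PiE_dflt_def)
              then show ?thesis using fin z(3) by (auto simp: set_Pi_pmf PiE_dflt_def)
            qed
            then have "labels (f v u) (swap_vertex \<tau> v u) \<subseteq> V"
              by (intro tree_shape_labels set_branching[OF V sw(1)[OF z(2,3)]])
            then show "f \<in> (\<Union>b\<in>V. G b)" using f(2) by (auto simp: E2_def G_def z z')
          qed
          also have "\<dots> \<le> (\<Sum>b\<in>V. ?P (G b))"
            by (rule measure_pmf.finite_measure_subadditive_finite) (use V in auto)
          also have "\<dots> \<le> (\<Sum>b\<in>V. (D * p) * (D * p))"
          proof (rule sum_mono)
            fix b
            have ne: "(v, u) \<noteq> (v', u')" using zz(3) z z' by simp
            have "?P (G b) = measure_pmf.prob (branching V p k (swap_vertex \<tau> v u)) {L. b \<in> labels L (swap_vertex \<tau> v u)} *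
                measure_pmf.prob (branching V p k (swap_vertex \<tau> v' u')) {L. b \<in> labels L (swap_vertex \<tau> v' u')}"
              unfolding G_def by (rule prob_two_children[OF finN fin z(2,3) z'(2,3) ne])
            also have "\<dots> \<le> (D * p) * (D * p)"
              by (intro mult_mono lab[OF V p n] sw z z') (use D p in auto)
            finally show "?P (G b) \<le> (D * p) * (D * p)" .
          qed
          also have "\<dots> = (real (card V) * p) * (D\<^sup>2 * p)" by (simp add: power2_eq_square)
          also have "\<dots> \<le> c * (D\<^sup>2 * p)" using n p by (intro mult_right_mono) auto
          finally show ?thesis by (simp add: ac_simps)
        qed
        have "?P {f. \<not> fresh (Node N f) \<tau> A} \<le> ?P ((\<Union>z\<in>I. E1 z) \<union> (\<Union>z\<in>I. \<Union>z'\<in>I - {z}. E2 z z'))"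
        proof (rule measure_pmf.finite_measure_mono)
          show "{f. \<not> fresh (Node N f) \<tau> A} \<subseteq> (\<Union>z\<in>I. E1 z) \<union> (\<Union>z\<in>I. \<Union>z'\<in>I - {z}. E2 z z')"
          proof (rule subsetI, rule ccontr)
            fix f assume f: "f \<in> {f. \<not> fresh (Node N f) \<tau> A}"
              and no: "f \<notin> (\<Union>z\<in>I. E1 z) \<union> (\<Union>z\<in>I. \<Union>z'\<in>I - {z}. E2 z z')"
            have "f \<notin> E1 (v, u)" if "v \<in> N" "u \<in> \<tau>" for v u
              using no that by (auto simp: I_def)
            moreover have "f \<notin> E2 (v, u) (v', u')" if "v \<in> N" "u \<in> \<tau>" "v' \<in> N" "u' \<in> \<tau>" "(v, u) \<noteq> (v', u')" for v u v' u'
            proof -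
              have "(v, u) \<in> I" "(v', u') \<in> I - {(v, u)}" using that by (auto simp: I_def)
              then show ?thesis using no by blast
            qed
            ultimately have "fresh (Node N f) \<tau> A" using True by (simp add: E1_def E2_def)
            then show False using CollectD[OF f] by (rule notE[rotated])
          qed
        qed simp
        also have "\<dots> \<le> ?P (\<Union>z\<in>I. E1 z) + ?P (\<Union>z\<in>I. \<Union>z'\<in>I - {z}. E2 z z')"
          by (rule measure_Un_le) auto
        also have "\<dots> \<le> (\<Sum>z\<in>I. ?P (E1 z)) + (\<Sum>z\<in>I. \<Sum>z'\<in>I - {z}. ?P (E2 z z'))"
        proof (rule add_mono)
          show "?P (\<Union>z\<in>I. E1 z) \<le> (\<Sum>z\<in>I. ?P (E1 z))"
            by (rule measure_pmf.finite_measure_subadditive_finite) (use I in auto)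
          have "?P (\<Union>z\<in>I. \<Union>z'\<in>I - {z}. E2 z z') \<le> (\<Sum>z\<in>I. ?P (\<Union>z'\<in>I - {z}. E2 z z'))"
            by (rule measure_pmf.finite_measure_subadditive_finite) (use I in auto)
          also have "\<dots> \<le> (\<Sum>z\<in>I. \<Sum>z'\<in>I - {z}. ?P (E2 z z'))"
            by (intro sum_mono measure_pmf.finite_measure_subadditive_finite) (use I in auto)
          finally show "?P (\<Union>z\<in>I. \<Union>z'\<in>I - {z}. E2 z z') \<le> \<dots>" .
        qed
        also have "\<dots> \<le> (\<Sum>z\<in>I. C * p * (a + ?m + 1)) + (\<Sum>z\<in>I. \<Sum>z'\<in>I. c * D\<^sup>2 * p)"
        proof (intro add_mono sum_mono e1)
          fix z assume z: "z \<in> I"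
          have "(\<Sum>z'\<in>I - {z}. ?P (E2 z z')) \<le> (\<Sum>z'\<in>I - {z}. c * D\<^sup>2 * p)"
            using z by (intro sum_mono e2) auto
          also have "\<dots> \<le> (\<Sum>z'\<in>I. c * D\<^sup>2 * p)"
            using I c p by (intro sum_mono2) auto
          finally show "(\<Sum>z'\<in>I - {z}. ?P (E2 z z')) \<le> (\<Sum>z'\<in>I. c * D\<^sup>2 * p)" .
        qed
        also have "\<dots> = ?m * ((a + 1) * x) + ?m\<^sup>2 * (x + y)"
          using I by (simp add: x_def y_def power2_eq_square algebra_simps)
        finally have "ennreal (?P {f. \<not> fresh (Node N f) \<tau> A}) \<le> ennreal (?m * ((a + 1) * x) + ?m\<^sup>2 * (x + y))"
          by (rule ennreal_leI)
        also have "\<dots> = ennreal ?m * ennreal ((a + 1) * x) + ennreal (?m\<^sup>2) * ennreal (x + y)"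
          using xy by (subst ennreal_plus) (auto simp: a_def ennreal_mult simp del: ennreal_plus)
        finally show ?thesis by (rule order_trans) (simp add: add_increasing)
      qed
    qed
    also have "\<dots> = emeasure (random_subset (V - \<tau>) p) {N. N \<inter> A \<noteq> {}} +
      ((\<integral>\<^sup>+N. ennreal (real (card N)) \<partial>random_subset (V - \<tau>) p) * ennreal ((a + 1) * x) +
       (\<integral>\<^sup>+N. ennreal ((real (card N))\<^sup>2) \<partial>random_subset (V - \<tau>) p) * ennreal (x + y))"
      by (simp add: nn_integral_add nn_integral_multc)
    also have "\<dots> \<le> ennreal (a * p) + (ennreal c * ennreal ((a + 1) * x) + ennreal (c + c\<^sup>2) * ennreal (x + y))"
      unfolding measure_pmf.emeasure_eq_measure a_def using V p n c A
      by (intro add_mono mult_right_mono ennreal_leI prob_random_subset_meets nn_integral_random_subset_bounds) auto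
    also have "\<dots> = ennreal (a * p + (c * ((a + 1) * x) + (c + c\<^sup>2) * (x + y)))"
    proof -
      have "0 \<le> a * p" "0 \<le> c * ((a + 1) * x)" "0 \<le> (c + c\<^sup>2) * (x + y)" "0 \<le> (a + 1) * x"
        using xy c p by (auto simp: a_def)
      then show ?thesis using c xy by (simp add: ennreal_mult[symmetric] ennreal_plus[symmetric] del: ennreal_plus)
    qed
    also have "\<dots> \<le> ennreal (C' * (a + 1) * p)"
    proof (rule ennreal_leI)
      have a: "a \<ge> 0" by (simp add: a_def)
      have "(c + c\<^sup>2) * (x + y) * 1 \<le> (c + c\<^sup>2) * (x + y) * (a + 1)"
        using xy c a by (intro mult_left_mono) auto
      moreover have "a * p \<le> (a + 1) * p" using p by (intro mult_right_mono) auto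
      ultimately have "a * p + (c * ((a + 1) * x) + (c + c\<^sup>2) * (x + y)) \<le> (a + 1) * p + (c * ((a + 1) * x) + (c + c\<^sup>2) * (x + y) * (a + 1))"
        by simp
      also have "\<dots> = C' * (a + 1) * p"
        by (simp add: C'_def x_def y_def algebra_simps power2_eq_square)
      finally show "a * p + (c * ((a + 1) * x) + (c + c\<^sup>2) * (x + y)) \<le> C' * (a + 1) * p" .
    qed
    finally show ?thesis using C' p unfolding a_def by (subst (asm) ennreal_le_iff) auto
  qed
  then show ?case using C' by blast
qed

section \<open>A local lower bound for the rank\<close>

text \<open>One minus the energy, a lower bound for the contribution of \<open>\<tau>\<close> to the rank that depends on the faces near \<open>\<tau>\<close> only; trees
that are not fresh contribute \<open>0\<close>.\<close>

definition score :: "nat set \<Rightarrow> nat \<Rightarrow> nat set \<Rightarrow> nat set set \<Rightarrow> real" where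
  "score V k \<tau> F = (let L = explore V F k \<tau> {} in if fresh L \<tau> \<tau> then 1 - energy L \<tau> else 0)"

lemma score_nonneg: "finite \<tau> \<Longrightarrow> \<tau> \<noteq> {} \<Longrightarrow> 0 \<le> score V k \<tau> F"
  by (simp add: score_def Let_def energy_le_1)

lemma score_witness:
  assumes "finite \<tau>" "\<tau> \<noteq> {}"
  shows "\<exists>w\<in>span (face_boundary ` F). score V k \<tau> F \<le> 1 - sq_norm (Poly_Mapping.single \<tau> 1 - w)"
proof (cases "fresh (explore V F k \<tau> {}) \<tau> \<tau>")
  case True
  obtain w where w: "w \<in> span (face_boundary ` tree_faces (explore V F k \<tau> {}) \<tau>)"
    "sq_norm (Poly_Mapping.single \<tau> 1 - w) \<le> energy (explore V F k \<tau> {}) \<tau>"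
    using local_approximation[OF True order_refl assms] by blast
  have "span (face_boundary ` tree_faces (explore V F k \<tau> {}) \<tau>) \<subseteq> span (face_boundary ` F)"
    by (intro span_mono image_mono tree_faces_explore)
  then have "w \<in> span (face_boundary ` F)" using w(1) by (rule subsetD)
  moreover have "score V k \<tau> F \<le> 1 - sq_norm (Poly_Mapping.single \<tau> 1 - w)"
    using w(2) True by (simp add: score_def)
  ultimately show ?thesis by (rule bexI[rotated])
next
  case False
  then show ?thesis by (intro bexI[of _ 0]) (simp_all add: score_def sq_norm_single span_zero)
qed

text \<open>The average of \<open>1 - x\<close> over the branching process consists of the fresh trees, which the exploration produces at least as
often, and of the others, whose contribution is at most their probability.\<close>

lemma score_expectation_ge:
  assumes V: "finite V" and p: "0 \<le> p" "p \<le> 1" and \<tau>: "\<tau> \<subseteq> V" "card \<tau> = d" and d: "d > 0"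
  shows "(\<integral>\<^sup>+x. ennreal (1 - x) \<partial>cavity (binomial_pmf (card V - d) p) d k) \<le>
    (\<integral>\<^sup>+F. ennreal (score V k \<tau> F) \<partial>random_subset {\<sigma>. \<sigma> \<subseteq> V \<and> card \<sigma> = d + 1} p) +
    ennreal (measure_pmf.prob (branching V p k \<tau>) {L. \<not> fresh L \<tau> \<tau>})"
proof -
  have fin: "finite \<tau>" "\<tau> \<noteq> {}" using \<tau> d card_gt_0_iff[of \<tau>] by auto
  let ?RF = "random_subset {\<sigma>. \<sigma> \<subseteq> V \<and> card \<sigma> = d + 1} p"
  let ?h = "\<lambda>L. if fresh L \<tau> \<tau> then ennreal (1 - energy L \<tau>) else 0"
  have "(\<integral>\<^sup>+x. ennreal (1 - x) \<partial>cavity (binomial_pmf (card V - d) p) d k) = (\<integral>\<^sup>+L. ennreal (1 - energy L \<tau>) \<partial>branching V p k \<tau>)"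
    unfolding energy_branching[OF V p \<tau> d, symmetric] by simp
  also have "\<dots> \<le> (\<integral>\<^sup>+L. ?h L + indicator {L. \<not> fresh L \<tau> \<tau>} L \<partial>branching V p k \<tau>)"
    by (intro nn_integral_mono) (auto simp: ennreal_le_1 less_imp_le[OF energy_pos[OF fin]])
  also have "\<dots> = (\<integral>\<^sup>+L. ?h L \<partial>branching V p k \<tau>) + ennreal (measure_pmf.prob (branching V p k \<tau>) {L. \<not> fresh L \<tau> \<tau>})"
    by (subst nn_integral_add) (auto simp: measure_pmf.emeasure_eq_measure)
  also have "(\<integral>\<^sup>+L. ?h L \<partial>branching V p k \<tau>) \<le> (\<integral>\<^sup>+L. ?h L \<partial>map_pmf (\<lambda>F. explore V F k \<tau> {}) ?RF)"
    unfolding nn_integral_measure_pmf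
  proof (rule nn_integral_mono)
    fix L
    show "ennreal (pmf (branching V p k \<tau>) L) * ?h L \<le> ennreal (pmf (map_pmf (\<lambda>F. explore V F k \<tau> {}) ?RF) L) * ?h L"
    proof (cases "fresh L \<tau> \<tau>")
      case True
      show ?thesis by (intro mult_right_mono ennreal_leI pmf_branching_le_explore[OF V p \<tau> True]) simp
    qed simp
  qed
  also have "\<dots> = (\<integral>\<^sup>+F. ennreal (score V k \<tau> F) \<partial>?RF)"
    unfolding nn_integral_map_pmf by (intro nn_integral_cong) (simp add: score_def)
  finally show ?thesis by (simp add: add_right_mono)
qed

lemma score_expectation_limit:
  assumes c: "c > 0" and d: "d > 0" and e: "e > 0"
  shows "\<forall>\<^sub>F n in sequentially. \<forall>\<tau>. \<tau> \<subseteq> {..<n} \<longrightarrow> card \<tau> = d \<longrightarrow>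
    (\<integral>\<^sup>+x. ennreal (1 - x) \<partial>cavity (poisson_pmf c) d k) \<le>
    (\<integral>\<^sup>+F. ennreal (score {..<n} k \<tau> F) \<partial>random_subset {\<sigma>. \<sigma> \<subseteq> {..<n} \<and> card \<sigma> = d + 1} (c / real n)) + ennreal e"
proof -
  obtain C where C: "C \<ge> 0" and fr: "\<And>V p \<tau> A. finite V \<Longrightarrow> 0 \<le> p \<Longrightarrow> p \<le> 1 \<Longrightarrow> real (card V) * p \<le> c \<Longrightarrow> \<tau> \<subseteq> V \<Longrightarrow> card \<tau> = d \<Longrightarrow> finite A \<Longrightarrow>
    measure_pmf.prob (branching V p k \<tau>) {L. \<not> fresh L \<tau> A} \<le> C * (real (card A) + 1) * p"
    using prob_not_fresh_le[of c d k] c by (auto 0 3)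
  have "(\<lambda>n. C * (real d + 1) * (c / real n)) \<longlonglongrightarrow> C * (real d + 1) * 0"
    by (intro tendsto_intros lim_const_over_n)
  then have "\<forall>\<^sub>F n in sequentially. C * (real d + 1) * (c / real n) < e / 2"
    by (intro order_tendstoD(2)) (use e in auto)
  moreover have "\<forall>\<^sub>F n in sequentially. c \<le> real n"
    using eventually_ge_at_top[of "nat \<lceil>c\<rceil>"] by eventually_elim linarith
  moreover have "\<forall>\<^sub>F n in sequentially. tv_close (cavity (binomial_pmf (n - d) (c / real n)) d k) (cavity (poisson_pmf c) d k) (ennreal (e / 2))"
    by (rule tv_close_cavity_binomial[OF c]) (use e in simp)
  ultimately show ?thesis
  proof eventually_elim
    case (elim n)
    have n0: "real n > 0" using c elim(2) by simp
    have p: "0 \<le> c / real n" "c / real n \<le> 1" using c elim(2) n0 by auto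
    show ?case
    proof (intro allI impI)
      fix \<tau> assume \<tau>: "\<tau> \<subseteq> {..<n}" "card \<tau> = d"
      let ?N = "binomial_pmf (n - d) (c / real n)"
      let ?S = "\<integral>\<^sup>+F. ennreal (score {..<n} k \<tau> F) \<partial>random_subset {\<sigma>. \<sigma> \<subseteq> {..<n} \<and> card \<sigma> = d + 1} (c / real n)"
      define h where "h x = (if 0 \<le> x then ennreal (1 - x) else 1)" for x :: real
      have h: "h x = ennreal (1 - x)" if "x \<in> set_pmf (cavity N d k)" for x N
        using that set_cavity[OF d, of N k] by (auto simp: h_def)
      have "(\<integral>\<^sup>+x. ennreal (1 - x) \<partial>cavity (poisson_pmf c) d k) = (\<integral>\<^sup>+x. h x \<partial>cavity (poisson_pmf c) d k)"
        by (intro nn_integral_cong_AE AE_pmfI) (simp add: h)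
      also have "\<dots> \<le> (\<integral>\<^sup>+x. h x \<partial>cavity ?N d k) + ennreal (e / 2)"
        by (rule tv_closeD[OF elim(3)]) (simp add: h_def ennreal_le_1)
      also have "(\<integral>\<^sup>+x. h x \<partial>cavity ?N d k) = (\<integral>\<^sup>+x. ennreal (1 - x) \<partial>cavity ?N d k)"
        by (intro nn_integral_cong_AE AE_pmfI) (simp add: h)
      also have "\<dots> \<le> ?S + ennreal (measure_pmf.prob (branching {..<n} (c / real n) k \<tau>) {L. \<not> fresh L \<tau> \<tau>})"
        using score_expectation_ge[OF _ p \<tau> d, of k] by simp
      also have "\<dots> \<le> ?S + ennreal (e / 2)"
      proof (intro add_left_mono ennreal_leI)
        have "measure_pmf.prob (branching {..<n} (c / real n) k \<tau>) {L. \<not> fresh L \<tau> \<tau>} \<le> C * (real (card \<tau>) + 1) * (c / real n)"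
          by (rule fr[OF _ p _ \<tau>]) (use n0 \<tau> finite_subset[of \<tau> "{..<n}"] in auto)
        then show "measure_pmf.prob (branching {..<n} (c / real n) k \<tau>) {L. \<not> fresh L \<tau> \<tau>} \<le> e / 2"
          using elim(1) unfolding \<tau>(2) by linarith
      qed
      finally have "(\<integral>\<^sup>+x. ennreal (1 - x) \<partial>cavity (poisson_pmf c) d k) \<le> ?S + ennreal (e / 2) + ennreal (e / 2)"
        by (simp add: add_right_mono)
      also have "\<dots> = ?S + ennreal e"
        using e by (simp add: add.assoc ennreal_plus[symmetric] del: ennreal_plus)
      finally show "(\<integral>\<^sup>+x. ennreal (1 - x) \<partial>cavity (poisson_pmf c) d k) \<le> ?S + ennreal e" .
    qed
  qed
qed

section \<open>Cores on few vertices\<close>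

definition has_simplex_boundary :: "nat \<Rightarrow> nat set set \<Rightarrow> bool" where
  "has_simplex_boundary d K \<longleftrightarrow> (\<exists>\<tau>. card \<tau> = d + 2 \<and> (\<forall>\<sigma>\<subseteq>\<tau>. card \<sigma> = d + 1 \<longrightarrow> \<sigma> \<in> K))"

lemma core_neighbour:
  assumes "core L" "\<And>\<sigma>. \<sigma> \<in> L \<Longrightarrow> card \<sigma> = s" "\<sigma> \<in> L" "u \<in> \<sigma>" "s > 0"
  shows "\<exists>v. v \<notin> \<sigma> \<and> insert v (\<sigma> - {u}) \<in> L"
proof -
  obtain \<sigma>' where \<sigma>': "\<sigma>' \<in> L" "\<sigma>' \<noteq> \<sigma>" "\<sigma> - {u} \<subseteq> \<sigma>'"
    using assms(1,3,4) unfolding core_def by blast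
  have fin: "finite \<sigma>" "finite \<sigma>'" using assms(2)[OF assms(3)] assms(2)[OF \<sigma>'(1)] assms(5) by (auto intro: card_ge_0_finite)
  have "card (\<sigma>' - (\<sigma> - {u})) = 1"
    using fin \<sigma>' assms(2)[OF assms(3)] assms(2)[OF \<sigma>'(1)] assms(4,5) by (simp add: card_Diff_subset)
  then obtain v where v: "\<sigma>' - (\<sigma> - {u}) = {v}" by (auto simp: card_1_singleton_iff)
  then have eq: "\<sigma>' = insert v (\<sigma> - {u})" using \<sigma>'(3) by auto
  moreover have "v \<notin> \<sigma>"
  proof
    assume "v \<in> \<sigma>"
    then have "v = u" using v by auto
    then have "\<sigma>' = \<sigma>" using eq assms(4) by auto
    then show False using \<sigma>'(2) by simp
  qed
  ultimately show ?thesis using \<sigma>'(1) by auto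
qed

text \<open>Across each facet of \<open>\<sigma>\<close> lies another face, and these faces are different because the one across the facet opposite to \<open>u\<close>
is the only one that misses \<open>u\<close>.\<close>

lemma core_star:
  assumes "core L" "\<And>\<sigma>. \<sigma> \<in> L \<Longrightarrow> card \<sigma> = s" "s > 0" "finite L" "\<sigma> \<in> L"
  shows "\<exists>v. (\<forall>u\<in>\<sigma>. v u \<notin> \<sigma>) \<and> (\<forall>u\<in>\<sigma>. insert (v u) (\<sigma> - {u}) \<in> L) \<and>
    card (insert \<sigma> ((\<lambda>u. insert (v u) (\<sigma> - {u})) ` \<sigma>)) = s + 1"
proof -
  have "\<exists>v. \<forall>u\<in>\<sigma>. v u \<notin> \<sigma> \<and> insert (v u) (\<sigma> - {u}) \<in> L"
    using core_neighbour[OF assms(1,2,5) _ assms(3)] by (intro bchoice) blast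
  then obtain v where v: "\<And>u. u \<in> \<sigma> \<Longrightarrow> v u \<notin> \<sigma>" "\<And>u. u \<in> \<sigma> \<Longrightarrow> insert (v u) (\<sigma> - {u}) \<in> L" by blast
  have fin: "finite \<sigma>" using assms(2)[OF assms(5)] assms(3) by (auto intro: card_ge_0_finite)
  let ?f = "\<lambda>u. insert (v u) (\<sigma> - {u})"
  have "inj_on ?f \<sigma>"
  proof (rule inj_onI)
    fix x y assume xy: "x \<in> \<sigma>" "y \<in> \<sigma>" "?f x = ?f y"
    have "x \<notin> ?f x" using v(1)[OF xy(1)] xy(1) by auto
    then have "x \<notin> ?f y" using xy(3) by simp
    then show "x = y" using xy(1) by auto
  qed
  then have "card (?f ` \<sigma>) = s" using assms(2)[OF assms(5)] by (simp add: card_image)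
  moreover have "\<sigma> \<notin> ?f ` \<sigma>" using v(1) by blast
  ultimately have "card (insert \<sigma> (?f ` \<sigma>)) = s + 1" using fin by simp
  with v show ?thesis by (intro exI[of _ v]) simp
qed

lemma core_card_ge:
  assumes "core L" "\<And>\<sigma>. \<sigma> \<in> L \<Longrightarrow> card \<sigma> = s" "s > 0" "finite L"
  shows "s + 1 \<le> card L"
proof -
  obtain \<sigma> where \<sigma>: "\<sigma> \<in> L" using assms(1) by (auto simp: core_def)
  obtain v where v: "\<And>u. u \<in> \<sigma> \<Longrightarrow> v u \<notin> \<sigma>"
    "\<And>u. u \<in> \<sigma> \<Longrightarrow> insert (v u) (\<sigma> - {u}) \<in> L"
    "card (insert \<sigma> ((\<lambda>u. insert (v u) (\<sigma> - {u})) ` \<sigma>)) = s + 1"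
    using core_star[OF assms \<sigma>] by blast
  have "insert \<sigma> ((\<lambda>u. insert (v u) (\<sigma> - {u})) ` \<sigma>) \<subseteq> L" using \<sigma> v(2) by auto
  from card_mono[OF assms(4) this] show ?thesis using v(3) by simp
qed

text \<open>A core of the least possible size consists of one face and its neighbours across the facets. Since the neighbours
must also be adjacent to one another, all of them use the same additional vertex.\<close>

lemma core_card_eq:
  assumes "core L" "\<And>\<sigma>. \<sigma> \<in> L \<Longrightarrow> card \<sigma> = s" "s \<ge> 2" "finite L" "card L = s + 1"
  shows "\<exists>W. card W = s + 1 \<and> L = (\<lambda>w. W - {w}) ` W"
proof -
  have s: "s > 0" using assms(3) by simp
  obtain \<sigma> where \<sigma>: "\<sigma> \<in> L" using assms(1) by (auto simp: core_def)
  obtain v where v: "\<And>u. u \<in> \<sigma> \<Longrightarrow> v u \<notin> \<sigma>"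
    "\<And>u. u \<in> \<sigma> \<Longrightarrow> insert (v u) (\<sigma> - {u}) \<in> L"
    "card (insert \<sigma> ((\<lambda>u. insert (v u) (\<sigma> - {u})) ` \<sigma>)) = s + 1"
    using core_star[OF assms(1,2) s assms(4) \<sigma>] by blast
  have fin: "finite \<sigma>" "card \<sigma> = s" using assms(2)[OF \<sigma>] s by (auto intro: card_ge_0_finite)
  have "insert \<sigma> ((\<lambda>u. insert (v u) (\<sigma> - {u})) ` \<sigma>) \<subseteq> L" using \<sigma> v(2) by auto
  then have L: "L = insert \<sigma> ((\<lambda>u. insert (v u) (\<sigma> - {u})) ` \<sigma>)"
    using assms(4,5) v(3) by (metis card_subset_eq)
  have same: "v u = v u'" if u: "u \<in> \<sigma>" "u' \<in> \<sigma>" "u \<noteq> u'" for u u'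
  proof -
    have "u' \<in> insert (v u) (\<sigma> - {u})" using u by auto
    then obtain r where r: "r \<in> L" "r \<noteq> insert (v u) (\<sigma> - {u})" "insert (v u) (\<sigma> - {u}) - {u'} \<subseteq> r"
      using assms(1) v(2)[OF u(1)] unfolding core_def by blast
    have vr: "v u \<in> r" using r(3) v(1)[OF u(1)] u(2) by auto
    then have "r \<noteq> \<sigma>" using v(1)[OF u(1)] by auto
    then obtain x where x: "x \<in> \<sigma>" "r = insert (v x) (\<sigma> - {x})" using r(1) unfolding L by auto
    have "x \<noteq> u" using x(2) r(2) by auto
    moreover have "x \<notin> r" using x v(1)[OF x(1)] by auto
    ultimately have "x = u'" using r(3) x(1) by auto
    then show ?thesis using vr x(2) v(1)[OF u(1)] by auto
  qed
  obtain u0 where u0: "u0 \<in> \<sigma>" using fin s by fastforce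
  define W where "W = insert (v u0) \<sigma>"
  have vv: "v u = v u0" if "u \<in> \<sigma>" for u using same[OF that u0] by (cases "u = u0") auto
  have "card W = s + 1" using v(1)[OF u0] fin by (simp add: W_def)
  moreover have "L = (\<lambda>w. W - {w}) ` W"
  proof -
    have "W - {v u0} = \<sigma>" using v(1)[OF u0] by (auto simp: W_def)
    moreover have "W - {u} = insert (v u) (\<sigma> - {u})" if "u \<in> \<sigma>" for u
      using that vv[OF that] v(1)[OF u0] by (auto simp: W_def)
    ultimately show ?thesis unfolding L W_def image_insert by (metis (no_types, lifting) W_def image_cong)
  qed
  ultimately show ?thesis by blast
qed

definition link :: "nat set set \<Rightarrow> nat \<Rightarrow> nat set set" where
  "link K u = (\<lambda>\<sigma>. \<sigma> - {u}) ` {\<sigma> \<in> K. u \<in> \<sigma>}"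

lemma mem_link: "\<rho> \<in> link K u \<longleftrightarrow> u \<notin> \<rho> \<and> insert u \<rho> \<in> K"
proof
  assume "\<rho> \<in> link K u"
  then obtain \<sigma> where "\<rho> = \<sigma> - {u}" "\<sigma> \<in> K" "u \<in> \<sigma>" by (auto simp: link_def)
  moreover from this have "insert u \<rho> = \<sigma>" by auto
  ultimately show "u \<notin> \<rho> \<and> insert u \<rho> \<in> K" by simp
next
  assume "u \<notin> \<rho> \<and> insert u \<rho> \<in> K"
  then show "\<rho> \<in> link K u" unfolding link_def by (intro image_eqI[of _ _ "insert u \<rho>"]) auto
qed

lemma card_link: "card (link K u) = card {\<sigma> \<in> K. u \<in> \<sigma>}"
  unfolding link_def by (rule card_image) (auto simp: inj_on_def)

text \<open>The property passes to links: the facet \<open>\<rho> - {x}\<close> of \<open>\<rho>\<close> in the link corresponds to the facet of \<open>insert u \<rho>\<close> opposite to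
\<open>x\<close>.\<close>

lemma core_link:
  assumes "core K" "u \<in> \<Union>K" shows "core (link K u)"
  unfolding core_def
proof (intro conjI ballI)
  obtain \<sigma> where "\<sigma> \<in> K" "u \<in> \<sigma>" using assms(2) by auto
  then have "\<sigma> - {u} \<in> link K u" by (auto simp: link_def)
  then show "link K u \<noteq> {}" by auto
next
  fix \<rho> x assume \<rho>: "\<rho> \<in> link K u" and x: "x \<in> \<rho>"
  then have s: "insert u \<rho> \<in> K" "u \<notin> \<rho>" by (auto simp: mem_link)
  have "\<forall>\<sigma>\<in>K. \<forall>u\<in>\<sigma>. \<exists>\<sigma>'\<in>K. \<sigma>' \<noteq> \<sigma> \<and> \<sigma> - {u} \<subseteq> \<sigma>'" using assms(1) by (simp add: core_def)
  from bspec[OF bspec[OF this s(1)], of x] x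
  obtain r where r: "r \<in> K" "r \<noteq> insert u \<rho>" "insert u \<rho> - {x} \<subseteq> r" by auto
  have "u \<in> r" using r(3) s x by auto
  then have "r - {u} \<in> link K u" using r(1) unfolding link_def by (intro imageI) simp
  moreover have "r - {u} \<noteq> \<rho>" using r(2) insert_Diff[OF \<open>u \<in> r\<close>] by metis
  moreover have "\<rho> - {x} \<subseteq> r - {u}" using r(3) s by auto
  ultimately show "\<exists>\<sigma>'\<in>link K u. \<sigma>' \<noteq> \<rho> \<and> \<rho> - {x} \<subseteq> \<sigma>'" by (intro bexI[of _ "r - {u}"] conjI)
qed

text \<open>Links are cores of one dimension less, thus every vertex lies in at least \<open>d + 1\<close> faces. Double counting gives at
least as many faces as vertices. If there are no more, all links have the least possible size, so the link of \<open>u\<close> is the set of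
all facets of a \<open>(d+1)\<close>-set \<open>W\<close>; the links of the vertices of \<open>W\<close> then show that \<open>W\<close> is a face, too, which
yields the boundary of a simplex on \<open>insert u W\<close>.\<close>

lemma core_few_vertices:
  assumes K: "core K" "finite K" "\<And>\<sigma>. \<sigma> \<in> K \<Longrightarrow> card \<sigma> = d + 1" and d: "d \<ge> 2"
    and no: "\<not> has_simplex_boundary d K"
  shows "card (\<Union>K) < card K"
proof (rule ccontr)
  assume "\<not> card (\<Union>K) < card K"
  then have le: "card K \<le> card (\<Union>K)" by simp
  have fin\<sigma>: "finite \<sigma>" if "\<sigma> \<in> K" for \<sigma> using K(3)[OF that] by (auto intro: card_ge_0_finite)
  then have finU: "finite (\<Union>K)" using K(2) by auto
  have deg: "d + 1 \<le> card (link K u)" if "u \<in> \<Union>K" for u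
  proof (rule core_card_ge[OF core_link[OF K(1) that]])
    fix \<rho> assume "\<rho> \<in> link K u"
    then have "insert u \<rho> \<in> K" "u \<notin> \<rho>" by (simp_all add: mem_link)
    then have "card (insert u \<rho>) = d + 1" "u \<notin> \<rho>" "finite \<rho>" using K(3) fin\<sigma>[of "insert u \<rho>"] by simp_all
    then show "card \<rho> = d" by simp
  next
    show "finite (link K u)" using K(2) by (simp add: link_def)
  qed (use d in simp_all)
  have "(\<Sum>u\<in>\<Union>K. card (link K u)) = (\<Sum>u\<in>\<Union>K. \<Sum>\<sigma>\<in>K. if u \<in> \<sigma> then 1 else 0)"
    using K(2) by (simp add: card_link sum.If_cases Int_def)
  also have "\<dots> = (\<Sum>\<sigma>\<in>K. \<Sum>u\<in>\<Union>K. if u \<in> \<sigma> then 1 else 0)" by (rule sum.swap)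
  also have "\<dots> = (\<Sum>\<sigma>\<in>K. card \<sigma>)"
    using finU by (intro sum.cong refl) (auto simp: sum.If_cases intro!: arg_cong[where f = card])
  also have "\<dots> = card K * (d + 1)" using K(3) by simp
  also have "\<dots> \<le> card (\<Union>K) * (d + 1)" using le by (rule mult_le_mono1)
  also have "\<dots> = (\<Sum>u\<in>\<Union>K. d + 1)" by simp
  finally have sum_le: "(\<Sum>u\<in>\<Union>K. card (link K u)) \<le> (\<Sum>u\<in>\<Union>K. d + 1)" .
  \<comment> \<open>There is equality on average, hence everywhere.\<close>
  have deg_eq: "card (link K u) = d + 1" if "u \<in> \<Union>K" for u
  proof (rule ccontr)
    assume "card (link K u) \<noteq> d + 1"
    then have "d + 1 < card (link K u)" using deg[OF that] by simp
    then have "(\<Sum>u\<in>\<Union>K. d + 1) < (\<Sum>u\<in>\<Union>K. card (link K u))"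
      using finU deg that by (intro sum_strict_mono_ex1) blast+
    then show False using sum_le by simp
  qed
  have facets: "\<exists>W. card W = d + 1 \<and> link K u = (\<lambda>w. W - {w}) ` W" if "u \<in> \<Union>K" for u
  proof (rule core_card_eq[OF core_link[OF K(1) that]])
    fix \<rho> assume "\<rho> \<in> link K u"
    then have "insert u \<rho> \<in> K" "u \<notin> \<rho>" by (simp_all add: mem_link)
    then have "card (insert u \<rho>) = d + 1" "u \<notin> \<rho>" "finite \<rho>" using K(3) fin\<sigma>[of "insert u \<rho>"] by simp_all
    then show "card \<rho> = d" by simp
  next
    show "finite (link K u)" using K(2) by (simp add: link_def)
  qed (use d deg_eq[OF that] in simp_all)
  obtain u where u: "u \<in> \<Union>K"
  proof -
    obtain \<sigma> where "\<sigma> \<in> K" using K(1) by (auto simp: core_def)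
    moreover from this have "\<sigma> \<noteq> {}" using K(3) by fastforce
    ultimately show ?thesis using that by blast
  qed
  obtain W where W: "card W = d + 1" "link K u = (\<lambda>w. W - {w}) ` W" using facets[OF u] by blast
  have finW: "finite W" using W(1) by (auto intro: card_ge_0_finite)
  have uW: "u \<notin> W"
  proof
    assume "u \<in> W"
    obtain w where w: "w \<in> W" "w \<noteq> u"
    proof -
      have "\<not> W \<subseteq> {u}" using W(1) d card_mono[of "{u}" W] by auto
      then show ?thesis using that by blast
    qed
    then have "W - {w} \<in> link K u" using W(2) by auto
    then show False using \<open>u \<in> W\<close> w by (auto simp: mem_link)
  qed
  have K1: "insert u (W - {w}) \<in> K" if "w \<in> W" for w
  proof -
    have "W - {w} \<in> link K u" using that unfolding W(2) by (rule imageI)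
    then show ?thesis by (simp add: mem_link)
  qed
  \<comment> \<open>The link of \<open>w \<in> W\<close> is the set of all facets of some \<open>W'\<close>. Two members of it that are known already determine \<open>W' = insert u (W - {w})\<close>, and the facet \<open>W' - {u}\<close> of \<open>W'\<close> shows that \<open>W\<close> is in \<open>K\<close>.\<close>
  have KW: "W \<in> K"
  proof -
    obtain w where w: "w \<in> W" using W(1) by fastforce
    obtain w1 where w1: "w1 \<in> W" "w1 \<noteq> w"
    proof -
      have "\<not> W \<subseteq> {w}" using W(1) d card_mono[of "{w}" W] by auto
      then show ?thesis using that by blast
    qed
    obtain w2 where w2: "w2 \<in> W" "w2 \<noteq> w" "w2 \<noteq> w1"
    proof -
      have "card {w, w1} = 2" using w1 by simp
      then have "\<not> W \<subseteq> {w, w1}" using W(1) d card_mono[of "{w, w1}" W] by auto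
      then show ?thesis using that by blast
    qed
    have wU: "w \<in> \<Union>K" by (rule UnionI[OF K1[OF w1(1)]]) (use w w1 in simp)
    obtain W' where W': "card W' = d + 1" "link K w = (\<lambda>x. W' - {x}) ` W'" using facets[OF wU] by blast
    have finW': "finite W'" using W'(1) by (auto intro: card_ge_0_finite)
    have in_link: "insert u (W - {w'}) - {w} \<in> link K w" if "w' \<in> W" "w' \<noteq> w" for w'
    proof -
      have "insert w (insert u (W - {w'}) - {w}) = insert u (W - {w'})" using w that by auto
      then show ?thesis unfolding mem_link using K1[OF that(1)] by simp
    qed
    have sub: "insert u (W - {w'}) - {w} \<subseteq> W'" if "w' \<in> W" "w' \<noteq> w" for w'
      using in_link[OF that] unfolding W'(2) by auto
    have "insert u (W - {w}) \<subseteq> W'"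
      using sub[OF w1] sub[OF w2(1,2)] w2(3) w uW by blast
    moreover have "card (insert u (W - {w})) = card W'" using w W(1) W'(1) finW uW by simp
    ultimately have eq: "W' = insert u (W - {w})" by (rule card_subset_eq[OF finW', symmetric])
    then have "W' - {u} \<in> link K w" unfolding W'(2) by (intro imageI) simp
    then have "insert w (W' - {u}) \<in> K" by (simp add: mem_link)
    moreover have "insert w (W' - {u}) = W" using eq w uW by auto
    ultimately show ?thesis by simp
  qed
  have "\<sigma> \<in> K" if \<sigma>: "\<sigma> \<subseteq> insert u W" "card \<sigma> = d + 1" for \<sigma>
  proof -
    have "finite \<sigma>" by (rule finite_subset[OF \<sigma>(1)]) (simp add: finW)
    then have "card (insert u W - \<sigma>) = 1"
      using \<sigma> finW uW W(1) by (simp add: card_Diff_subset)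
    then obtain x where x: "insert u W - \<sigma> = {x}" by (auto simp: card_1_singleton_iff)
    then have "\<sigma> = insert u W - {x}" using \<sigma>(1) double_diff[OF \<sigma>(1) order_refl] by simp
    moreover have "x \<in> insert u W - \<sigma>" by (simp only: x singletonI)
    then have "x = u \<or> x \<in> W" by simp
    moreover have "insert u W - {u} = W" using uW by auto
    moreover have "insert u W - {x} = insert u (W - {x})" if "x \<in> W" using that uW by blast
    ultimately show ?thesis using KW K1[of x] by (elim disjE) simp_all
  qed
  then have "has_simplex_boundary d K"
    unfolding has_simplex_boundary_def using W(1) uW finW by (intro exI[of _ "insert u W"]) auto
  then show False using no by simp
qed

section \<open>Sets all of whose facets belong to a sparse family\<close>

text \<open>A family of \<open>j\<close>-sets that is sparse compared to all \<open>j\<close>-sets can contain all facets of only few \<open>(j+1)\<close>-sets, namely a small multiple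
of \<open>card V\<close> per member of the family. The induction on \<open>j\<close> passes to links. Vertices whose link is sparse are handled by the induction hypothesis;
there are few other vertices since the links have \<open>j * card B\<close> members in total, and each of these vertices lies
in at most \<open>card B\<close> of the sets.\<close>

lemma few_cliques:
  assumes "\<zeta> > 0"
  shows "\<exists>\<beta>>0. \<forall>V :: nat set. \<forall>B. finite V \<longrightarrow> B \<subseteq> {\<rho>. \<rho> \<subseteq> V \<and> card \<rho> = j} \<longrightarrow> real (card B) \<le> \<beta> * real (card V) ^ j \<longrightarrow>
    real (card {\<tau>. \<tau> \<subseteq> V \<and> card \<tau> = Suc j \<and> (\<forall>u\<in>\<tau>. \<tau> - {u} \<in> B)}) \<le> \<zeta> * real (card V) * real (card B)"
  using assms
proof (induction j arbitrary: \<zeta>)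
  case 0
  show ?case
  proof (intro exI[of _ "1 / 2"] conjI allI impI)
    fix V :: "nat set" and B
    assume V: "finite V" and B: "B \<subseteq> {\<rho>. \<rho> \<subseteq> V \<and> card \<rho> = 0}" "real (card B) \<le> 1 / 2 * real (card V) ^ 0"
    have "B \<subseteq> Pow V" using B(1) by auto
    then have "finite B" using V finite_subset by auto
    moreover have "card B = 0" using B(2) by (cases "card B") auto
    ultimately have "B = {}" by simp
    then have "{\<tau>. \<tau> \<subseteq> V \<and> card \<tau> = Suc 0 \<and> (\<forall>u\<in>\<tau>. \<tau> - {u} \<in> B)} = {}" by force
    then show "real (card {\<tau>. \<tau> \<subseteq> V \<and> card \<tau> = Suc 0 \<and> (\<forall>u\<in>\<tau>. \<tau> - {u} \<in> B)}) \<le> \<zeta> * real (card V) * real (card B)"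
      using \<open>B = {}\<close> by (simp only: card.empty)
  qed simp
next
  case (Suc j)
  define \<zeta>1 where "\<zeta>1 = \<zeta> / (2 * real (Suc j))"
  have "\<zeta>1 > 0" using Suc.prems by (simp add: \<zeta>1_def)
  then obtain \<beta>1 where \<beta>1: "\<beta>1 > 0" and IH: "\<And>(V :: nat set) B. finite V \<Longrightarrow> B \<subseteq> {\<rho>. \<rho> \<subseteq> V \<and> card \<rho> = j} \<Longrightarrow> real (card B) \<le> \<beta>1 * real (card V) ^ j \<Longrightarrow>
    real (card {\<tau>. \<tau> \<subseteq> V \<and> card \<tau> = Suc j \<and> (\<forall>u\<in>\<tau>. \<tau> - {u} \<in> B)}) \<le> \<zeta>1 * real (card V) * real (card B)"
    using Suc.IH[of \<zeta>1] by blast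
  define \<beta> where "\<beta> = \<beta>1 * \<zeta> / (2 * real (Suc j))"
  show ?case
  proof (intro exI[of _ \<beta>] conjI allI impI)
    show "\<beta> > 0" using \<beta>1 Suc.prems by (simp add: \<beta>_def)
    fix V :: "nat set" and B
    assume V: "finite V" and B: "B \<subseteq> {\<rho>. \<rho> \<subseteq> V \<and> card \<rho> = Suc j}" "real (card B) \<le> \<beta> * real (card V) ^ Suc j"
    define n where "n = real (card V)"
    define T where "T = {\<tau>. \<tau> \<subseteq> V \<and> card \<tau> = Suc (Suc j) \<and> (\<forall>u\<in>\<tau>. \<tau> - {u} \<in> B)}"
    have finB: "finite B" by (rule finite_subset[of _ "Pow V"]) (use B V in auto)
    have finT: "finite T" by (rule finite_subset[of _ "Pow V"]) (use V in \<open>auto simp: T_def\<close>)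
    define t where "t u = card {\<tau> \<in> T. u \<in> \<tau>}" for u
    define b where "b u = card (link B u)" for u
    have t_le_B: "t u \<le> card B" for u
      unfolding t_def
    proof (rule card_inj_on_le[where f = "\<lambda>\<tau>. \<tau> - {u}"])
      show "inj_on (\<lambda>\<tau>. \<tau> - {u}) {\<tau> \<in> T. u \<in> \<tau>}" by (auto simp: inj_on_def)
    qed (use finB in \<open>auto simp: T_def\<close>)
    have t_light: "real (t u) \<le> \<zeta>1 * n * real (b u)" if "real (b u) \<le> \<beta>1 * n ^ j" for u
    proof -
      let ?C = "{\<tau>. \<tau> \<subseteq> V \<and> card \<tau> = Suc j \<and> (\<forall>x\<in>\<tau>. \<tau> - {x} \<in> link B u)}"
      have "t u \<le> card ?C"
        unfolding t_def
      proof (rule card_inj_on_le[where f = "\<lambda>\<tau>. \<tau> - {u}"])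
        show "inj_on (\<lambda>\<tau>. \<tau> - {u}) {\<tau> \<in> T. u \<in> \<tau>}" by (auto simp: inj_on_def)
        show "(\<lambda>\<tau>. \<tau> - {u}) ` {\<tau> \<in> T. u \<in> \<tau>} \<subseteq> ?C"
        proof (intro image_subsetI CollectI conjI ballI)
          fix \<tau> assume \<tau>: "\<tau> \<in> {\<tau> \<in> T. u \<in> \<tau>}"
          show "\<tau> - {u} \<subseteq> V" "card (\<tau> - {u}) = Suc j" using \<tau> by (auto simp: T_def)
          fix x assume x: "x \<in> \<tau> - {u}"
          have "\<tau> - {x} \<in> B" using \<tau> x by (auto simp: T_def)
          moreover have "insert u (\<tau> - {u} - {x}) = \<tau> - {x}" using \<tau> x by auto
          ultimately show "\<tau> - {u} - {x} \<in> link B u" by (simp add: mem_link)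
        qed
        show "finite ?C" by (rule finite_subset[of _ "Pow V"]) (use V in auto)
      qed
      also have "real (card ?C) \<le> \<zeta>1 * n * real (b u)"
        unfolding n_def b_def
      proof (rule IH[OF V])
        show "link B u \<subseteq> {\<rho>. \<rho> \<subseteq> V \<and> card \<rho> = j}"
        proof
          fix \<rho> assume "\<rho> \<in> link B u"
          then have \<rho>: "u \<notin> \<rho>" "insert u \<rho> \<in> B" by (simp_all add: mem_link)
          then have "insert u \<rho> \<subseteq> V" "card (insert u \<rho>) = Suc j" using B(1) by auto
          moreover from this have "finite \<rho>" using V by (auto intro: finite_subset)
          ultimately show "\<rho> \<in> {\<rho>. \<rho> \<subseteq> V \<and> card \<rho> = j}" using \<rho>(1) by simp
        qed
      qed (use that in \<open>simp add: n_def b_def\<close>)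
      finally show ?thesis by simp
    qed
    have sum_b: "(\<Sum>u\<in>V. b u) = Suc j * card B"
    proof -
      have "(\<Sum>u\<in>V. b u) = (\<Sum>u\<in>V. \<Sum>\<rho>\<in>B. if u \<in> \<rho> then 1 else 0)"
        using finB by (simp add: b_def card_link sum.If_cases Int_def)
      also have "\<dots> = (\<Sum>\<rho>\<in>B. \<Sum>u\<in>V. if u \<in> \<rho> then 1 else 0)" by (rule sum.swap)
      also have "\<dots> = (\<Sum>\<rho>\<in>B. Suc j)"
      proof (rule sum.cong[OF refl])
        fix \<rho> assume "\<rho> \<in> B"
        then have "V \<inter> \<rho> = \<rho>" "card \<rho> = Suc j" using B(1) by auto
        then show "(\<Sum>u\<in>V. if u \<in> \<rho> then 1 else 0) = Suc j" using V by (simp add: sum.If_cases)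
      qed
      finally show ?thesis by simp
    qed
    define X where "X = {u \<in> V. \<not> real (b u) \<le> \<beta>1 * n ^ j}"
    have X: "real (card X) * real (card B) \<le> \<zeta> / 2 * n * real (card B)"
    proof (cases "n = 0")
      case True
      then have "X = {}" using V by (auto simp: n_def X_def)
      then show ?thesis using True by simp
    next
      case False
      then have n: "n > 0" by (simp add: n_def)
      have "real (card X) * (\<beta>1 * n ^ j) = (\<Sum>u\<in>X. \<beta>1 * n ^ j)" by simp
      also have "\<dots> \<le> (\<Sum>u\<in>X. real (b u))" by (intro sum_mono) (auto simp: X_def)
      also have "\<dots> \<le> (\<Sum>u\<in>V. real (b u))" using V by (intro sum_mono2) (auto simp: X_def)
      also have "\<dots> = real (Suc j) * real (card B)" using sum_b by (metis of_nat_mult of_nat_sum)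
      also have "\<dots> \<le> real (Suc j) * (\<beta> * n ^ Suc j)" using B(2) by (intro mult_left_mono) (auto simp: n_def)
      also have "\<dots> = (\<zeta> / 2 * n) * (\<beta>1 * n ^ j)" by (simp add: \<beta>_def field_simps del: of_nat_Suc)
      finally have "real (card X) \<le> \<zeta> / 2 * n" using \<beta>1 n by (simp add: mult_le_cancel_right)
      then show ?thesis by (intro mult_right_mono) auto
    qed
    have "card T \<le> (\<Sum>u\<in>V. t u)"
    proof -
      have "T \<subseteq> (\<Union>u\<in>V. {\<tau> \<in> T. u \<in> \<tau>})"
      proof
        fix \<tau> assume "\<tau> \<in> T"
        moreover from this obtain u where "u \<in> \<tau>" by (fastforce simp: T_def)
        ultimately show "\<tau> \<in> (\<Union>u\<in>V. {\<tau> \<in> T. u \<in> \<tau>})" by (auto simp: T_def)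
      qed
      then have "card T \<le> card (\<Union>u\<in>V. {\<tau> \<in> T. u \<in> \<tau>})" using V finT by (intro card_mono) auto
      also have "\<dots> \<le> (\<Sum>u\<in>V. t u)" unfolding t_def by (rule card_UN_le[OF V])
      finally show ?thesis .
    qed
    then have "real (card T) \<le> (\<Sum>u\<in>V. real (t u))" by (metis of_nat_le_iff of_nat_sum)
    also have "\<dots> \<le> (\<Sum>u\<in>V. \<zeta>1 * n * real (b u) + (if u \<in> X then real (card B) else 0))"
    proof (rule sum_mono)
      fix u assume u: "u \<in> V"
      show "real (t u) \<le> \<zeta>1 * n * real (b u) + (if u \<in> X then real (card B) else 0)"
      proof (cases "u \<in> X")
        case True
        then show ?thesis using t_le_B[of u] \<open>\<zeta>1 > 0\<close> by (simp add: n_def add_increasing)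
      next
        case False
        then show ?thesis using t_light[of u] u by (simp add: X_def)
      qed
    qed
    also have "\<dots> = \<zeta>1 * n * (\<Sum>u\<in>V. real (b u)) + real (card X) * real (card B)"
    proof -
      have "V \<inter> {u. u \<in> X} = X" by (auto simp: X_def)
      then show ?thesis using V by (simp add: sum.distrib sum_distrib_left sum.If_cases)
    qed
    also have "(\<Sum>u\<in>V. real (b u)) = real (Suc j) * real (card B)" using sum_b by (metis of_nat_mult of_nat_sum)
    also have "\<zeta>1 * n * (real (Suc j) * real (card B)) = \<zeta> / 2 * n * real (card B)"
      by (simp add: \<zeta>1_def field_simps del: of_nat_Suc)
    also have "\<zeta> / 2 * n * real (card B) + real (card X) * real (card B) \<le> \<zeta> / 2 * n * real (card B) + \<zeta> / 2 * n * real (card B)"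
      using X by simp
    also have "\<dots> = \<zeta> * n * real (card B)" by simp
    finally show "real (card {\<tau>. \<tau> \<subseteq> V \<and> card \<tau> = Suc (Suc j) \<and> (\<forall>u\<in>\<tau>. \<tau> - {u} \<in> B)}) \<le> \<zeta> * real (card V) * real (card B)"
      by (simp add: T_def n_def)
  qed
qed

section \<open>Walks inside a core\<close>

definition facets :: "nat set \<Rightarrow> nat set set" where
  "facets \<sigma> = (\<lambda>u. \<sigma> - {u}) ` \<sigma>"

definition ridges :: "nat set set \<Rightarrow> nat set set" where
  "ridges S = (\<Union>\<sigma>\<in>S. facets \<sigma>)"

text \<open>The facets that lie in exactly one face of \<open>S\<close>. A core containing \<open>S\<close> must contain another face across each of
them, so an exploration can continue there.\<close>

definition exposed :: "nat set set \<Rightarrow> nat set set" where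
  "exposed S = {\<tau> \<in> ridges S. \<exists>!\<sigma>. \<sigma> \<in> S \<and> \<tau> \<subseteq> \<sigma>}"

definition pick :: "nat set set \<Rightarrow> nat set" where
  "pick S = (SOME \<tau>. \<tau> \<in> exposed S)"

lemma pick_in: "exposed S \<noteq> {} \<Longrightarrow> pick S \<in> exposed S"
  unfolding pick_def by (rule someI_ex) auto

lemma mem_facets:
  assumes "card \<sigma> = d + 1" shows "\<rho> \<in> facets \<sigma> \<longleftrightarrow> \<rho> \<subseteq> \<sigma> \<and> card \<rho> = d"
proof
  assume "\<rho> \<in> facets \<sigma>"
  then show "\<rho> \<subseteq> \<sigma> \<and> card \<rho> = d" using assms by (auto simp: facets_def)
next
  assume \<rho>: "\<rho> \<subseteq> \<sigma> \<and> card \<rho> = d"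
  have fin: "finite \<sigma>" using assms by (intro card_ge_0_finite) simp
  then have "finite \<rho>" using \<rho> finite_subset by blast
  then have "card (\<sigma> - \<rho>) = 1" using \<rho> assms by (simp add: card_Diff_subset)
  then obtain u where u: "\<sigma> - \<rho> = {u}" by (auto simp: card_1_singleton_iff)
  then have "\<rho> = \<sigma> - {u}" "u \<in> \<sigma>" using \<rho> by auto
  then show "\<rho> \<in> facets \<sigma>" unfolding facets_def by blast
qed

lemma card_facets_le: "finite \<sigma> \<Longrightarrow> card (facets \<sigma>) \<le> card \<sigma>"
  unfolding facets_def by (rule card_image_le)

lemma facets_insert:
  assumes "v \<notin> \<tau>" shows "facets (insert v \<tau>) = insert \<tau> ((\<lambda>u. insert v (\<tau> - {u})) ` \<tau>)"
proof -
  have "insert v \<tau> - {v} = \<tau>" using assms by auto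
  moreover have "(\<lambda>u. insert v \<tau> - {u}) ` \<tau> = (\<lambda>u. insert v (\<tau> - {u})) ` \<tau>"
    using assms by (intro image_cong) auto
  ultimately show ?thesis by (simp add: facets_def)
qed

lemma mem_ridges:
  assumes "\<And>\<sigma>. \<sigma> \<in> S \<Longrightarrow> card \<sigma> = d + 1"
  shows "\<rho> \<in> ridges S \<longleftrightarrow> card \<rho> = d \<and> (\<exists>\<sigma>\<in>S. \<rho> \<subseteq> \<sigma>)"
  unfolding ridges_def using mem_facets[OF assms] by auto

lemma ridges_insert: "ridges (insert \<sigma> S) = facets \<sigma> \<union> ridges S"
  by (simp add: ridges_def)

lemma ridges_mono: "S \<subseteq> S' \<Longrightarrow> ridges S \<subseteq> ridges S'"
  by (auto simp: ridges_def)

lemma exposed_insert: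
  assumes "\<And>\<sigma>'. \<sigma>' \<in> insert \<sigma> S \<Longrightarrow> card \<sigma>' = d + 1" "\<sigma> \<notin> S"
  shows "exposed (insert \<sigma> S) = (exposed S - facets \<sigma>) \<union> (facets \<sigma> - ridges S)"
proof -
  have S: "\<And>\<sigma>'. \<sigma>' \<in> S \<Longrightarrow> card \<sigma>' = d + 1" using assms(1) by simp
  have "\<rho> \<in> exposed (insert \<sigma> S) \<longleftrightarrow> \<rho> \<in> (exposed S - facets \<sigma>) \<union> (facets \<sigma> - ridges S)" for \<rho>
  proof (cases "card \<rho> = d")
    case True
    have 1: "(\<exists>!\<sigma>'. \<sigma>' \<in> insert \<sigma> S \<and> \<rho> \<subseteq> \<sigma>') \<longleftrightarrow>
      ((\<exists>!\<sigma>'. \<sigma>' \<in> S \<and> \<rho> \<subseteq> \<sigma>') \<and> \<not> \<rho> \<subseteq> \<sigma>) \<or> (\<rho> \<subseteq> \<sigma> \<and> \<not> (\<exists>\<sigma>'\<in>S. \<rho> \<subseteq> \<sigma>'))"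
      using assms(2) by (cases "\<rho> \<subseteq> \<sigma>") auto
    have f: "\<rho> \<in> facets \<sigma> \<longleftrightarrow> \<rho> \<subseteq> \<sigma>" using mem_facets[where \<sigma> = \<sigma> and d = d and \<rho> = \<rho>] assms(1) True by simp
    have r: "\<rho> \<in> ridges S \<longleftrightarrow> (\<exists>\<sigma>'\<in>S. \<rho> \<subseteq> \<sigma>')" using mem_ridges[OF S, where \<rho> = \<rho>] True by simp
    have r': "\<rho> \<in> ridges (insert \<sigma> S) \<longleftrightarrow> \<rho> \<subseteq> \<sigma> \<or> (\<exists>\<sigma>'\<in>S. \<rho> \<subseteq> \<sigma>')" unfolding ridges_insert Un_iff f r ..
    show ?thesis unfolding exposed_def mem_Collect_eq Un_iff Diff_iff 1 f r r' by auto
  next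
    case False
    then have "\<rho> \<notin> ridges S" "\<rho> \<notin> facets \<sigma>" using mem_ridges[OF S, where \<rho> = \<rho>] mem_facets[where \<sigma> = \<sigma> and d = d and \<rho> = \<rho>] assms(1) by auto
    then show ?thesis unfolding exposed_def by (simp add: ridges_insert)
  qed
  then show ?thesis by blast
qed

lemma core_if_not_exposed:
  assumes "S \<noteq> {}" "\<And>\<sigma>. \<sigma> \<in> S \<Longrightarrow> card \<sigma> = d + 1" "exposed S = {}"
  shows "core S"
  unfolding core_def
proof (intro conjI ballI assms(1))
  fix \<sigma> u assume \<sigma>: "\<sigma> \<in> S" "u \<in> \<sigma>"
  have "\<sigma> - {u} \<in> ridges S" using \<sigma> by (auto simp: ridges_def facets_def)
  then have no: "\<not> (\<exists>!\<sigma>'. \<sigma>' \<in> S \<and> \<sigma> - {u} \<subseteq> \<sigma>')" using assms(3) unfolding exposed_def by simp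
  show "\<exists>\<sigma>'\<in>S. \<sigma>' \<noteq> \<sigma> \<and> \<sigma> - {u} \<subseteq> \<sigma>'"
  proof (rule ccontr)
    assume "\<not> ?thesis"
    then have "\<exists>!\<sigma>'. \<sigma>' \<in> S \<and> \<sigma> - {u} \<subseteq> \<sigma>'"
      using \<sigma>(1) by (intro ex1I[of _ \<sigma>]) auto
    then show False using no by simp
  qed
qed

text \<open>An exploration is the list of its faces, the most recent one first. Since the facet to be crossed is determined by the
faces seen so far, a step is described by the new vertex \<open>v\<close> alone. Walks stop when no facet is exposed.\<close>

primrec walks :: "nat set \<Rightarrow> nat \<Rightarrow> nat \<Rightarrow> nat set list set" where
  "walks V d 0 = (\<lambda>\<sigma>. [\<sigma>]) ` {\<sigma>. \<sigma> \<subseteq> V \<and> card \<sigma> = d + 1}"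
| "walks V d (Suc m) = (\<lambda>(xs, v). insert v (pick (set xs)) # xs) `
     (SIGMA xs:{xs \<in> walks V d m. exposed (set xs) \<noteq> {}}.
        {v \<in> V. v \<notin> pick (set xs) \<and> insert v (pick (set xs)) \<notin> set xs})"

lemma walks_induct [consumes 1, case_names start step]:
  assumes "xs \<in> walks V d m"
    and "\<And>\<sigma>. \<sigma> \<subseteq> V \<Longrightarrow> card \<sigma> = d + 1 \<Longrightarrow> P 0 [\<sigma>]"
    and "\<And>m xs v. xs \<in> walks V d m \<Longrightarrow> P m xs \<Longrightarrow> pick (set xs) \<in> exposed (set xs) \<Longrightarrow> v \<in> V \<Longrightarrow> v \<notin> pick (set xs) \<Longrightarrow>
       insert v (pick (set xs)) \<notin> set xs \<Longrightarrow> P (Suc m) (insert v (pick (set xs)) # xs)"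
  shows "P m xs"
  using assms(1)
proof (induction m arbitrary: xs)
  case 0
  then show ?case using assms(2) by auto
next
  case (Suc m)
  then obtain ys v where "ys \<in> walks V d m" "exposed (set ys) \<noteq> {}" "v \<in> V" "v \<notin> pick (set ys)"
    "insert v (pick (set ys)) \<notin> set ys" "xs = insert v (pick (set ys)) # ys" by auto
  then show ?case using assms(3)[of ys m v] Suc.IH[of ys] pick_in by simp
qed

lemma walks_basic:
  assumes "xs \<in> walks V d m"
  shows "length xs = Suc m \<and> distinct xs \<and> (\<forall>\<sigma>\<in>set xs. \<sigma> \<subseteq> V \<and> card \<sigma> = d + 1)"
  using assms
proof (induction rule: walks_induct)
  case (step m xs v)
  have "pick (set xs) \<in> ridges (set xs)" using step.hyps by (simp add: exposed_def)
  moreover have "\<rho> \<in> ridges (set xs) \<longleftrightarrow> card \<rho> = d \<and> (\<exists>\<sigma>\<in>set xs. \<rho> \<subseteq> \<sigma>)" for \<rho>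
    by (rule mem_ridges) (use step.IH in blast)
  ultimately obtain \<sigma> where \<sigma>: "card (pick (set xs)) = d" "\<sigma> \<in> set xs" "pick (set xs) \<subseteq> \<sigma>" by blast
  have s: "\<sigma> \<subseteq> V" "card \<sigma> = d + 1" using step.IH \<sigma>(2) by auto
  then have "finite \<sigma>" by (intro card_ge_0_finite) simp
  then have "finite (pick (set xs))" using \<sigma>(3) finite_subset by blast
  then have "card (insert v (pick (set xs))) = d + 1" using step.hyps \<sigma>(1) by simp
  moreover have "insert v (pick (set xs)) \<subseteq> V" using step.hyps \<sigma>(3) s(1) by auto
  ultimately show ?case using step by simp
qed simp

lemma finite_walks: "finite V \<Longrightarrow> finite (walks V d m)"
  by (induction m) auto

text \<open>As long as some facet is exposed, the core supplies a new face across it. Inside a finite core this must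
end, and then no facet is exposed.\<close>

lemma core_contains_walk:
  assumes K: "core K" "finite K" "\<And>\<sigma>. \<sigma> \<in> K \<Longrightarrow> \<sigma> \<subseteq> V \<and> card \<sigma> = d + 1"
  shows "\<exists>m. \<exists>xs\<in>walks V d m. set xs \<subseteq> K \<and> exposed (set xs) = {}"
proof (rule ccontr)
  assume no: "\<not> ?thesis"
  have "\<exists>xs\<in>walks V d m. set xs \<subseteq> K" for m
  proof (induction m)
    case 0
    obtain \<sigma> where "\<sigma> \<in> K" using K(1) by (auto simp: core_def)
    then show ?case using K(3) by (intro bexI[of _ "[\<sigma>]"]) auto
  next
    case (Suc m)
    then obtain xs where xs: "xs \<in> walks V d m" "set xs \<subseteq> K" by blast
    have ex: "exposed (set xs) \<noteq> {}" using no xs by blast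
    define \<tau> where "\<tau> = pick (set xs)"
    have \<tau>: "\<tau> \<in> exposed (set xs)" unfolding \<tau>_def by (rule pick_in[OF ex])
    then have "\<tau> \<in> ridges (set xs)" by (simp add: exposed_def)
    then obtain \<sigma> u where \<sigma>: "\<sigma> \<in> set xs" "u \<in> \<sigma>" "\<tau> = \<sigma> - {u}" by (auto simp: ridges_def facets_def)
    have "\<sigma> \<in> K" using \<sigma>(1) xs(2) by auto
    have "\<exists>v. v \<notin> \<sigma> \<and> insert v (\<sigma> - {u}) \<in> K"
      by (rule core_neighbour[OF K(1) _ \<open>\<sigma> \<in> K\<close> \<sigma>(2), of "d + 1"]) (use K(3) in auto)
    then obtain v where v: "v \<notin> \<sigma>" "insert v \<tau> \<in> K" using \<sigma>(3) by auto
    have "insert v \<tau> \<notin> set xs"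
    proof
      assume "insert v \<tau> \<in> set xs"
      moreover have "\<exists>!\<sigma>. \<sigma> \<in> set xs \<and> \<tau> \<subseteq> \<sigma>" using \<tau> by (simp add: exposed_def)
      moreover have "\<tau> \<subseteq> insert v \<tau>" "\<tau> \<subseteq> \<sigma>" using \<sigma> by auto
      ultimately have "insert v \<tau> = \<sigma>" using \<sigma>(1) by blast
      then show False using v(1) by auto
    qed
    moreover have "v \<in> V" using K(3)[OF v(2)] by auto
    moreover have "v \<notin> \<tau>" using v \<sigma> by auto
    ultimately have "insert v \<tau> # xs \<in> walks V d (Suc m)"
      using xs(1) ex unfolding walks.simps \<tau>_def by (intro image_eqI[of _ _ "(xs, v)"]) auto
    then show ?case using v(2) xs(2) by (intro bexI[of _ "insert v \<tau> # xs"]) auto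
  qed
  then obtain xs where xs: "xs \<in> walks V d (card K)" "set xs \<subseteq> K" by blast
  then have "length xs = Suc (card K)" "distinct xs" using walks_basic by blast+
  then have "card (set xs) = Suc (card K)" by (simp add: distinct_card)
  then show False using card_mono[OF K(2) xs(2)] by simp
qed

text \<open>A step across \<open>\<tau> = pick S\<close> to the vertex \<open>v\<close> is a gain if some proper subset \<open>\<eta>\<close> of \<open>\<tau>\<close> that is not exceptional (not in
\<open>H\<close>) becomes exceptional or becomes a facet seen before when \<open>v\<close> is added. There are few such \<open>v\<close> if \<open>S\<close> is
\<open>light\<close>. The family \<open>H\<close> collects the sets for which there are many such vertices.\<close>

definition gain :: "nat set set \<Rightarrow> nat set set \<Rightarrow> nat set \<Rightarrow> bool" where
  "gain H S \<sigma> \<longleftrightarrow> (\<exists>\<eta> v. \<eta> \<subset> pick S \<and> v \<in> \<sigma> - pick S \<and> \<eta> \<notin> H \<and> insert v \<eta> \<in> H \<union> ridges S)"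

primrec gains :: "nat set set \<Rightarrow> nat set list \<Rightarrow> nat" where
  "gains H [] = 0"
| "gains H (\<sigma> # xs) = gains H xs + (if xs \<noteq> [] \<and> gain H (set xs) \<sigma> then 1 else 0)"

text \<open>A step across a facet is accounted for by the clean subsets with one element less. Pure facets have all
of them, foul ones none.\<close>

definition clean :: "nat set set \<Rightarrow> nat set \<Rightarrow> bool" where
  "clean H \<alpha> \<longleftrightarrow> (\<forall>\<eta>\<subseteq>\<alpha>. \<eta> \<notin> H)"

definition pure :: "nat set set \<Rightarrow> nat set \<Rightarrow> bool" where
  "pure H \<tau> \<longleftrightarrow> (\<forall>u\<in>\<tau>. clean H (\<tau> - {u}))"

definition foul :: "nat set set \<Rightarrow> nat set \<Rightarrow> bool" where
  "foul H \<tau> \<longleftrightarrow> (\<forall>u\<in>\<tau>. \<not> clean H (\<tau> - {u}))"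

text \<open>Consider a step that is no gain. For each \<open>u \<in> \<tau>\<close> with \<open>\<tau> - {u}\<close> clean, the new facet \<open>insert v (\<tau> - {u})\<close> has not been
seen before and is pure. If \<open>\<tau>\<close> is pure, it ceases to be exposed, but all \<open>d \<ge> 2\<close> new facets are pure. If \<open>\<tau>\<close> is not pure, at least one new
facet is, unless \<open>\<tau>\<close> is foul, and then \<open>\<tau>\<close> itself joins the foul facets that are no longer exposed.
In each case the count on the left increases by at least one. A gain destroys at most the \<open>d + 1\<close> facets of
the new face.\<close>

lemma gain_step:
  assumes S: "finite S" "\<And>\<sigma>. \<sigma> \<in> S \<Longrightarrow> card \<sigma> = d + 1" and d: "d \<ge> 2"
    and \<tau>: "\<tau> = pick S" "\<tau> \<in> exposed S" and v: "v \<notin> \<tau>" "insert v \<tau> \<notin> S"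
  defines "S' \<equiv> insert (insert v \<tau>) S"
  shows "card {\<rho> \<in> exposed S. pure H \<rho>} + card {\<rho> \<in> ridges S - exposed S. foul H \<rho>} + 1 \<le>
    (if gain H S (insert v \<tau>) then d + 2 else 0) +
    card {\<rho> \<in> exposed S'. pure H \<rho>} + card {\<rho> \<in> ridges S' - exposed S'. foul H \<rho>}"
proof -
  define \<sigma> where "\<sigma> = insert v \<tau>"
  have \<tau>r: "\<tau> \<in> ridges S" using \<tau>(2) by (simp add: exposed_def)
  have c\<tau>: "card \<tau> = d" using mem_ridges[OF S(2)] \<tau>r by blast
  then have fin\<tau>: "finite \<tau>" using d by (intro card_ge_0_finite) simp
  have c\<sigma>: "card \<sigma> = d + 1" using c\<tau> fin\<tau> v(1) by (simp add: \<sigma>_def)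
  have uni: "card \<sigma>' = d + 1" if "\<sigma>' \<in> insert \<sigma> S" for \<sigma>' using that S(2) c\<sigma> by auto
  have exp': "exposed S' = (exposed S - facets \<sigma>) \<union> (facets \<sigma> - ridges S)"
    unfolding S'_def \<sigma>_def[symmetric] by (rule exposed_insert[OF uni]) (use v(2) in \<open>simp_all add: \<sigma>_def\<close>)
  have rid': "ridges S' = facets \<sigma> \<union> ridges S" unfolding S'_def \<sigma>_def[symmetric] by (rule ridges_insert)
  have fac: "facets \<sigma> = insert \<tau> ((\<lambda>u. insert v (\<tau> - {u})) ` \<tau>)"
    unfolding \<sigma>_def by (rule facets_insert[OF v(1)])
  have fin_fac: "finite (facets \<sigma>)" unfolding fac using fin\<tau> by simp
  have fin_s: "finite s" if "s \<in> S" for s using S(2)[OF that] by (intro card_ge_0_finite) simp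
  have fin_rid: "finite (ridges S)"
    unfolding ridges_def facets_def using S(1) fin_s by auto
  have fin_exp: "finite (exposed S)" by (rule finite_subset[OF _ fin_rid]) (auto simp: exposed_def)
  have fin_rid': "finite (ridges S')" unfolding rid' using fin_fac fin_rid by simp
  have fin_exp': "finite (exposed S')" by (rule finite_subset[OF _ fin_rid']) (auto simp: exposed_def)
  define U where "U = {\<rho> \<in> exposed S. pure H \<rho>}"
  define U' where "U' = {\<rho> \<in> exposed S'. pure H \<rho>}"
  define Q where "Q = {\<rho> \<in> ridges S - exposed S. foul H \<rho>}"
  define Q' where "Q' = {\<rho> \<in> ridges S' - exposed S'. foul H \<rho>}"
  have fin: "finite U" "finite U'" "finite Q" "finite Q'"
    using fin_exp fin_exp' fin_rid fin_rid' by (auto simp: U_def U'_def Q_def Q'_def)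
  have QQ': "Q \<subseteq> Q'" unfolding Q_def Q'_def exp' rid' by auto
  then have cQ: "card Q \<le> card Q'" by (rule card_mono[OF fin(4)])
  show ?thesis
  proof (cases "gain H S \<sigma>")
    case True
    have "U \<subseteq> U' \<union> facets \<sigma>" unfolding U_def U'_def exp' by auto
    then have "card U \<le> card (U' \<union> facets \<sigma>)" using fin fin_fac by (intro card_mono) auto
    also have "\<dots> \<le> card U' + card (facets \<sigma>)" by (rule card_Un_le)
    also have "card (facets \<sigma>) \<le> d + 1" using card_facets_le[of \<sigma>] c\<sigma> fin\<tau> by (simp add: \<sigma>_def)
    finally have "card U \<le> card U' + (d + 1)" by simp
    then show ?thesis using True cQ unfolding U_def[symmetric] U'_def[symmetric] Q_def[symmetric] Q'_def[symmetric] \<sigma>_def[symmetric]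
      by simp
  next
    case False
    have nog: "insert v \<eta> \<notin> H" "insert v \<eta> \<notin> ridges S" if "\<eta> \<subset> \<tau>" "\<eta> \<notin> H" for \<eta>
      using False that v(1) unfolding gain_def \<tau>(1)[symmetric] \<sigma>_def by blast+
    have psub: "\<tau> - {u} \<subset> \<tau>" if "u \<in> \<tau>" for u using that by auto
    have new: "insert v (\<tau> - {u}) \<notin> ridges S" if "u \<in> \<tau>" "clean H (\<tau> - {u})" for u
      by (rule nog(2)[OF psub[OF that(1)]]) (use that(2) in \<open>auto simp: clean_def\<close>)
    have new_pure: "pure H (insert v (\<tau> - {u}))" if u: "u \<in> \<tau>" and cl: "clean H (\<tau> - {u})" for u
      unfolding pure_def
    proof
      fix x assume x: "x \<in> insert v (\<tau> - {u})"
      show "clean H (insert v (\<tau> - {u}) - {x})"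
        unfolding clean_def
      proof (intro allI impI)
        fix \<eta> assume \<eta>: "\<eta> \<subseteq> insert v (\<tau> - {u}) - {x}"
        show "\<eta> \<notin> H"
        proof (cases "v \<in> \<eta>")
          case True
          have "\<eta> - {v} \<subseteq> \<tau> - {u}" using \<eta> by auto
          then have "\<eta> - {v} \<notin> H" "\<eta> - {v} \<subset> \<tau>" using cl u by (auto simp: clean_def)
          then have "insert v (\<eta> - {v}) \<notin> H" by (intro nog)
          then show ?thesis using True by (simp add: insert_absorb)
        next
          case False
          then have "\<eta> \<subseteq> \<tau> - {u}" using \<eta> by auto
          then show ?thesis using cl by (simp add: clean_def)
        qed
      qed
    qed
    have old_pure: "clean H (\<tau> - {u})" if "u \<in> \<tau>" "pure H (insert v (\<tau> - {u}))" for u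
    proof -
      have "clean H (insert v (\<tau> - {u}) - {v})" using that(2) by (simp add: pure_def)
      moreover have "insert v (\<tau> - {u}) - {v} = \<tau> - {u}" using v(1) by auto
      ultimately show ?thesis by simp
    qed
    have lost: "U \<inter> facets \<sigma> \<subseteq> {\<tau>}"
    proof
      fix \<rho> assume \<rho>: "\<rho> \<in> U \<inter> facets \<sigma>"
      then have \<rho>r: "\<rho> \<in> ridges S" "pure H \<rho>" by (auto simp: U_def exposed_def)
      show "\<rho> \<in> {\<tau>}"
      proof (rule ccontr)
        assume "\<rho> \<notin> {\<tau>}"
        then obtain u where u: "u \<in> \<tau>" "\<rho> = insert v (\<tau> - {u})" using \<rho> unfolding fac by auto
        then show False using new[OF u(1) old_pure[OF u(1)]] \<rho>r by simp
      qed
    qed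
    define P where "P = {u \<in> \<tau>. clean H (\<tau> - {u})}"
    define Nw where "Nw = (\<lambda>u. insert v (\<tau> - {u})) ` P"
    have cNw: "card Nw = card P"
      unfolding Nw_def
    proof (rule card_image, rule inj_onI)
      fix x y assume "x \<in> P" "y \<in> P" "insert v (\<tau> - {x}) = insert v (\<tau> - {y})"
      then have "x \<in> \<tau>" "y \<in> \<tau>" "\<tau> - {x} = \<tau> - {y}" using v(1) unfolding P_def by auto
      then show "x = y" by auto
    qed
    have NwU': "Nw \<subseteq> U'"
      unfolding Nw_def U'_def exp' P_def fac using new new_pure by auto
    have Nw_r: "Nw \<inter> ridges S = {}" unfolding Nw_def P_def using new by auto
    have U_r: "U \<subseteq> ridges S" by (auto simp: U_def exposed_def)
    have keep: "U - {\<tau>} \<subseteq> U'"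
    proof
      fix \<rho> assume \<rho>: "\<rho> \<in> U - {\<tau>}"
      then have "\<rho> \<notin> facets \<sigma>" using lost by auto
      then show "\<rho> \<in> U'" using \<rho> unfolding U_def U'_def exp' by auto
    qed
    have total: "card (U - {\<tau>}) + card P \<le> card U'"
    proof -
      have "card ((U - {\<tau>}) \<union> Nw) = card (U - {\<tau>}) + card Nw"
        using fin(1) fin\<tau> U_r Nw_r by (intro card_Un_disjoint) (auto simp: Nw_def P_def)
      moreover have "card ((U - {\<tau>}) \<union> Nw) \<le> card U'"
        using keep NwU' by (intro card_mono fin(2)) auto
      ultimately show ?thesis using cNw by simp
    qed
    have main: "card U + card Q + 1 \<le> card U' + card Q'"
    proof (cases "P = {}")
      case True
      then have foul: "foul H \<tau>" by (auto simp: foul_def P_def)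
      obtain u where u: "u \<in> \<tau>" using c\<tau> d by fastforce
      then have "\<not> pure H \<tau>" using foul by (auto simp: foul_def pure_def)
      then have "\<tau> \<notin> U" by (simp add: U_def)
      then have UU': "card U \<le> card U'" using total by simp
      have "\<tau> \<in> Q'" unfolding Q'_def exp' rid' using \<tau>r foul by (auto simp: fac)
      moreover have "\<tau> \<notin> Q" using \<tau>(2) by (simp add: Q_def)
      ultimately have "Q \<subset> Q'" using QQ' by auto
      then have "card Q < card Q'" by (rule psubset_card_mono[OF fin(4)])
      then show ?thesis using UU' by simp
    next
      case False
      show ?thesis
      proof (cases "\<tau> \<in> U")
        case True
        then have "P = \<tau>" by (auto simp: U_def pure_def P_def)
        then have "card P \<ge> 2" using c\<tau> d by simp
        moreover have "card (U - {\<tau>}) = card U - 1" "card U > 0" using True fin(1) by (auto simp: card_gt_0_iff)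
        ultimately show ?thesis using total cQ by simp
      next
        case notU: False
        have "finite P" using fin\<tau> by (simp add: P_def)
        then have "card P \<ge> 1" using False by (simp add: Suc_leI card_gt_0_iff)
        then show ?thesis using total cQ notU by simp
      qed
    qed
    then show ?thesis using False unfolding U_def[symmetric] U'_def[symmetric] Q_def[symmetric] Q'_def[symmetric] \<sigma>_def[symmetric]
      by simp
  qed
qed

text \<open>When no facet is exposed any more, the second summand is \<open>0\<close>. So, apart from foul facets, a proportion of
at least \<open>1 / (d + 2)\<close> of the steps are gains.\<close>

lemma walk_invariant:
  assumes "xs \<in> walks V d m" "d \<ge> 2"
  shows "m \<le> (d + 2) * gains H xs + card {\<rho> \<in> exposed (set xs). pure H \<rho>} + card {\<rho> \<in> ridges (set xs) - exposed (set xs). foul H \<rho>}"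
  using assms(1)
proof (induction rule: walks_induct)
  case (step m xs v)
  have b: "length xs = Suc m" "\<And>\<sigma>. \<sigma> \<in> set xs \<Longrightarrow> card \<sigma> = d + 1" using walks_basic[OF step.hyps(1)] by auto
  have "xs \<noteq> []" using b(1) by auto
  then show ?case
    using gain_step[of "set xs" d "pick (set xs)" v H] b(2) assms(2) step.hyps step.IH by (simp split: if_splits)
qed simp

section \<open>Weighted counting of walks\<close>

text \<open>The bound \<open>\<theta>\<close> for the number of vertices that make a given unexceptional \<open>\<eta>\<close> exceptional or a facet of \<open>S\<close>, as needed to
bound the number of gains.\<close>

definition light :: "nat set \<Rightarrow> nat set set \<Rightarrow> real \<Rightarrow> nat \<Rightarrow> nat set set \<Rightarrow> bool" where
  "light V H \<theta> d S \<longleftrightarrow> (\<forall>\<eta>. \<eta> \<subseteq> V \<longrightarrow> card \<eta> < d \<longrightarrow> \<eta> \<notin> H \<longrightarrow> real (card {v \<in> V. insert v \<eta> \<in> H \<union> ridges S}) \<le> \<theta>)"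

lemma light_antimono:
  assumes "finite V" "light V H \<theta> d S'" "S \<subseteq> S'" shows "light V H \<theta> d S"
  unfolding light_def
proof (intro allI impI)
  fix \<eta> assume \<eta>: "\<eta> \<subseteq> V" "card \<eta> < d" "\<eta> \<notin> H"
  have "card {v \<in> V. insert v \<eta> \<in> H \<union> ridges S} \<le> card {v \<in> V. insert v \<eta> \<in> H \<union> ridges S'}"
    using assms(1) ridges_mono[OF assms(3)] by (intro card_mono) auto
  also have "real \<dots> \<le> \<theta>" using assms(2) \<eta> by (simp add: light_def)
  finally show "real (card {v \<in> V. insert v \<eta> \<in> H \<union> ridges S}) \<le> \<theta>" by simp
qed

lemma card_gain_choices:
  assumes V: "finite V" and l: "light V H \<theta> d S" and \<tau>: "pick S \<subseteq> V" "card (pick S) = d" and \<theta>: "\<theta> \<ge> 0"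
  shows "real (card {v \<in> V. v \<notin> pick S \<and> gain H S (insert v (pick S))}) \<le> 2 ^ d * \<theta>"
proof -
  define E where "E = {\<eta>. \<eta> \<subset> pick S \<and> \<eta> \<notin> H}"
  have fin: "finite (pick S)" using \<tau>(1) V finite_subset by blast
  have E: "finite E" "card E \<le> 2 ^ d"
  proof -
    have sub: "E \<subseteq> Pow (pick S)" by (auto simp: E_def)
    show "finite E" by (rule finite_subset[OF sub]) (simp add: fin)
    have "card E \<le> card (Pow (pick S))" by (rule card_mono[OF _ sub]) (simp add: fin)
    then show "card E \<le> 2 ^ d" using \<tau>(2) fin by (simp add: card_Pow)
  qed
  have "{v \<in> V. v \<notin> pick S \<and> gain H S (insert v (pick S))} \<subseteq> (\<Union>\<eta>\<in>E. {v \<in> V. insert v \<eta> \<in> H \<union> ridges S})"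
  proof
    fix v assume "v \<in> {v \<in> V. v \<notin> pick S \<and> gain H S (insert v (pick S))}"
    then have v: "v \<in> V" "v \<notin> pick S" "gain H S (insert v (pick S))" by auto
    from v(3) obtain \<eta> w where "\<eta> \<subset> pick S" "w \<in> insert v (pick S) - pick S" "\<eta> \<notin> H" "insert w \<eta> \<in> H \<union> ridges S"
      unfolding gain_def by blast
    then show "v \<in> (\<Union>\<eta>\<in>E. {v \<in> V. insert v \<eta> \<in> H \<union> ridges S})"
      using v(1) by (intro UN_I[of \<eta>]) (auto simp: E_def)
  qed
  then have "card {v \<in> V. v \<notin> pick S \<and> gain H S (insert v (pick S))} \<le> card (\<Union>\<eta>\<in>E. {v \<in> V. insert v \<eta> \<in> H \<union> ridges S})"
    using E(1) V by (intro card_mono) auto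
  also have "\<dots> \<le> (\<Sum>\<eta>\<in>E. card {v \<in> V. insert v \<eta> \<in> H \<union> ridges S})" by (rule card_UN_le[OF E(1)])
  finally have "real (card {v \<in> V. v \<notin> pick S \<and> gain H S (insert v (pick S))}) \<le> (\<Sum>\<eta>\<in>E. real (card {v \<in> V. insert v \<eta> \<in> H \<union> ridges S}))"
    unfolding of_nat_sum[symmetric] by (rule of_nat_mono)
  also have "\<dots> \<le> (\<Sum>\<eta>\<in>E. \<theta>)"
  proof (rule sum_mono)
    fix \<eta> assume "\<eta> \<in> E"
    then have \<eta>: "\<eta> \<subset> pick S" "\<eta> \<notin> H" by (simp_all add: E_def)
    have "\<eta> \<subseteq> V" "card \<eta> < d" using \<eta>(1) \<tau> psubset_card_mono[OF fin \<eta>(1)] by auto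
    then show "real (card {v \<in> V. insert v \<eta> \<in> H \<union> ridges S}) \<le> \<theta>"
      using l[unfolded light_def, rule_format, OF _ _ \<eta>(2)] by simp
  qed
  also have "\<dots> = real (card E) * \<theta>" by simp
  also have "\<dots> \<le> 2 ^ d * \<theta>" using of_nat_mono[OF E(2), where ?'a = real] \<theta> by (intro mult_right_mono) simp_all
  finally show ?thesis .
qed

lemma pick_walk:
  assumes "xs \<in> walks V d m" "exposed (set xs) \<noteq> {}"
  shows "pick (set xs) \<subseteq> V \<and> card (pick (set xs)) = d"
proof -
  have "pick (set xs) \<in> ridges (set xs)" using pick_in[OF assms(2)] by (simp add: exposed_def)
  then obtain \<sigma> u where "\<sigma> \<in> set xs" "u \<in> \<sigma>" "pick (set xs) = \<sigma> - {u}" by (auto simp: ridges_def facets_def)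
  then show ?thesis using walks_basic[OF assms(1)] by auto
qed

text \<open>Each step chooses among at most \<open>card V\<close> vertices with weight \<open>1\<close>, or among at most \<open>2^d * \<theta>\<close> vertices, by
\<open>card_gain_choices\<close>, with weight \<open>z\<close>.\<close>

lemma walks_weight:
  assumes V: "finite V" and \<theta>: "\<theta> \<ge> 0" and z: "z \<ge> 0"
  shows "(\<Sum>xs\<in>{xs \<in> walks V d m. light V H \<theta> d (set xs)}. z ^ gains H xs) \<le>
    real (card V choose (d + 1)) * (real (card V) + 2 ^ d * \<theta> * z) ^ m"
proof (induction m)
  case 0
  have "(\<Sum>xs\<in>{xs \<in> walks V d 0. light V H \<theta> d (set xs)}. z ^ gains H xs) \<le> (\<Sum>xs\<in>walks V d 0. z ^ gains H xs)"
    using V z by (intro sum_mono2) (auto intro: finite_walks)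
  also have "\<dots> = (\<Sum>\<sigma>\<in>{\<sigma>. \<sigma> \<subseteq> V \<and> card \<sigma> = d + 1}. 1)"
    unfolding walks.simps by (subst sum.reindex) (auto simp: inj_on_def)
  also have "\<dots> = real (card V choose (d + 1))" using n_subsets[OF V, of "d + 1"] by simp
  finally show ?case by simp
next
  case (Suc m)
  define W where "W = {xs \<in> walks V d m. light V H \<theta> d (set xs)}"
  define W1 where "W1 = {xs \<in> W. exposed (set xs) \<noteq> {}}"
  define A where "A xs = {v \<in> V. v \<notin> pick (set xs)}" for xs :: "nat set list"
  define h where "h = (\<lambda>(xs, v). insert v (pick (set xs)) # xs)"
  have finW: "finite W" "finite W1" using finite_walks[OF V, of d m] by (auto simp: W_def W1_def)
  have finA: "finite (A xs)" for xs using V by (simp add: A_def)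
  have "(\<Sum>xs\<in>{xs \<in> walks V d (Suc m). light V H \<theta> d (set xs)}. z ^ gains H xs) \<le> (\<Sum>xs\<in>h ` (SIGMA xs:W1. A xs). z ^ gains H xs)"
  proof (rule sum_mono2)
    show "finite (h ` (SIGMA xs:W1. A xs))" using finW finA by auto
    show "{xs \<in> walks V d (Suc m). light V H \<theta> d (set xs)} \<subseteq> h ` (SIGMA xs:W1. A xs)"
    proof
      fix ys assume "ys \<in> {xs \<in> walks V d (Suc m). light V H \<theta> d (set xs)}"
      then have ys: "ys \<in> walks V d (Suc m)" "light V H \<theta> d (set ys)" by auto
      from ys(1) obtain xs v where xs: "xs \<in> walks V d m" "exposed (set xs) \<noteq> {}" "v \<in> V" "v \<notin> pick (set xs)"
        "ys = insert v (pick (set xs)) # xs" by auto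
      have "light V H \<theta> d (set xs)" by (rule light_antimono[OF V ys(2)]) (use xs(5) in auto)
      then show "ys \<in> h ` (SIGMA xs:W1. A xs)"
        using xs by (intro image_eqI[of _ _ "(xs, v)"]) (auto simp: h_def W1_def W_def A_def)
    qed
  qed (use z in simp)
  also have "\<dots> \<le> (\<Sum>p\<in>(SIGMA xs:W1. A xs). z ^ gains H (h p))"
    using sum_image_le[of "SIGMA xs:W1. A xs" "\<lambda>xs. z ^ gains H xs" h] finW finA z by (simp add: o_def)
  also have "\<dots> = (\<Sum>xs\<in>W1. \<Sum>v\<in>A xs. z ^ gains H (h (xs, v)))"
    using finW finA by (subst sum.Sigma) auto
  also have "\<dots> \<le> (\<Sum>xs\<in>W1. z ^ gains H xs * (real (card V) + 2 ^ d * \<theta> * z))"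
  proof (rule sum_mono)
    fix xs assume xs: "xs \<in> W1"
    then have xw: "xs \<in> walks V d m" "light V H \<theta> d (set xs)" "exposed (set xs) \<noteq> {}" by (auto simp: W1_def W_def)
    let ?g = "\<lambda>v. gain H (set xs) (insert v (pick (set xs)))"
    have "(\<Sum>v\<in>A xs. z ^ gains H (h (xs, v))) \<le> (\<Sum>v\<in>A xs. z ^ gains H xs * (1 + (if ?g v then z else 0)))"
      using z by (intro sum_mono) (auto simp: h_def mult_left_mono distrib_left)
    also have "\<dots> = z ^ gains H xs * (real (card (A xs)) + z * real (card {v \<in> A xs. ?g v}))"
      using finA by (simp add: sum_distrib_left[symmetric] sum.distrib sum.If_cases Int_def)
    also have "\<dots> \<le> z ^ gains H xs * (real (card V) + z * (2 ^ d * \<theta>))"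
    proof (intro mult_left_mono add_mono)
      show "real (card (A xs)) \<le> real (card V)" using V by (auto simp: A_def intro!: card_mono)
      have "{v \<in> A xs. ?g v} = {v \<in> V. v \<notin> pick (set xs) \<and> ?g v}" by (auto simp: A_def)
      then show "real (card {v \<in> A xs. ?g v}) \<le> 2 ^ d * \<theta>"
        using card_gain_choices[OF V xw(2) _ _ \<theta>] pick_walk[OF xw(1,3)] by simp
    qed (use z in simp_all)
    finally show "(\<Sum>v\<in>A xs. z ^ gains H (h (xs, v))) \<le> z ^ gains H xs * (real (card V) + 2 ^ d * \<theta> * z)"
      by (simp add: ac_simps)
  qed
  also have "\<dots> \<le> (\<Sum>xs\<in>W. z ^ gains H xs * (real (card V) + 2 ^ d * \<theta> * z))"
    using finW z \<theta> by (intro sum_mono2) (auto simp: W1_def)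
  also have "\<dots> = (\<Sum>xs\<in>W. z ^ gains H xs) * (real (card V) + 2 ^ d * \<theta> * z)"
    by (rule sum_distrib_right[symmetric])
  also have "\<dots> \<le> (real (card V choose (d + 1)) * (real (card V) + 2 ^ d * \<theta> * z) ^ m) * (real (card V) + 2 ^ d * \<theta> * z)"
    unfolding W_def by (rule mult_right_mono[OF Suc]) (use z \<theta> in simp)
  finally show ?case by (simp add: ac_simps)
qed

lemma choose_le_power: "real (n choose r) \<le> real n ^ r"
proof (cases "r \<le> n")
  case True
  then have "n choose r \<le> n ^ r" by (rule binomial_le_pow)
  then show ?thesis by (metis of_nat_le_iff of_nat_power)
qed (simp add: binomial_eq_0)

definition dfaces :: "nat \<Rightarrow> nat \<Rightarrow> nat set set" where
  "dfaces d n = {\<sigma>. \<sigma> \<subseteq> {..<n} \<and> card \<sigma> = d + 1}"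

lemma finite_dfaces: "finite (dfaces d n)"
  by (simp add: dfaces_def)

text \<open>A union bound with Rankin's trick. The weight \<open>z = q^(-D)\<close> balances the two kinds of steps in \<open>walks_weight\<close>, so that the sum
of \<open>z ^ gains\<close> is at most \<open>n^(d+1) (2 n)^m\<close>. A walk with \<open>m \<le> D * gains\<close> has \<open>q^m * z^gains \<ge> 1\<close>, which gains the factor \<open>q^m\<close>.\<close>

lemma prob_walks_le:
  assumes n: "n > 0" and c: "0 < c" "c \<le> real n" and \<theta>: "\<theta> > 0" and q: "0 < q" "q \<le> 1" "q ^ D * real n = 2 ^ d * \<theta>"
    and WW: "\<And>xs. xs \<in> WW \<Longrightarrow> xs \<in> walks {..<n} d m \<and> light {..<n} H \<theta> d (set xs) \<and> m \<le> D * gains H xs"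
  shows "measure_pmf.prob (random_subset (dfaces d n) (c / real n)) {F. \<exists>xs\<in>WW. set xs \<subseteq> F} \<le> c * real n ^ d * (2 * c * q) ^ m"
proof -
  define p where "p = c / real n"
  have p: "0 \<le> p" "p \<le> 1" using n c by (auto simp: p_def)
  define z where "z = 1 / q ^ D"
  have z: "z \<ge> 0" using q by (simp add: z_def)
  have zt: "2 ^ d * \<theta> * z = real n" using q by (simp add: z_def flip: q(3))
  have fin: "finite WW" by (rule finite_subset[OF _ finite_walks[of "{..<n}" d m]]) (use WW in auto)
  have "measure_pmf.prob (random_subset (dfaces d n) p) {F. \<exists>xs\<in>WW. set xs \<subseteq> F} =
    measure_pmf.prob (random_subset (dfaces d n) p) (\<Union>xs\<in>WW. {F. set xs \<subseteq> F})"
    by (intro arg_cong[where f = "measure_pmf.prob _"]) auto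
  also have "\<dots> \<le> (\<Sum>xs\<in>WW. measure_pmf.prob (random_subset (dfaces d n) p) {F. set xs \<subseteq> F})"
    by (rule measure_pmf.finite_measure_subadditive_finite) (use fin in auto)
  also have "\<dots> \<le> (\<Sum>xs\<in>WW. p ^ Suc m * (q ^ m * z ^ gains H xs))"
  proof (rule sum_mono)
    fix xs assume xs: "xs \<in> WW"
    then have w: "xs \<in> walks {..<n} d m" "m \<le> D * gains H xs" using WW by auto
    have "card (set xs) = Suc m" using walks_basic[OF w(1)] by (simp add: distinct_card)
    then have "measure_pmf.prob (random_subset (dfaces d n) p) {F. set xs \<subseteq> F} \<le> p ^ Suc m"
      using prob_random_subset_superset_le[OF finite_dfaces p, of "set xs" d n] by simp
    also have "\<dots> \<le> p ^ Suc m * (q ^ m * z ^ gains H xs)"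
    proof -
      have "q ^ (D * gains H xs) \<le> q ^ m" by (rule power_decreasing[OF w(2)]) (use q in auto)
      then have "1 \<le> q ^ m * z ^ gains H xs" using q by (simp add: z_def power_divide power_mult[symmetric])
      from mult_left_mono[OF this, of "p ^ Suc m"] p show ?thesis by simp
    qed
    finally show "measure_pmf.prob (random_subset (dfaces d n) p) {F. set xs \<subseteq> F} \<le> p ^ Suc m * (q ^ m * z ^ gains H xs)" .
  qed
  also have "\<dots> = p ^ Suc m * q ^ m * (\<Sum>xs\<in>WW. z ^ gains H xs)"
    by (simp add: sum_distrib_left ac_simps)
  also have "\<dots> \<le> p ^ Suc m * q ^ m * (real n ^ (d + 1) * (2 * real n) ^ m)"
  proof (rule mult_left_mono)
    have "(\<Sum>xs\<in>WW. z ^ gains H xs) \<le> (\<Sum>xs\<in>{xs \<in> walks {..<n} d m. light {..<n} H \<theta> d (set xs)}. z ^ gains H xs)"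
      using z WW by (intro sum_mono2) (auto intro: finite_subset[OF _ finite_walks[of "{..<n}" d m]])
    also have "\<dots> \<le> real (card {..<n} choose (d + 1)) * (real (card {..<n}) + 2 ^ d * \<theta> * z) ^ m"
      by (rule walks_weight) (use \<theta> z in auto)
    also have "\<dots> \<le> real n ^ (d + 1) * (2 * real n) ^ m"
      unfolding zt using choose_le_power[of n "d + 1"] by (intro mult_mono) simp_all
    finally show "(\<Sum>xs\<in>WW. z ^ gains H xs) \<le> real n ^ (d + 1) * (2 * real n) ^ m" .
  qed (use p q in simp)
  also have "\<dots> = (p * real n) ^ Suc m * real n ^ d * (2 * q) ^ m"
    by (simp add: power_mult_distrib)
  also have "p * real n = c" using n by (simp add: p_def)
  finally show ?thesis by (simp add: p_def power_mult_distrib ac_simps)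
qed

section \<open>Heavy sets\<close>

text \<open>A set is heavy at level \<open>j\<close> if more than \<open>\<theta>\<close> vertices extend it to a heavy set at level \<open>j - 1\<close>. Level \<open>0\<close>
consists of the facets of \<open>S\<close>. With the heavy sets as exceptions, \<open>S\<close> is light.\<close>

primrec heavy :: "nat set \<Rightarrow> real \<Rightarrow> nat \<Rightarrow> nat set set \<Rightarrow> nat \<Rightarrow> nat set set" where
  "heavy V \<theta> d S 0 = ridges S"
| "heavy V \<theta> d S (Suc j) = {\<eta>. \<eta> \<subseteq> V \<and> card \<eta> + Suc j = d \<and> \<theta> < real (card {v \<in> V. insert v \<eta> \<in> heavy V \<theta> d S j})}"

definition heavies :: "nat set \<Rightarrow> real \<Rightarrow> nat \<Rightarrow> nat set set \<Rightarrow> nat set set" where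
  "heavies V \<theta> d S = (\<Union>j\<in>{1..d}. heavy V \<theta> d S j)"

context
  fixes V :: "nat set" and \<theta> :: real and d :: nat and S :: "nat set set"
  assumes V: "finite V" and \<theta>: "\<theta> > 0" and S: "\<And>\<sigma>. \<sigma> \<in> S \<Longrightarrow> \<sigma> \<subseteq> V \<and> card \<sigma> = d + 1"
begin

lemma finite_family: "finite S"
  by (rule finite_subset[of _ "Pow V"]) (use S V in auto)

lemma mem_heavy: "\<eta> \<in> heavy V \<theta> d S j \<Longrightarrow> \<eta> \<subseteq> V \<and> card \<eta> + j = d"
proof (cases j)
  case 0
  assume "\<eta> \<in> heavy V \<theta> d S j"
  then obtain \<sigma> u where "\<sigma> \<in> S" "u \<in> \<sigma>" "\<eta> = \<sigma> - {u}" using 0 by (auto simp: ridges_def facets_def)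
  then show ?thesis using S[of \<sigma>] 0 by auto
qed auto

lemma finite_heavy: "finite (heavy V \<theta> d S j)"
  by (rule finite_subset[of _ "Pow V"]) (use mem_heavy V in \<open>blast+\<close>)

lemma light_heavies: "light V (heavies V \<theta> d S) \<theta> d S"
  unfolding light_def
proof (intro allI impI)
  fix \<eta> assume \<eta>: "\<eta> \<subseteq> V" "card \<eta> < d" "\<eta> \<notin> heavies V \<theta> d S"
  have fin: "finite \<eta>" using \<eta>(1) V finite_subset by blast
  define j where "j = d - card \<eta> - 1"
  have j: "card \<eta> + Suc j = d" using \<eta>(2) by (simp add: j_def)
  have "{v \<in> V. insert v \<eta> \<in> heavies V \<theta> d S \<union> ridges S} \<subseteq> {v \<in> V. insert v \<eta> \<in> heavy V \<theta> d S j}"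
  proof
    fix v assume "v \<in> {v \<in> V. insert v \<eta> \<in> heavies V \<theta> d S \<union> ridges S}"
    then have v: "v \<in> V" "insert v \<eta> \<in> heavies V \<theta> d S \<union> ridges S" by auto
    have "\<exists>i. insert v \<eta> \<in> heavy V \<theta> d S i"
      using v(2) by (auto simp: heavies_def intro: exI[of _ 0])
    then obtain i where i: "insert v \<eta> \<in> heavy V \<theta> d S i" ..
    then have ci: "card (insert v \<eta>) + i = d" using mem_heavy by blast
    have "v \<notin> \<eta>"
    proof
      assume "v \<in> \<eta>"
      then have eq: "insert v \<eta> = \<eta>" by auto
      then have "i = Suc j" using ci j by simp
      then have "\<eta> \<in> heavies V \<theta> d S" using i eq j unfolding heavies_def by (intro UN_I[of "Suc j"]) auto
      then show False using \<eta>(3) by simp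
    qed
    then have "i = j" using ci j fin by simp
    then show "v \<in> {v \<in> V. insert v \<eta> \<in> heavy V \<theta> d S j}" using i v by simp
  qed
  then have "card {v \<in> V. insert v \<eta> \<in> heavies V \<theta> d S \<union> ridges S} \<le> card {v \<in> V. insert v \<eta> \<in> heavy V \<theta> d S j}"
    using V by (intro card_mono) auto
  moreover have "\<eta> \<notin> heavy V \<theta> d S (Suc j)"
    using \<eta>(3) j unfolding heavies_def by (auto simp del: heavy.simps)
  then have "real (card {v \<in> V. insert v \<eta> \<in> heavy V \<theta> d S j}) \<le> \<theta>" using \<eta>(1) j by auto
  ultimately show "real (card {v \<in> V. insert v \<eta> \<in> heavies V \<theta> d S \<union> ridges S}) \<le> \<theta>" by linarith
qed

text \<open>Double counting of the pairs of a heavy set and an extension of it one level below.\<close>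

lemma card_heavy_Suc: "real (card (heavy V \<theta> d S (Suc j))) * \<theta> \<le> real d * real (card (heavy V \<theta> d S j))"
proof -
  let ?A = "heavy V \<theta> d S (Suc j)"
  let ?B = "heavy V \<theta> d S j"
  have "real (card ?A) * \<theta> = (\<Sum>\<eta>\<in>?A. \<theta>)" by simp
  also have "\<dots> \<le> (\<Sum>\<eta>\<in>?A. real (card {v \<in> V. insert v \<eta> \<in> ?B}))" by (intro sum_mono) auto
  also have "\<dots> = real (\<Sum>\<eta>\<in>?A. card {v \<in> V. insert v \<eta> \<in> ?B})" by simp
  also have "(\<Sum>\<eta>\<in>?A. card {v \<in> V. insert v \<eta> \<in> ?B}) = card (SIGMA \<eta>:?A. {v \<in> V. insert v \<eta> \<in> ?B})"
    using finite_heavy V by (subst card_SigmaI) (auto simp del: heavy.simps)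
  also have "\<dots> \<le> card (SIGMA \<alpha>:?B. \<alpha>)"
  proof (rule card_inj_on_le[where f = "\<lambda>(\<eta>, v). (insert v \<eta>, v)"])
    have nv: "v \<notin> \<eta>" if "\<eta> \<in> ?A" "insert v \<eta> \<in> ?B" for \<eta> v
    proof
      assume "v \<in> \<eta>"
      then have "insert v \<eta> = \<eta>" by auto
      then show False using mem_heavy[OF that(1)] mem_heavy[OF that(2)] by simp
    qed
    show "inj_on (\<lambda>(\<eta>, v). (insert v \<eta>, v)) (SIGMA \<eta>:?A. {v \<in> V. insert v \<eta> \<in> ?B})"
    proof (rule inj_onI)
      fix x y assume x: "x \<in> (SIGMA \<eta>:?A. {v \<in> V. insert v \<eta> \<in> ?B})" and y: "y \<in> (SIGMA \<eta>:?A. {v \<in> V. insert v \<eta> \<in> ?B})"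
        and eq: "(case x of (\<eta>, v) \<Rightarrow> (insert v \<eta>, v)) = (case y of (\<eta>, v) \<Rightarrow> (insert v \<eta>, v))"
      obtain \<eta> v \<eta>' v' where xy: "x = (\<eta>, v)" "y = (\<eta>', v')" by (cases x, cases y)
      have "v \<notin> \<eta>" "v' \<notin> \<eta>'" using nv[of \<eta> v] nv[of \<eta>' v'] x y xy by (auto simp del: heavy.simps)
      then show "x = y" using eq xy by (auto simp: insert_ident)
    qed
    show "(\<lambda>(\<eta>, v). (insert v \<eta>, v)) ` (SIGMA \<eta>:?A. {v \<in> V. insert v \<eta> \<in> ?B}) \<subseteq> (SIGMA \<alpha>:?B. \<alpha>)" by auto
    have "finite \<alpha>" if "\<alpha> \<in> ?B" for \<alpha> using mem_heavy[OF that] V finite_subset by blast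
    then show "finite (SIGMA \<alpha>:?B. \<alpha>)" by (intro finite_SigmaI finite_heavy)
  qed
  also have "card (SIGMA \<alpha>:?B. \<alpha>) = (\<Sum>\<alpha>\<in>?B. card \<alpha>)"
  proof (rule card_SigmaI[OF finite_heavy], rule ballI)
    fix \<alpha> assume "\<alpha> \<in> ?B" then show "finite \<alpha>" using mem_heavy[of \<alpha> j] V finite_subset by blast
  qed
  also have "\<dots> \<le> (\<Sum>\<alpha>\<in>?B. d)" by (rule sum_mono) (use mem_heavy in fastforce)
  finally show ?thesis by (simp add: mult.commute)
qed

lemma card_heavy: "real (card (heavy V \<theta> d S j)) \<le> (real d / \<theta>) ^ j * ((real d + 1) * real (card S))"
proof (induction j)
  case 0
  have "card (ridges S) \<le> (\<Sum>\<sigma>\<in>S. card (facets \<sigma>))" unfolding ridges_def by (rule card_UN_le[OF finite_family])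
  also have "\<dots> \<le> (\<Sum>\<sigma>\<in>S. d + 1)"
  proof (rule sum_mono)
    fix \<sigma> assume "\<sigma> \<in> S"
    then have "card \<sigma> = d + 1" using S by simp
    moreover from this have "finite \<sigma>" by (intro card_ge_0_finite) simp
    ultimately show "card (facets \<sigma>) \<le> d + 1" using card_facets_le[of \<sigma>] by simp
  qed
  finally have "real (card (ridges S)) \<le> real ((d + 1) * card S)" by (simp only: sum_constant mult.commute of_nat_le_iff of_nat_id)
  then show ?case by (simp add: algebra_simps)
next
  case (Suc j)
  have "real (card (heavy V \<theta> d S (Suc j))) \<le> real d * real (card (heavy V \<theta> d S j)) / \<theta>"
    using card_heavy_Suc[of j] \<theta> by (simp add: pos_le_divide_eq del: heavy.simps)
  also have "\<dots> \<le> real d * ((real d / \<theta>) ^ j * ((real d + 1) * real (card S))) / \<theta>"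
    using Suc \<theta> by (intro divide_right_mono mult_left_mono) auto
  finally show ?case by (simp add: ac_simps del: heavy.simps)
qed

end

section \<open>Heavy sets at a linear threshold\<close>

lemma card_subsets_le:
  assumes "finite X"
  shows "finite {A. A \<subseteq> X \<and> card A \<le> h} \<and> card {A. A \<subseteq> X \<and> card A \<le> h} \<le> (card X + 1) ^ h"
proof (induction h)
  case 0
  have "{A. A \<subseteq> X \<and> card A \<le> 0} = {{}}"
    using assms by (auto dest: finite_subset)
  then show ?case by simp
next
  case (Suc h)
  let ?f = "\<lambda>(A, x). (case x of None \<Rightarrow> A | Some x \<Rightarrow> insert x A)"
  let ?D = "{A. A \<subseteq> X \<and> card A \<le> h} \<times> insert None (Some ` X)"
  have sub: "{A. A \<subseteq> X \<and> card A \<le> Suc h} \<subseteq> ?f ` ?D"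
  proof
    fix A assume "A \<in> {A. A \<subseteq> X \<and> card A \<le> Suc h}"
    then have A: "A \<subseteq> X" "card A \<le> Suc h" by auto
    have finA: "finite A" using A(1) assms finite_subset by blast
    show "A \<in> ?f ` ?D"
    proof (cases "A = {}")
      case True
      then show ?thesis by (intro image_eqI[of _ _ "({}, None)"]) auto
    next
      case False
      then obtain x where x: "x \<in> A" by blast
      then have "card (A - {x}) \<le> h" using A(2) finA by simp
      then show ?thesis using x A(1) by (intro image_eqI[of _ _ "(A - {x}, Some x)"]) auto
    qed
  qed
  have fin: "finite ?D" using Suc assms by simp
  have "card {A. A \<subseteq> X \<and> card A \<le> Suc h} \<le> card (?f ` ?D)" using fin by (intro card_mono sub) simp
  also have "\<dots> \<le> card ?D" by (rule card_image_le[OF fin])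
  also have "\<dots> = card {A. A \<subseteq> X \<and> card A \<le> h} * (card X + 1)"
    using assms by (simp add: card_cartesian_product card_insert_if card_image image_iff)
  also have "\<dots> \<le> (card X + 1) ^ h * (card X + 1)" using Suc by (intro mult_right_mono) auto
  finally show ?case using finite_subset[OF sub] fin by (simp add: mult.commute)
qed

lemma card_supersets_le:
  assumes V: "finite V" and \<eta>: "\<eta> \<subseteq> V"
  shows "card {\<rho>. \<rho> \<subseteq> V \<and> card \<rho> = card \<eta> + i \<and> \<eta> \<subseteq> \<rho>} \<le> card V ^ i"
proof -
  have fin: "finite \<eta>" using V \<eta> finite_subset by blast
  have "card {\<rho>. \<rho> \<subseteq> V \<and> card \<rho> = card \<eta> + i \<and> \<eta> \<subseteq> \<rho>} \<le> card {\<alpha>. \<alpha> \<subseteq> V \<and> card \<alpha> = i}"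
  proof (rule card_inj_on_le[where f = "\<lambda>\<rho>. \<rho> - \<eta>"])
    show "inj_on (\<lambda>\<rho>. \<rho> - \<eta>) {\<rho>. \<rho> \<subseteq> V \<and> card \<rho> = card \<eta> + i \<and> \<eta> \<subseteq> \<rho>}"
      by (rule inj_onI) blast
    show "(\<lambda>\<rho>. \<rho> - \<eta>) ` {\<rho>. \<rho> \<subseteq> V \<and> card \<rho> = card \<eta> + i \<and> \<eta> \<subseteq> \<rho>} \<subseteq> {\<alpha>. \<alpha> \<subseteq> V \<and> card \<alpha> = i}"
      using fin by (auto simp: card_Diff_subset)
  qed (use V in simp)
  also have "\<dots> = card V choose i" by (rule n_subsets[OF V])
  finally show ?thesis
    using choose_le_power[of "card V" i] by (metis le_trans of_nat_le_iff of_nat_power)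
qed

text \<open>The constant in the bounds \<open>card_heavies\<close> and \<open>card_unclean\<close>.\<close>

definition heavy_const :: "nat \<Rightarrow> real \<Rightarrow> real" where
  "heavy_const d \<epsilon> = real d * ((real d / \<epsilon>) ^ d * (real d + 1))"

context
  fixes n d :: nat and \<epsilon> :: real and S :: "nat set set"
  assumes n: "n > 0" and \<epsilon>: "0 < \<epsilon>" "\<epsilon> \<le> 1" and d: "d \<ge> 2" and S: "S \<subseteq> dfaces d n"
begin

private abbreviation "\<H> \<equiv> heavies {..<n} (\<epsilon> * real n) d S"

lemma family_face: "\<sigma> \<in> S \<Longrightarrow> \<sigma> \<subseteq> {..<n} \<and> card \<sigma> = d + 1"
  using S by (auto simp: dfaces_def)

lemma threshold_pos: "\<epsilon> * real n > 0" using n \<epsilon> by simp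

lemma mem_heavy_dfaces: "\<eta> \<in> heavy {..<n} (\<epsilon> * real n) d S j \<Longrightarrow> \<eta> \<subseteq> {..<n} \<and> card \<eta> + j = d"
  by (rule mem_heavy[OF _ threshold_pos family_face]) auto

lemma finite_heavy_dfaces: "finite (heavy {..<n} (\<epsilon> * real n) d S j)"
  by (rule finite_heavy[OF _ threshold_pos family_face]) auto

lemma card_heavy_dfaces:
  "real (card (heavy {..<n} (\<epsilon> * real n) d S j)) \<le> (real d / (\<epsilon> * real n)) ^ j * ((real d + 1) * real (card S))"
  by (rule card_heavy[OF _ threshold_pos family_face]) auto

lemma card_heavy_scaled:
  assumes "j \<in> {1..d}"
  shows "real (card (heavy {..<n} (\<epsilon> * real n) d S j)) * real n ^ (j - 1) \<le> (real d / \<epsilon>) ^ d * (real d + 1) * (real (card S) / real n)"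
proof -
  have "real d / \<epsilon> \<ge> 1" using \<epsilon> d by (simp add: le_divide_eq)
  then have le: "(real d / \<epsilon>) ^ j \<le> (real d / \<epsilon>) ^ d" using assms by (intro power_increasing) auto
  have "real (card (heavy {..<n} (\<epsilon> * real n) d S j)) * real n ^ (j - 1) \<le>
    (real d / (\<epsilon> * real n)) ^ j * ((real d + 1) * real (card S)) * real n ^ (j - 1)"
    by (rule mult_right_mono[OF card_heavy_dfaces]) auto
  also have "\<dots> = (real d / \<epsilon>) ^ j * ((real d + 1) * (real (card S) / real n))"
  proof -
    have "real n ^ j = real n * real n ^ (j - 1)" using assms by (cases j) auto
    then have eq: "(real d / (\<epsilon> * real n)) ^ j * real n ^ (j - 1) = (real d / \<epsilon>) ^ j / real n"
        using n by (simp add: power_divide power_mult_distrib)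
      have "(real d / (\<epsilon> * real n)) ^ j * ((real d + 1) * real (card S)) * real n ^ (j - 1) =
        (real d / (\<epsilon> * real n)) ^ j * real n ^ (j - 1) * ((real d + 1) * real (card S))" by (simp only: ac_simps)
      also have "\<dots> = (real d / \<epsilon>) ^ j / real n * ((real d + 1) * real (card S))" by (simp only: eq)
      finally show ?thesis by simp
  qed
  also have "\<dots> \<le> (real d / \<epsilon>) ^ d * ((real d + 1) * (real (card S) / real n))"
    by (rule mult_right_mono[OF le]) simp
  finally show ?thesis by simp
qed

lemma card_heavies: "real (card \<H>) \<le> heavy_const d \<epsilon> * (real (card S) / real n)"
proof -
  have "card \<H> \<le> (\<Sum>j\<in>{1..d}. card (heavy {..<n} (\<epsilon> * real n) d S j))"
    unfolding heavies_def by (rule card_UN_le) simp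
  then have "real (card \<H>) \<le> (\<Sum>j\<in>{1..d}. real (card (heavy {..<n} (\<epsilon> * real n) d S j)))"
    unfolding of_nat_sum[symmetric] by (rule of_nat_mono)
  also have "\<dots> \<le> (\<Sum>j\<in>{1..d}. (real d / \<epsilon>) ^ d * (real d + 1) * (real (card S) / real n))"
  proof (rule sum_mono)
    fix j assume j: "j \<in> {1..d}"
    have "real (card (heavy {..<n} (\<epsilon> * real n) d S j)) * 1 \<le> real (card (heavy {..<n} (\<epsilon> * real n) d S j)) * real n ^ (j - 1)"
      using n by (intro mult_left_mono) auto
    then show "real (card (heavy {..<n} (\<epsilon> * real n) d S j)) \<le> (real d / \<epsilon>) ^ d * (real d + 1) * (real (card S) / real n)"
      using card_heavy_scaled[OF j] by linarith
  qed
  finally show ?thesis by (simp add: heavy_const_def ac_simps)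
qed

text \<open>A heavy set at level \<open>j\<close> has \<open>d - j\<close> elements, thus at most \<open>n^(j-1)\<close> supersets with \<open>d - 1\<close> elements, while the number of
these heavy sets is of order \<open>card S / n^j\<close>.\<close>

lemma card_unclean:
  "real (card {\<rho>. \<rho> \<subseteq> {..<n} \<and> card \<rho> = d - 1 \<and> \<not> clean \<H> \<rho>}) \<le> heavy_const d \<epsilon> * (real (card S) / real n)"
proof -
  let ?h = "heavy {..<n} (\<epsilon> * real n) d S"
  let ?U = "\<lambda>\<eta> j. {\<rho>. \<rho> \<subseteq> {..<n} \<and> card \<rho> = card \<eta> + (j - 1) \<and> \<eta> \<subseteq> \<rho>}"
  have "{\<rho>. \<rho> \<subseteq> {..<n} \<and> card \<rho> = d - 1 \<and> \<not> clean \<H> \<rho>} \<subseteq> (\<Union>j\<in>{1..d}. \<Union>\<eta>\<in>?h j. ?U \<eta> j)"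
  proof
    fix \<rho> assume "\<rho> \<in> {\<rho>. \<rho> \<subseteq> {..<n} \<and> card \<rho> = d - 1 \<and> \<not> clean \<H> \<rho>}"
    then have \<rho>: "\<rho> \<subseteq> {..<n}" "card \<rho> = d - 1" "\<not> clean \<H> \<rho>" by auto
    then obtain \<eta> j where \<eta>: "\<eta> \<subseteq> \<rho>" "j \<in> {1..d}" "\<eta> \<in> ?h j" unfolding clean_def heavies_def by auto
    have "card \<eta> + j = d" using mem_heavy_dfaces[OF \<eta>(3)] by simp
    then have "\<rho> \<in> ?U \<eta> j" using \<rho> \<eta> by auto
    then show "\<rho> \<in> (\<Union>j\<in>{1..d}. \<Union>\<eta>\<in>?h j. ?U \<eta> j)" using \<eta> by blast
  qed
  moreover have fin: "finite (\<Union>\<eta>\<in>?h j. ?U \<eta> j)" for j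
    by (rule finite_subset[of _ "Pow {..<n}"]) auto
  ultimately have "card {\<rho>. \<rho> \<subseteq> {..<n} \<and> card \<rho> = d - 1 \<and> \<not> clean \<H> \<rho>} \<le> card (\<Union>j\<in>{1..d}. \<Union>\<eta>\<in>?h j. ?U \<eta> j)"
    by (intro card_mono finite_UN_I fin) simp_all
  also have "\<dots> \<le> (\<Sum>j\<in>{1..d}. card (\<Union>\<eta>\<in>?h j. ?U \<eta> j))" by (rule card_UN_le) simp
  finally have "real (card {\<rho>. \<rho> \<subseteq> {..<n} \<and> card \<rho> = d - 1 \<and> \<not> clean \<H> \<rho>}) \<le> (\<Sum>j\<in>{1..d}. real (card (\<Union>\<eta>\<in>?h j. ?U \<eta> j)))"
    unfolding of_nat_sum[symmetric] by (rule of_nat_mono)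
  also have "\<dots> \<le> (\<Sum>j\<in>{1..d}. (real d / \<epsilon>) ^ d * (real d + 1) * (real (card S) / real n))"
  proof (rule sum_mono)
    fix j assume j: "j \<in> {1..d}"
    have "card (\<Union>\<eta>\<in>?h j. ?U \<eta> j) \<le> (\<Sum>\<eta>\<in>?h j. card (?U \<eta> j))"
      by (rule card_UN_le) (rule finite_heavy_dfaces)
    also have "\<dots> \<le> (\<Sum>\<eta>\<in>?h j. n ^ (j - 1))"
    proof (rule sum_mono)
      fix \<eta> assume "\<eta> \<in> ?h j"
      then have "\<eta> \<subseteq> {..<n}" using mem_heavy_dfaces by blast
      then show "card (?U \<eta> j) \<le> n ^ (j - 1)" using card_supersets_le[of "{..<n}" \<eta> "j - 1"] by simp
    qed
    finally have "real (card (\<Union>\<eta>\<in>?h j. ?U \<eta> j)) \<le> real (card (?h j) * n ^ (j - 1))"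
      by (simp only: sum_constant of_nat_le_iff of_nat_id)
    then show "real (card (\<Union>\<eta>\<in>?h j. ?U \<eta> j)) \<le> (real d / \<epsilon>) ^ d * (real d + 1) * (real (card S) / real n)"
      using card_heavy_scaled[OF j] by simp
  qed
  finally show ?thesis by (simp add: heavy_const_def ac_simps)
qed

lemma light_heavies_dfaces: "light {..<n} \<H> (\<epsilon> * real n) d S"
  by (rule light_heavies[OF _ threshold_pos family_face]) simp

end

lemma heavy_const_pos: "\<epsilon> > 0 \<Longrightarrow> d \<ge> 2 \<Longrightarrow> heavy_const d \<epsilon> > 0"
  unfolding heavy_const_def by (intro mult_pos_pos zero_less_power divide_pos_pos) auto

text \<open>All facets of a foul set are unclean. By \<open>card_unclean\<close> the unclean sets form a sparse family, of size about
\<open>card S / n\<close>, to which \<open>few_cliques\<close> applies.\<close>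

lemma few_foul:
  assumes "d \<ge> 2" "0 < \<epsilon>" "\<epsilon> \<le> 1"
  shows "\<exists>\<delta>>0. \<forall>n>0. \<forall>S\<subseteq>dfaces d n. real (card S) \<le> \<delta> * real n ^ d \<longrightarrow>
    4 * card {\<rho> \<in> ridges S. foul (heavies {..<n} (\<epsilon> * real n) d S) \<rho>} \<le> card S"
proof -
  define C where "C = heavy_const d \<epsilon>"
  have C: "C > 0" unfolding C_def using assms by (intro heavy_const_pos) auto
  from few_cliques[of "1 / (4 * C)" "d - 1"] C obtain \<beta> where \<beta>: "\<beta> > 0" and cl:
    "\<And>V B. finite V \<Longrightarrow> B \<subseteq> {\<rho> :: nat set. \<rho> \<subseteq> V \<and> card \<rho> = d - 1} \<Longrightarrow> real (card B) \<le> \<beta> * real (card V) ^ (d - 1) \<Longrightarrow>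
    real (card {\<tau>. \<tau> \<subseteq> V \<and> card \<tau> = Suc (d - 1) \<and> (\<forall>u\<in>\<tau>. \<tau> - {u} \<in> B)}) \<le> 1 / (4 * C) * real (card V) * real (card B)"
    by auto
  show ?thesis
  proof (intro exI[of _ "\<beta> / C"] conjI allI impI)
    show "\<beta> / C > 0" using \<beta> C by simp
    fix n :: nat and S assume n: "n > 0" and S: "S \<subseteq> dfaces d n" and le: "real (card S) \<le> \<beta> / C * real n ^ d"
    let ?H = "heavies {..<n} (\<epsilon> * real n) d S"
    define B where "B = {\<rho>. \<rho> \<subseteq> {..<n} \<and> card \<rho> = d - 1 \<and> \<not> clean ?H \<rho>}"
    have cB: "real (card B) \<le> C * (real (card S) / real n)"
      unfolding B_def C_def by (rule card_unclean[OF n assms(2,3,1) S])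
    also have "\<dots> \<le> \<beta> * real n ^ (d - 1)"
    proof -
      have "real n ^ d = real n * real n ^ (d - 1)" using assms(1) by (cases d) auto
      then have "C * real (card S) \<le> \<beta> * real n ^ (d - 1) * real n" using le C by (simp add: field_simps)
      then show ?thesis using n by (simp add: field_simps)
    qed
    finally have cB': "real (card B) \<le> \<beta> * real (card {..<n}) ^ (d - 1)" by simp
    have "{\<rho> \<in> ridges S. foul ?H \<rho>} \<subseteq> {\<tau>. \<tau> \<subseteq> {..<n} \<and> card \<tau> = Suc (d - 1) \<and> (\<forall>u\<in>\<tau>. \<tau> - {u} \<in> B)}"
    proof
      fix \<rho> assume "\<rho> \<in> {\<rho> \<in> ridges S. foul ?H \<rho>}"
      then have \<rho>: "\<rho> \<in> ridges S" "foul ?H \<rho>" by auto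
      have "\<rho> \<in> ridges S \<longleftrightarrow> card \<rho> = d \<and> (\<exists>\<sigma>\<in>S. \<rho> \<subseteq> \<sigma>)"
        by (rule mem_ridges) (use S in \<open>auto simp: dfaces_def\<close>)
      then have c: "card \<rho> = d" "\<rho> \<subseteq> {..<n}" using \<rho>(1) S by (auto simp: dfaces_def)
      have "finite \<rho>" using c(2) finite_subset by blast
      then show "\<rho> \<in> {\<tau>. \<tau> \<subseteq> {..<n} \<and> card \<tau> = Suc (d - 1) \<and> (\<forall>u\<in>\<tau>. \<tau> - {u} \<in> B)}"
        using \<rho>(2) c assms(1) unfolding foul_def B_def by auto
    qed
    then have "card {\<rho> \<in> ridges S. foul ?H \<rho>} \<le> card {\<tau>. \<tau> \<subseteq> {..<n} \<and> card \<tau> = Suc (d - 1) \<and> (\<forall>u\<in>\<tau>. \<tau> - {u} \<in> B)}"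
      by (intro card_mono) simp_all
    also have "real \<dots> \<le> 1 / (4 * C) * real (card {..<n}) * real (card B)"
      by (rule cl[OF _ _ cB']) (auto simp: B_def)
    also have "\<dots> \<le> 1 / (4 * C) * real (card {..<n}) * (C * (real (card S) / real n))"
      using C by (intro mult_left_mono cB) simp
    also have "\<dots> = real (card S) / 4" using C n by simp
    finally have "real (4 * card {\<rho> \<in> ridges S. foul ?H \<rho>}) \<le> real (card S)" by simp
    then show "4 * card {\<rho> \<in> ridges S. foul ?H \<rho>} \<le> card S" by (simp only: of_nat_le_iff)
  qed
qed

text \<open>At the end of the exploration of a core with few foul facets, a fixed proportion of the steps are gains.\<close>

lemma gains_of_core:
  assumes xs: "xs \<in> walks V d m" "exposed (set xs) = {}" and d: "d \<ge> 2" and m: "m > 0"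
    and few: "4 * card {\<rho> \<in> ridges (set xs). foul H \<rho>} \<le> card (set xs)"
  shows "m \<le> 2 * (d + 2) * gains H xs"
proof -
  have "card (set xs) = Suc m" using walks_basic[OF xs(1)] by (simp add: distinct_card)
  moreover have "m \<le> (d + 2) * gains H xs + card {\<rho> \<in> ridges (set xs). foul H \<rho>}"
    using walk_invariant[OF xs(1) d, of H] xs(2) by simp
  moreover have "2 * (d + 2) * gains H xs = 2 * ((d + 2) * gains H xs)" by simp
  ultimately show ?thesis using few m by linarith
qed

lemma gains_of_core_empty:
  assumes xs: "xs \<in> walks V d m" "exposed (set xs) = {}" and d: "d \<ge> 2"
  shows "m \<le> (d + 2) * gains {} xs"
proof -
  have "\<rho> \<in> ridges (set xs) \<longleftrightarrow> card \<rho> = d \<and> (\<exists>\<sigma>\<in>set xs. \<rho> \<subseteq> \<sigma>)" for \<rho>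
    by (rule mem_ridges) (use walks_basic[OF xs(1)] in blast)
  then have none: "{\<rho> \<in> ridges (set xs). foul {} \<rho>} = {}"
    using d by (auto simp: foul_def clean_def)
  show ?thesis using walk_invariant[OF xs(1) d, of "{}"] unfolding xs(2) Diff_empty none by simp
qed

section \<open>No small core without the boundary of a simplex\<close>

text \<open>The explorations whose faces form a core without the boundary of a simplex.\<close>

definition bad_walks :: "nat \<Rightarrow> nat \<Rightarrow> nat \<Rightarrow> nat set list set" where
  "bad_walks d n m = {xs \<in> walks {..<n} d m. exposed (set xs) = {} \<and> \<not> has_simplex_boundary d (set xs)}"

lemma bad_walksD:
  assumes "xs \<in> bad_walks d n m"
  shows "xs \<in> walks {..<n} d m" "exposed (set xs) = {}" "\<not> has_simplex_boundary d (set xs)"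
    "card (set xs) = Suc m" "set xs \<subseteq> dfaces d n"
  using assms walks_basic[of xs "{..<n}" d m] by (auto simp: bad_walks_def dfaces_def distinct_card)

lemma prob_UN_geometric:
  fixes E :: "nat \<Rightarrow> 'a set"
  assumes "finite I" "\<And>m. m \<in> I \<Longrightarrow> a \<le> m" "0 \<le> x" "x \<le> 1 / 2" "K \<ge> 0"
    and "\<And>m. m \<in> I \<Longrightarrow> measure_pmf.prob P (E m) \<le> K * x ^ m"
  shows "measure_pmf.prob P (\<Union>m\<in>I. E m) \<le> 2 * K * x ^ a"
proof -
  have "measure_pmf.prob P (\<Union>m\<in>I. E m) \<le> (\<Sum>m\<in>I. measure_pmf.prob P (E m))"
    by (rule measure_pmf.finite_measure_subadditive_finite) (use assms in auto)
  also have "\<dots> \<le> (\<Sum>m\<in>I. K * x ^ m)" by (intro sum_mono assms)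
  also have "\<dots> = K * (\<Sum>m\<in>I. x ^ m)" by (rule sum_distrib_left[symmetric])
  also have "\<dots> \<le> K * (2 * x ^ a)"
  proof (rule mult_left_mono[OF _ assms(5)])
    have "(\<Sum>m\<in>I. x ^ m) = (\<Sum>i\<in>(\<lambda>m. m - a) ` I. x ^ a * x ^ i)"
    proof (subst sum.reindex)
      show "inj_on (\<lambda>m. m - a) I" using assms(2) by (intro inj_onI) (metis eq_diff_iff)
    qed (use assms(2) in \<open>auto simp: power_add[symmetric] intro!: sum.cong\<close>)
    also have "\<dots> = x ^ a * (\<Sum>i\<in>(\<lambda>m. m - a) ` I. x ^ i)" by (rule sum_distrib_left[symmetric])
    also have "\<dots> \<le> x ^ a * 2"
    proof (rule mult_left_mono)
      have "(\<Sum>i\<in>(\<lambda>m. m - a) ` I. x ^ i) \<le> suminf (\<lambda>i. x ^ i)"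
        using assms(1,3,4) by (intro sum_le_suminf summable_geometric) auto
      also have "\<dots> = 1 / (1 - x)" using assms(3,4) by (intro suminf_geometric) auto
      also have "\<dots> \<le> 2" using assms(3,4) by (simp add: field_simps)
      finally show "(\<Sum>i\<in>(\<lambda>m. m - a) ` I. x ^ i) \<le> 2" .
    qed (use assms(3) in simp)
    finally show "(\<Sum>m\<in>I. x ^ m) \<le> 2 * x ^ a" by simp
  qed
  finally show ?thesis by simp
qed

text \<open>By \<open>core_few_vertices\<close> such a core of \<open>m + 1\<close> faces has at most \<open>m\<close> vertices. The expected number of these cores is of
order \<open>n^m * p^(m+1)\<close>, thus of order \<open>1 / n\<close>.\<close>

lemma no_small_bad_walks:
  assumes d: "d \<ge> 2" and c: "c > 0"
  shows "(\<lambda>n. measure_pmf.prob (random_subset (dfaces d n) (c / real n)) {F. \<exists>xs\<in>bad_walks d n m. set xs \<subseteq> F}) \<longlonglongrightarrow> 0"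
proof (rule tendsto_sandwich[of "\<lambda>_. 0" _ _ "\<lambda>n. (real n + 1) ^ m * 2 ^ 2 ^ m * (c / real n) ^ Suc m"])
  show "(\<lambda>n. (real n + 1) ^ m * 2 ^ 2 ^ m * (c / real n) ^ Suc m) \<longlonglongrightarrow> 0"
  proof -
    have "(\<lambda>n. (1 + 1 / real n) ^ m * 2 ^ 2 ^ m * c ^ Suc m * (1 / real n)) \<longlonglongrightarrow> (1 + 0) ^ m * 2 ^ 2 ^ m * c ^ Suc m * 0"
      by (intro tendsto_intros lim_1_over_n)
    moreover have "\<forall>\<^sub>F n in sequentially. (1 + 1 / real n) ^ m * 2 ^ 2 ^ m * c ^ Suc m * (1 / real n) =
      (real n + 1) ^ m * 2 ^ 2 ^ m * (c / real n) ^ Suc m"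
      using eventually_gt_at_top[of 0]
    proof eventually_elim
      case (elim n)
      have "1 + 1 / real n = (real n + 1) / real n" using elim by (simp add: field_simps)
      then show ?case by (simp add: power_divide)
    qed
    ultimately have "(\<lambda>n. (real n + 1) ^ m * 2 ^ 2 ^ m * (c / real n) ^ Suc m) \<longlonglongrightarrow> (1 + 0) ^ m * 2 ^ 2 ^ m * c ^ Suc m * 0"
      by (rule Lim_transform_eventually)
    then show ?thesis by simp
  qed
  show "\<forall>\<^sub>F n in sequentially. measure_pmf.prob (random_subset (dfaces d n) (c / real n)) {F. \<exists>xs\<in>bad_walks d n m. set xs \<subseteq> F}
     \<le> (real n + 1) ^ m * 2 ^ 2 ^ m * (c / real n) ^ Suc m"
    using eventually_ge_at_top[of "nat \<lceil>c\<rceil>"]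
  proof eventually_elim
    case (elim n)
    define p where "p = c / real n"
    have "c \<le> real n" using elim by linarith
    then have p: "0 \<le> p" "p \<le> 1" using c by (auto simp: p_def)
    let ?W = "{W. W \<subseteq> {..<n} \<and> card W \<le> m}"
    define KK where "KK = {K \<in> (\<Union>W\<in>?W. Pow (Pow W)). card K = Suc m}"
    have W: "finite ?W" "card ?W \<le> (n + 1) ^ m" using card_subsets_le[of "{..<n}" m] by auto
    have fin: "finite (\<Union>W\<in>?W. Pow (Pow W))" using W(1) finite_subset[of _ "{..<n}"] by auto
    have finK: "finite KK" unfolding KK_def using fin by simp
    have cK: "card KK \<le> (n + 1) ^ m * 2 ^ 2 ^ m"
    proof -
      have "card KK \<le> card (\<Union>W\<in>?W. Pow (Pow W))" unfolding KK_def by (intro card_mono fin) auto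
      also have "\<dots> \<le> (\<Sum>W\<in>?W. card (Pow (Pow W)))" by (rule card_UN_le[OF W(1)])
      also have "\<dots> \<le> (\<Sum>W\<in>?W. 2 ^ 2 ^ m)"
      proof (rule sum_mono)
        fix W assume "W \<in> ?W"
        then have "finite W" "card W \<le> m" using finite_subset[of W "{..<n}"] by auto
        then show "card (Pow (Pow W)) \<le> 2 ^ 2 ^ m" by (simp add: card_Pow)
      qed
      also have "\<dots> = card ?W * 2 ^ 2 ^ m" by simp
      also have "\<dots> \<le> (n + 1) ^ m * 2 ^ 2 ^ m" by (rule mult_right_mono[OF W(2)]) simp
      finally show ?thesis .
    qed
    have "measure_pmf.prob (random_subset (dfaces d n) p) {F. \<exists>xs\<in>bad_walks d n m. set xs \<subseteq> F} \<le>
      measure_pmf.prob (random_subset (dfaces d n) p) (\<Union>K\<in>KK. {F. K \<subseteq> F})"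
    proof (rule measure_pmf.finite_measure_mono)
      show "{F. \<exists>xs\<in>bad_walks d n m. set xs \<subseteq> F} \<subseteq> (\<Union>K\<in>KK. {F. K \<subseteq> F})"
      proof
        fix F assume "F \<in> {F. \<exists>xs\<in>bad_walks d n m. set xs \<subseteq> F}"
        then obtain xs where xs: "xs \<in> bad_walks d n m" "set xs \<subseteq> F" by auto
        note b = bad_walksD[OF xs(1)]
        have fc: "card \<sigma> = d + 1" if "\<sigma> \<in> set xs" for \<sigma> using b(5) that by (auto simp: dfaces_def)
        have "set xs \<noteq> {}" using b(4) by (intro notI) simp
        then have "core (set xs)" by (rule core_if_not_exposed[OF _ fc b(2)])
        then have "card (\<Union>(set xs)) < card (set xs)" by (rule core_few_vertices[OF _ _ fc d b(3)]) simp
        then have "\<Union>(set xs) \<in> ?W" using b(4,5) by (auto simp: dfaces_def)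
        then have "set xs \<in> KK" unfolding KK_def using b(4) by blast
        then show "F \<in> (\<Union>K\<in>KK. {F. K \<subseteq> F})" using xs(2) by blast
      qed
    qed simp
    also have "\<dots> \<le> (\<Sum>K\<in>KK. measure_pmf.prob (random_subset (dfaces d n) p) {F. K \<subseteq> F})"
      by (rule measure_pmf.finite_measure_subadditive_finite) (use finK in auto)
    also have "\<dots> \<le> (\<Sum>K\<in>KK. p ^ Suc m)"
    proof (rule sum_mono)
      fix K assume "K \<in> KK"
      then have cardK: "card K = Suc m" by (simp add: KK_def)
      then have "finite K" by (intro card_ge_0_finite) simp
      then show "measure_pmf.prob (random_subset (dfaces d n) p) {F. K \<subseteq> F} \<le> p ^ Suc m"
        using prob_random_subset_superset_le[OF finite_dfaces p, of K d n] cardK by simp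
    qed
    also have "\<dots> = real (card KK) * p ^ Suc m" by simp
    also have "\<dots> \<le> real ((n + 1) ^ m * 2 ^ 2 ^ m) * p ^ Suc m"
      by (rule mult_right_mono) (use cK p in \<open>simp_all only: of_nat_le_iff zero_le_power\<close>)
    finally show ?case unfolding p_def by (simp add: add.commute)
  qed
qed simp_all

text \<open>Here \<open>H\<close> is empty and no set is foul. A walk of at most \<open>sqrt n\<close> steps sees at most \<open>\<theta> = (d+1) (sqrt n + 1)\<close>
vertices, which is a valid bound for light families. The resulting factor \<open>q\<close> is of order \<open>n^(-1/(2(d+2)))\<close>; the
lower limit for \<open>m\<close> is chosen such that \<open>n^d * q^m\<close> is of order \<open>1 / n\<close>.\<close>

lemma no_medium_bad_walks:
  assumes d: "d \<ge> 2" and c: "c > 0"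
  shows "(\<lambda>n. measure_pmf.prob (random_subset (dfaces d n) (c / real n))
    (\<Union>m\<in>{2 * (d + 2) * (d + 1)..<nat \<lceil>sqrt (real n)\<rceil>}. {F. \<exists>xs\<in>bad_walks d n m. set xs \<subseteq> F})) \<longlonglongrightarrow> 0"
proof -
  define y where "y n = 2 ^ d * ((real d + 1) * (sqrt (real n) + 1)) / real n" for n
  define q where "q n = y n powr (1 / real (d + 2))" for n
  define M where "M = 2 * (d + 2) * (d + 1)"
  have y0: "y \<longlonglongrightarrow> 0" unfolding y_def by real_asymp
  have q0: "q \<longlonglongrightarrow> 0" unfolding q_def
  proof (rule tendsto_zero_powrI[OF y0])
    show "(\<lambda>n. 1 / real (d + 2)) \<longlonglongrightarrow> 1 / real (d + 2)" by simp
    show "\<forall>\<^sub>F n in sequentially. 0 \<le> y n" by (auto simp: y_def)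
  qed simp
  have lim: "(\<lambda>n. 2 * (c * real n ^ d) * (2 * c * q n) ^ M) \<longlonglongrightarrow> 0"
  proof -
    have ev: "\<forall>\<^sub>F n in sequentially. (2 * c * (2 * c) ^ M * (2 ^ d * (real d + 1)) ^ (2 * (d + 1))) * (((sqrt (real n) + 1)\<^sup>2 / real n) ^ (d + 1) * (1 / real n)) =
      2 * (c * real n ^ d) * (2 * c * q n) ^ M"
      using eventually_gt_at_top[of 0]
    proof eventually_elim
      case (elim n)
      have yp: "y n > 0" unfolding y_def using elim d by (intro divide_pos_pos mult_pos_pos add_pos_pos) auto
      have "q n ^ M = (q n ^ (d + 2)) ^ (2 * (d + 1))" unfolding M_def power_mult[symmetric] by (simp only: ac_simps)
      also have "q n ^ (d + 2) = y n" unfolding q_def using yp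
        by (subst powr_realpow[symmetric]) (simp_all add: powr_powr)
      finally have qM: "q n ^ M = y n ^ (2 * (d + 1))" .
      have y1: "y n ^ (2 * (d + 1)) = (2 ^ d * (real d + 1)) ^ (2 * (d + 1)) * ((sqrt (real n) + 1) ^ (2 * (d + 1)) / real n ^ (2 * (d + 1)))"
        unfolding y_def by (simp only: power_mult_distrib power_divide mult.assoc[symmetric] times_divide_eq_right)
      have u1: "(sqrt (real n) + 1) ^ (2 * (d + 1)) / real n ^ (2 * (d + 1)) * real n ^ d = ((sqrt (real n) + 1)\<^sup>2 / real n) ^ (d + 1) * (1 / real n)"
      proof -
        have n2: "real n ^ (2 * (d + 1)) = real n ^ (d + 1) * (real n * real n ^ d)"
          by (simp add: mult_2 power_add)
        have s2: "(sqrt (real n) + 1) ^ (2 * (d + 1)) = ((sqrt (real n) + 1)\<^sup>2) ^ (d + 1)" by (rule power_mult)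
        have "A / (B * (r * R)) * R = A / B * (1 / r)" if "R \<noteq> 0" for A B r R :: real using that by simp
        then show ?thesis unfolding n2 s2 power_divide using elim by simp
      qed
      show ?case unfolding power_mult_distrib[of "2 * c" "q n"] qM y1 u1[symmetric] by (simp only: ac_simps)
    qed
    have "(\<lambda>n. (sqrt (real n) + 1)\<^sup>2 / real n) \<longlonglongrightarrow> 1" by real_asymp
    then have "(\<lambda>n. (2 * c * (2 * c) ^ M * (2 ^ d * (real d + 1)) ^ (2 * (d + 1))) * (((sqrt (real n) + 1)\<^sup>2 / real n) ^ (d + 1) * (1 / real n)))
       \<longlonglongrightarrow> (2 * c * (2 * c) ^ M * (2 ^ d * (real d + 1)) ^ (2 * (d + 1))) * (1 ^ (d + 1) * 0)"
      by (intro tendsto_intros lim_1_over_n)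
    from Lim_transform_eventually[OF this ev] show ?thesis by simp
  qed
  have e2: "\<forall>\<^sub>F n in sequentially. q n < min 1 (1 / (4 * c))"
    by (rule order_tendstoD(2)[OF q0]) (use c in simp)
  show ?thesis
  proof (rule tendsto_sandwich[OF _ _ tendsto_const lim])
    show "\<forall>\<^sub>F n in sequentially. measure_pmf.prob (random_subset (dfaces d n) (c / real n))
       (\<Union>m\<in>{2 * (d + 2) * (d + 1)..<nat \<lceil>sqrt (real n)\<rceil>}. {F. \<exists>xs\<in>bad_walks d n m. set xs \<subseteq> F})
       \<le> 2 * (c * real n ^ d) * (2 * c * q n) ^ M"
      using e2 eventually_ge_at_top[of "nat \<lceil>c\<rceil>"] eventually_gt_at_top[of 0]
    proof eventually_elim
      case (elim n)
      have cn: "c \<le> real n" using elim by linarith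
      have yp: "y n > 0" unfolding y_def using elim d by (intro divide_pos_pos mult_pos_pos add_pos_pos) auto
      have q: "0 < q n" "q n \<le> 1" "2 * c * q n \<le> 1 / 2" using elim yp c by (auto simp: q_def field_simps)
      have qy: "q n ^ (d + 2) = y n" unfolding q_def using yp
        by (subst powr_realpow[symmetric]) (simp_all add: powr_powr)
      let ?\<theta> = "(real d + 1) * (sqrt (real n) + 1)"
      have \<theta>: "?\<theta> > 0" by (intro mult_pos_pos add_nonneg_pos) auto
      show ?case unfolding M_def
      proof (rule prob_UN_geometric)
        fix m assume m: "m \<in> {2 * (d + 2) * (d + 1)..<nat \<lceil>sqrt (real n)\<rceil>}"
        then have "int m < \<lceil>sqrt (real n)\<rceil>" by (simp add: zless_nat_eq_int_zless)
        then have m': "real m < sqrt (real n)" by (simp add: less_ceiling_iff)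
        show "measure_pmf.prob (random_subset (dfaces d n) (c / real n)) {F. \<exists>xs\<in>bad_walks d n m. set xs \<subseteq> F} \<le> c * real n ^ d * (2 * c * q n) ^ m"
        proof (rule prob_walks_le[where H = "{}" and \<theta> = ?\<theta> and D = "d + 2"])
          show "q n ^ (d + 2) * real n = 2 ^ d * ?\<theta>" unfolding qy y_def using elim by simp
          fix xs assume xs: "xs \<in> bad_walks d n m"
          note b = bad_walksD[OF xs]
          have "light {..<n} {} ?\<theta> d (set xs)" unfolding light_def
          proof (intro allI impI)
            fix \<eta> :: "nat set"
            have sub: "{v \<in> {..<n}. insert v \<eta> \<in> {} \<union> ridges (set xs)} \<subseteq> \<Union>(set xs)"
              by (auto simp: ridges_def facets_def)
            have fc: "finite \<sigma>" "card \<sigma> = d + 1" if "\<sigma> \<in> set xs" for \<sigma>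
              using b(5) that finite_subset[of \<sigma> "{..<n}"] by (auto simp: dfaces_def)
            have "card {v \<in> {..<n}. insert v \<eta> \<in> {} \<union> ridges (set xs)} \<le> card (\<Union>(set xs))"
              by (rule card_mono[OF _ sub]) (use fc in auto)
            also have "\<dots> \<le> (\<Sum>\<sigma>\<in>set xs. card \<sigma>)" using card_UN_le[of "set xs" "\<lambda>\<sigma>. \<sigma>"] by simp
            also have "\<dots> = Suc m * (d + 1)" using fc b(4) by simp
            finally have "real (card {v \<in> {..<n}. insert v \<eta> \<in> {} \<union> ridges (set xs)}) \<le> real (Suc m * (d + 1))"
              by (rule of_nat_mono)
            also have "\<dots> = (real d + 1) * (real m + 1)" by (simp add: algebra_simps)
            also have "\<dots> \<le> ?\<theta>" using m' by (intro mult_left_mono) auto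
            finally show "real (card {v \<in> {..<n}. insert v \<eta> \<in> {} \<union> ridges (set xs)}) \<le> ?\<theta>" .
          qed
          then show "xs \<in> walks {..<n} d m \<and> light {..<n} {} ?\<theta> d (set xs) \<and> m \<le> (d + 2) * gains {} xs"
            using b(1) gains_of_core_empty[OF b(1,2) d] by blast
        qed (use elim c cn \<theta> q in auto)
      qed (use c q in auto)
    qed
  qed simp
qed

text \<open>Take \<open>\<theta> = \<epsilon> n\<close> and for \<open>H\<close> the heavy sets. The estimate \<open>prob_walks_le\<close> is for a fixed \<open>H\<close>, so a union bound over all
possible \<open>H\<close> is needed. The number of heavy sets is of order \<open>m / n\<close>, so there are only \<open>exp (O (m ln n / n)) \<le> 2^m\<close>
choices, and choosing \<open>\<epsilon>\<close> small beats this factor. The sum over \<open>m \<ge> sqrt n\<close> is superpolynomially small.\<close>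

lemma no_large_bad_walks:
  assumes d: "d \<ge> 2" and c: "c > 0"
  shows "\<exists>\<delta>>0. (\<lambda>n. measure_pmf.prob (random_subset (dfaces d n) (c / real n))
    (\<Union>m\<in>{m. nat \<lceil>sqrt (real n)\<rceil> \<le> m \<and> real (Suc m) \<le> \<delta> * real n ^ d}. {F. \<exists>xs\<in>bad_walks d n m. set xs \<subseteq> F})) \<longlonglongrightarrow> 0"
proof -
  define D where "D = 2 * (d + 2)"
  define q where "q = min 1 (1 / (8 * c))"
  \<comment> \<open>forced by the balance \<open>q^D * n = 2^d * \<theta>\<close> with \<open>\<theta> = \<epsilon> n\<close>; the choice of \<open>q\<close> leaves \<open>4 c q \<le> 1 / 2\<close>, where one factor \<open>2\<close> pays for the choice of \<open>H\<close>\<close>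
  define \<epsilon> where "\<epsilon> = q ^ D / 2 ^ d"
  have q: "0 < q" "q \<le> 1" "4 * c * q \<le> 1 / 2" using c by (auto simp: q_def min_def field_simps)
  have \<epsilon>: "0 < \<epsilon>" "\<epsilon> \<le> 1"
  proof -
    show "0 < \<epsilon>" using q by (simp add: \<epsilon>_def)
    have "q ^ D \<le> 1" using q by (intro power_le_one) auto
    also have "(1 :: real) \<le> 2 ^ d" by simp
    finally show "\<epsilon> \<le> 1" by (simp add: \<epsilon>_def)
  qed
  define C where "C = heavy_const d \<epsilon>"
  have C: "C > 0" unfolding C_def by (rule heavy_const_pos[OF \<epsilon>(1) d])
  from few_foul[OF d \<epsilon>] obtain \<delta> where \<delta>: "\<delta> > 0" and foul: "\<And>n S. n > 0 \<Longrightarrow> S \<subseteq> dfaces d n \<Longrightarrow> real (card S) \<le> \<delta> * real n ^ d \<Longrightarrow>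
    4 * card {\<rho> \<in> ridges S. foul (heavies {..<n} (\<epsilon> * real n) d S) \<rho>} \<le> card S" by blast
  have lim: "(\<lambda>n. 2 * (c * real n ^ d) * (1 / 2) ^ nat \<lceil>sqrt (real n)\<rceil>) \<longlonglongrightarrow> 0"
  proof (rule tendsto_sandwich[of "\<lambda>_. 0" _ _ "\<lambda>n. 2 * (c * real n ^ d) * (1 / 2) powr (sqrt (real n))"])
    show "(\<lambda>n. 2 * (c * real n ^ d) * (1 / 2) powr sqrt (real n)) \<longlonglongrightarrow> 0" using c by real_asymp
    show "\<forall>\<^sub>F n in sequentially. 2 * (c * real n ^ d) * (1 / 2) ^ nat \<lceil>sqrt (real n)\<rceil> \<le> 2 * (c * real n ^ d) * (1 / 2) powr sqrt (real n)"
    proof (intro always_eventually allI mult_left_mono)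
      fix n :: nat
      have "(1 / 2 :: real) ^ nat \<lceil>sqrt (real n)\<rceil> = (1 / 2) powr real (nat \<lceil>sqrt (real n)\<rceil>)"
        by (rule powr_realpow[symmetric]) simp
      also have "\<dots> \<le> (1 / 2) powr sqrt (real n)" by (intro powr_mono') linarith+
      finally show "(1 / 2 :: real) ^ nat \<lceil>sqrt (real n)\<rceil> \<le> (1 / 2) powr sqrt (real n)" .
    qed (use c in auto)
  qed (use c in auto)
  have e2: "\<forall>\<^sub>F n in sequentially. 2 * C * (real d * ln (real n + 2)) / real n < ln 2"
  proof (rule order_tendstoD(2))
    show "(\<lambda>n. 2 * C * (real d * ln (real n + 2)) / real n) \<longlonglongrightarrow> 0" by real_asymp
  qed simp
  show ?thesis
  proof (intro exI[of _ \<delta>] conjI \<delta>)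
    show "(\<lambda>n. measure_pmf.prob (random_subset (dfaces d n) (c / real n))
      (\<Union>m\<in>{m. nat \<lceil>sqrt (real n)\<rceil> \<le> m \<and> real (Suc m) \<le> \<delta> * real n ^ d}. {F. \<exists>xs\<in>bad_walks d n m. set xs \<subseteq> F})) \<longlonglongrightarrow> 0"
    proof (rule tendsto_sandwich[OF _ _ tendsto_const lim])
      show "\<forall>\<^sub>F n in sequentially. measure_pmf.prob (random_subset (dfaces d n) (c / real n))
        (\<Union>m\<in>{m. nat \<lceil>sqrt (real n)\<rceil> \<le> m \<and> real (Suc m) \<le> \<delta> * real n ^ d}. {F. \<exists>xs\<in>bad_walks d n m. set xs \<subseteq> F}) \<le>
        2 * (c * real n ^ d) * (1 / 2) ^ nat \<lceil>sqrt (real n)\<rceil>"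
        using e2 eventually_ge_at_top[of "nat \<lceil>c\<rceil>"] eventually_gt_at_top[of 0]
      proof eventually_elim
        case (elim n)
        have cn: "c \<le> real n" using elim by linarith
        let ?P = "random_subset (dfaces d n) (c / real n)"
        show ?case
        proof (rule prob_UN_geometric)
          show "finite {m. nat \<lceil>sqrt (real n)\<rceil> \<le> m \<and> real (Suc m) \<le> \<delta> * real n ^ d}"
          proof (rule finite_subset)
            show "{m. nat \<lceil>sqrt (real n)\<rceil> \<le> m \<and> real (Suc m) \<le> \<delta> * real n ^ d} \<subseteq> {..nat \<lceil>\<delta> * real n ^ d\<rceil>}" by (auto; linarith)
          qed simp
          fix m assume m: "m \<in> {m. nat \<lceil>sqrt (real n)\<rceil> \<le> m \<and> real (Suc m) \<le> \<delta> * real n ^ d}"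
          have "nat \<lceil>sqrt (real n)\<rceil> > 0" using elim by simp
          moreover have "nat \<lceil>sqrt (real n)\<rceil> \<le> m" using m by blast
          ultimately have m0: "m > 0" by (rule order.strict_trans2)
          \<comment> \<open>the maximal number of heavy sets\<close>
          define h where "h = nat \<lfloor>C * (real (Suc m) / real n)\<rfloor>"
          define X where "X = {\<eta>. \<eta> \<subseteq> {..<n} \<and> card \<eta> \<le> d}"
          define HH where "HH = {H. H \<subseteq> X \<and> card H \<le> h}"
          have X: "finite X" "card X \<le> (n + 1) ^ d" unfolding X_def using card_subsets_le[of "{..<n}" d] by auto
          have HH: "finite HH" "card HH \<le> (card X + 1) ^ h" unfolding HH_def using card_subsets_le[OF X(1), of h] by auto
          have cHH: "real (card HH) \<le> 2 ^ m"
          proof -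
            have "(n + 1) ^ d + 1 \<le> (n + 2) ^ d"
            proof -
              have "(n + 1) ^ d < (n + 2) ^ d" by (rule power_strict_mono) (use d in auto)
              then show ?thesis by simp
            qed
            then have "(card X + 1) ^ h \<le> ((n + 2) ^ d) ^ h" using X(2) by (intro power_mono) auto
            then have "real (card HH) \<le> real (((n + 2) ^ d) ^ h)" using HH(2) by (meson le_trans of_nat_mono)
            also have "\<dots> = (real n + 2) ^ (d * h)" by (simp add: power_mult add.commute)
            also have "\<dots> = exp (real h * (real d * ln (real n + 2)))"
              by (simp add: powr_realpow[symmetric] powr_def ac_simps)
            also have "\<dots> \<le> exp (real m * ln 2)"
            proof (subst exp_le_cancel_iff)
              have "real h \<le> C * (real (Suc m) / real n)" unfolding h_def using C by (intro of_nat_floor) auto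
              also have "\<dots> \<le> C * (real (2 * m) / real n)" using C m0 by (intro mult_left_mono divide_right_mono) auto
              finally have "real h * (real d * ln (real n + 2)) \<le> C * (real (2 * m) / real n) * (real d * ln (real n + 2))"
                by (rule mult_right_mono) auto
              also have "\<dots> = real m * (2 * C * (real d * ln (real n + 2)) / real n)" by simp
              also have "\<dots> \<le> real m * ln 2" using elim by (intro mult_left_mono) auto
              finally show "real h * (real d * ln (real n + 2)) \<le> real m * ln 2" .
            qed
            also have "\<dots> = 2 ^ m" by (simp add: powr_realpow[symmetric] powr_def)
            finally show ?thesis .
          qed
          define WW where "WW H = {xs \<in> bad_walks d n m. heavies {..<n} (\<epsilon> * real n) d (set xs) = H}" for H
          have "measure_pmf.prob ?P {F. \<exists>xs\<in>bad_walks d n m. set xs \<subseteq> F} \<le> measure_pmf.prob ?P (\<Union>H\<in>HH. {F. \<exists>xs\<in>WW H. set xs \<subseteq> F})"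
          proof (rule measure_pmf.finite_measure_mono)
            show "{F. \<exists>xs\<in>bad_walks d n m. set xs \<subseteq> F} \<subseteq> (\<Union>H\<in>HH. {F. \<exists>xs\<in>WW H. set xs \<subseteq> F})"
            proof
              fix F assume "F \<in> {F. \<exists>xs\<in>bad_walks d n m. set xs \<subseteq> F}"
              then obtain xs where xs: "xs \<in> bad_walks d n m" "set xs \<subseteq> F" by auto
              note b = bad_walksD[OF xs(1)]
              let ?H = "heavies {..<n} (\<epsilon> * real n) d (set xs)"
              have "?H \<subseteq> X"
              proof
                fix \<eta> assume "\<eta> \<in> ?H"
                then obtain j where "\<eta> \<in> heavy {..<n} (\<epsilon> * real n) d (set xs) j" unfolding heavies_def by blast
                from mem_heavy_dfaces[OF elim(3) \<epsilon> d b(5) this] show "\<eta> \<in> X" by (auto simp: X_def)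
              qed
              moreover have "card ?H \<le> h"
                using card_heavies[OF elim(3) \<epsilon> d b(5)] b(4) unfolding h_def C_def by (simp add: le_nat_floor)
              ultimately have "?H \<in> HH" by (simp add: HH_def)
              moreover have "xs \<in> WW ?H" using xs(1) by (simp add: WW_def)
              ultimately show "F \<in> (\<Union>H\<in>HH. {F. \<exists>xs\<in>WW H. set xs \<subseteq> F})" using xs(2) by blast
            qed
          qed simp
          also have "\<dots> \<le> (\<Sum>H\<in>HH. measure_pmf.prob ?P {F. \<exists>xs\<in>WW H. set xs \<subseteq> F})"
            by (rule measure_pmf.finite_measure_subadditive_finite) (use HH in auto)
          also have "\<dots> \<le> (\<Sum>H\<in>HH. c * real n ^ d * (2 * c * q) ^ m)"
          proof (rule sum_mono)
            fix H assume "H \<in> HH"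
            show "measure_pmf.prob ?P {F. \<exists>xs\<in>WW H. set xs \<subseteq> F} \<le> c * real n ^ d * (2 * c * q) ^ m"
            proof (rule prob_walks_le[where H = H and \<theta> = "\<epsilon> * real n" and D = D])
              show "q ^ D * real n = 2 ^ d * (\<epsilon> * real n)" by (simp add: \<epsilon>_def)
              fix xs assume "xs \<in> WW H"
              then have xs: "xs \<in> bad_walks d n m" and H: "H = heavies {..<n} (\<epsilon> * real n) d (set xs)" by (auto simp: WW_def)
              note b = bad_walksD[OF xs]
              have "4 * card {\<rho> \<in> ridges (set xs). foul H \<rho>} \<le> card (set xs)"
                unfolding H by (rule foul[OF elim(3) b(5)]) (use b(4) m in simp)
              then have "m \<le> D * gains H xs" unfolding D_def by (rule gains_of_core[OF b(1,2) d m0])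
              then show "xs \<in> walks {..<n} d m \<and> light {..<n} H (\<epsilon> * real n) d (set xs) \<and> m \<le> D * gains H xs"
                using b(1) light_heavies_dfaces[OF elim(3) \<epsilon> d b(5)] by (simp only: H simp_thms)
            qed (use elim(3) c cn \<epsilon> q in simp_all)
          qed
          also have "\<dots> = real (card HH) * (c * real n ^ d * (2 * c * q) ^ m)" by simp
          also have "\<dots> \<le> 2 ^ m * (c * real n ^ d * (2 * c * q) ^ m)"
            by (rule mult_right_mono[OF cHH]) (use c q in simp)
          also have "\<dots> = c * real n ^ d * (4 * c * q) ^ m"
          proof -
            have "4 * c * q = 2 * (2 * c * q)" by simp
            then have "(4 * c * q) ^ m = 2 ^ m * (2 * c * q) ^ m" by (simp only: power_mult_distrib)
            then show ?thesis by (simp only: ac_simps)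
          qed
          also have "\<dots> \<le> c * real n ^ d * (1 / 2) ^ m" using q c by (intro mult_left_mono power_mono) auto
          finally show "measure_pmf.prob ?P {F. \<exists>xs\<in>bad_walks d n m. set xs \<subseteq> F} \<le> c * real n ^ d * (1 / 2) ^ m" .
        qed (use c in auto)
      qed
    qed simp
  qed
qed

text \<open>Every core contains a core that is explored completely by a walk, with at most as many faces and still without the boundary of a
simplex. The three preceding lemmas cover all possible lengths of this walk.\<close>

theorem core_gap:
  assumes d: "d \<ge> 2" and c: "c > 0"
  shows "\<exists>\<delta>>0. (\<lambda>n. measure_pmf.prob (random_subset (dfaces d n) (c / real n))
    {F. \<exists>K\<subseteq>F. core K \<and> real (card K) \<le> \<delta> * real n ^ d \<and> \<not> has_simplex_boundary d K}) \<longlonglongrightarrow> 0"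
proof -
  define M where "M = 2 * (d + 2) * (d + 1)"
  from no_large_bad_walks[OF d c] obtain \<delta> where \<delta>: "\<delta> > 0" and large:
    "(\<lambda>n. measure_pmf.prob (random_subset (dfaces d n) (c / real n))
    (\<Union>m\<in>{m. nat \<lceil>sqrt (real n)\<rceil> \<le> m \<and> real (Suc m) \<le> \<delta> * real n ^ d}. {F. \<exists>xs\<in>bad_walks d n m. set xs \<subseteq> F})) \<longlonglongrightarrow> 0" by blast
  let ?P = "\<lambda>n. random_subset (dfaces d n) (c / real n)"
  let ?E = "\<lambda>n m. {F. \<exists>xs\<in>bad_walks d n m. set xs \<subseteq> F}"
  let ?I = "\<lambda>n. {m. nat \<lceil>sqrt (real n)\<rceil> \<le> m \<and> real (Suc m) \<le> \<delta> * real n ^ d}"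
  have lim: "(\<lambda>n. (\<Sum>m<M. measure_pmf.prob (?P n) (?E n m)) +
     (measure_pmf.prob (?P n) (\<Union>m\<in>{M..<nat \<lceil>sqrt (real n)\<rceil>}. ?E n m) + measure_pmf.prob (?P n) (\<Union>m\<in>?I n. ?E n m))) \<longlonglongrightarrow> (\<Sum>m<M. 0) + (0 + 0)"
    by (intro tendsto_add tendsto_sum no_small_bad_walks[OF d c] large no_medium_bad_walks[OF d c, folded M_def])
  show ?thesis
  proof (intro exI[of _ \<delta>] conjI \<delta>)
    show "(\<lambda>n. measure_pmf.prob (?P n) {F. \<exists>K\<subseteq>F. core K \<and> real (card K) \<le> \<delta> * real n ^ d \<and> \<not> has_simplex_boundary d K}) \<longlonglongrightarrow> 0"
    proof (rule tendsto_sandwich[OF _ _ tendsto_const])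
      show "(\<lambda>n. (\<Sum>m<M. measure_pmf.prob (?P n) (?E n m)) +
     (measure_pmf.prob (?P n) (\<Union>m\<in>{M..<nat \<lceil>sqrt (real n)\<rceil>}. ?E n m) + measure_pmf.prob (?P n) (\<Union>m\<in>?I n. ?E n m))) \<longlonglongrightarrow> 0"
        using lim by simp
      show "\<forall>\<^sub>F n in sequentially. measure_pmf.prob (?P n) {F. \<exists>K\<subseteq>F. core K \<and> real (card K) \<le> \<delta> * real n ^ d \<and> \<not> has_simplex_boundary d K} \<le>
        (\<Sum>m<M. measure_pmf.prob (?P n) (?E n m)) +
     (measure_pmf.prob (?P n) (\<Union>m\<in>{M..<nat \<lceil>sqrt (real n)\<rceil>}. ?E n m) + measure_pmf.prob (?P n) (\<Union>m\<in>?I n. ?E n m))"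
      proof (intro always_eventually allI)
        fix n
        let ?A = "\<Union>m<M. ?E n m"
        let ?B = "\<Union>m\<in>{M..<nat \<lceil>sqrt (real n)\<rceil>}. ?E n m"
        let ?C = "\<Union>m\<in>?I n. ?E n m"
        have "measure_pmf.prob (?P n) {F. \<exists>K\<subseteq>F. core K \<and> real (card K) \<le> \<delta> * real n ^ d \<and> \<not> has_simplex_boundary d K} \<le>
          measure_pmf.prob (?P n) (?A \<union> (?B \<union> ?C))"
        proof (rule measure_pmf.finite_measure_mono_AE)
          show "AE F in ?P n. F \<in> {F. \<exists>K\<subseteq>F. core K \<and> real (card K) \<le> \<delta> * real n ^ d \<and> \<not> has_simplex_boundary d K} \<longrightarrow>
            F \<in> ?A \<union> (?B \<union> ?C)"
          proof (rule AE_pmfI, rule impI)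
            fix F assume "F \<in> set_pmf (?P n)"
            then have F: "F \<subseteq> dfaces d n" using set_random_subset by blast
            assume "F \<in> {F. \<exists>K\<subseteq>F. core K \<and> real (card K) \<le> \<delta> * real n ^ d \<and> \<not> has_simplex_boundary d K}"
            then obtain K where K: "K \<subseteq> F" "core K" "real (card K) \<le> \<delta> * real n ^ d" "\<not> has_simplex_boundary d K" by blast
            have finK: "finite K" using K(1) F finite_dfaces finite_subset by metis
            have "\<sigma> \<subseteq> {..<n} \<and> card \<sigma> = d + 1" if "\<sigma> \<in> K" for \<sigma> using K(1) F that by (auto simp: dfaces_def)
            from core_contains_walk[OF K(2) finK this] obtain m xs where
              xs: "xs \<in> walks {..<n} d m" "set xs \<subseteq> K" "exposed (set xs) = {}" by blast
            have "\<not> has_simplex_boundary d (set xs)" using K(4) xs(2) unfolding has_simplex_boundary_def by blast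
            then have bad: "xs \<in> bad_walks d n m" using xs by (simp add: bad_walks_def)
            then have FE: "F \<in> ?E n m" using xs(2) K(1) by blast
            have "Suc m \<le> card K" using bad_walksD(4)[OF bad] card_mono[OF finK xs(2)] by simp
            then have le: "real (Suc m) \<le> \<delta> * real n ^ d" using K(3) by linarith
            consider "m < M" | "m \<in> {M..<nat \<lceil>sqrt (real n)\<rceil>}" | "m \<in> ?I n" using le
              by (cases "m < M"; cases "m < nat \<lceil>sqrt (real n)\<rceil>") (auto simp: not_less)
            then show "F \<in> ?A \<union> (?B \<union> ?C)" using FE by cases blast+
          qed
        qed simp
        also have "\<dots> \<le> measure_pmf.prob (?P n) ?A + measure_pmf.prob (?P n) (?B \<union> ?C)"
          by (rule measure_Un_le) auto
        also have "\<dots> \<le> (\<Sum>m<M. measure_pmf.prob (?P n) (?E n m)) + (measure_pmf.prob (?P n) ?B + measure_pmf.prob (?P n) ?C)"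
          by (intro add_mono measure_pmf.finite_measure_subadditive_finite measure_Un_le) auto
        finally show "measure_pmf.prob (?P n) {F. \<exists>K\<subseteq>F. core K \<and> real (card K) \<le> \<delta> * real n ^ d \<and> \<not> has_simplex_boundary d K} \<le>
          (\<Sum>m<M. measure_pmf.prob (?P n) (?E n m)) + (measure_pmf.prob (?P n) ?B + measure_pmf.prob (?P n) ?C)" .
      qed
    qed simp
  qed
qed

section \<open>Sprinkling\<close>

text \<open>The second round of exposure: the elements of \<open>F\<close> are kept, and each other element of \<open>A\<close> is added with probability
\<open>r\<close>.\<close>

definition sprinkle :: "'a set \<Rightarrow> real \<Rightarrow> 'a set \<Rightarrow> 'a set pmf" where
  "sprinkle A r F = map_pmf (\<lambda>f. {x \<in> A. f x}) (Pi_pmf A False (\<lambda>x. if x \<in> F then return_pmf True else bernoulli_pmf r))"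

lemma random_subset_sprinkle:
  assumes A: "finite A" and p: "0 \<le> p" "p \<le> 1" and r: "0 \<le> r" "r \<le> 1"
  shows "random_subset A (p + (1 - p) * r) = bind_pmf (random_subset A p) (sprinkle A r)"
proof -
  define N where "N b = (if b then return_pmf True else bernoulli_pmf r)" for b
  have le: "p + (1 - p) * r \<le> 1" using mult_left_mono[of r 1 "1 - p"] p r by simp
  have ge: "0 \<le> p + (1 - p) * r" using p r by simp
  have bern: "bernoulli_pmf (p + (1 - p) * r) = bind_pmf (bernoulli_pmf p) N"
  proof (rule pmf_eqI)
    fix b show "pmf (bernoulli_pmf (p + (1 - p) * r)) b = pmf (bind_pmf (bernoulli_pmf p) N) b"
      by (cases b) (simp_all only: pmf_bernoulli_True[OF ge le] pmf_bernoulli_False[OF ge le],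
        use p r in \<open>simp_all add: N_def pmf_bind algebra_simps\<close>)
  qed
  have inner: "Pi_pmf A False (\<lambda>x. N (f x)) = Pi_pmf A False (\<lambda>x. if x \<in> {x \<in> A. f x} then return_pmf True else bernoulli_pmf r)" for f
    by (rule Pi_pmf_cong) (auto simp: N_def)
  show ?thesis
    unfolding random_subset_def bern Pi_pmf_bind[OF A, where d' = False] map_bind_pmf bind_map_pmf inner sprinkle_def ..
qed

lemma sprinkle_superset:
  assumes "finite A" "F \<subseteq> A" "F' \<in> set_pmf (sprinkle A r F)"
  shows "F \<subseteq> F' \<and> F' \<subseteq> A"
proof -
  from assms(3) obtain f where f: "F' = {x \<in> A. f x}" "f \<in> set_pmf (Pi_pmf A False (\<lambda>x. if x \<in> F then return_pmf True else bernoulli_pmf r))"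
    by (auto simp: sprinkle_def)
  have "f x" if "x \<in> F" for x
  proof -
    have "f x \<in> set_pmf (if x \<in> F then return_pmf True else bernoulli_pmf r)"
      using f(2) that assms(2) unfolding set_Pi_pmf[OF assms(1)] by (auto simp: PiE_dflt_def)
    then show ?thesis using that by simp
  qed
  then show ?thesis using f(1) assms(2) by auto
qed

lemma prob_sprinkle:
  assumes A: "finite A" and r: "0 \<le> r" "r \<le> 1" and x: "x \<in> A - F"
  shows "measure_pmf.prob (sprinkle A r F) {F'. x \<in> F'} = r"
proof -
  let ?q = "\<lambda>x. if x \<in> F then return_pmf True else bernoulli_pmf r"
  have "measure_pmf.prob (sprinkle A r F) {F'. x \<in> F'} = measure_pmf.prob (Pi_pmf A False ?q) {f. f x}"
    unfolding sprinkle_def measure_map_pmf using x by (intro arg_cong[where f = "measure_pmf.prob _"]) auto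
  also have "{f :: 'a \<Rightarrow> bool. f x} = (\<lambda>f. f x) -` {True}" by auto
  also have "measure_pmf.prob (Pi_pmf A False ?q) \<dots> = measure_pmf.prob (map_pmf (\<lambda>f. f x) (Pi_pmf A False ?q)) {True}"
    by (rule measure_map_pmf[symmetric])
  also have "\<dots> = r" using x r by (simp add: Pi_pmf_component[OF A] measure_pmf_single)
  finally show ?thesis .
qed

lemma nn_integral_card_sprinkle:
  assumes A: "finite A" and r: "0 \<le> r" "r \<le> 1" and H: "H \<subseteq> A - F"
  shows "(\<integral>\<^sup>+F'. of_nat (card (H \<inter> F')) \<partial>sprinkle A r F) = ennreal (real (card H) * r)"
proof -
  have fin: "finite H" using H A finite_subset by blast
  have "of_nat (card (H \<inter> F')) = (\<Sum>x\<in>H. indicator {F'. x \<in> F'} F' :: ennreal)" for F'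
    using fin by (simp add: indicator_def sum.If_cases Int_def)
  then have "(\<integral>\<^sup>+F'. of_nat (card (H \<inter> F')) \<partial>sprinkle A r F) = (\<integral>\<^sup>+F'. (\<Sum>x\<in>H. indicator {F'. x \<in> F'} F') \<partial>sprinkle A r F)" by simp
  also have "\<dots> = (\<Sum>x\<in>H. emeasure (sprinkle A r F) {F'. x \<in> F'})" by (subst nn_integral_sum) auto
  also have "\<dots> = (\<Sum>x\<in>H. ennreal r)"
    using H by (intro sum.cong refl) (auto simp: measure_pmf.emeasure_eq_measure intro!: arg_cong[where f = ennreal] prob_sprinkle[OF A r])
  also have "\<dots> = ennreal (real (card H) * r)" using r by (simp add: ennreal_mult ennreal_of_nat_eq_real_of_nat)
  finally show ?thesis .
qed

text \<open>The map \<open>N \<mapsto> insert x N\<close> is a bijection between the two events, and it multiplies probabilities by \<open>p / (1 - p)\<close>.\<close>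

lemma prob_insert_vs_remove:
  assumes A: "finite A" and p: "0 \<le> p" "p \<le> 1" and x: "x \<in> A"
  shows "(1 - p) * measure_pmf.prob (random_subset A p) {F. x \<in> F \<and> Q (F - {x})} =
    p * measure_pmf.prob (random_subset A p) {F. x \<notin> F \<and> Q F}"
proof -
  let ?P = "random_subset A p"
  define I where "I = {N. N \<subseteq> A - {x} \<and> Q N}"
  have finI: "finite I" unfolding I_def by (rule finite_subset[of _ "Pow A"]) (use A in auto)
  have inj: "inj_on (insert x) I" unfolding I_def by (rule inj_onI) blast
  have "measure_pmf.prob ?P {F. x \<in> F \<and> Q (F - {x})} = measure_pmf.prob ?P (insert x ` I)"
  proof (rule measure_pmf.finite_measure_eq_AE)
    show "AE F in ?P. F \<in> {F. x \<in> F \<and> Q (F - {x})} \<longleftrightarrow> F \<in> insert x ` I"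
    proof (rule AE_pmfI)
      fix F assume "F \<in> set_pmf ?P"
      then have F: "F \<subseteq> A" using set_random_subset by blast
      show "F \<in> {F. x \<in> F \<and> Q (F - {x})} \<longleftrightarrow> F \<in> insert x ` I"
      proof
        assume "F \<in> {F. x \<in> F \<and> Q (F - {x})}"
        then show "F \<in> insert x ` I" using F by (intro image_eqI[of _ _ "F - {x}"]) (auto simp: I_def)
      next
        assume "F \<in> insert x ` I"
        then obtain N where "F = insert x N" "N \<subseteq> A - {x}" "Q N" by (auto simp: I_def)
        moreover from this have "F - {x} = N" by auto
        ultimately show "F \<in> {F. x \<in> F \<and> Q (F - {x})}" by simp
      qed
    qed
  qed simp_all
  also have "\<dots> = (\<Sum>F\<in>insert x ` I. pmf ?P F)" using finI by (simp add: measure_measure_pmf_finite)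
  also have "\<dots> = (\<Sum>N\<in>I. pmf ?P (insert x N))" using inj by (simp add: sum.reindex)
  finally have 1: "measure_pmf.prob ?P {F. x \<in> F \<and> Q (F - {x})} = (\<Sum>N\<in>I. pmf ?P (insert x N))" .
  have "measure_pmf.prob ?P {F. x \<notin> F \<and> Q F} = measure_pmf.prob ?P I"
  proof (rule measure_pmf.finite_measure_eq_AE)
    show "AE F in ?P. F \<in> {F. x \<notin> F \<and> Q F} \<longleftrightarrow> F \<in> I"
      by (rule AE_pmfI) (use set_random_subset[of A p] in \<open>auto simp: I_def\<close>)
  qed simp_all
  also have "\<dots> = (\<Sum>N\<in>I. pmf ?P N)" using finI by (simp add: measure_measure_pmf_finite)
  finally have 2: "measure_pmf.prob ?P {F. x \<notin> F \<and> Q F} = (\<Sum>N\<in>I. pmf ?P N)" .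
  show ?thesis unfolding 1 2 sum_distrib_left
  proof (rule sum.cong[OF refl])
    fix N assume "N \<in> I"
    then have N: "N \<subseteq> A" "x \<notin> N" by (auto simp: I_def)
    then have finN: "finite N" using A finite_subset by blast
    have "A - N = insert x (A - insert x N)" using N x by blast
    then have "card (A - N) = card (insert x (A - insert x N))" by (rule arg_cong)
    also have "\<dots> = Suc (card (A - insert x N))" by (rule card_insert_disjoint) (use A in auto)
    finally have c: "card (A - N) = Suc (card (A - insert x N))" .
    have sub: "insert x N \<subseteq> A" using N x by blast
    have "pmf ?P (insert x N) = p ^ Suc (card N) * (1 - p) ^ card (A - insert x N)"
      using pmf_random_subset[OF A p, of "insert x N"] unfolding if_P[OF sub] card_insert_disjoint[OF finN N(2)] .
    moreover have "pmf ?P N = p ^ card N * (1 - p) ^ Suc (card (A - insert x N))"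
      using pmf_random_subset[OF A p, of N] unfolding if_P[OF N(1)] c .
    ultimately show "(1 - p) * pmf ?P (insert x N) = p * pmf ?P N" by simp
  qed
qed

section \<open>Faces contained in cycles\<close>

text \<open>The sets outside \<open>F\<close> that would create a new cycle when added to \<open>F\<close>.\<close>

definition shadow :: "nat \<Rightarrow> nat \<Rightarrow> nat set set \<Rightarrow> nat set set" where
  "shadow d n F = {\<sigma> \<in> dfaces d n - F. face_boundary \<sigma> \<in> span (face_boundary ` F)}"

text \<open>The faces of \<open>F\<close> that lie in the support of some cycle.\<close>

definition cyclic :: "nat set set \<Rightarrow> nat set set" where
  "cyclic F = {\<sigma> \<in> F. face_boundary \<sigma> \<in> span (face_boundary ` (F - {\<sigma>}))}"

lemma keys_cycle_cyclic:
  assumes fin: "finite (faces Y d)" and x: "x \<in> top_homology Y d"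
  shows "Poly_Mapping.keys x \<subseteq> cyclic (faces Y d)"
proof
  let ?F = "faces Y d"
  fix \<sigma> assume \<sigma>: "\<sigma> \<in> Poly_Mapping.keys x"
  have k: "Poly_Mapping.keys x \<subseteq> ?F" "boundary x = 0" using x by (auto simp: top_homology_def chains_def)
  let ?b = "\<lambda>\<rho>. Poly_Mapping.lookup x \<rho> *\<^sub>R face_boundary \<rho>"
  have "0 = (\<Sum>\<rho>\<in>?F. ?b \<rho>)" using boundary_superset[OF fin k(1)] k(2) by simp
  also have "\<dots> = ?b \<sigma> + (\<Sum>\<rho>\<in>?F - {\<sigma>}. ?b \<rho>)" using fin k(1) \<sigma> by (intro sum.remove) auto
  finally have "?b \<sigma> = - (\<Sum>\<rho>\<in>?F - {\<sigma>}. ?b \<rho>)" by (simp add: eq_neg_iff_add_eq_0)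
  moreover have "(\<Sum>\<rho>\<in>?F - {\<sigma>}. ?b \<rho>) \<in> span (face_boundary ` (?F - {\<sigma>}))"
    by (intro span_sum span_scale span_base) auto
  ultimately have "?b \<sigma> \<in> span (face_boundary ` (?F - {\<sigma>}))" by (simp add: span_neg)
  then have "inverse (Poly_Mapping.lookup x \<sigma>) *\<^sub>R ?b \<sigma> \<in> span (face_boundary ` (?F - {\<sigma>}))" by (rule span_scale)
  moreover have "Poly_Mapping.lookup x \<sigma> \<noteq> 0" using \<sigma> by (simp add: in_keys_iff)
  ultimately show "\<sigma> \<in> cyclic ?F" using \<sigma> k(1) by (auto simp: cyclic_def)
qed

text \<open>Removing the shadow of \<open>F\<close> from \<open>F'\<close> does not change the span of the boundaries, and the rank of the remaining
faces is at least the sum of the scores.\<close>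

lemma shadow_hits:
  assumes F: "F \<subseteq> F'" "F' \<subseteq> dfaces d n" and d: "d > 0"
  shows "real (card (shadow d n F \<inter> F')) + (\<Sum>\<tau>\<in>{\<tau>. \<tau> \<subseteq> {..<n} \<and> card \<tau> = d}. score {..<n} k \<tau> F') \<le> real (card F')"
proof -
  let ?E = "{\<tau>. \<tau> \<subseteq> {..<n} \<and> card \<tau> = d}"
  let ?G = "F' - shadow d n F"
  have finF: "finite F'" using F(2) finite_dfaces finite_subset by blast
  have FG: "F \<subseteq> ?G" using F(1) by (auto simp: shadow_def)
  have sub: "span (face_boundary ` F') \<subseteq> span (face_boundary ` ?G)"
  proof (rule span_minimal[OF _ subspace_span], rule image_subsetI)
    fix \<sigma> assume "\<sigma> \<in> F'"
    show "face_boundary \<sigma> \<in> span (face_boundary ` ?G)"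
    proof (cases "\<sigma> \<in> shadow d n F")
      case True
      then have "face_boundary \<sigma> \<in> span (face_boundary ` F)" by (simp add: shadow_def)
      then show ?thesis using span_mono[OF image_mono[OF FG]] by blast
    next
      case False
      then show ?thesis using \<open>\<sigma> \<in> F'\<close> by (intro span_base) auto
    qed
  qed
  have "\<forall>\<tau>\<in>?E. \<exists>w. w \<in> span (face_boundary ` ?G) \<and> score {..<n} k \<tau> F' \<le> 1 - sq_norm (Poly_Mapping.single \<tau> 1 - w)"
  proof
    fix \<tau> assume \<tau>: "\<tau> \<in> ?E"
    then have "finite \<tau>" "\<tau> \<noteq> {}" using d finite_subset[of \<tau> "{..<n}"] by auto
    from score_witness[OF this, of F' "{..<n}" k] obtain w where
      w: "w \<in> span (face_boundary ` F')" "score {..<n} k \<tau> F' \<le> 1 - sq_norm (Poly_Mapping.single \<tau> 1 - w)" by (rule bexE)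
    then show "\<exists>w. w \<in> span (face_boundary ` ?G) \<and> score {..<n} k \<tau> F' \<le> 1 - sq_norm (Poly_Mapping.single \<tau> 1 - w)"
      by (intro exI[of _ w] conjI subsetD[OF sub])
  qed
  from bchoice[OF this] obtain w0 where w0: "\<forall>\<tau>\<in>?E. w0 \<tau> \<in> span (face_boundary ` ?G) \<and> score {..<n} k \<tau> F' \<le> 1 - sq_norm (Poly_Mapping.single \<tau> 1 - w0 \<tau>)" ..
  then have w: "\<And>\<tau>. \<tau> \<in> ?E \<Longrightarrow> w0 \<tau> \<in> span (face_boundary ` ?G)"
    "\<And>\<tau>. \<tau> \<in> ?E \<Longrightarrow> score {..<n} k \<tau> F' \<le> 1 - sq_norm (Poly_Mapping.single \<tau> 1 - w0 \<tau>)"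
    by simp_all
  have "(\<Sum>\<tau>\<in>?E. score {..<n} k \<tau> F') \<le> (\<Sum>\<tau>\<in>?E. 1 - sq_norm (Poly_Mapping.single \<tau> 1 - w0 \<tau>))"
    by (intro sum_mono w)
  also have "\<dots> \<le> real (card (face_boundary ` ?G))"
    by (rule card_ge_of_approximation[OF _ _ w(1)]) (simp_all add: finF)
  also have "\<dots> \<le> real (card ?G)" using finF by (intro of_nat_mono card_image_le) simp
  also have "card ?G = card F' - card (shadow d n F \<inter> F')"
    using finF by (simp add: card_Diff_subset_Int Int_commute)
  also have "real \<dots> = real (card F') - real (card (shadow d n F \<inter> F'))"
    using finF by (intro of_nat_diff card_mono) auto
  finally show ?thesis by simp
qed

text \<open>Integrates \<open>shadow_hits\<close> over both rounds. Given the first round, each set of its shadow is hit with probability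
\<open>r\<close>.\<close>

lemma expected_shadow:
  assumes p: "0 \<le> p" "p \<le> 1" and r: "0 \<le> r" "r \<le> 1" and d: "d > 0"
  shows "ennreal r * (\<integral>\<^sup>+F. of_nat (card (shadow d n F)) \<partial>random_subset (dfaces d n) p) +
      (\<Sum>\<tau>\<in>{\<tau>. \<tau> \<subseteq> {..<n} \<and> card \<tau> = d}. \<integral>\<^sup>+F. ennreal (score {..<n} k \<tau> F) \<partial>random_subset (dfaces d n) (p + (1 - p) * r)) \<le>
    ennreal (real (card (dfaces d n)) * (p + (1 - p) * r))"
proof -
  let ?E = "{\<tau>. \<tau> \<subseteq> {..<n} \<and> card \<tau> = d}"
  let ?A = "dfaces d n"
  let ?P = "random_subset ?A p"
  let ?P' = "random_subset ?A (p + (1 - p) * r)"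
  have le: "0 \<le> p + (1 - p) * r" "p + (1 - p) * r \<le> 1" using mult_left_mono[of r 1 "1 - p"] p r by auto
  note bind = random_subset_sprinkle[OF finite_dfaces[of d n] p r]
  have nz: "finite \<tau>" "\<tau> \<noteq> {}" if "\<tau> \<in> ?E" for \<tau> using that d finite_subset[of \<tau> "{..<n}"] by auto
  have "ennreal r * (\<integral>\<^sup>+F. of_nat (card (shadow d n F)) \<partial>?P) + (\<Sum>\<tau>\<in>?E. \<integral>\<^sup>+F. ennreal (score {..<n} k \<tau> F) \<partial>?P') =
    (\<integral>\<^sup>+F. ennreal r * of_nat (card (shadow d n F)) \<partial>?P) + (\<integral>\<^sup>+F. (\<Sum>\<tau>\<in>?E. ennreal (score {..<n} k \<tau> F)) \<partial>?P')"
    by (simp add: nn_integral_cmult nn_integral_sum)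
  also have "(\<integral>\<^sup>+F. (\<Sum>\<tau>\<in>?E. ennreal (score {..<n} k \<tau> F)) \<partial>?P') = (\<integral>\<^sup>+F. \<integral>\<^sup>+F'. (\<Sum>\<tau>\<in>?E. ennreal (score {..<n} k \<tau> F')) \<partial>sprinkle ?A r F \<partial>?P)"
    unfolding bind by (simp add: nn_integral_bind_pmf)
  also have "(\<integral>\<^sup>+F. ennreal r * of_nat (card (shadow d n F)) \<partial>?P) = (\<integral>\<^sup>+F. \<integral>\<^sup>+F'. of_nat (card (shadow d n F \<inter> F')) \<partial>sprinkle ?A r F \<partial>?P)"
  proof (intro nn_integral_cong)
    fix F
    have "shadow d n F \<subseteq> ?A - F" by (auto simp: shadow_def)
    from nn_integral_card_sprinkle[OF finite_dfaces r this]
    show "ennreal r * of_nat (card (shadow d n F)) = (\<integral>\<^sup>+F'. of_nat (card (shadow d n F \<inter> F')) \<partial>sprinkle ?A r F)"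
      using r by (simp only: ennreal_mult' ennreal_of_nat_eq_real_of_nat mult.commute of_nat_0_le_iff)
  qed
  also have "(\<integral>\<^sup>+F. \<integral>\<^sup>+F'. of_nat (card (shadow d n F \<inter> F')) \<partial>sprinkle ?A r F \<partial>?P) +
      (\<integral>\<^sup>+F. \<integral>\<^sup>+F'. (\<Sum>\<tau>\<in>?E. ennreal (score {..<n} k \<tau> F')) \<partial>sprinkle ?A r F \<partial>?P) =
    (\<integral>\<^sup>+F. \<integral>\<^sup>+F'. of_nat (card (shadow d n F \<inter> F')) + (\<Sum>\<tau>\<in>?E. ennreal (score {..<n} k \<tau> F')) \<partial>sprinkle ?A r F \<partial>?P)"
    by (simp add: nn_integral_add)
  also have "\<dots> \<le> (\<integral>\<^sup>+F. \<integral>\<^sup>+F'. of_nat (card F') \<partial>sprinkle ?A r F \<partial>?P)"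
  proof (intro nn_integral_mono_AE AE_pmfI)
    fix F F' assume "F \<in> set_pmf ?P" "F' \<in> set_pmf (sprinkle ?A r F)"
    then have F: "F \<subseteq> F'" "F' \<subseteq> ?A"
      using set_random_subset[of ?A p] sprinkle_superset[OF finite_dfaces[of d n], of F F' r] by blast+
    have "of_nat (card (shadow d n F \<inter> F')) + (\<Sum>\<tau>\<in>?E. ennreal (score {..<n} k \<tau> F')) =
      ennreal (real (card (shadow d n F \<inter> F')) + (\<Sum>\<tau>\<in>?E. score {..<n} k \<tau> F'))"
    proof -
      have nonneg: "0 \<le> score {..<n} k \<tau> F'" if "\<tau> \<in> ?E" for \<tau> by (rule score_nonneg[OF nz[OF that]])
      have "(\<Sum>\<tau>\<in>?E. ennreal (score {..<n} k \<tau> F')) = ennreal (\<Sum>\<tau>\<in>?E. score {..<n} k \<tau> F')"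
        by (rule sum_ennreal[OF nonneg])
      moreover have "0 \<le> (\<Sum>\<tau>\<in>?E. score {..<n} k \<tau> F')" by (rule sum_nonneg[OF nonneg])
      ultimately show ?thesis by (simp only: ennreal_of_nat_eq_real_of_nat ennreal_plus of_nat_0_le_iff)
    qed
    also have "\<dots> \<le> ennreal (real (card F'))" by (intro ennreal_leI shadow_hits F d)
    finally show "of_nat (card (shadow d n F \<inter> F')) + (\<Sum>\<tau>\<in>?E. ennreal (score {..<n} k \<tau> F')) \<le> of_nat (card F')"
      by (simp add: ennreal_of_nat_eq_real_of_nat)
  qed
  also have "\<dots> = (\<integral>\<^sup>+F. of_nat (card F) \<partial>?P')" unfolding bind by (simp add: nn_integral_bind_pmf)
  also have "\<dots> = ennreal (real (card ?A) * (p + (1 - p) * r))" by (rule nn_integral_card_random_subset[OF finite_dfaces le])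
  finally show ?thesis .
qed

text \<open>A face \<open>\<sigma>\<close> is cyclic in \<open>F\<close> if and only if it belongs to the shadow of \<open>F - {\<sigma>}\<close>.\<close>

lemma expected_cyclic:
  assumes p: "0 \<le> p" "p \<le> 1"
  shows "ennreal (1 - p) * (\<integral>\<^sup>+F. of_nat (card (cyclic F)) \<partial>random_subset (dfaces d n) p) =
    ennreal p * (\<integral>\<^sup>+F. of_nat (card (shadow d n F)) \<partial>random_subset (dfaces d n) p)"
proof -
  let ?A = "dfaces d n"
  let ?P = "random_subset ?A p"
  define Q where "Q \<sigma> F \<longleftrightarrow> face_boundary \<sigma> \<in> span (face_boundary ` F)" for \<sigma> F
  have c: "(\<integral>\<^sup>+F. of_nat (card (cyclic F)) \<partial>?P) = (\<Sum>\<sigma>\<in>?A. ennreal (measure_pmf.prob ?P {F. \<sigma> \<in> F \<and> Q \<sigma> (F - {\<sigma>})}))"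
  proof -
    have "(\<integral>\<^sup>+F. of_nat (card (cyclic F)) \<partial>?P) = (\<integral>\<^sup>+F. (\<Sum>\<sigma>\<in>?A. indicator {F. \<sigma> \<in> F \<and> Q \<sigma> (F - {\<sigma>})} F) \<partial>?P)"
    proof (intro nn_integral_cong_AE AE_pmfI)
      fix F assume "F \<in> set_pmf ?P"
      then have "F \<subseteq> ?A" using set_random_subset by blast
      then have "cyclic F = ?A \<inter> {\<sigma>. \<sigma> \<in> F \<and> Q \<sigma> (F - {\<sigma>})}" by (auto simp: cyclic_def Q_def)
      then show "of_nat (card (cyclic F)) = (\<Sum>\<sigma>\<in>?A. indicator {F. \<sigma> \<in> F \<and> Q \<sigma> (F - {\<sigma>})} F :: ennreal)"
        by (simp add: indicator_def sum.If_cases finite_dfaces)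
    qed
    then show ?thesis by (simp add: nn_integral_sum measure_pmf.emeasure_eq_measure)
  qed
  have s: "(\<integral>\<^sup>+F. of_nat (card (shadow d n F)) \<partial>?P) = (\<Sum>\<sigma>\<in>?A. ennreal (measure_pmf.prob ?P {F. \<sigma> \<notin> F \<and> Q \<sigma> F}))"
  proof -
    have "of_nat (card (shadow d n F)) = (\<Sum>\<sigma>\<in>?A. indicator {F. \<sigma> \<notin> F \<and> Q \<sigma> F} F :: ennreal)" for F
    proof -
      have "shadow d n F = ?A \<inter> {\<sigma>. \<sigma> \<notin> F \<and> Q \<sigma> F}" by (auto simp: shadow_def Q_def)
      then show ?thesis by (simp add: indicator_def sum.If_cases finite_dfaces)
    qed
    then show ?thesis by (simp add: nn_integral_sum measure_pmf.emeasure_eq_measure)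
  qed
  show ?thesis unfolding c s sum_distrib_left
  proof (rule sum.cong[OF refl])
    fix \<sigma> assume "\<sigma> \<in> ?A"
    from prob_insert_vs_remove[OF finite_dfaces p this, of "Q \<sigma>"]
    show "ennreal (1 - p) * ennreal (measure_pmf.prob ?P {F. \<sigma> \<in> F \<and> Q \<sigma> (F - {\<sigma>})}) =
      ennreal p * ennreal (measure_pmf.prob ?P {F. \<sigma> \<notin> F \<and> Q \<sigma> F})"
      using p by (simp add: ennreal_mult[symmetric])
  qed
qed

section \<open>Few faces lie in cycles\<close>

lemma markov_pmf:
  assumes "(\<integral>\<^sup>+x. ennreal (f x) \<partial>measure_pmf P) \<le> ennreal b" "a > 0" "b \<ge> 0"
  shows "measure_pmf.prob P {x. a < f x} \<le> b / a"
proof -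
  have "ennreal (a * measure_pmf.prob P {x. a < f x}) = (\<integral>\<^sup>+x. ennreal a * indicator {x. a < f x} x \<partial>measure_pmf P)"
    using assms(2) by (simp add: nn_integral_cmult measure_pmf.emeasure_eq_measure ennreal_mult)
  also have "\<dots> \<le> (\<integral>\<^sup>+x. ennreal (f x) \<partial>measure_pmf P)"
    by (intro nn_integral_mono) (auto simp: indicator_def intro!: ennreal_leI)
  also note assms(1)
  finally show ?thesis using assms(2,3) by (simp add: ennreal_le_iff field_simps)
qed

text \<open>For \<open>c < c' < c_star d\<close> the scores at \<open>c'\<close> add up to at least \<open>c' / (d+1)\<close> times the number of \<open>(d-1)\<close>-sets, up
to a small multiple of \<open>n^d\<close>, by \<open>cavity_mean_limit\<close> and \<open>score_expectation_limit\<close>. This is also the expected number of faces, so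
that \<open>expected_shadow\<close> leaves little room for the shadow of the first round.\<close>

lemma expected_cyclic_small:
  assumes d: "2 \<le> d" and c: "0 < c" "c < c_star d" and e: "e > 0"
  shows "\<forall>\<^sub>F n in sequentially.
    (\<integral>\<^sup>+F. of_nat (card (cyclic F)) \<partial>random_subset (dfaces d n) (c / real n)) \<le> ennreal (e * real n ^ d)"
proof -
  define c' where "c' = (c + c_star d) / 2"
  have c': "c < c'" "c' < c_star d" "0 < c'" using c by (auto simp: c'_def)
  \<comment> \<open>the precision; the first bound keeps \<open>b\<close> positive, and the second one absorbs the factor \<open>c / (c' - c)\<close> lost below\<close>
  define h where "h = min (c' / (real d + 1) / 2) (e * (c' - c) / (2 * c))"
  have h: "h > 0" "h < c' / (real d + 1)" "c / (c' - c) * (2 * h) \<le> e"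
  proof -
    have pos: "c' / (real d + 1) > 0" "e * (c' - c) / (2 * c) > 0" using c c' e by auto
    from pos show "h > 0" unfolding h_def min_less_iff_conj by (intro conjI half_gt_zero)
    have "h \<le> c' / (real d + 1) / 2" unfolding h_def by (rule min.cobounded1)
    also have "\<dots> < c' / (real d + 1)"
    proof -
      have "a / 2 < a" if "a > 0" for a :: real using that by simp
      from this[OF pos(1)] show ?thesis .
    qed
    finally show "h < c' / (real d + 1)" .
    have "h \<le> e * (c' - c) / (2 * c)" by (simp add: h_def)
    then have "h * (2 * c) \<le> e * (c' - c)" using c by (simp add: pos_le_divide_eq)
    then show "c / (c' - c) * (2 * h) \<le> e" using c' by (simp add: pos_divide_le_eq mult.commute mult.left_commute)
  qed
  obtain k where k: "cavity_mean c' d k \<le> 1 - c' / (real d + 1) + h" using cavity_mean_limit[OF d c'(3,2) h(1)] ..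
  have d0: "d > 0" using d by simp
  define b where "b = c' / (real d + 1) - h"
  have b: "b > 0" using h by (simp add: b_def)
  let ?I = "\<integral>\<^sup>+x. ennreal (1 - x) \<partial>cavity (poisson_pmf c') d k"
  have bI: "ennreal b \<le> ?I"
  proof -
    have mn: "0 \<le> cavity_mean c' d k" by (rule cavity_mean_nonneg[OF c'(3) d0])
    have "ennreal (cavity_mean c' d k) + ennreal b \<le> ennreal 1"
      using k b mn by (simp add: ennreal_plus[symmetric] b_def del: ennreal_plus ennreal_1)
    also have "\<dots> = (\<integral>\<^sup>+x. ennreal x + ennreal (1 - x) \<partial>cavity (poisson_pmf c') d k)"
    proof -
      have "(\<integral>\<^sup>+x. ennreal x + ennreal (1 - x) \<partial>cavity (poisson_pmf c') d k) = (\<integral>\<^sup>+x. 1 \<partial>cavity (poisson_pmf c') d k)"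
      proof (intro nn_integral_cong_AE AE_pmfI)
        fix x assume "x \<in> set_pmf (cavity (poisson_pmf c') d k)"
        then have "0 \<le> x" "x \<le> 1" using set_cavity[OF d0, of "poisson_pmf c'" k] by (force, force)
        then show "ennreal x + ennreal (1 - x) = 1" by (simp add: ennreal_plus[symmetric] del: ennreal_plus)
      qed
      then show ?thesis by (simp add: measure_pmf.emeasure_space_1)
    qed
    also have "\<dots> = ennreal (cavity_mean c' d k) + ?I"
      by (simp add: nn_integral_add nn_cavity_mean[OF c'(3) d0])
    finally show ?thesis by (simp add: ennreal_add_left_cancel_le)
  qed
  show ?thesis
    using score_expectation_limit[OF c'(3) d0 h(1), of k] eventually_gt_at_top[of "nat \<lceil>c'\<rceil>"]
  proof eventually_elim
    case (elim n)
    have cn: "c' < real n" using elim(2) by linarith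
    then have n: "real n > 0" using c' by linarith
    define p where "p = c / real n"
    \<comment> \<open>the probability in the second round for which the two rounds together have probability \<open>c' / n\<close>\<close>
    define r where "r = (c' - c) / real n / (1 - p)"
    have p: "0 \<le> p" "p < 1" using c c' cn by (auto simp: p_def)
    have p': "p + (1 - p) * r = c' / real n" using p n by (simp add: r_def p_def add_divide_distrib[symmetric])
    have r: "0 \<le> r" "r \<le> 1"
    proof -
      show "0 \<le> r" using p c' by (simp add: r_def)
      have "(c' - c) / real n \<le> 1 - p" using n cn by (simp add: p_def field_simps)
      moreover have "0 < 1 - p" using p by simp
      ultimately show "r \<le> 1" unfolding r_def by (subst divide_le_eq_1_pos)
    qed
    let ?E = "{\<tau>. \<tau> \<subseteq> {..<n} \<and> card \<tau> = d}"
    let ?P = "random_subset (dfaces d n) p"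
    let ?T = "\<lambda>\<tau>. \<integral>\<^sup>+F. ennreal (score {..<n} k \<tau> F) \<partial>random_subset (dfaces d n) (c' / real n)"
    define X where "X = (\<integral>\<^sup>+F. of_nat (card (shadow d n F)) \<partial>?P)"
    define Y where "Y = (\<integral>\<^sup>+F. of_nat (card (cyclic F)) \<partial>?P)"
    define N where "N = real (n choose d)"
    have cE: "real (card ?E) = N" unfolding N_def using n_subsets[of "{..<n}" d] by simp
    have N: "0 \<le> N" "N \<le> real n ^ d" unfolding N_def using choose_le_power by auto
    have cD: "real (card (dfaces d n)) * (c' / real n) \<le> N * (c' / (real d + 1))"
    proof -
      have "card (dfaces d n) = n choose Suc d" unfolding dfaces_def using n_subsets[of "{..<n}" "d + 1"] by simp
      moreover have "Suc d * (n choose Suc d) \<le> n * (n choose d)"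
        using binomial_absorption[of d n] binomial_right_mono[of "n - 1" n d] by simp
      then have "real (Suc d * (n choose Suc d)) \<le> real (n * (n choose d))" by (rule of_nat_mono)
      ultimately have "(real d + 1) * real (card (dfaces d n)) \<le> real n * N" by (simp add: N_def algebra_simps)
      then have "real (card (dfaces d n)) / real n \<le> N / (real d + 1)" using n by (simp add: field_simps)
      from mult_right_mono[OF this, of c'] show ?thesis using c' by simp
    qed
    have rX: "ennreal r * X \<le> ennreal (2 * N * h)"
    proof -
      have "ennreal (N * b) + ennreal r * X = (\<Sum>\<tau>\<in>?E. ennreal b) + ennreal r * X"
        unfolding cE[symmetric] using b by (simp add: ennreal_mult ennreal_of_nat_eq_real_of_nat)
      also have "\<dots> \<le> (\<Sum>\<tau>\<in>?E. ?T \<tau> + ennreal h) + ennreal r * X"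
      proof (intro add_mono sum_mono order_refl)
        fix \<tau> assume "\<tau> \<in> ?E"
        then have "?I \<le> ?T \<tau> + ennreal h" using elim(1) by (simp add: dfaces_def)
        then show "ennreal b \<le> ?T \<tau> + ennreal h" using bI by (rule order_trans[rotated])
      qed
      also have "\<dots> = (ennreal r * X + (\<Sum>\<tau>\<in>?E. ?T \<tau>)) + ennreal (N * h)"
        unfolding cE[symmetric] using h by (simp add: sum.distrib ennreal_mult ennreal_of_nat_eq_real_of_nat ac_simps)
      also have "\<dots> \<le> ennreal (real (card (dfaces d n)) * (c' / real n)) + ennreal (N * h)"
        using expected_shadow[of p r d n k] p r d0 unfolding p' X_def by (intro add_mono) auto
      also have "\<dots> \<le> ennreal (N * (c' / (real d + 1))) + ennreal (N * h)"
        by (intro add_mono ennreal_leI cD order_refl)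
      also have "\<dots> = ennreal (N * (c' / (real d + 1)) + N * h)"
        using N h c' by (intro ennreal_plus[symmetric] mult_nonneg_nonneg) auto
      also have "N * (c' / (real d + 1)) + N * h = N * b + 2 * N * h" by (simp add: b_def algebra_simps)
      also have "ennreal \<dots> = ennreal (N * b) + ennreal (2 * N * h)"
        using N h b by (intro ennreal_plus mult_nonneg_nonneg) auto
      finally show ?thesis by (simp add: ennreal_add_left_cancel_le)
    qed
    have eq: "ennreal (1 - p) * Y = ennreal p * X"
      unfolding X_def Y_def by (rule expected_cyclic) (use p in auto)
    have "Y = ennreal (real n / (c' - c)) * (ennreal ((c' - c) / real n) * Y)"
      using n c' by (simp add: mult.assoc[symmetric] ennreal_mult[symmetric])
    also have "ennreal ((c' - c) / real n) * Y = ennreal r * (ennreal (1 - p) * Y)"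
      using p r by (simp add: mult.assoc[symmetric] ennreal_mult[symmetric]) (simp add: r_def)
    also have "\<dots> = ennreal p * (ennreal r * X)" unfolding eq by (simp only: ac_simps)
    also have "ennreal (real n / (c' - c)) * \<dots> \<le> ennreal (real n / (c' - c)) * (ennreal p * ennreal (2 * N * h))"
      by (intro mult_left_mono rX) auto
    also have "\<dots> = ennreal (real n / (c' - c) * (p * (2 * N * h)))"
    proof -
      have "0 \<le> real n / (c' - c)" using c' by simp
      from ennreal_mult'[OF this] ennreal_mult'[OF p(1)] show ?thesis by (simp only:)
    qed
    also have "\<dots> \<le> ennreal (e * real n ^ d)"
    proof (rule ennreal_leI)
      have "real n / (c' - c) * (p * (2 * N * h)) = (c / (c' - c) * (2 * h)) * N"
        using n by (simp add: p_def)
      also have "\<dots> \<le> e * real n ^ d" using h N e by (intro mult_mono) auto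
      finally show "real n / (c' - c) * (p * (2 * N * h)) \<le> e * real n ^ d" .
    qed
    finally show ?case unfolding Y_def p_def .
  qed
qed

lemma few_cyclic:
  assumes d: "2 \<le> d" and c: "0 < c" "c < c_star d" and \<delta>: "\<delta> > 0"
  shows "(\<lambda>n. measure_pmf.prob (random_subset (dfaces d n) (c / real n)) {F. \<delta> * real n ^ d < real (card (cyclic F))}) \<longlonglongrightarrow> 0"
proof (rule LIMSEQ_I)
  fix e :: real assume e: "e > 0"
  have de: "\<delta> * e / 2 > 0" using \<delta> e by simp
  have "\<forall>\<^sub>F n in sequentially. measure_pmf.prob (random_subset (dfaces d n) (c / real n)) {F. \<delta> * real n ^ d < real (card (cyclic F))} < e"
    using expected_cyclic_small[OF d c de] eventually_gt_at_top[of 0]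
  proof eventually_elim
    case (elim n)
    have "measure_pmf.prob (random_subset (dfaces d n) (c / real n)) {F. \<delta> * real n ^ d < real (card (cyclic F))} \<le>
      (\<delta> * e / 2 * real n ^ d) / (\<delta> * real n ^ d)"
      by (rule markov_pmf) (use elim \<delta> e in \<open>simp_all add: ennreal_of_nat_eq_real_of_nat\<close>)
    also have "\<dots> = e / 2" using elim \<delta> by simp
    finally show ?case using e by linarith
  qed
  then show "\<exists>no. \<forall>n\<ge>no. norm (measure_pmf.prob (random_subset (dfaces d n) (c / real n)) {F. \<delta> * real n ^ d < real (card (cyclic F))} - 0) < e"
    unfolding eventually_sequentially by simp
qed

section \<open>Copies of the boundary of a simplex\<close>

definition simplices :: "nat \<Rightarrow> nat \<Rightarrow> nat set set \<Rightarrow> nat set set" where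
  "simplices d n F = {\<tau>. \<tau> \<subseteq> {..<n} \<and> card \<tau> = d + 2 \<and> (\<forall>\<sigma>\<subseteq>\<tau>. card \<sigma> = d + 1 \<longrightarrow> \<sigma> \<in> F)}"

text \<open>There are at most \<open>n^(d+2)\<close> possible vertex sets, each of which needs \<open>d + 2\<close> faces.\<close>

lemma expected_simplices:
  assumes n: "n > 0" and c: "0 \<le> c" "c \<le> real n"
  shows "(\<integral>\<^sup>+F. of_nat (card (simplices d n F)) \<partial>random_subset (dfaces d n) (c / real n)) \<le> ennreal (c ^ (d + 2))"
proof -
  define p where "p = c / real n"
  have p: "0 \<le> p" "p \<le> 1" using n c by (auto simp: p_def)
  let ?E = "{\<tau>. \<tau> \<subseteq> {..<n} \<and> card \<tau> = d + 2}"
  let ?S = "\<lambda>\<tau> :: nat set. {\<sigma>. \<sigma> \<subseteq> \<tau> \<and> card \<sigma> = d + 1}"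
  have "of_nat (card (simplices d n F)) = (\<Sum>\<tau>\<in>?E. indicator {F. ?S \<tau> \<subseteq> F} F :: ennreal)" for F
  proof -
    have "simplices d n F = ?E \<inter> {\<tau>. ?S \<tau> \<subseteq> F}" by (auto simp: simplices_def)
    then show ?thesis by (simp add: indicator_def sum.If_cases)
  qed
  then have "(\<integral>\<^sup>+F. of_nat (card (simplices d n F)) \<partial>random_subset (dfaces d n) p) =
    (\<Sum>\<tau>\<in>?E. ennreal (measure_pmf.prob (random_subset (dfaces d n) p) {F. ?S \<tau> \<subseteq> F}))"
    by (simp add: nn_integral_sum measure_pmf.emeasure_eq_measure)
  also have "\<dots> \<le> (\<Sum>\<tau>\<in>?E. ennreal (p ^ (d + 2)))"
  proof (intro sum_mono ennreal_leI)
    fix \<tau> assume "\<tau> \<in> ?E"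
    then have \<tau>: "finite \<tau>" "card \<tau> = d + 2" using finite_subset[of \<tau> "{..<n}"] by auto
    have "card (?S \<tau>) = (d + 2) choose (d + 1)" using n_subsets[OF \<tau>(1), of "d + 1"] \<tau>(2) by simp
    also have "\<dots> = d + 2" using binomial_Suc_n[of "d + 1"] by simp
    finally have "card (?S \<tau>) = d + 2" .
    then show "measure_pmf.prob (random_subset (dfaces d n) p) {F. ?S \<tau> \<subseteq> F} \<le> p ^ (d + 2)"
      using prob_random_subset_superset_le[OF finite_dfaces p, of "?S \<tau>" d n] \<tau>(1) by simp
  qed
  also have "\<dots> = ennreal (real (n choose (d + 2)) * p ^ (d + 2))"
    using n_subsets[of "{..<n}" "d + 2"] p by (simp add: ennreal_mult ennreal_of_nat_eq_real_of_nat)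
  also have "\<dots> \<le> ennreal (c ^ (d + 2))"
  proof (rule ennreal_leI)
    have "real (n choose (d + 2)) * p ^ (d + 2) \<le> real n ^ (d + 2) * p ^ (d + 2)"
      by (rule mult_right_mono[OF choose_le_power]) (use p in simp)
    also have "\<dots> = c ^ (d + 2)" using n by (simp only: power_mult_distrib[symmetric] p_def) simp
    finally show "real (n choose (d + 2)) * p ^ (d + 2) \<le> c ^ (d + 2)" .
  qed
  finally show ?thesis by (simp add: p_def)
qed

section \<open>The homology of the random complex\<close>

definition skeleton :: "nat \<Rightarrow> nat \<Rightarrow> nat set set" where
  "skeleton d n = {\<sigma>. \<sigma> \<subseteq> {..<n} \<and> card \<sigma> \<le> d}"

lemma random_complex_eq: "random_complex d n p = map_pmf (\<lambda>F. skeleton d n \<union> F) (random_subset (dfaces d n) p)"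
  unfolding random_complex_def random_subset_def skeleton_def dfaces_def pmf.map_comp o_def
  by (intro map_pmf_cong refl) auto

lemma faces_skeleton_Un: "F \<subseteq> dfaces d n \<Longrightarrow> faces (skeleton d n \<union> F) d = F"
  by (auto simp: faces_def skeleton_def dfaces_def)

lemma simplex_boundaries_skeleton_Un:
  assumes F: "F \<subseteq> dfaces d n"
  shows "simplex_boundaries (skeleton d n \<union> F) d = face_boundary ` simplices d n F"
proof -
  have "\<tau> \<subseteq> {..<n}" if \<tau>: "card \<tau> = d + 2" "\<forall>\<sigma>\<subseteq>\<tau>. card \<sigma> = d + 1 \<longrightarrow> \<sigma> \<in> F" for \<tau>
  proof
    fix v assume v: "v \<in> \<tau>"
    have fin: "finite \<tau>" using \<tau>(1) by (intro card_ge_0_finite) simp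
    have "card (\<tau> - {v}) = d + 1" using \<tau>(1) v fin by simp
    then have "\<tau> - {v} \<noteq> {}" by (intro notI) simp
    then obtain u where u: "u \<in> \<tau>" "u \<noteq> v" by blast
    have "card (\<tau> - {u}) = d + 1" using \<tau>(1) u fin by simp
    then have "\<tau> - {u} \<in> F" using \<tau>(2) by simp
    then have "\<tau> - {u} \<in> dfaces d n" by (rule subsetD[OF F])
    then have "\<tau> - {u} \<subseteq> {..<n}" by (simp add: dfaces_def)
    moreover have "v \<in> \<tau> - {u}" using v u(2) by simp
    ultimately show "v \<in> {..<n}" by (rule subsetD)
  qed
  then have "{\<tau>. card \<tau> = d + 2 \<and> (\<forall>\<sigma>\<subseteq>\<tau>. card \<sigma> = d + 1 \<longrightarrow> \<sigma> \<in> F)} = simplices d n F"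
    unfolding simplices_def by (intro Collect_cong iffI conjI; elim conjE) simp_all
  then show ?thesis unfolding simplex_boundaries_def faces_skeleton_Un[OF F] setcompr_eq_image by (rule arg_cong)
qed

lemma finite_simplices: "finite (simplices d n F)"
  by (rule finite_subset[of _ "Pow {..<n}"]) (auto simp: simplices_def)

text \<open>Every cycle is supported by \<open>cyclic F\<close>, so the bound \<open>L\<close> on this set makes all supports small.\<close>

lemma generated_by_simplices:
  assumes F: "F \<subseteq> dfaces d n"
    and cores: "\<not> (\<exists>K\<subseteq>F. core K \<and> real (card K) \<le> L \<and> \<not> has_simplex_boundary d K)"
    and cyc: "real (card (cyclic F)) \<le> L"
  shows "top_homology (skeleton d n \<union> F) d = span (simplex_boundaries (skeleton d n \<union> F) d)"
proof (rule top_homology_eq_span)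
  note f = faces_skeleton_Un[OF F]
  have fin: "finite F" using F finite_dfaces finite_subset by blast
  show finf: "finite (faces (skeleton d n \<union> F) d)" by (simp add: f fin)
  fix K assume "core K" "K \<subseteq> faces (skeleton d n \<union> F) d" "real (card K) \<le> L"
  then have "has_simplex_boundary d K" using cores f by blast
  then show "\<exists>\<tau>. card \<tau> = d + 2 \<and> (\<forall>\<sigma>\<subseteq>\<tau>. card \<sigma> = d + 1 \<longrightarrow> \<sigma> \<in> K)" by (simp add: has_simplex_boundary_def)
next
  note f = faces_skeleton_Un[OF F]
  have fin: "finite F" using F finite_dfaces finite_subset by blast
  fix x assume "x \<in> top_homology (skeleton d n \<union> F) d"
  then have "Poly_Mapping.keys x \<subseteq> cyclic F" using keys_cycle_cyclic[of "skeleton d n \<union> F" d x] by (simp add: f fin)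
  moreover have "finite (cyclic F)" using fin by (simp add: cyclic_def)
  ultimately have "card (Poly_Mapping.keys x) \<le> card (cyclic F)" by (intro card_mono)
  then show "real (card (Poly_Mapping.keys x)) \<le> L" using cyc by linarith
qed

lemma whp_generated_by_simplices:
  assumes d: "2 \<le> d" and c: "0 < c" "c < c_star d"
  shows "(\<lambda>n. measure_pmf.prob (random_subset (dfaces d n) (c / real n))
    {F. top_homology (skeleton d n \<union> F) d = span (simplex_boundaries (skeleton d n \<union> F) d)}) \<longlonglongrightarrow> 1"
proof -
  let ?P = "\<lambda>n. random_subset (dfaces d n) (c / real n)"
  from core_gap[OF d c(1)] obtain \<delta> where \<delta>: "\<delta> > 0" and gap:
    "(\<lambda>n. measure_pmf.prob (?P n) {F. \<exists>K\<subseteq>F. core K \<and> real (card K) \<le> \<delta> * real n ^ d \<and> \<not> has_simplex_boundary d K}) \<longlonglongrightarrow> 0"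
    by blast
  let ?A = "\<lambda>n. {F. \<exists>K\<subseteq>F. core K \<and> real (card K) \<le> \<delta> * real n ^ d \<and> \<not> has_simplex_boundary d K}"
  let ?B = "\<lambda>n. {F. \<delta> * real n ^ d < real (card (cyclic F))}"
  let ?G = "\<lambda>n. {F. top_homology (skeleton d n \<union> F) d = span (simplex_boundaries (skeleton d n \<union> F) d)}"
  have lim: "(\<lambda>n. 1 - (measure_pmf.prob (?P n) (?A n) + measure_pmf.prob (?P n) (?B n))) \<longlonglongrightarrow> 1 - (0 + 0)"
    by (intro tendsto_intros gap few_cyclic[OF d c \<delta>])
  show ?thesis
  proof (rule tendsto_sandwich[OF _ _ _ tendsto_const])
    show "(\<lambda>n. 1 - (measure_pmf.prob (?P n) (?A n) + measure_pmf.prob (?P n) (?B n))) \<longlonglongrightarrow> 1" using lim by simp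
    show "\<forall>\<^sub>F n in sequentially. 1 - (measure_pmf.prob (?P n) (?A n) + measure_pmf.prob (?P n) (?B n)) \<le> measure_pmf.prob (?P n) (?G n)"
    proof (intro always_eventually allI)
      fix n
      have "measure_pmf.prob (?P n) (- ?G n) \<le> measure_pmf.prob (?P n) (?A n \<union> ?B n)"
      proof (rule measure_pmf_mono_AE)
        fix F assume "F \<in> set_pmf (?P n)" "F \<in> - ?G n"
        moreover from this have "F \<subseteq> dfaces d n" using set_random_subset by blast
        ultimately show "F \<in> ?A n \<union> ?B n" using generated_by_simplices[of F d n "\<delta> * real n ^ d"] by fastforce
      qed
      also have "\<dots> \<le> measure_pmf.prob (?P n) (?A n) + measure_pmf.prob (?P n) (?B n)" by (rule measure_Un_le) auto
      finally show "1 - (measure_pmf.prob (?P n) (?A n) + measure_pmf.prob (?P n) (?B n)) \<le> measure_pmf.prob (?P n) (?G n)"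
        using measure_pmf.prob_compl[of "?G n" "?P n"] by (simp add: Compl_eq_Diff_UNIV)
    qed
  qed simp
qed

lemma tight_simplices:
  assumes c: "c > 0" and e: "e > 0"
  shows "\<exists>M :: nat. \<forall>\<^sub>F n in sequentially. measure_pmf.prob (random_subset (dfaces d n) (c / real n)) {F. M < card (simplices d n F)} \<le> e"
proof -
  define M where "M = Suc (nat \<lceil>c ^ (d + 2) / e\<rceil>)"
  have M: "c ^ (d + 2) / e \<le> real M" "M > 0" unfolding M_def by linarith+
  show ?thesis
  proof (intro exI[of _ M])
    show "\<forall>\<^sub>F n in sequentially. measure_pmf.prob (random_subset (dfaces d n) (c / real n)) {F. M < card (simplices d n F)} \<le> e"
      using eventually_gt_at_top[of 0] eventually_ge_at_top[of "nat \<lceil>c\<rceil>"]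
    proof eventually_elim
      case (elim n)
      have cn: "c \<le> real n" using elim by linarith
      have "measure_pmf.prob (random_subset (dfaces d n) (c / real n)) {F. real M < real (card (simplices d n F))} \<le> c ^ (d + 2) / real M"
        by (rule markov_pmf) (use expected_simplices[OF elim(1) _ cn, of d] c M in \<open>simp_all add: ennreal_of_nat_eq_real_of_nat\<close>)
      also have "\<dots> \<le> e" using M e by (simp add: field_simps)
      finally show ?case by simp
    qed
  qed
qed

theorem theorem1p1:
  fixes d :: nat and c :: real
  assumes "2 \<le> d" and "0 < c" and "c < c_star d"
  shows "(\<lambda>n. measure_pmf.prob (random_complex d n (c / real n))
            {Y. top_homology Y d = {0} \<or>
                (\<exists>S\<subseteq>simplex_boundaries Y d. top_homology Y d = span S)}) \<longlonglongrightarrow> 1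
       \<and> (\<forall>\<epsilon>>0. \<exists>M::nat. \<forall>\<^sub>F n in sequentially.
            measure_pmf.prob (random_complex d n (c / real n))
              {Y. top_homology Y d = {0} \<or>
                  (\<exists>S\<subseteq>simplex_boundaries Y d. finite S \<and> card S \<le> M \<and> top_homology Y d = span S)}
            \<ge> 1 - \<epsilon>)"
proof -
  let ?P = "\<lambda>n. random_subset (dfaces d n) (c / real n)"
  let ?G = "\<lambda>n. {F. top_homology (skeleton d n \<union> F) d = span (simplex_boundaries (skeleton d n \<union> F) d)}"
  note whp = whp_generated_by_simplices[OF assms]
  have vim: "measure_pmf.prob (random_complex d n (c / real n)) A = measure_pmf.prob (?P n) {F. skeleton d n \<union> F \<in> A}" for n A
    by (simp add: random_complex_eq vimage_def)
  show ?thesis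
  proof (intro conjI allI impI)
    show "(\<lambda>n. measure_pmf.prob (random_complex d n (c / real n))
            {Y. top_homology Y d = {0} \<or> (\<exists>S\<subseteq>simplex_boundaries Y d. top_homology Y d = span S)}) \<longlonglongrightarrow> 1"
    proof (rule tendsto_sandwich[OF _ _ whp tendsto_const])
      show "\<forall>\<^sub>F n in sequentially. measure_pmf.prob (?P n) (?G n) \<le> measure_pmf.prob (random_complex d n (c / real n))
            {Y. top_homology Y d = {0} \<or> (\<exists>S\<subseteq>simplex_boundaries Y d. top_homology Y d = span S)}"
        unfolding vim by (intro always_eventually allI measure_pmf.finite_measure_mono) auto
    qed simp
  next
    fix \<epsilon> :: real assume \<epsilon>: "\<epsilon> > 0"
    obtain M :: nat where M: "\<forall>\<^sub>F n in sequentially. measure_pmf.prob (?P n) {F. M < card (simplices d n F)} \<le> \<epsilon> / 2"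
      using tight_simplices[OF assms(2), of "\<epsilon> / 2" d] \<epsilon> by auto
    have G: "\<forall>\<^sub>F n in sequentially. 1 - \<epsilon> / 2 < measure_pmf.prob (?P n) (?G n)"
      by (rule order_tendstoD(1)[OF whp]) (use \<epsilon> in simp)
    show "\<exists>M::nat. \<forall>\<^sub>F n in sequentially.
            measure_pmf.prob (random_complex d n (c / real n))
              {Y. top_homology Y d = {0} \<or>
                  (\<exists>S\<subseteq>simplex_boundaries Y d. finite S \<and> card S \<le> M \<and> top_homology Y d = span S)}
            \<ge> 1 - \<epsilon>"
    proof (intro exI[of _ M])
      show "\<forall>\<^sub>F n in sequentially.
            measure_pmf.prob (random_complex d n (c / real n))
              {Y. top_homology Y d = {0} \<or>
                  (\<exists>S\<subseteq>simplex_boundaries Y d. finite S \<and> card S \<le> M \<and> top_homology Y d = span S)}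
            \<ge> 1 - \<epsilon>"
        using M G
      proof eventually_elim
        case (elim n)
        let ?R = "{F. skeleton d n \<union> F \<in> {Y. top_homology Y d = {0} \<or>
                  (\<exists>S\<subseteq>simplex_boundaries Y d. finite S \<and> card S \<le> M \<and> top_homology Y d = span S)}}"
        let ?B = "{F. M < card (simplices d n F)}"
        have "measure_pmf.prob (?P n) (?G n) \<le> measure_pmf.prob (?P n) (?R \<union> ?B)"
        proof (rule measure_pmf_mono_AE)
          fix F assume "F \<in> set_pmf (?P n)" and G: "F \<in> ?G n"
          then have F: "F \<subseteq> dfaces d n" using set_random_subset by blast
          let ?S = "simplex_boundaries (skeleton d n \<union> F) d"
          have S: "finite ?S" "card ?S \<le> card (simplices d n F)"
            using finite_simplices card_image_le[OF finite_simplices, of face_boundary d n F]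
            by (simp_all add: simplex_boundaries_skeleton_Un[OF F])
          show "F \<in> ?R \<union> ?B"
          proof (cases "M < card (simplices d n F)")
            case False
            then have "card ?S \<le> M" using S(2) by simp
            then have "\<exists>S\<subseteq>?S. finite S \<and> card S \<le> M \<and> top_homology (skeleton d n \<union> F) d = span S"
              using S(1) G by (intro exI[of _ ?S]) simp
            then show ?thesis by simp
          qed simp
        qed
        also have "\<dots> \<le> measure_pmf.prob (?P n) ?R + measure_pmf.prob (?P n) ?B" by (rule measure_Un_le) auto
        finally show ?case unfolding vim using elim by linarith
      qed
    qed
  qed
qed

end
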